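(* Let $k,n$ be positive integers. Then the antichain polynomial $\mathcal N_{[k]\times H_n}(x)$ is palindromic if and only if either $k=1$ and $n$ is odd, or $(k,n)\in\{(3,2),(5,3),(3,4),(7,4)\}$.
   Context: For a positive integer $k$, $[k]=\{1<\cdots<k\}$ is the $k$-element chain; products carry the componentwise order. $H_n=\{(i,j)\in[n]\times[n]: i\le j\}$, ordered componentwise. The antichain polynomial of a finite poset $Q$ is $\mathcal N_Q(x)=\sum_{\mathcal A}x^{|\mathcal A|}$, the sum over all antichains $\mathcal A$ of $Q$ (sets of pairwise incomparable elements, including the empty set). A polynomial $f(x)=\sum_{j=0}^d a_jx^j$ of degree $d$ with positive coefficients is palindromic if $a_j=a_{d-j}$ for every $0\le j\le d$. *)

theory Defs
  imports
    "HOL-Library.Product_Order"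
    "HOL-Computational_Algebra.Polynomial"
begin

text \<open>
  Finite posets are represented as finite sets of elements of a type of class
  \<^class>\<open>order\<close>, with the induced order. On product types this is the
  componentwise order of \<^theory>\<open>HOL-Library.Product_Order\<close>.
\<close>

definition antichains :: "'a::order set \<Rightarrow> 'a set set" where
  "antichains Q = {A. A \<subseteq> Q \<and> (\<forall>x\<in>A. \<forall>y\<in>A. x \<noteq> y \<longrightarrow> \<not> x \<le> y \<and> \<not> y \<le> x)}"

definition antichain_poly :: "'a::order set \<Rightarrow> int poly" where
  "antichain_poly Q = (\<Sum>A\<in>antichains Q. monom 1 (card A))"

definition chain :: "nat \<Rightarrow> nat set" where
  "chain k = {1..k}"

definition H :: "nat \<Rightarrow> (nat \<times> nat) set" where
  "H n = {(i, j). i \<in> chain n \<and> j \<in> chain n \<and> i \<le> j}"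

text \<open>
  Palindromicity is only considered for polynomials all of whose coefficients up to the
  degree are positive, which is the first conjunct. It holds for every antichain polynomial
  of a finite poset (see below).
\<close>

definition palindromic :: "int poly \<Rightarrow> bool" where
  "palindromic f \<longleftrightarrow>
     (\<forall>j\<le>degree f. coeff f j > 0) \<and>
     (\<forall>j\<le>degree f. coeff f j = coeff f (degree f - j))"

lemma finite_antichains: "finite Q \<Longrightarrow> finite (antichains Q)"
  by (rule finite_subset[of _ "Pow Q"]) (auto simp: antichains_def)

lemma coeff_antichain_poly:
  assumes "finite Q"
  shows "coeff (antichain_poly Q) j = int (card {A \<in> antichains Q. card A = j})"
proof -
  have "coeff (antichain_poly Q) j = (\<Sum>A\<in>antichains Q. if card A = j then 1 else 0)"
    by (simp add: antichain_poly_def coeff_sum)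
  also have "\<dots> = (\<Sum>A\<in>{A \<in> antichains Q. card A = j}. 1)"
    by (rule sum.inter_filter[symmetric]) (rule finite_antichains[OF assms])
  finally show ?thesis by simp
qed

lemma coeff_antichain_poly_pos:
  assumes "finite Q" and "j \<le> degree (antichain_poly Q)"
  shows "coeff (antichain_poly Q) j > 0"
proof -
  have fin: "finite {A \<in> antichains Q. card A = i}" for i
    using finite_antichains[OF assms(1)] by simp
  have "{} \<in> {A \<in> antichains Q. card A = 0}"
    by (simp add: antichains_def)
  then have "card {A \<in> antichains Q. card A = 0} \<noteq> 0"
    using fin[of 0] by (auto simp only: card_eq_0_iff)
  then have "antichain_poly Q \<noteq> 0"
    using coeff_antichain_poly[OF assms(1), of 0] by (auto simp del: card_eq_0_iff)
  then have "coeff (antichain_poly Q) (degree (antichain_poly Q)) \<noteq> 0"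
    by simp
  then have "{A \<in> antichains Q. card A = degree (antichain_poly Q)} \<noteq> {}"
    unfolding coeff_antichain_poly[OF assms(1)] by (metis card.empty of_nat_0)
  then obtain A where A: "A \<in> antichains Q" "card A = degree (antichain_poly Q)"
    by blast
  obtain B where B: "B \<subseteq> A" "card B = j"
    using obtain_subset_with_card_n[of j A] A(2) assms(2) by metis
  then have "B \<in> {A \<in> antichains Q. card A = j}"
    using A(1) by (auto simp: antichains_def)
  then have "card {A \<in> antichains Q. card A = j} > 0"
    using fin[of j] card_gt_0_iff by blast
  then show ?thesis
    by (simp add: coeff_antichain_poly[OF assms(1)])
qed

end

theory Submission
  imports Defs
begin

text \<open>
  Write \<open>P\<close> for the product and \<open>w\<close> for its width. Covering \<open>H n\<close> by the saturated chains
  \<open>min i (n + 1 - j) = a\<close> with \<open>2 n + 3 - 4 a\<close> elements shows that \<open>w\<close> is attained by the middle rank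
  levels; if \<open>k\<close> is none of these lengths, there are two of them and the leading coefficient exceeds one.
  Otherwise \<open>k = 2 m + 1\<close>, \<open>n + 1 = 2 r + m\<close>, the middle level \<open>M\<close> is the only antichain of size \<open>w\<close>, and
  an antichain is described by its part \<open>X\<close> below \<open>M\<close>, its part above \<open>M\<close>, and the elements of \<open>M\<close> which are
  comparable to neither and missing. Its size is \<open>w\<close> minus the excesses \<open>card (N X) - card X\<close> of the two
  parts (\<open>N X\<close> is the shadow of \<open>X\<close> on \<open>M\<close>) minus the number of missing elements. Decomposing a shadow
  into rows \<open>i + j = t\<close> expresses the excess as a sum of nonnegative local costs, so that low antichains
  of small excess can be enumerated.

  Comparing the coefficients of degree \<open>1\<close> and \<open>w - 1\<close>, palindromicity forces as many low antichains of
  excess one as there are elements below \<open>M\<close>. This fails for \<open>m = 1\<close> or \<open>r = 1\<close>, except in the four listed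
  cases. For \<open>m, r \<ge> 2\<close> it is a cubic equation in \<open>r\<close> and \<open>m\<close>, which has no solution with
  \<open>m < 910\<close>. For larger \<open>m\<close> it forces \<open>6 m < r < 7 m\<close>, and then the coefficient of degree \<open>2\<close> exceeds
  that of degree \<open>w - 2\<close>, since there are only \<open>O((r + m)^5)\<close> low antichains of excess two.
\<close>

section \<open>Integral points on a cubic curve\<close>

text \<open>The elements of a low antichain on a level never cover its previous shadow, so the sizes
  add up and the excess telescopes over the levels. The obstacle is that a row can shrink: a full
  row of even index above \<open>n\<close> touches both the wall \<open>j = n\<close> and the
  diagonal \<open>i = j\<close>. Cutting the sum after the last such row trades all earlier costs
  for losses. At odd distance \<open>D <= 2 r\<close> below \<open>M\<close> a nonempty shadow costs
  at least one unit; apart from small \<open>r\<close> this confines antichains of excess one to two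
  levels and those of excess two to four.

  The cubic has leading form \<open>2 r^3 - 12 r^2 m - 12 r m^2 - 3 m^3\<close>, whose positive root
  has \<open>r / m\<close> close to 6.9, so size alone cannot exclude integral points with large
  \<open>m\<close>. For such points the comparison in degree 2 is between two quantities of order
  \<open>m^2 n^4\<close>, with constants 1/4 (square of the lower half) and 1/6 (comparable pairs);
  910 is where the gap between them beats the crude constant obtained for the antichains of excess
  two.\<close>

definition cubic :: "int \<Rightarrow> int \<Rightarrow> int" where
  "cubic r m = r * (r * (2 * r + (9 - 12 * m)) + (7 + 6 * m - 12 * (m * m))) + (m * (m * (6 - 3 * m) + 9) - 6)"

text \<open>Dividing by \<open>r^2\<close> leaves \<open>2 r\<close>, a constant, and multiples of
  \<open>1 / r\<close> and \<open>1 / r^2\<close> whose coefficients are nonpositive for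
  \<open>m >= 3\<close>. So \<open>cubic r m / r^2\<close> increases and has at most one positive
  zero. Cross-multiplication keeps the statement in the integers.\<close>

lemma cubic_mono:
  assumes "0 < r" "r < s" "3 \<le> m"
  shows "cubic r m * (s * s) < cubic s m * (r * r)"
proof -
  have "cubic s m * (r * r) - cubic r m * (s * s) =
    (s - r) * (2 * (r * r * (s * s)) + r * s * (12 * (m * m) - 6 * m - 7) + (s + r) * (m * (m * (3 * m - 6) - 9) + 6))"
    unfolding cubic_def by (simp add: algebra_simps)
  also have "\<dots> > 0"
  proof (rule mult_pos_pos)
    have "3 * m \<le> m * m" using assms(3) by (intro mult_right_mono) simp_all
    then have 1: "12 * (m * m) - 6 * m - 7 \<ge> 0" using assms(3) by linarith
    have "3 * 3 \<le> m * (3 * m - 6)" by (rule mult_mono) (use assms(3) in simp_all)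
    then have 2: "m * (m * (3 * m - 6) - 9) + 6 \<ge> 0" using assms(3) by simp
    have "0 < 2 * (r * r * (s * s))" using assms by simp
    moreover have "0 \<le> r * s * (12 * (m * m) - 6 * m - 7)" using assms 1 by simp
    moreover have "0 \<le> (s + r) * (m * (m * (3 * m - 6) - 9) + 6)" using assms 2 by simp
    ultimately show "0 < 2 * (r * r * (s * s)) + r * s * (12 * (m * m) - 6 * m - 7) + (s + r) * (m * (m * (3 * m - 6) - 9) + 6)"
      by linarith
  qed (use assms in simp)
  finally show ?thesis by simp
qed

text \<open>The quotient by \<open>r^2\<close> changes sign only once, so two consecutive integers
  with opposite signs enclose its only positive zero.\<close>

lemma cubic_between:
  assumes "3 \<le> m" "0 < g" "cubic g m < 0" "0 < cubic (g + 1) m" "0 < r"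
  shows "cubic r m \<noteq> 0"
proof
  assume z: "cubic r m = 0"
  consider "r < g" | "r = g" | "r = g + 1" | "g + 1 < r" by linarith
  then show False
  proof cases
    case 1
    then have "0 < cubic g m * (r * r)" using cubic_mono[OF assms(5) 1 assms(1)] z by simp
    moreover have "cubic g m * (r * r) < 0" using assms(3,5) by (simp add: mult_neg_pos)
    ultimately show False by simp
  next
    case 4
    then have "cubic (g + 1) m * (r * r) < 0" using cubic_mono[of "g + 1" r m] assms z by simp
    moreover have "0 < cubic (g + 1) m * (r * r)" using assms by simp
    ultimately show False by simp
  qed (use z assms in simp_all)
qed

text \<open>The list contains the increments of the integer part of the positive root of the cubic.\<close>

fun walk :: "int \<Rightarrow> int \<Rightarrow> int list \<Rightarrow> bool" where
  "walk m g [] = True"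
| "walk m g (d # ds) = (let h = g + d in cubic h m < 0 \<and> 0 < cubic (h + 1) m \<and> 0 < h \<and> walk (m + 1) h ds)"

lemma walk_no_root:
  "walk m g ds \<Longrightarrow> 3 \<le> m \<Longrightarrow> m \<le> x \<Longrightarrow> x < m + int (length ds) \<Longrightarrow> 0 < r \<Longrightarrow> cubic r x \<noteq> 0"
proof (induction ds arbitrary: m g)
  case (Cons d ds)
  show ?case
  proof (cases "x = m")
    case True
    then show ?thesis using Cons.prems cubic_between[of m "g + d" r] by (simp add: Let_def)
  next
    case False
    then show ?thesis using Cons.prems Cons.IH[of "m + 1" "g + d"] by (simp add: Let_def)
  qed
qed simp

text \<open>The zero grows like \<open>6.9 m\<close>, whence the sevens with a six about every tenth
  place. The first entry is its integer part for \<open>m = 3\<close>, and the 907 entries reach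
  \<open>m = 909\<close>.\<close>

definition increments :: "int list" where
  "increments = [16, 7, 6, 7, 7, 7, 7, 7, 7, 7, 7, 7, 7, 6, 7, 7, 7, 7, 7, 7, 7, 7, 7, 7, 6, 7, 7, 7, 7, 7, 7, 7, 7, 7, 6, 7, 7, 7, 7, 7,
    7, 7, 7, 7, 6, 7, 7, 7, 7, 7, 7, 7, 7, 7, 6, 7, 7, 7, 7, 7, 7, 7, 7, 7, 6, 7, 7, 7, 7, 7, 7, 7, 7, 7, 6, 7, 7, 7, 7, 7,
    7, 7, 7, 7, 6, 7, 7, 7, 7, 7, 7, 7, 7, 7, 6, 7, 7, 7, 7, 7, 7, 7, 7, 7, 6, 7, 7, 7, 7, 7, 7, 7, 7, 7, 7, 6, 7, 7, 7, 7,
    7, 7, 7, 7, 7, 6, 7, 7, 7, 7, 7, 7, 7, 7, 7, 6, 7, 7, 7, 7, 7, 7, 7, 7, 7, 6, 7, 7, 7, 7, 7, 7, 7, 7, 7, 6, 7, 7, 7, 7,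
    7, 7, 7, 7, 7, 6, 7, 7, 7, 7, 7, 7, 7, 7, 7, 6, 7, 7, 7, 7, 7, 7, 7, 7, 7, 6, 7, 7, 7, 7, 7, 7, 7, 7, 7, 6, 7, 7, 7, 7,
    7, 7, 7, 7, 7, 6, 7, 7, 7, 7, 7, 7, 7, 7, 7, 7, 6, 7, 7, 7, 7, 7, 7, 7, 7, 7, 6, 7, 7, 7, 7, 7, 7, 7, 7, 7, 6, 7, 7, 7,
    7, 7, 7, 7, 7, 7, 6, 7, 7, 7, 7, 7, 7, 7, 7, 7, 6, 7, 7, 7, 7, 7, 7, 7, 7, 7, 6, 7, 7, 7, 7, 7, 7, 7, 7, 7, 6, 7, 7, 7,
    7, 7, 7, 7, 7, 7, 6, 7, 7, 7, 7, 7, 7, 7, 7, 7, 6, 7, 7, 7, 7, 7, 7, 7, 7, 7, 6, 7, 7, 7, 7, 7, 7, 7, 7, 7, 6, 7, 7, 7,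
    7, 7, 7, 7, 7, 7, 7, 6, 7, 7, 7, 7, 7, 7, 7, 7, 7, 6, 7, 7, 7, 7, 7, 7, 7, 7, 7, 6, 7, 7, 7, 7, 7, 7, 7, 7, 7, 6, 7, 7,
    7, 7, 7, 7, 7, 7, 7, 6, 7, 7, 7, 7, 7, 7, 7, 7, 7, 6, 7, 7, 7, 7, 7, 7, 7, 7, 7, 6, 7, 7, 7, 7, 7, 7, 7, 7, 7, 6, 7, 7,
    7, 7, 7, 7, 7, 7, 7, 6, 7, 7, 7, 7, 7, 7, 7, 7, 7, 6, 7, 7, 7, 7, 7, 7, 7, 7, 7, 7, 6, 7, 7, 7, 7, 7, 7, 7, 7, 7, 6, 7,
    7, 7, 7, 7, 7, 7, 7, 7, 6, 7, 7, 7, 7, 7, 7, 7, 7, 7, 6, 7, 7, 7, 7, 7, 7, 7, 7, 7, 6, 7, 7, 7, 7, 7, 7, 7, 7, 7, 6, 7,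
    7, 7, 7, 7, 7, 7, 7, 7, 6, 7, 7, 7, 7, 7, 7, 7, 7, 7, 6, 7, 7, 7, 7, 7, 7, 7, 7, 7, 6, 7, 7, 7, 7, 7, 7, 7, 7, 7, 6, 7,
    7, 7, 7, 7, 7, 7, 7, 7, 6, 7, 7, 7, 7, 7, 7, 7, 7, 7, 7, 6, 7, 7, 7, 7, 7, 7, 7, 7, 7, 6, 7, 7, 7, 7, 7, 7, 7, 7, 7, 6,
    7, 7, 7, 7, 7, 7, 7, 7, 7, 6, 7, 7, 7, 7, 7, 7, 7, 7, 7, 6, 7, 7, 7, 7, 7, 7, 7, 7, 7, 6, 7, 7, 7, 7, 7, 7, 7, 7, 7, 6,
    7, 7, 7, 7, 7, 7, 7, 7, 7, 6, 7, 7, 7, 7, 7, 7, 7, 7, 7, 6, 7, 7, 7, 7, 7, 7, 7, 7, 7, 6, 7, 7, 7, 7, 7, 7, 7, 7, 7, 7,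
    6, 7, 7, 7, 7, 7, 7, 7, 7, 7, 6, 7, 7, 7, 7, 7, 7, 7, 7, 7, 6, 7, 7, 7, 7, 7, 7, 7, 7, 7, 6, 7, 7, 7, 7, 7, 7, 7, 7, 7,
    6, 7, 7, 7, 7, 7, 7, 7, 7, 7, 6, 7, 7, 7, 7, 7, 7, 7, 7, 7, 6, 7, 7, 7, 7, 7, 7, 7, 7, 7, 6, 7, 7, 7, 7, 7, 7, 7, 7, 7,
    6, 7, 7, 7, 7, 7, 7, 7, 7, 7, 6, 7, 7, 7, 7, 7, 7, 7, 7, 7, 6, 7, 7, 7, 7, 7, 7, 7, 7, 7, 7, 6, 7, 7, 7, 7, 7, 7, 7, 7,
    7, 6, 7, 7, 7, 7, 7, 7, 7, 7, 7, 6, 7, 7, 7, 7, 7, 7, 7, 7, 7, 6, 7, 7, 7, 7, 7, 7, 7, 7, 7, 6, 7, 7, 7, 7, 7, 7, 7, 7,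
    7, 6, 7, 7, 7, 7, 7, 7, 7, 7, 7, 6, 7, 7, 7, 7, 7, 7, 7, 7, 7, 6, 7, 7, 7, 7, 7, 7, 7, 7, 7, 6, 7, 7, 7, 7, 7, 7, 7, 7,
    7, 6, 7, 7, 7, 7, 7, 7, 7, 7, 7, 7, 6, 7, 7, 7, 7, 7, 7, 7, 7, 7, 6, 7, 7, 7, 7, 7, 7, 7, 7, 7, 6, 7, 7, 7, 7, 7, 7, 7,
    7, 7, 6, 7, 7, 7, 7, 7, 7, 7, 7, 7, 6, 7, 7, 7, 7, 7, 7, 7, 7, 7, 6, 7, 7, 7, 7]"

lemma walk_increments: "walk 3 0 increments" "length increments = 907"
  by code_simp+

lemma cubic_small:
  assumes "3 \<le> m" "m < 910" "0 < r"
  shows "cubic r m \<noteq> 0"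
  by (rule walk_no_root[OF walk_increments(1)]) (use assms walk_increments(2) in simp_all)

text \<open>At \<open>m = 2\<close> the constant coefficient is 12, so the sign pattern behind
  \<open>cubic_mono\<close> is lost. The cubic term wins from \<open>r = 10\<close> on, and smaller
  \<open>r\<close> are evaluated.\<close>

lemma cubic_2:
  assumes "0 < r"
  shows "cubic r 2 \<noteq> 0"
proof (cases "r \<le> 9")
  case True
  then have "r \<in> {1..9}" using assms by simp
  also have "{1..9} = {1, 2, 3, 4, 5, 6, 7, 8, 9 :: int}" by auto
  finally show ?thesis by (auto simp: cubic_def)
next
  case False
  then have "10 \<le> r" by simp
  then have "10 * r \<le> r * r" by (intro mult_right_mono) simp_all
  moreover have "10 * (r * r) \<le> r * (r * r)" using \<open>10 \<le> r\<close> by (intro mult_right_mono) simp_all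
  moreover have "cubic r 2 = 2 * (r * (r * r)) - 15 * (r * r) - 29 * r + 12" by (simp add: cubic_def algebra_simps)
  ultimately show ?thesis using \<open>10 \<le> r\<close> by linarith
qed

text \<open>The leading form at \<open>r = 6 m\<close> and \<open>r = 7 m\<close> equals
  \<open>-75 m^3\<close> and \<open>11 m^3\<close>; for \<open>m >= 910\<close> the terms of lower
  degree cannot change these signs.\<close>

lemma cubic_range:
  assumes "910 \<le> m" "0 < r" "cubic r m = 0"
  shows "6 * m < r" "r < 7 * m"
proof -
  have mm: "910 * m \<le> m * m" using assms(1) by (intro mult_right_mono) simp_all
  have mp: "0 < m" using assms(1) by simp
  have eq: "cubic r m = 2 * (r * r) * (r - 6 * m) + r * (9 * r + 7 + 6 * m - 12 * (m * m)) + (m * (m * (6 - 3 * m) + 9) - 6)"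
    unfolding cubic_def by (simp add: algebra_simps)
  show "6 * m < r"
  proof (rule ccontr)
    assume "\<not> 6 * m < r"
    then have r: "r \<le> 6 * m" by simp
    have "2 * (r * r) * (r - 6 * m) \<le> 0" using r by (simp add: mult_nonneg_nonpos)
    moreover have "r * (9 * r + 7 + 6 * m - 12 * (m * m)) \<le> 0"
      by (rule mult_nonneg_nonpos) (use assms(2) r mm mp in linarith)+
    moreover have "m * (6 - 3 * m) = 6 * m - 3 * (m * m)" by (simp add: algebra_simps)
    then have "m * (6 - 3 * m) + 9 \<le> 0" using mm assms(1) by linarith
    then have "m * (m * (6 - 3 * m) + 9) \<le> 0" using mp by (simp add: mult_nonneg_nonpos)
    ultimately show False using assms(3) eq by linarith
  qed
  show "r < 7 * m"
  proof (rule ccontr)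
    assume "\<not> r < 7 * m"
    then have r: "7 * m \<le> r" by simp
    have "m \<le> r - 6 * m" using r by simp
    then have "2 * (r * r) * m \<le> 2 * (r * r) * (r - 6 * m)" by (rule mult_left_mono) simp
    moreover have "r * (7 * m) \<le> r * r" using r assms(2) by (intro mult_left_mono) simp_all
    then have "2 * m * (r * (7 * m)) \<le> 2 * m * (r * r)" by (rule mult_left_mono) (use mp in simp)
    ultimately have 1: "14 * (r * (m * m)) \<le> 2 * (r * r) * (r - 6 * m)" by (simp add: algebra_simps)
    have 2: "r * (9 * r + 7 + 6 * m - 12 * (m * m)) = r * (9 * r + 7 + 6 * m) - 12 * (r * (m * m))"
      by (simp add: algebra_simps)
    have 3: "r * 1 \<le> r * (9 * r + 7 + 6 * m)" using assms(2) mp by (intro mult_left_mono) simp_all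
    have "7 * m * (m * m) \<le> r * (m * m)" using r by (intro mult_right_mono) simp_all
    moreover have "m * (m * (6 - 3 * m) + 9) = 6 * (m * m) - 3 * (m * (m * m)) + 9 * m" by (simp add: algebra_simps)
    moreover have "0 \<le> m * (m * m)" using mp by simp
    ultimately show False using assms(3) eq 1 2 3 r mp mm by linarith
  qed
qed

section \<open>The case of a single color\<close>

lemma antichains_empty_set: "antichains {} = {{}}"
  by (auto simp: antichains_def)

lemma antichainsI:
  "A \<subseteq> Q \<Longrightarrow> (\<And>x y. x \<in> A \<Longrightarrow> y \<in> A \<Longrightarrow> x \<noteq> y \<Longrightarrow> \<not> x \<le> y \<and> \<not> y \<le> x) \<Longrightarrow> A \<in> antichains Q"
  by (simp add: antichains_def)

text \<open>\<open>H n\<close> is \<open>tri 1 (Suc n)\<close>. The lower bound is a parameter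
  because an antichain through \<open>(i, c)\<close> in the last column continues in the triangle
  whose indices exceed \<open>i\<close>.\<close>

definition tri :: "nat \<Rightarrow> nat \<Rightarrow> (nat \<times> nat) set" where
  "tri a c = {(i, j). a \<le> i \<and> i \<le> j \<and> j < c}"

lemma finite_tri [simp]: "finite (tri a c)"
  by (rule finite_subset[of _ "{..c} \<times> {..c}"]) (auto simp: tri_def)

definition tcount :: "nat \<Rightarrow> nat \<Rightarrow> nat \<Rightarrow> nat" where
  "tcount a c l = card {A \<in> antichains (tri a c). card A = l}"

lemma insert_antichain:
  assumes "x \<in> Q" "A \<in> antichains Q" "\<And>y. y \<in> A \<Longrightarrow> \<not> x \<le> y \<and> \<not> y \<le> x"
  shows "insert x A \<in> antichains Q"
proof -
  have "A \<subseteq> Q" and A: "\<And>y z. y \<in> A \<Longrightarrow> z \<in> A \<Longrightarrow> y \<noteq> z \<Longrightarrow> \<not> y \<le> z \<and> \<not> z \<le> y"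
    using assms(2) by (simp_all add: antichains_def)
  then have "insert x A \<subseteq> Q" using assms(1) by simp
  moreover have "\<not> y \<le> z \<and> \<not> z \<le> y" if "y \<in> insert x A" "z \<in> insert x A" "y \<noteq> z" for y z
    using that A[of y z] assms(3)[of y] assms(3)[of z] by (elim insertE) simp_all
  ultimately show ?thesis by (simp add: antichains_def)
qed

lemma tcount_empty: "c \<le> a \<Longrightarrow> tcount a c l = (if l = 0 then 1 else 0)"
proof -
  assume "c \<le> a"
  then have e: "tri a c = {}" by (auto simp: tri_def)
  have "{A \<in> antichains (tri a c). card A = l} = (if l = 0 then {{}} else {})"
    unfolding e antichains_empty_set by auto
  then show ?thesis by (simp add: tcount_def)
qed

lemma tcount_0: "tcount a c 0 = 1"
proof -
  have "{A \<in> antichains (tri a c). card A = 0} = {{}}"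
    using finite_subset[OF _ finite_tri] by (auto simp: antichains_def)
  then show ?thesis by (simp add: tcount_def)
qed

text \<open>Split according to the element of the last column \<open>j = c\<close>, of which an antichain has at most one.\<close>

lemma tcount_Suc:
  assumes "a \<le> c"
  shows "tcount a (Suc c) (Suc l) = tcount a c (Suc l) + (\<Sum>i\<in>{a..c}. tcount (Suc i) c l)"
proof -
  let ?S = "{A \<in> antichains (tri a (Suc c)). card A = Suc l}"
  let ?N = "{A \<in> antichains (tri a c). card A = Suc l}"
  let ?C = "\<lambda>i. {A \<in> antichains (tri (Suc i) c). card A = l}"
  have fin: "finite A" if "A \<in> antichains (tri x y)" for A x y
    using that finite_subset[OF _ finite_tri] by (auto simp: antichains_def)
  have nin: "(i, c) \<notin> A" if "A \<in> antichains (tri x c)" for A i x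
    using that by (auto simp: antichains_def tri_def)
  have "?S = ?N \<union> (\<Union>i\<in>{a..c}. insert (i, c) ` ?C i)"
  proof (intro equalityI subsetI)
    fix A assume A: "A \<in> ?S"
    show "A \<in> ?N \<union> (\<Union>i\<in>{a..c}. insert (i, c) ` ?C i)"
    proof (cases "\<exists>i. (i, c) \<in> A")
      case False
      have "A \<subseteq> tri a c"
      proof
        fix p assume p: "p \<in> A"
        obtain i j where ij: "p = (i, j)" by (cases p)
        have "p \<in> tri a (Suc c)" using A p by (auto simp: antichains_def)
        moreover have "j \<noteq> c" using False p ij by blast
        ultimately show "p \<in> tri a c" by (auto simp: tri_def ij)
      qed
      then show ?thesis using A by (auto simp: antichains_def)
    next
      case True
      then obtain i where i: "(i, c) \<in> A" by blast
      have anti: "\<And>p q. p \<in> A \<Longrightarrow> q \<in> A \<Longrightarrow> p \<noteq> q \<Longrightarrow> \<not> p \<le> q" and sub: "A \<subseteq> tri a (Suc c)"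
        using A by (auto simp: antichains_def)
      let ?B = "A - {(i, c)}"
      have "?B \<subseteq> tri (Suc i) c"
      proof
        fix p assume p: "p \<in> ?B"
        obtain i' j' where ij: "p = (i', j')" by (cases p)
        have "\<not> p \<le> (i, c)" "\<not> (i, c) \<le> p" using anti[of p "(i, c)"] anti[of "(i, c)" p] p i by auto
        then show "p \<in> tri (Suc i) c" using sub p by (auto simp: ij tri_def)
      qed
      then have "?B \<in> ?C i" using A i fin[of A] by (auto simp: antichains_def)
      moreover have "A = insert (i, c) ?B" using i by blast
      moreover have "i \<in> {a..c}" using sub i by (auto simp: tri_def)
      ultimately show ?thesis by blast
    qed
  next
    fix A assume "A \<in> ?N \<union> (\<Union>i\<in>{a..c}. insert (i, c) ` ?C i)"
    then consider "A \<in> ?N" | i B where "i \<in> {a..c}" "B \<in> ?C i" "A = insert (i, c) B" by blast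
    then show "A \<in> ?S"
    proof cases
      case 1
      moreover have "tri a c \<subseteq> tri a (Suc c)" by (auto simp: tri_def)
      ultimately show ?thesis by (auto simp: antichains_def)
    next
      case 2
      have "(i, c) \<notin> B" "finite B" using nin[of B] fin[of B] 2(2) by auto
      then have "card A = Suc l" using 2 by simp
      moreover have "tri (Suc i) c \<subseteq> tri a (Suc c)" using 2(1) by (auto simp: tri_def)
      then have "B \<in> antichains (tri a (Suc c))" "B \<subseteq> tri (Suc i) c" using 2(2) by (auto simp: antichains_def)
      moreover have "(i, c) \<in> tri a (Suc c)" using 2(1) by (auto simp: tri_def)
      moreover have "\<not> (i, c) \<le> y \<and> \<not> y \<le> (i, c)" if "y \<in> B" for y
        using that \<open>B \<subseteq> tri (Suc i) c\<close> by (cases y) (auto simp: tri_def)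
      ultimately show ?thesis using insert_antichain[of "(i, c)" "tri a (Suc c)" B] unfolding 2(3) by simp
    qed
  qed
  moreover have fN: "finite ?N" "\<And>i. finite (insert (i, c) ` ?C i)"
    using finite_antichains[OF finite_tri] by auto
  moreover have "?N \<inter> (\<Union>i\<in>{a..c}. insert (i, c) ` ?C i) = {}"
    using nin by blast
  ultimately have "card ?S = card ?N + card (\<Union>i\<in>{a..c}. insert (i, c) ` ?C i)"
    by (simp add: card_Un_disjoint)
  also have "card (\<Union>i\<in>{a..c}. insert (i, c) ` ?C i) = (\<Sum>i\<in>{a..c}. card (insert (i, c) ` ?C i))"
  proof (rule card_UN_disjoint)
    show "\<forall>i\<in>{a..c}. \<forall>j\<in>{a..c}. i \<noteq> j \<longrightarrow> insert (i, c) ` ?C i \<inter> insert (j, c) ` ?C j = {}"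
    proof (intro ballI impI equals0I)
      fix i j A assume ij: "i \<noteq> j" and "A \<in> insert (i, c) ` ?C i \<inter> insert (j, c) ` ?C j"
      then obtain B B' where "A = insert (i, c) B" "A = insert (j, c) B'" "B \<in> ?C i" "B' \<in> ?C j" by blast
      moreover from this have "(j, c) \<notin> B" using nin[of B "Suc i" j] by simp
      moreover have "(j, c) \<in> insert (j, c) B'" by simp
      ultimately have "(j, c) = (i, c)" by (metis insertE)
      then show False using ij by simp
    qed
  qed (use fN in auto)
  also have "\<dots> = (\<Sum>i\<in>{a..c}. tcount (Suc i) c l)"
  proof (rule sum.cong)
    fix i
    have "inj_on (insert (i, c)) (?C i)"
    proof (rule inj_onI)
      fix B B' assume "B \<in> ?C i" "B' \<in> ?C i" "insert (i, c) B = insert (i, c) B'"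
      moreover from this have "(i, c) \<notin> B" "(i, c) \<notin> B'" using nin by blast+
      ultimately show "B = B'" by (simp add: insert_ident)
    qed
    then show "card (insert (i, c) ` ?C i) = tcount (Suc i) c l" by (simp add: card_image tcount_def)
  qed simp
  finally show ?thesis by (simp add: tcount_def)
qed

text \<open>An antichain is \<open>i1 < ... < il <= jl < ... < j1\<close>; raising the second
  coordinates by one makes it an arbitrary subset of \<open>{a..c}\<close> with \<open>2 l\<close>
  elements. In the induction this appears as the hockey stick identity.\<close>

lemma tcount_eq: "a \<le> Suc c \<Longrightarrow> tcount a c l = (Suc c - a) choose (2 * l)"
proof (induction c arbitrary: a l)
  case 0
  then have "a = 0 \<or> a = 1" by auto
  then show ?case using tcount_empty[of 0 a l] by (cases l) auto
next
  case (Suc c)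
  show ?case
  proof (cases "a \<le> c")
    case False
    then have "tcount a (Suc c) l = (if l = 0 then 1 else if a = Suc c \<or> a = Suc (Suc c) then 0 else 0)"
      using Suc.prems tcount_empty[of "Suc c" a l] by auto
    moreover have "a = Suc c \<or> a = Suc (Suc c)" using False Suc.prems by auto
    ultimately show ?thesis by (cases l) auto
  next
    case True
    show ?thesis
    proof (cases l)
      case 0
      then show ?thesis by (simp add: tcount_0)
    next
      case (Suc l')
      have "(\<Sum>i\<in>{a..c}. tcount (Suc i) c l') = (\<Sum>i\<in>{a..c}. (c - i) choose (2 * l'))"
        by (rule sum.cong) (auto simp: Suc.IH)
      also have "\<dots> = (\<Sum>s\<le>c - a. s choose (2 * l'))"
        by (rule sum.reindex_bij_witness[of _ "\<lambda>s. c - s" "\<lambda>i. c - i"]) (use True in auto)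
      also have "\<dots> = Suc (c - a) choose Suc (2 * l')" using sum_choose_upper[of "2 * l'" "c - a"] by (simp only: atMost_atLeast0)
      finally show ?thesis using tcount_Suc[OF True, of l'] Suc.IH[of a "Suc l'"] True Suc
        by (simp add: Suc_diff_le)
    qed
  qed
qed

lemma coeff_k1: "coeff (antichain_poly (chain 1 \<times> H n)) j = int ((n + 1) choose (2 * j))"
proof -
  have Hn: "H n = tri 1 (Suc n)" by (auto simp: H_def chain_def tri_def)
  have fin: "finite (chain 1 \<times> H n)" by (simp add: Hn chain_def)
  have bij: "bij_betw ((`) (Pair 1)) {A \<in> antichains (H n). card A = j}
      {A \<in> antichains (chain 1 \<times> H n). card A = j}"
  proof (rule bij_betw_byWitness[where f' = "(`) snd"])
    have c: "chain 1 = {1}" by (auto simp: chain_def)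
    show "\<forall>A\<in>{A \<in> antichains (H n). card A = j}. snd ` Pair 1 ` A = A" by (simp add: image_image)
    show "\<forall>A\<in>{A \<in> antichains (chain 1 \<times> H n). card A = j}. Pair 1 ` snd ` A = A"
      unfolding c antichains_def by (force simp: image_image)
    show "(`) (Pair 1) ` {A \<in> antichains (H n). card A = j} \<subseteq> {A \<in> antichains (chain 1 \<times> H n). card A = j}"
    proof (rule image_subsetI)
      fix A assume A: "A \<in> {A \<in> antichains (H n). card A = j}"
      then have "A \<subseteq> H n" "\<And>x y. x \<in> A \<Longrightarrow> y \<in> A \<Longrightarrow> x \<noteq> y \<Longrightarrow> \<not> x \<le> y \<and> \<not> y \<le> x"
        by (simp_all add: antichains_def)
      then have "Pair 1 ` A \<in> antichains (chain 1 \<times> H n)"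
      proof -
        assume sub: "A \<subseteq> H n" and a: "\<And>x y. x \<in> A \<Longrightarrow> y \<in> A \<Longrightarrow> x \<noteq> y \<Longrightarrow> \<not> x \<le> y \<and> \<not> y \<le> x"
        have "Pair 1 ` A \<subseteq> chain 1 \<times> H n" using sub unfolding c by blast
        then show ?thesis
        proof (rule antichainsI)
          fix x y :: "nat \<times> nat \<times> nat" assume xy: "x \<in> Pair 1 ` A" "y \<in> Pair 1 ` A" "x \<noteq> y"
          obtain u v where "x = (1, u)" "y = (1, v)" "u \<in> A" "v \<in> A" using xy(1,2) by blast
          then show "\<not> x \<le> y \<and> \<not> y \<le> x" using a[of u v] xy(3) by (simp add: less_eq_prod_def)
        qed
      qed
      then show "Pair 1 ` A \<in> {A \<in> antichains (chain 1 \<times> H n). card A = j}"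
        using A by (simp add: card_image inj_on_def)
    qed
    show "(`) snd ` {A \<in> antichains (chain 1 \<times> H n). card A = j} \<subseteq> {A \<in> antichains (H n). card A = j}"
    proof (rule image_subsetI)
      fix A assume A: "A \<in> {A \<in> antichains (chain 1 \<times> H n). card A = j}"
      then have sub: "A \<subseteq> chain 1 \<times> H n"
        and a: "\<And>x y. x \<in> A \<Longrightarrow> y \<in> A \<Longrightarrow> x \<noteq> y \<Longrightarrow> \<not> x \<le> y"
        by (simp_all add: antichains_def)
      have le: "x = y" if "x \<in> A" "y \<in> A" "snd x \<le> snd y" for x y
      proof (rule ccontr)
        assume "x \<noteq> y"
        moreover have "fst x = 1" "fst y = 1" using that sub unfolding c by auto
        then have "x \<le> y" using that(3) by (simp add: less_eq_prod_def)
        ultimately show False using a[OF that(1,2)] by simp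
      qed
      have "inj_on snd A" by (rule inj_onI) (rule le, simp_all)
      then have "card (snd ` A) = j" using A by (simp add: card_image)
      moreover have "snd ` A \<in> antichains (H n)"
      proof (rule antichainsI)
        show "snd ` A \<subseteq> H n" using sub by auto
        fix u v assume uv: "u \<in> snd ` A" "v \<in> snd ` A" "u \<noteq> v"
        obtain x where x: "u = snd x" "x \<in> A" using uv(1) by (rule imageE)
        obtain y where y: "v = snd y" "y \<in> A" using uv(2) by (rule imageE)
        have "\<not> u \<le> v"
        proof
          assume "u \<le> v"
          then have "x = y" using le[OF x(2) y(2)] x(1) y(1) by simp
          then show False using uv(3) x(1) y(1) by simp
        qed
        moreover have "\<not> v \<le> u"
        proof
          assume "v \<le> u"
          then have "y = x" using le[OF y(2) x(2)] x(1) y(1) by simp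
          then show False using uv(3) x(1) y(1) by simp
        qed
        ultimately show "\<not> u \<le> v \<and> \<not> v \<le> u" by simp
      qed
      ultimately show "snd ` A \<in> {A \<in> antichains (H n). card A = j}" by simp
    qed
  qed
  have "card {A \<in> antichains (chain 1 \<times> H n). card A = j} = tcount 1 (Suc n) j"
    unfolding tcount_def Hn[symmetric] by (rule bij_betw_same_card[OF bij, symmetric])
  then show ?thesis unfolding coeff_antichain_poly[OF fin] by (simp add: tcount_eq)
qed

lemma palindromic_k1:
  assumes "odd n"
  shows "palindromic (antichain_poly (chain 1 \<times> H n))"
proof -
  obtain p where p: "n + 1 = 2 * p" using assms by (metis even_Suc Suc_eq_plus1 evenE)
  let ?f = "antichain_poly (chain 1 \<times> H n)"
  have c: "coeff ?f j = int ((2 * p) choose (2 * j))" for j using coeff_k1[of n j] p by simp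
  have "degree ?f = p"
  proof (rule antisym)
    show "degree ?f \<le> p" by (rule degree_le, intro allI impI, unfold c) (simp add: binomial_eq_0)
    show "p \<le> degree ?f" by (rule le_degree, unfold c) simp
  qed
  moreover have "coeff ?f j = coeff ?f (p - j)" if "j \<le> p" for j
    unfolding c using that binomial_symmetric[of "2 * j" "2 * p"] by (simp add: diff_mult_distrib2)
  moreover have "coeff ?f j > 0" if "j \<le> p" for j unfolding c using that by simp
  ultimately show ?thesis unfolding palindromic_def by blast
qed

section \<open>The exceptional cases\<close>

type_synonym pt = "nat \<times> nat"

definition ple :: "pt \<Rightarrow> pt \<Rightarrow> bool" where
  "ple x y \<longleftrightarrow> fst x \<le> fst y \<and> snd x \<le> snd y"

lemma ple_iff: "ple x y \<longleftrightarrow> x \<le> y"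
  by (simp add: ple_def less_eq_prod_def)

function acs :: "pt list \<Rightarrow> pt list list" where
  "acs [] = [[]]"
| "acs (x # xs) = acs xs @ map ((#) x) (acs (filter (\<lambda>y. \<not> ple x y \<and> \<not> ple y x) xs))"
  by pat_completeness auto
termination by (relation "measure length") (auto simp: le_imp_less_Suc)

text \<open>The weight \<open>g\<close> is general because the recursion replaces it by
  \<open>g (insert x A)\<close>, and later it takes polynomial values.\<close>

lemma sum_antichains_insert:
  fixes g :: "'b::order set \<Rightarrow> 'c::comm_monoid_add"
  assumes "finite Q" "x \<notin> Q"
  shows "(\<Sum>A\<in>antichains (insert x Q). g A) = (\<Sum>A\<in>antichains Q. g A) +
    (\<Sum>A\<in>antichains {y \<in> Q. \<not> x \<le> y \<and> \<not> y \<le> x}. g (insert x A))"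
proof -
  let ?R = "{y \<in> Q. \<not> x \<le> y \<and> \<not> y \<le> x}"
  have eq: "antichains (insert x Q) = antichains Q \<union> insert x ` antichains ?R"
  proof (intro equalityI subsetI)
    fix A assume A: "A \<in> antichains (insert x Q)"
    show "A \<in> antichains Q \<union> insert x ` antichains ?R"
    proof (cases "x \<in> A")
      case True
      then have "A - {x} \<in> antichains ?R" "A = insert x (A - {x})" using A by (auto simp: antichains_def)
      then show ?thesis by blast
    next
      case False
      then show ?thesis using A by (auto simp: antichains_def)
    qed
  next
    fix A assume "A \<in> antichains Q \<union> insert x ` antichains ?R"
    then show "A \<in> antichains (insert x Q)" by (fastforce simp: antichains_def)
  qed
  have fin: "finite (antichains Q)" "finite (antichains ?R)"
    by (rule finite_antichains, simp add: assms)+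
  have "inj_on (insert x) (antichains ?R)"
    using assms(2) by (intro inj_onI) (metis (no_types, lifting) antichains_def insert_ident mem_Collect_eq subset_iff)
  moreover have "antichains Q \<inter> insert x ` antichains ?R = {}" using assms(2) by (auto simp: antichains_def)
  ultimately show ?thesis unfolding eq using fin by (simp add: sum.union_disjoint sum.reindex)
qed

lemma sum_acs:
  fixes g :: "pt set \<Rightarrow> 'c::comm_monoid_add"
  shows "distinct xs \<Longrightarrow> (\<Sum>A\<in>antichains (set xs). g A) = sum_list (map (\<lambda>D. g (set D)) (acs xs))"
proof (induction xs arbitrary: g rule: acs.induct)
  case 1
  have "antichains {} = {{} :: pt set}" by (auto simp: antichains_def)
  then show ?case by simp
next
  case (2 x xs)
  have "set (filter (\<lambda>y. \<not> ple x y \<and> \<not> ple y x) xs) = {y \<in> set xs. \<not> x \<le> y \<and> \<not> y \<le> x}"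
    by (auto simp: ple_iff)
  moreover have "distinct (filter (\<lambda>y. \<not> ple x y \<and> \<not> ple y x) xs)" "distinct xs" "x \<notin> set xs" using 2(3) by simp_all
  ultimately show ?case using 2(1)[of g] 2(2)[of "\<lambda>A. g (insert x A)"] sum_antichains_insert[of "set xs" x g]
    by (simp add: comp_def)
qed

lemma acs_distinct: "distinct xs \<Longrightarrow> D \<in> set (acs xs) \<Longrightarrow> distinct D \<and> set D \<subseteq> set xs"
proof (induction xs arbitrary: D rule: acs.induct)
  case (2 x xs)
  let ?ys = "filter (\<lambda>y. \<not> ple x y \<and> \<not> ple y x) xs"
  have d: "distinct xs" "distinct ?ys" "x \<notin> set xs" using 2(3) by simp_all
  from 2(4) consider "D \<in> set (acs xs)" | D' where "D = x # D'" "D' \<in> set (acs ?ys)" by auto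
  then show ?case
  proof cases
    case 1
    then show ?thesis using 2(1)[OF d(1) 1] by auto
  next
    case 2
    then have "distinct D' \<and> set D' \<subseteq> set ?ys" using "2.IH"(2)[OF d(2)] by blast
    then show ?thesis using 2(1) d(3) by auto
  qed
qed simp

definition above :: "pt list \<Rightarrow> pt list \<Rightarrow> pt list" where
  "above U D = filter (\<lambda>h. \<forall>d\<in>set D. \<not> ple h d) U"

lemma antichain_poly_chain_0: "antichain_poly (chain 0 \<times> (U :: pt set)) = 1"
proof -
  have e: "chain 0 \<times> U = {}" by (simp add: chain_def)
  have a: "antichains ({} :: (nat \<times> pt) set) = {{}}" by (auto simp: antichains_def)
  show ?thesis unfolding antichain_poly_def e a by simp
qed

text \<open>Transfer step: split off the top color. A lower element \<open>(c, h)\<close> is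
  comparable to \<open>(Suc k, d)\<close> exactly if \<open>h <= d\<close>, so the lower colors see
  only the part of \<open>U\<close> that is not below \<open>D\<close>.\<close>

lemma antichain_poly_chain_Suc:
  assumes "finite (U :: pt set)"
  shows "antichain_poly (chain (Suc k) \<times> U) =
    (\<Sum>D\<in>antichains U. monom 1 (card D) * antichain_poly (chain k \<times> {h \<in> U. \<forall>d\<in>D. \<not> h \<le> d}))"
proof -
  let ?U = "\<lambda>D. {h \<in> U. \<forall>d\<in>D. \<not> h \<le> d}"
  let ?S = "SIGMA D:antichains U. antichains (chain k \<times> ?U D)"
  let ?f = "\<lambda>(D, A). A \<union> Pair (Suc k) ` D"
  have fin: "finite (chain j \<times> V)" if "V \<subseteq> U" for j V
    using that assms finite_subset by (auto simp: chain_def)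
  have new: "\<And>D A h. (D, A) \<in> ?S \<Longrightarrow> (Suc k, h) \<notin> A" by (auto simp: antichains_def chain_def)
  have bij: "bij_betw ?f ?S (antichains (chain (Suc k) \<times> U))"
  proof (rule bij_betw_byWitness[where f' = "\<lambda>A. ({h. (Suc k, h) \<in> A}, {x \<in> A. fst x \<noteq> Suc k})"])
    show "\<forall>p\<in>?S. ({h. (Suc k, h) \<in> ?f p}, {x \<in> ?f p. fst x \<noteq> Suc k}) = p"
      using new by (fastforce simp: antichains_def chain_def)
    show "\<forall>A\<in>antichains (chain (Suc k) \<times> U). ?f ({h. (Suc k, h) \<in> A}, {x \<in> A. fst x \<noteq> Suc k}) = A"
      by auto
    show "?f ` ?S \<subseteq> antichains (chain (Suc k) \<times> U)"
    proof (rule image_subsetI, clarify)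
      fix D A assume D: "D \<in> antichains U" and A: "A \<in> antichains (chain k \<times> ?U D)"
      have 1: "A \<union> Pair (Suc k) ` D \<subseteq> chain (Suc k) \<times> U"
        using D A by (auto simp: antichains_def chain_def)
      have 2: "\<not> x \<le> y \<and> \<not> y \<le> x" if "x \<in> A" "y \<in> Pair (Suc k) ` D" for x y
        using that A by (fastforce simp: antichains_def chain_def)
      show "A \<union> Pair (Suc k) ` D \<in> antichains (chain (Suc k) \<times> U)"
        unfolding antichains_def mem_Collect_eq
      proof (intro conjI ballI impI 1)
        fix x y assume xy: "x \<in> A \<union> Pair (Suc k) ` D" "y \<in> A \<union> Pair (Suc k) ` D" "x \<noteq> y"
        then consider "x \<in> A" "y \<in> A" | "x \<in> A" "y \<in> Pair (Suc k) ` D" | "x \<in> Pair (Suc k) ` D" "y \<in> A"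
          | "x \<in> Pair (Suc k) ` D" "y \<in> Pair (Suc k) ` D" by blast
        then have "\<not> x \<le> y \<and> \<not> y \<le> x"
        proof cases
          case 1
          then show ?thesis using A xy(3) by (auto simp: antichains_def)
        next
          case 4
          then obtain u v where uv: "u \<in> D" "v \<in> D" "x = (Suc k, u)" "y = (Suc k, v)" by blast
          then have "\<not> u \<le> v \<and> \<not> v \<le> u" using D xy(3) unfolding antichains_def by blast
          then show ?thesis using uv(3,4) by (simp add: less_eq_prod_def)
        qed (use 2 in blast)+
        then show "\<not> x \<le> y" "\<not> y \<le> x" by blast+
      qed
    qed
    show "(\<lambda>A. ({h. (Suc k, h) \<in> A}, {x \<in> A. fst x \<noteq> Suc k})) ` antichains (chain (Suc k) \<times> U) \<subseteq> ?S"
    proof (rule image_subsetI)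
      fix A assume A: "A \<in> antichains (chain (Suc k) \<times> U)"
      then have sub: "A \<subseteq> chain (Suc k) \<times> U" and anti: "\<And>x y. x \<in> A \<Longrightarrow> y \<in> A \<Longrightarrow> x \<noteq> y \<Longrightarrow> \<not> x \<le> y"
        by (auto simp: antichains_def)
      have "{h. (Suc k, h) \<in> A} \<in> antichains U"
        unfolding antichains_def using sub anti[of "(Suc k, _)" "(Suc k, _)"] by auto
      moreover have "{x \<in> A. fst x \<noteq> Suc k} \<in> antichains (chain k \<times> ?U {h. (Suc k, h) \<in> A})"
        unfolding antichains_def mem_Collect_eq
      proof (intro conjI ballI impI subsetI)
        fix x assume x: "x \<in> {x \<in> A. fst x \<noteq> Suc k}"
        obtain c h where ch: "x = (c, h)" by (cases x)
        have "c \<in> chain k" "h \<in> U" using sub x ch by (auto simp: chain_def le_Suc_eq)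
        moreover have "\<not> h \<le> d" if "(Suc k, d) \<in> A" for d
          using anti[of x "(Suc k, d)"] x ch that \<open>c \<in> chain k\<close> by (auto simp: chain_def)
        ultimately show "x \<in> chain k \<times> ?U {h. (Suc k, h) \<in> A}" using ch by simp
      qed (use anti in blast)+
      ultimately show "({h. (Suc k, h) \<in> A}, {x \<in> A. fst x \<noteq> Suc k}) \<in> ?S" by simp
    qed
  qed
  have "antichain_poly (chain (Suc k) \<times> U) = (\<Sum>p\<in>?S. monom 1 (card (?f p)))"
    unfolding antichain_poly_def by (rule sum.reindex_bij_betw[OF bij, symmetric])
  also have "\<dots> = (\<Sum>(D, A)\<in>?S. monom 1 (card D) * monom 1 (card A))"
  proof (rule sum.cong, simp, clarify)
    fix D A assume DA: "D \<in> antichains U" "A \<in> antichains (chain k \<times> ?U D)"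
    have "finite D" using DA(1) assms finite_subset by (auto simp: antichains_def)
    moreover have "finite A" using DA(2) fin[of "?U D" k] finite_subset by (auto simp: antichains_def)
    moreover have "A \<inter> Pair (Suc k) ` D = {}" using DA(2) by (auto simp: antichains_def chain_def)
    ultimately have "card (A \<union> Pair (Suc k) ` D) = card D + card A"
      by (simp add: card_Un_disjoint card_image inj_on_def)
    then show "monom (1 :: int) (card (A \<union> Pair (Suc k) ` D)) = monom 1 (card D) * monom 1 (card A)"
      by (simp add: mult_monom)
  qed
  also have "\<dots> = (\<Sum>D\<in>antichains U. \<Sum>A\<in>antichains (chain k \<times> ?U D). monom 1 (card D) * monom 1 (card A))"
  proof (rule sum.Sigma[symmetric])
    show "finite (antichains U)" by (rule finite_antichains[OF assms])
    show "\<forall>D\<in>antichains U. finite (antichains (chain k \<times> ?U D))"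
      by (intro ballI finite_antichains fin) blast
  qed
  finally show ?thesis by (simp add: antichain_poly_def sum_distrib_left)
qed

fun padd :: "int list \<Rightarrow> int list \<Rightarrow> int list" where
  "padd [] ys = ys"
| "padd xs [] = xs"
| "padd (x # xs) (y # ys) = (x + y) # padd xs ys"

lemma Poly_padd: "Poly (padd xs ys) = Poly xs + Poly ys"
  by (induction xs ys rule: padd.induct) auto

lemma Poly_shift: "Poly (replicate d 0 @ xs) = monom 1 d * Poly xs" for xs :: "int list"
proof (induction d)
  case 0
  have "monom (1 :: int) 0 = 1" by (simp add: monom_0)
  then show ?case by simp
next
  case (Suc d)
  then show ?case by (simp add: monom_Suc mult_pCons_left)
qed

definition idx :: "pt list list \<Rightarrow> pt list \<Rightarrow> nat" where
  "idx sts U = length (takeWhile (\<lambda>V. V \<noteq> U) sts)"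

lemma nth_idx: "U \<in> set sts \<Longrightarrow> sts ! idx sts U = U \<and> idx sts U < length sts"
  unfolding idx_def by (induction sts) auto

text \<open>The transitions do not depend on the number of colors. They are tabulated once by state
  number, and \<open>layer\<close> only adds shifted coefficient lists.\<close>

definition trans_table :: "pt list list \<Rightarrow> (nat \<times> nat) list list" where
  "trans_table sts = map (\<lambda>U. map (\<lambda>D. (length D, idx sts (above U D))) (acs U)) sts"

definition layer :: "(nat \<times> nat) list list \<Rightarrow> int list list \<Rightarrow> int list list" where
  "layer tr v = map (\<lambda>row. foldr (\<lambda>(d, i) acc. padd (replicate d 0 @ v ! i) acc) row []) tr"

fun layers :: "(nat \<times> nat) list list \<Rightarrow> nat \<Rightarrow> int list list" where
  "layers tr 0 = map (\<lambda>_. [1]) tr"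
| "layers tr (Suc k) = layer tr (layers tr k)"

lemma Poly_foldr: "Poly (foldr (\<lambda>(d, i) acc. padd (replicate d 0 @ v ! i) acc) row []) =
    sum_list (map (\<lambda>(d, i). monom 1 d * Poly (v ! i)) row)"
  by (induction row) (auto simp: Poly_padd Poly_shift)

lemma layers_correct:
  assumes "list_all distinct sts" "list_all (\<lambda>U. list_all (\<lambda>D. above U D \<in> set sts) (acs U)) sts"
  shows "i < length sts \<Longrightarrow>
    Poly (layers (trans_table sts) k ! i) = antichain_poly (chain k \<times> set (sts ! i))"
proof (induction k arbitrary: i)
  case 0
  then show ?case by (simp add: trans_table_def antichain_poly_chain_0 one_pCons)
next
  case (Suc k)
  let ?U = "sts ! i"
  have U: "?U \<in> set sts" "distinct ?U" using Suc.prems assms(1) by (auto simp: list_all_length)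
  have D: "above ?U D \<in> set sts" "distinct D" if "D \<in> set (acs ?U)" for D
    using assms(2) U that acs_distinct by (auto simp: list_all_iff)
  have "Poly (layers (trans_table sts) (Suc k) ! i) =
    sum_list (map (\<lambda>D. monom 1 (length D) * Poly (layers (trans_table sts) k ! idx sts (above ?U D))) (acs ?U))"
    using Suc.prems by (simp add: layer_def trans_table_def Poly_foldr comp_def)
  also have "\<dots> = sum_list (map (\<lambda>D. monom 1 (card (set D)) *
      antichain_poly (chain k \<times> {h \<in> set ?U. \<forall>d\<in>set D. \<not> h \<le> d})) (acs ?U))"
  proof (rule arg_cong[of _ _ sum_list], rule map_cong[OF refl])
    fix D assume "D \<in> set (acs ?U)"
    then have *: "above ?U D \<in> set sts" "distinct D" using D by auto
    have "set (above ?U D) = {h \<in> set ?U. \<forall>d\<in>set D. \<not> h \<le> d}" by (auto simp: above_def ple_iff)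
    then show "monom 1 (length D) * Poly (layers (trans_table sts) k ! idx sts (above ?U D)) =
      monom 1 (card (set D)) * antichain_poly (chain k \<times> {h \<in> set ?U. \<forall>d\<in>set D. \<not> h \<le> d})"
      using Suc.IH[of "idx sts (above ?U D)"] nth_idx[OF *(1)] *(2) by (simp add: distinct_card)
  qed
  also have "\<dots> = antichain_poly (chain (Suc k) \<times> set ?U)"
    unfolding antichain_poly_chain_Suc[OF finite_set] by (rule sum_acs[OF U(2), symmetric])
  finally show ?case .
qed

definition pts :: "nat \<Rightarrow> pt list" where
  "pts n = concat (map (\<lambda>i. map (\<lambda>j. (i, j)) [i..<Suc n]) [1..<Suc n])"

lemma set_pts: "set (pts n) = H n"
  by (auto simp: pts_def H_def chain_def image_iff simp del: upt_Suc)

text \<open>The whole of \<open>H n\<close> comes first, so entry 0 of a layer is the polynomial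
  sought. That the list is closed under further \<open>above\<close> steps is evaluated for each
  \<open>n\<close> in \<open>checked\<close> instead of being derived in general.\<close>

definition states :: "nat \<Rightarrow> pt list list" where
  "states n = pts n # filter (\<lambda>U. U \<noteq> pts n) (remdups (map (above (pts n)) (acs (pts n))))"

definition checked :: "nat \<Rightarrow> bool" where
  "checked n \<longleftrightarrow> list_all distinct (states n) \<and>
    list_all (\<lambda>U. list_all (\<lambda>D. above U D \<in> set (states n)) (acs U)) (states n)"

lemma antichain_poly_layers:
  assumes "checked n" "layers (trans_table (states n)) k ! 0 = cs"
  shows "antichain_poly (chain k \<times> H n) = Poly cs"
  using layers_correct[of "states n" 0 k] assms by (simp add: checked_def states_def set_pts)

lemma palindromic_Poly:
  assumes "list_all (\<lambda>c. c > 0) cs" "rev cs = cs" "cs \<noteq> []"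
  shows "palindromic (Poly cs)"
proof -
  have "last cs > 0" using assms(1,3) by (simp add: list_all_iff)
  then have "coeffs (Poly cs) = cs" using assms(3) by (simp add: coeffs_Poly strip_while_idem no_trailing_unfold)
  then have deg: "degree (Poly cs) = length cs - 1" by (simp add: degree_eq_length_coeffs)
  have c: "coeff (Poly cs) j = cs ! j" if "j < length cs" for j using that by (simp add: nth_default_nth)
  have sym: "cs ! j = cs ! (length cs - 1 - j)" if "j < length cs" for j
    using that assms(2) rev_nth[of j cs] by simp
  have pos: "cs ! j > 0" if "j < length cs" for j using that assms(1) by (simp add: list_all_length)
  have lt: "j < length cs" if "j \<le> length cs - 1" for j using that assms(3) by (cases cs) auto
  have lt': "length cs - 1 - j < length cs" for j using assms(3) by (cases cs) auto
  show ?thesis unfolding palindromic_def deg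
  proof (intro conjI allI impI)
    fix j assume "j \<le> length cs - 1"
    then have j: "j < length cs" by (rule lt)
    show "coeff (Poly cs) j > 0" unfolding c[OF j] by (rule pos[OF j])
    show "coeff (Poly cs) j = coeff (Poly cs) (length cs - 1 - j)"
      unfolding c[OF j] c[OF lt'] by (rule sym[OF j])
  qed
qed

lemma palindromic_small:
  "palindromic (antichain_poly (chain 3 \<times> H 2))" "palindromic (antichain_poly (chain 5 \<times> H 3))"
  "palindromic (antichain_poly (chain 3 \<times> H 4))" "palindromic (antichain_poly (chain 7 \<times> H 4))"
proof -
  have c2: "checked 2" by code_simp
  have c3: "checked 3" by code_simp
  have c4: "checked 4" by code_simp
  have "layers (trans_table (states 2)) 3 ! 0 = [1, 9, 9, 1]" by code_simp
  then show "palindromic (antichain_poly (chain 3 \<times> H 2))"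
    using antichain_poly_layers[OF c2] palindromic_Poly[of "[1, 9, 9, 1]"] by simp
  have "layers (trans_table (states 3)) 5 ! 0 = [1, 30, 165, 280, 165, 30, 1]" by code_simp
  then show "palindromic (antichain_poly (chain 5 \<times> H 3))"
    using antichain_poly_layers[OF c3] palindromic_Poly[of "[1, 30, 165, 280, 165, 30, 1]"] by simp
  have "layers (trans_table (states 4)) 3 ! 0 = [1, 30, 165, 280, 165, 30, 1]" by code_simp
  then show "palindromic (antichain_poly (chain 3 \<times> H 4))"
    using antichain_poly_layers[OF c4] palindromic_Poly[of "[1, 30, 165, 280, 165, 30, 1]"] by simp
  have "layers (trans_table (states 4)) 7 ! 0 = [1, 70, 1085, 6440, 17780, 24752, 17780, 6440, 1085, 70, 1]" by code_simp
  then show "palindromic (antichain_poly (chain 7 \<times> H 4))"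
    using antichain_poly_layers[OF c4] palindromic_Poly[of "[1, 70, 1085, 6440, 17780, 24752, 17780, 6440, 1085, 70, 1]"] by simp
qed

section \<open>Rows of a rank level\<close>

text \<open>The point \<open>(i, t - i)\<close> of \<open>H n\<close> is recorded by
  \<open>i\<close>. The left bound \<open>t - n\<close> is the wall \<open>j = n\<close>; the right
  bound \<open>t div 2\<close> lies on the diagonal when \<open>t\<close> is even.\<close>

definition row :: "nat \<Rightarrow> nat \<Rightarrow> nat set" where
  "row n t = {i. 1 \<le> i \<and> t \<le> i + n \<and> 2 * i \<le> t}"

text \<open>The covers of \<open>(i, t - i)\<close> in \<open>H n\<close> are
  \<open>(i, t + 1 - i)\<close> and \<open>(i + 1, t - i)\<close>, where they exist; they are
  recorded by \<open>i\<close> and \<open>Suc i\<close>.\<close>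

definition rise :: "nat \<Rightarrow> nat \<Rightarrow> nat set \<Rightarrow> nat set" where
  "rise n t S = row n (Suc t) \<inter> (S \<union> Suc ` S)"

text \<open>One element for each maximal run of consecutive numbers.\<close>

definition ends :: "nat set \<Rightarrow> nat set" where
  "ends S = {i \<in> S. Suc i \<notin> S}"

definition growth :: "nat \<Rightarrow> nat \<Rightarrow> nat set \<Rightarrow> int" where
  "growth n t S = int (card (rise n t S)) - int (card S)"

lemma row_eq: "row n t = {max 1 (t - n)..t div 2}"
  by (auto simp: row_def)

lemma finite_row [simp, intro]: "finite (row n t)"
  by (simp add: row_eq)

lemma finite_row_subset: "S \<subseteq> row n t \<Longrightarrow> finite S"
  by (rule finite_subset) auto

lemma rise_subset: "rise n t S \<subseteq> row n (Suc t)"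
  by (auto simp: rise_def)

lemma finite_rise [simp, intro]: "finite (rise n t S)"
  by (simp add: rise_def)

lemma rise_mono: "S \<subseteq> S' \<Longrightarrow> rise n t S \<subseteq> rise n t S'"
  by (auto simp: rise_def)

lemma rise_empty [simp]: "rise n t {} = {}"
  by (simp add: rise_def)

lemma growth_empty [simp]: "growth n t {} = 0"
  by (simp add: growth_def)

text \<open>Only two kinds of candidates leave the triangle: over a wall point the one with
  \<open>j = n + 1\<close>, and over a diagonal point the one with \<open>i = j + 1\<close>.\<close>

lemma rise_alt:
  assumes "S \<subseteq> row n t"
  shows "rise n t S = (S \<union> Suc ` ends S) - ({i. i \<in> S \<and> i + n = t} \<union> {Suc i |i. i \<in> S \<and> 2 * i = t})"
    (is "_ = ?A - ?B")
proof (intro equalityI subsetI)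
  fix x assume "x \<in> rise n t S"
  then have "x \<in> S \<or> x \<in> Suc ` S" "1 \<le> x" "Suc t \<le> x + n" "2 * x \<le> Suc t"
    by (auto simp: rise_def row_def)
  then show "x \<in> ?A - ?B" by (auto simp: ends_def)
next
  fix x assume x: "x \<in> ?A - ?B"
  then have "x \<in> S \<union> Suc ` S" by (auto simp: ends_def)
  moreover have "x \<in> row n (Suc t)"
  proof (cases "x \<in> S")
    case True
    then have "1 \<le> x" "t \<le> x + n" "2 * x \<le> t" "x + n \<noteq> t"
      using assms x by (auto simp: row_def)
    then show ?thesis by (auto simp: row_def)
  next
    case False
    then obtain i where "x = Suc i" "i \<in> S" "2 * i \<noteq> t" using x by (auto simp: ends_def)
    then show ?thesis using assms by (force simp: row_def)
  qed
  ultimately show "x \<in> rise n t S" by (simp add: rise_def)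
qed

text \<open>Each run gains its right neighbour; a run touching the wall loses its left end, and a
  run touching the diagonal does not gain. The additive form avoids truncated subtraction; for
  \<open>t <= n\<close> the truncated \<open>t - n\<close> is 0, which lies in no row.\<close>

lemma card_rise:
  assumes "S \<subseteq> row n t"
  shows "card (rise n t S) + of_bool (t - n \<in> S) + of_bool (even t \<and> t div 2 \<in> S)
    = card S + card (ends S)"
proof -
  have fin: "finite S" using assms finite_row_subset by blast
  have fe: "finite (ends S)" using fin by (simp add: ends_def)
  let ?B1 = "{i. i \<in> S \<and> i + n = t}" and ?B2 = "{Suc i |i. i \<in> S \<and> 2 * i = t}"
  have pos: "\<And>i. i \<in> S \<Longrightarrow> 1 \<le> i \<and> t \<le> i + n \<and> 2 * i \<le> t" using assms by (auto simp: row_def)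
  have B1: "card ?B1 = of_bool (t - n \<in> S)"
  proof (cases "t - n \<in> S")
    case True
    then have "?B1 = {t - n}" using pos[OF True] by auto
    then show ?thesis using True by simp
  next
    case False
    then have B1e: "?B1 = {}" by auto
    show ?thesis unfolding B1e using False by simp
  qed
  have B2: "card ?B2 = of_bool (even t \<and> t div 2 \<in> S)"
  proof (cases "even t \<and> t div 2 \<in> S")
    case True
    then have "?B2 = {Suc (t div 2)}" by auto
    then show ?thesis using True by simp
  next
    case False
    then have B2e: "?B2 = {}" by auto
    show ?thesis unfolding B2e using False by auto
  qed
  have disj: "?B1 \<inter> ?B2 = {}"
  proof (rule ccontr)
    assume "\<not> ?thesis"
    then obtain x where "x \<in> ?B1" "x \<in> ?B2" by blast
    then obtain i where "x + n = t" "x = Suc i" "i \<in> S" "2 * i = t" by blast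
    then show False using pos[of i] by linarith
  qed
  have sub: "?B1 \<union> ?B2 \<subseteq> S \<union> Suc ` ends S"
    using pos by (force simp: ends_def)
  have "card (S \<union> Suc ` ends S) = card S + card (Suc ` ends S)"
    by (rule card_Un_disjoint) (use fin fe in \<open>auto simp: ends_def\<close>)
  also have "card (Suc ` ends S) = card (ends S)" by (simp add: card_image)
  finally have "card (S \<union> Suc ` ends S) = card S + card (ends S)" .
  moreover have "card (?B1 \<union> ?B2) = card ?B1 + card ?B2"
    by (rule card_Un_disjoint) (use disj fin in auto)
  moreover have "finite (?B1 \<union> ?B2)" using sub fin fe by (meson finite_Un finite_imageI finite_subset)
  then have "card (rise n t S) = card (S \<union> Suc ` ends S) - card (?B1 \<union> ?B2)"
    unfolding rise_alt[OF assms] using sub by (intro card_Diff_subset) auto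
  moreover have "card (?B1 \<union> ?B2) \<le> card (S \<union> Suc ` ends S)"
    by (rule card_mono[OF _ sub]) (use fin fe in auto)
  ultimately show ?thesis using B1 B2 by simp
qed

lemma growth_eq:
  assumes "S \<subseteq> row n t"
  shows "growth n t S = int (card (ends S)) - of_bool (t - n \<in> S) - of_bool (even t \<and> t div 2 \<in> S)"
proof -
  have "int (card (rise n t S)) + of_bool (t - n \<in> S) + of_bool (even t \<and> t div 2 \<in> S)
    = int (card S) + int (card (ends S))"
    using arg_cong[OF card_rise[OF assms], of int] by (simp only: of_nat_add of_nat_of_bool)
  then show ?thesis by (simp only: growth_def)
qed

lemma ends_interval: "a \<le> b \<Longrightarrow> ends {a..b} = {b}"
  by (auto simp: ends_def)

lemma Max_in_ends: "finite S \<Longrightarrow> S \<noteq> {} \<Longrightarrow> Max S \<in> ends S"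
  using Max_ge[of S "Suc (Max S)"] Max_in[of S] by (auto simp: ends_def simp del: Max_ge)

lemma card_ends_pos: "finite S \<Longrightarrow> S \<noteq> {} \<Longrightarrow> card (ends S) \<ge> 1"
proof -
  assume "finite S" "S \<noteq> {}"
  then have "Max S \<in> ends S" by (rule Max_in_ends)
  moreover have "finite (ends S)" unfolding ends_def using \<open>finite S\<close> by simp
  ultimately have "0 < card (ends S)" unfolding card_gt_0_iff by blast
  then show "card (ends S) \<ge> 1" by linarith
qed

text \<open>Peeling off the last run reduces the number of runs by one; this classifies the sets
  with one or two runs.\<close>

lemma split_last_interval:
  assumes "finite (S :: nat set)" "S \<noteq> {}"
  obtains a b S' where "a \<le> b" "S = S' \<union> {a..b}" "b = Max S" "\<forall>x\<in>S'. Suc x < a"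
    "card (ends S) = Suc (card (ends S'))" "S' \<subseteq> S" "a \<in> S"
proof -
  define b where "b = Max S"
  have bS: "b \<in> S" using assms by (simp add: b_def)
  define a where "a = (LEAST a. {a..b} \<subseteq> S)"
  have ab: "{a..b} \<subseteq> S" unfolding a_def by (rule LeastI[of _ b]) (use bS in simp)
  have "a \<le> b" unfolding a_def by (rule Least_le) (use bS in simp)
  define S' where "S' = S - {a..b}"
  have le: "x \<le> b" if "x \<in> S" for x using that assms(1) by (simp add: b_def)
  have lt: "x < a" if "x \<in> S'" for x using that le by (fastforce simp: S'_def)
  have a1: "a - 1 \<notin> S" if "a > 0"
  proof
    assume "a - 1 \<in> S"
    then have "{a - 1..b} \<subseteq> S" using ab that by (auto simp: subset_eq) (metis Suc_pred atLeastAtMost_iff not_less_eq_eq le_antisym)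
    then have "a \<le> a - 1" unfolding a_def by (rule Least_le)
    then show False using that by simp
  qed
  have lt': "Suc x < a" if "x \<in> S'" for x
  proof -
    have "x < a" by (rule lt[OF that])
    moreover have "x \<noteq> a - 1" using a1 that \<open>x < a\<close> by (auto simp: S'_def)
    ultimately show ?thesis by simp
  qed
  have S: "S = S' \<union> {a..b}" using ab by (auto simp: S'_def)
  have "ends S = insert b (ends S')"
    using lt' \<open>a \<le> b\<close> by (subst S) (fastforce simp: ends_def)
  moreover have "b \<notin> ends S'" using \<open>a \<le> b\<close> by (auto simp: ends_def S'_def)
  moreover have "finite (ends S')" using assms(1) by (simp add: ends_def S'_def)
  ultimately have "card (ends S) = Suc (card (ends S'))" by simp
  moreover have "a \<in> S" using ab \<open>a \<le> b\<close> by auto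
  moreover have "S' \<subseteq> S" by (auto simp: S'_def)
  ultimately show ?thesis
    using that[OF \<open>a \<le> b\<close> S b_def] lt' by blast
qed

lemma interval_if_card_ends_1:
  assumes "finite S" "card (ends S) = 1"
  obtains a b where "a \<le> b" "S = {a..b}" "b = Max S"
proof -
  have "S \<noteq> {}" using assms(2) by (auto simp: ends_def)
  from split_last_interval[OF assms(1) this]
  obtain a b S' where *: "a \<le> b" "S = S' \<union> {a..b}" "b = Max S" "card (ends S) = Suc (card (ends S'))"
    "S' \<subseteq> S" .
  have "card (ends S') = 0" using assms(2) *(4) by simp
  then have "S' = {}" using card_ends_pos[OF finite_subset[OF *(5) assms(1)]] by linarith
  then have "S = {a..b}" using *(2) by simp
  then show ?thesis using *(1,3) that by blast
qed

lemma two_intervals_if_card_ends_2: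
  assumes "finite S" "card (ends S) = 2"
  obtains a b c d where "S = {a..b} \<union> {c..d}" "a \<le> b" "Suc b < c" "c \<le> d" "d = Max S"
proof -
  have "S \<noteq> {}" using assms(2) by (auto simp: ends_def)
  from split_last_interval[OF assms(1) this]
  obtain c d S' where *: "c \<le> d" "S = S' \<union> {c..d}" "d = Max S" "\<forall>x\<in>S'. Suc x < c"
    "card (ends S) = Suc (card (ends S'))" "S' \<subseteq> S" .
  have "card (ends S') = 1" "finite S'"
    using assms(2) *(5) finite_subset[OF *(6) assms(1)] by simp_all
  from interval_if_card_ends_1[OF this(2,1)] obtain a b where ab: "a \<le> b" "S' = {a..b}" .
  then have "Suc b < c" using *(4) by simp
  then show ?thesis using * ab that by blast
qed

text \<open>Growth \<open>-1\<close> needs a single run that touches both the wall and the diagonal,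
  and such a run is the entire row.\<close>

lemma growth_nonneg:
  assumes "S \<subseteq> row n t" "\<not> (even t \<and> n < t \<and> S = row n t \<and> S \<noteq> {})"
  shows "growth n t S \<ge> 0"
proof (cases "S = {}")
  case False
  have fin: "finite S" using assms(1) finite_row_subset by blast
  have e1: "card (ends S) \<ge> 1" using card_ends_pos[OF fin False] .
  show ?thesis
  proof (rule ccontr)
    assume "\<not> ?thesis"
    then have 1: "card (ends S) = 1" and l: "t - n \<in> S" and r: "even t" "t div 2 \<in> S"
      using e1 growth_eq[OF assms(1)] by (auto split: if_splits simp: of_bool_def)
    obtain a b where ab: "a \<le> b" "S = {a..b}" using interval_if_card_ends_1[OF fin 1] by metis
    have "t - n \<ge> 1" using l assms(1) by (auto simp: row_def)
    moreover have "a \<le> t - n" "t div 2 \<le> b" using l r ab by auto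
    ultimately have "row n t \<subseteq> S" unfolding ab(2) row_eq by auto
    then show False using assms r(1) False \<open>t - n \<ge> 1\<close> by auto
  qed
qed simp

lemma growth_ge_minus_1: "S \<subseteq> row n t \<Longrightarrow> growth n t S \<ge> - 1"
  using card_ends_pos[OF finite_row_subset[of S n t]] growth_eq[of S n t]
  by (cases "S = {}") (auto simp: of_bool_def)

text \<open>An odd row with \<open>t <= n\<close> has no boundary element at all, so every run costs
  one unit. This is the source of the lower bounds at odd distance from the middle.\<close>

lemma growth_odd_low:
  assumes "S \<subseteq> row n t" "odd t" "t \<le> n"
  shows "growth n t S = int (card (ends S))"
proof -
  have "t - n \<notin> S" using assms by (auto simp: row_def)
  then show ?thesis using growth_eq[OF assms(1)] assms(2) by simp
qed

lemma growth_odd_low_pos: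
  assumes "S \<subseteq> row n t" "odd t" "t \<le> n" "S \<noteq> {}"
  shows "growth n t S \<ge> 1"
  using growth_odd_low[OF assms(1-3)] card_ends_pos[OF finite_row_subset[OF assms(1)] assms(4)] by simp

lemma growth_even_low:
  assumes "S \<subseteq> row n t" "even t" "t \<le> n"
  shows "growth n t S = int (card (ends S)) - of_bool (t div 2 \<in> S)"
proof -
  have "t - n \<notin> S" using assms by (auto simp: row_def)
  then show ?thesis using growth_eq[OF assms(1)] assms(2) by simp
qed

lemma Max_row_subset: "S \<subseteq> row n t \<Longrightarrow> t div 2 \<in> S \<Longrightarrow> Max S = t div 2"
  by (rule Max_eqI) (auto simp: row_def finite_row_subset)

lemma growth_even_low_0:
  assumes "S \<subseteq> row n t" "even t" "t \<le> n" "growth n t S = 0" "S \<noteq> {}"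
  obtains a where "1 \<le> a" "a \<le> t div 2" "S = {a..t div 2}"
proof -
  have fin: "finite S" using assms(1) finite_row_subset by blast
  have *: "card (ends S) = 1" "t div 2 \<in> S"
    using card_ends_pos[OF fin assms(5)] growth_even_low[OF assms(1-3)] assms(4)
    by (auto split: if_splits simp: of_bool_def)
  from interval_if_card_ends_1[OF fin *(1)] obtain a b where ab: "a \<le> b" "S = {a..b}" "b = Max S" .
  have b: "b = t div 2" using ab(3) Max_row_subset[OF assms(1) *(2)] by simp
  have "a \<in> S" using ab(1,2) by simp
  then have "1 \<le> a" using assms(1) by (auto simp: row_def)
  then show ?thesis using that ab(1,2) b by blast
qed

lemma row_lower_0: "row n 0 = {}" "row n (Suc 0) = {}"
  by (auto simp: row_def)

lemma rise_row:
  assumes "2 \<le> t"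
  shows "rise n t (row n t) = row n (Suc t)"
proof -
  have "x \<in> row n t \<union> Suc ` row n t" if "x \<in> row n (Suc t)" for x
  proof (cases "x \<in> row n t")
    case False
    then have "2 * x = Suc t" "Suc t \<le> x + n" using that by (auto simp: row_def)
    then have "x - 1 \<in> row n t" "x = Suc (x - 1)" using assms by (auto simp: row_def)
    then show ?thesis by blast
  qed simp
  then show ?thesis by (auto simp: rise_def)
qed

lemma card_row_low: "t \<le> Suc n \<Longrightarrow> card (row n t) = t div 2"
  by (cases "t = Suc n") (simp_all add: row_eq)

lemma card_row_high: "n < t \<Longrightarrow> card (row n t) = Suc (t div 2) - (t - n)"
  by (simp add: row_eq max_def)

lemma card_row_le: "S \<subseteq> row n t \<Longrightarrow> card S \<le> t div 2"
proof -
  assume "S \<subseteq> row n t"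
  also have "row n t \<subseteq> {1..t div 2}" by (auto simp: row_def)
  finally have "card S \<le> card {1..t div 2}" by (intro card_mono) auto
  then show ?thesis by simp
qed

section \<open>Configurations of rows: costs, losses and excess\<close>

definition configs :: "nat \<Rightarrow> nat \<Rightarrow> nat \<Rightarrow> (nat \<Rightarrow> nat set) set" where
  "configs n lo hi = {Z. \<forall>t. Z t \<subseteq> row n t \<and> (t \<notin> {lo..hi} \<longrightarrow> Z t = {})}"

text \<open>On a level \<open>s\<close>, \<open>Z t\<close> holds the elements of color
  \<open>s - t\<close>. The next level receives in row \<open>t\<close> the rise of row
  \<open>t - 1\<close> and a copy of \<open>Z t\<close> one color up; the first summand counts what
  the copy adds. Row \<open>lo\<close> has the top color, so it has no copy.\<close>

definition cost :: "nat \<Rightarrow> nat \<Rightarrow> (nat \<Rightarrow> nat set) \<Rightarrow> nat \<Rightarrow> int" where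
  "cost n lo Z t = (if t = lo then 0 else int (card (Z t - rise n (t - 1) (Z (t - 1))))) + growth n t (Z t)"

definition loss :: "nat \<Rightarrow> (nat \<Rightarrow> nat set) \<Rightarrow> nat \<Rightarrow> nat" where
  "loss n Z s = card (rise n (s - 1) (Z (s - 1)) - Z s)"

lemma configsD:
  assumes "Z \<in> configs n lo hi"
  shows "Z t \<subseteq> row n t" "finite (Z t)" "t < lo \<Longrightarrow> Z t = {}" "hi < t \<Longrightarrow> Z t = {}"
proof -
  show "Z t \<subseteq> row n t" using assms unfolding configs_def by blast
  then show "finite (Z t)" by (rule finite_row_subset)
  show "t < lo \<Longrightarrow> Z t = {}" "hi < t \<Longrightarrow> Z t = {}"
    using assms unfolding configs_def by simp_all
qed

text \<open>Telescoping: \<open>Z (Suc u)\<close> and the rise of \<open>Z u\<close> have the same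
  intersection, so passing from one to the other exchanges gains for losses.\<close>

lemma sum_cost_partial:
  assumes "Z \<in> configs n lo hi" "lo \<le> u"
  shows "(\<Sum>t=lo..u. cost n lo Z t) =
    int (card (rise n u (Z u))) + (\<Sum>s=Suc lo..u. int (loss n Z s)) - int (card (Z lo))"
  using assms(2)
proof (induction u rule: dec_induct)
  case base
  then show ?case by (simp add: cost_def growth_def)
next
  case (step u)
  have fin: "finite (Z (Suc u))" "finite (rise n u (Z u))" by (rule configsD(2)[OF assms(1)]) simp
  have "card (Z (Suc u)) = card (Z (Suc u) - rise n u (Z u)) + card (Z (Suc u) \<inter> rise n u (Z u))"
    using card_Int_Diff[OF fin(1), of "rise n u (Z u)"] by simp
  moreover have "card (rise n u (Z u)) = card (rise n u (Z u) - Z (Suc u)) + card (Z (Suc u) \<inter> rise n u (Z u))"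
    using card_Int_Diff[OF fin(2), of "Z (Suc u)"] by (simp add: Int_commute)
  ultimately show ?case
    using step by (simp add: cost_def growth_def loss_def)
qed

definition excess :: "nat \<Rightarrow> nat \<Rightarrow> nat \<Rightarrow> (nat \<Rightarrow> nat set) \<Rightarrow> int" where
  "excess n lo hi Z = (\<Sum>t=lo..hi. cost n lo Z t)"

text \<open>Full rows are the only ones whose growth can be negative.\<close>

definition full :: "nat \<Rightarrow> (nat \<Rightarrow> nat set) \<Rightarrow> nat \<Rightarrow> bool" where
  "full n Z u \<longleftrightarrow> even u \<and> n < u \<and> Z u = row n u \<and> row n u \<noteq> {}"

lemma growth_nonneg_config: "Z \<in> configs n lo hi \<Longrightarrow> \<not> full n Z t \<Longrightarrow> growth n t (Z t) \<ge> 0"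
  by (rule growth_nonneg[OF configsD(1)]) (auto simp: full_def)

lemma cost_nonneg: "Z \<in> configs n lo hi \<Longrightarrow> \<not> full n Z t \<Longrightarrow> cost n lo Z t \<ge> 0"
  using growth_nonneg_config[of Z n lo hi t] by (simp add: cost_def)

lemma gain_eq_0_iff:
  assumes "Z \<in> configs n lo hi"
  shows "card (Z t - rise n (t - 1) (Z (t - 1))) = 0 \<longleftrightarrow> Z t \<subseteq> rise n (t - 1) (Z (t - 1))"
  using configsD(2)[OF assms, of t] by auto

lemma cost_0D:
  assumes "Z \<in> configs n lo hi" "\<not> full n Z t" "cost n lo Z t = 0"
  shows "growth n t (Z t) = 0" "t \<noteq> lo \<Longrightarrow> Z t \<subseteq> rise n (t - 1) (Z (t - 1))"
proof -
  have "growth n t (Z t) \<ge> 0" using growth_nonneg_config[OF assms(1,2)] .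
  then show "growth n t (Z t) = 0" "t \<noteq> lo \<Longrightarrow> Z t \<subseteq> rise n (t - 1) (Z (t - 1))"
    using assms(3) unfolding gain_eq_0_iff[OF assms(1), symmetric]
    by (auto simp: cost_def simp del: card_eq_0_iff card_0_eq split: if_splits)
qed

lemma cost_after_empty:
  assumes "Z \<in> configs n lo hi" "\<not> full n Z t" "t \<noteq> lo" "Z (t - 1) = {}"
  shows "cost n lo Z t = int (card (Z t)) + growth n t (Z t)" "cost n lo Z t \<ge> int (card (Z t))"
  using assms growth_nonneg_config[OF assms(1,2)] by (auto simp: cost_def)

lemma empty_after_empty:
  assumes "Z \<in> configs n lo hi" "lo \<le> t" "Z t = {}"
    and "\<And>s. t < s \<Longrightarrow> s \<le> hi \<Longrightarrow> \<not> full n Z s \<and> cost n lo Z s = 0"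
  shows "t \<le> s \<Longrightarrow> Z s = {}"
proof (induction s rule: dec_induct)
  case base
  show ?case by (rule assms(3))
next
  case (step s)
  show ?case
  proof (cases "Suc s \<le> hi")
    case True
    then have "Z (Suc s) \<subseteq> rise n (Suc s - 1) (Z (Suc s - 1))"
      using cost_0D(2)[OF assms(1), of "Suc s"] assms(4)[of "Suc s"] step assms(2) by simp
    then show ?thesis using step(3) by simp
  next
    case False
    then show ?thesis using configsD(4)[OF assms(1)] by simp
  qed
qed

lemma excess_split:
  assumes "lo \<le> t" "t \<le> hi"
  shows "excess n lo hi Z = cost n lo Z t + (\<Sum>s\<in>{lo..hi} - {t}. cost n lo Z s)"
  unfolding excess_def by (rule sum.remove) (use assms in auto)

lemma excess_ge_cost:
  assumes "Z \<in> configs n lo hi" "\<And>u. u \<le> hi \<Longrightarrow> \<not> full n Z u" "lo \<le> t" "t \<le> hi"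
  shows "cost n lo Z t \<le> excess n lo hi Z"
proof -
  have "(\<Sum>s\<in>{lo..hi} - {t}. cost n lo Z s) \<ge> 0"
    by (rule sum_nonneg) (use cost_nonneg[OF assms(1)] assms(2) in auto)
  then show ?thesis unfolding excess_split[OF assms(3,4)] by simp
qed

lemma other_costs_0:
  assumes "Z \<in> configs n lo hi" "\<And>u. u \<le> hi \<Longrightarrow> \<not> full n Z u" "lo \<le> t" "t \<le> hi"
    "excess n lo hi Z \<le> cost n lo Z t" "lo \<le> s" "s \<le> hi" "s \<noteq> t"
  shows "cost n lo Z s = 0"
proof -
  have nn: "cost n lo Z s \<ge> 0" if "s \<in> {lo..hi} - {t}" for s
    using cost_nonneg[OF assms(1)] assms(2) that by simp
  have "(\<Sum>s\<in>{lo..hi} - {t}. cost n lo Z s) \<le> 0"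
    using assms(5) unfolding excess_split[OF assms(3,4)] by simp
  moreover have "(\<Sum>s\<in>{lo..hi} - {t}. cost n lo Z s) \<ge> 0" by (rule sum_nonneg) (rule nn)
  ultimately have "(\<Sum>s\<in>{lo..hi} - {t}. cost n lo Z s) = 0" by linarith
  moreover have "finite ({lo..hi} - {t})" by simp
  ultimately have "\<forall>s\<in>{lo..hi} - {t}. cost n lo Z s = 0" using sum_nonneg_eq_0_iff nn by blast
  then show ?thesis using assms(6-8) by simp
qed

lemma card_rise_full:
  assumes "full n Z u"
  shows "card (rise n u (Z u)) = n - u div 2" "u div 2 \<le> n" "2 \<le> u"
proof -
  obtain v where u: "u = 2 * v" using assms by (auto simp: full_def)
  have "row n u \<noteq> {}" "n < u" using assms by (auto simp: full_def)
  then have "1 \<le> v" "v \<le> n" using u by (auto simp: row_eq)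
  then show "u div 2 \<le> n" "2 \<le> u" using u by simp_all
  then have "card (rise n u (Z u)) = card (row n (Suc u))" using assms by (simp add: full_def rise_row)
  also have "\<dots> = n - u div 2" using \<open>n < u\<close> u \<open>v \<le> n\<close> by (simp add: card_row_high)
  finally show "card (rise n u (Z u)) = n - u div 2" .
qed

text \<open>Cutting the sum of the costs after the last full row \<open>u\<close> leaves only nonnegative terms.\<close>

lemma excess_full:
  assumes "Z \<in> configs n lo hi" "full n Z u" "lo \<le> u" "u \<le> hi"
  shows "excess n lo hi Z = int (n - u div 2) + (\<Sum>s=Suc lo..u. int (loss n Z s)) - int (card (Z lo))
    + (\<Sum>t=Suc u..hi. cost n lo Z t)"
proof -
  have "excess n lo hi Z = (\<Sum>t=lo..u. cost n lo Z t) + (\<Sum>t=Suc u..hi. cost n lo Z t)"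
  proof -
    have "{lo..hi} = {lo..u} \<union> {Suc u..hi}" using assms(3,4) by auto
    moreover have "{lo..u} \<inter> {Suc u..hi} = {}" by auto
    ultimately show ?thesis unfolding excess_def by (simp add: sum.union_disjoint)
  qed
  then show ?thesis
    unfolding sum_cost_partial[OF assms(1,3)] using card_rise_full(1)[OF assms(2)] by simp
qed

lemma last_full:
  assumes "full n Z u" "u \<le> hi"
  obtains u' where "full n Z u'" "u' \<le> hi" "\<And>t. u' < t \<Longrightarrow> t \<le> hi \<Longrightarrow> \<not> full n Z t"
proof -
  let ?A = "{t. full n Z t \<and> t \<le> hi}"
  have fin: "finite ?A" by (rule finite_subset[of _ "{..hi}"]) auto
  have ne: "?A \<noteq> {}" using assms by blast
  have "Max ?A \<in> ?A" by (rule Max_in[OF fin ne])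
  moreover have "\<not> full n Z t" if "Max ?A < t" "t \<le> hi" for t
  proof
    assume "full n Z t"
    then have "t \<le> Max ?A" using that(2) by (intro Max_ge[OF fin]) blast
    then show False using that(1) by simp
  qed
  ultimately show ?thesis using that[of "Max ?A"] by blast
qed

lemma full_in_range: "Z \<in> configs n lo hi \<Longrightarrow> full n Z u \<Longrightarrow> lo \<le> u \<and> u \<le> hi"
  using configsD(3,4)[of Z n lo hi u] by (fastforce simp: full_def)

lemma first_nonempty:
  assumes "Z \<in> configs n lo hi" "Z t \<noteq> {}"
  obtains t0 where "Z t0 \<noteq> {}" "lo \<le> t0" "t0 \<le> hi" "\<And>s. s < t0 \<Longrightarrow> Z s = {}"
proof -
  define t0 where "t0 = (LEAST t. Z t \<noteq> {})"
  have ne: "Z t0 \<noteq> {}" unfolding t0_def by (rule LeastI[of _ t]) (rule assms(2))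
  moreover have "lo \<le> t0" using ne configsD(3)[OF assms(1)] not_le_imp_less by blast
  moreover have "t0 \<le> hi" using ne configsD(4)[OF assms(1)] not_le_imp_less by blast
  moreover have "\<And>s. s < t0 \<Longrightarrow> Z s = {}" unfolding t0_def using not_less_Least by blast
  ultimately show ?thesis using that by blast
qed

lemma card_pos_config: "Z \<in> configs n lo hi \<Longrightarrow> Z t \<noteq> {} \<Longrightarrow> card (Z t) \<ge> 1"
  using configsD(2)[of Z n lo hi t] by (simp add: Suc_le_eq card_gt_0_iff)

text \<open>Let \<open>u = 2 v\<close> be the last full row and \<open>h\<close> half of
  \<open>D\<close> rounded up. The excess is at least \<open>(n - v) - card (Z lo)\<close>, where
  \<open>v <= r + m - h\<close> and, for \<open>D <= 2 r\<close>,
  \<open>card (Z lo) <= r - h\<close>; this leaves \<open>2 h - 1\<close>.\<close>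

lemma excess_ge_full:
  assumes "Z \<in> configs n lo hi" "full n Z u" "n + 1 = 2 * r + m" "lo = 2 * r - D" "hi + D = 2 * r + 2 * m"
    "1 \<le> D" "1 \<le> r"
  shows "excess n lo hi Z \<ge> 0" "D \<le> 2 \<Longrightarrow> excess n lo hi Z \<ge> 1" "odd D \<Longrightarrow> D \<le> 2 * r \<Longrightarrow> excess n lo hi Z \<ge> 1"
proof -
  have uhi: "u \<le> hi" using full_in_range[OF assms(1,2)] by simp
  obtain u where u: "full n Z u" "u \<le> hi" "\<And>t. u < t \<Longrightarrow> t \<le> hi \<Longrightarrow> \<not> full n Z t"
    using last_full[OF assms(2) uhi] by blast
  have lou: "lo \<le> u" using full_in_range[OF assms(1) u(1)] by simp
  have ev: "even u" and vn: "u div 2 \<le> n" using u(1) card_rise_full(2) by (auto simp: full_def)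
  have rest: "(\<Sum>t=Suc u..hi. cost n lo Z t) \<ge> 0"
    by (rule sum_nonneg) (use cost_nonneg[OF assms(1)] u(3) in auto)
  have l: "(\<Sum>s=Suc lo..u. int (loss n Z s)) \<ge> 0" by (rule sum_nonneg) simp
  have ge: "excess n lo hi Z \<ge> int n - int (u div 2) - int (card (Z lo))"
    unfolding excess_full[OF assms(1) u(1) lou u(2)] using rest l vn by (simp add: of_nat_diff)
  have c: "card (Z lo) \<le> lo div 2" by (rule card_row_le[OF configsD(1)[OF assms(1)]])
  obtain v where v: "u = 2 * v" using ev by blast
  have D: "D = 2 * (D div 2) \<or> D = 2 * (D div 2) + 1" by presburger
  have v': "u div 2 = v" "v + (D + 1) div 2 \<le> r + m" using v u(2) assms(5) by auto
  have "card (Z lo) \<le> r - (D + 1) div 2" using c assms(4) by auto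
  then have "excess n lo hi Z \<ge> int n - int v - int (r - (D + 1) div 2)" using ge v'(1) by linarith
  moreover have "int n = 2 * int r + int m - 1" using assms(3) by linarith
  moreover have "(D + 1) div 2 \<ge> 1" using assms(6) by linarith
  ultimately show "excess n lo hi Z \<ge> 0" "D \<le> 2 \<Longrightarrow> excess n lo hi Z \<ge> 1"
    "odd D \<Longrightarrow> D \<le> 2 * r \<Longrightarrow> excess n lo hi Z \<ge> 1"
    using v'(2) assms(6,7) by linarith+
qed

lemma excess_nonneg:
  assumes "Z \<in> configs n lo hi" "n + 1 = 2 * r + m" "lo = 2 * r - D" "hi + D = 2 * r + 2 * m" "1 \<le> D" "1 \<le> r"
  shows "excess n lo hi Z \<ge> 0"
proof (cases "\<exists>u. full n Z u")
  case True
  then show ?thesis using excess_ge_full(1)[OF assms(1) _ assms(2-6)] by blast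
next
  case False
  then show ?thesis unfolding excess_def by (intro sum_nonneg cost_nonneg[OF assms(1)]) blast
qed

text \<open>Without full rows the first nonempty row costs at least one: above \<open>lo\<close> all
  its elements are gains, and \<open>lo\<close> itself is an odd row below the wall.\<close>

lemma excess_pos_odd:
  assumes "Z \<in> configs n lo hi" "n + 1 = 2 * r + m" "lo = 2 * r - D" "hi + D = 2 * r + 2 * m"
    "odd D" "D \<le> 2 * r" "1 \<le> r" "Z t \<noteq> {}"
  shows "excess n lo hi Z \<ge> 1"
proof (cases "\<exists>u. full n Z u")
  case True
  have "1 \<le> D" using assms(5) by (cases D) auto
  then show ?thesis using True excess_ge_full(3)[OF assms(1) _ assms(2-4) _ assms(7,5,6)] by blast
next
  case False
  obtain t0 where t0: "Z t0 \<noteq> {}" "lo \<le> t0" "t0 \<le> hi" "\<And>s. s < t0 \<Longrightarrow> Z s = {}"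
    using first_nonempty[OF assms(1,8)] by metis
  have "cost n lo Z t0 \<ge> 1"
  proof (cases "t0 = lo")
    case True
    have "1 \<le> D" using assms(5) by (cases D) auto
    then have "odd lo" "lo \<le> n" using assms(2-7) by auto
    then have "growth n lo (Z lo) \<ge> 1"
      using growth_odd_low_pos[OF configsD(1)[OF assms(1)]] t0(1) True by blast
    then show ?thesis using True by (simp add: cost_def)
  next
    case F: False
    then have "cost n lo Z t0 \<ge> int (card (Z t0))"
      using cost_after_empty(2)[OF assms(1), of t0] False t0 by simp
    then show ?thesis using card_pos_config[OF assms(1) t0(1)] by simp
  qed
  then show ?thesis using excess_ge_cost[OF assms(1) _ t0(2,3)] False by force
qed

text \<open>When every cost vanishes, the first nonempty row must be \<open>lo\<close>, where zero
  growth means a run ending on the diagonal. The next row is odd and at most \<open>n\<close>, hence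
  empty, and nothing starts later for free.\<close>

lemma excess_0_even:
  assumes "Z \<in> configs n lo hi" "n + 1 = 2 * r + m" "lo + 2 = 2 * r" "hi + 2 = 2 * r + 2 * m"
    "excess n lo hi Z = 0" "1 \<le> m" "Z t \<noteq> {}"
  obtains b where "1 \<le> b" "b < r" "Z = (\<lambda>t. if t = lo then {b..<r} else {})"
proof -
  have r1: "1 \<le> r" using assms(3) by simp
  have nf: "\<not> full n Z u" for u
  proof
    assume "full n Z u"
    moreover have "lo = 2 * r - 2" using assms(3) by linarith
    ultimately have "excess n lo hi Z \<ge> 1"
      using excess_ge_full(2)[OF assms(1) _ assms(2) _ assms(4) _ r1] by simp
    then show False using assms(5) by simp
  qed
  obtain t0 where t0: "Z t0 \<noteq> {}" "lo \<le> t0" "t0 \<le> hi" "\<And>s. s < t0 \<Longrightarrow> Z s = {}"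
    using first_nonempty[OF assms(1,7)] by metis
  have c0: "cost n lo Z s = 0" if "lo \<le> s" "s \<le> hi" for s
    using excess_ge_cost[OF assms(1) nf that] cost_nonneg[OF assms(1) nf, of s] assms(5) by simp
  have "t0 = lo"
  proof (rule ccontr)
    assume "t0 \<noteq> lo"
    then have "cost n lo Z t0 \<ge> int (card (Z t0))"
      using cost_after_empty(2)[OF assms(1) nf, of t0] t0 by simp
    then show False using card_pos_config[OF assms(1) t0(1)] c0[OF t0(2,3)] by simp
  qed
  have lo: "even lo" "lo \<le> n" "lo \<le> hi" "lo div 2 = r - 1"
    using assms(2,3,4,6) by presburger+
  have "growth n lo (Z lo) = 0" using c0[of lo] lo by (simp add: cost_def)
  from growth_even_low_0[OF configsD(1)[OF assms(1)] lo(1,2) this] t0(1) \<open>t0 = lo\<close>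
  obtain b where b: "1 \<le> b" "b \<le> lo div 2" "Z lo = {b..lo div 2}" by blast
  have Z1: "Z (Suc lo) = {}"
  proof (rule ccontr)
    assume ne: "Z (Suc lo) \<noteq> {}"
    have "growth n (Suc lo) (Z (Suc lo)) \<ge> 1"
      by (rule growth_odd_low_pos[OF configsD(1)[OF assms(1)] _ _ ne]) (use assms(2,3,6) lo in auto)
    moreover have "growth n (Suc lo) (Z (Suc lo)) = 0"
      by (rule cost_0D(1)[OF assms(1) nf c0]) (use assms(3,4,6) in auto)
    ultimately show False by simp
  qed
  have "Z s = {}" if "Suc lo \<le> s" for s
    by (rule empty_after_empty[OF assms(1) _ Z1 _ that]) (use nf c0 in auto)
  then have "Z s = (if s = lo then {b..<r} else {})" for s
    using b configsD(3)[OF assms(1), of s] lo(4) r1 by (cases s lo rule: linorder_cases) auto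
  moreover have "b < r" using b lo(4) r1 by simp
  ultimately show ?thesis using that[of b] b(1) by blast
qed

lemma growth_odd_high_0:
  assumes "S \<subseteq> row n t" "odd t" "n < t" "growth n t S = 0" "S \<noteq> {}"
  obtains b where "t - n \<le> b" "b \<le> t div 2" "S = {t - n..b}"
proof -
  have fin: "finite S" using assms(1) finite_row_subset by blast
  have *: "card (ends S) = 1" "t - n \<in> S"
    using card_ends_pos[OF fin assms(5)] growth_eq[OF assms(1)] assms(2,4)
    by (auto split: if_splits simp: of_bool_def)
  from interval_if_card_ends_1[OF fin *(1)] obtain a b where ab: "a \<le> b" "S = {a..b}" .
  have "a \<in> S" "b \<in> S" using ab by auto
  then have "t - n \<le> a" "b \<le> t div 2" using assms(1) by (auto simp: row_eq)
  moreover have "a \<le> t - n" using *(2) ab by simp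
  ultimately show ?thesis using that[of b] ab by simp
qed

lemma growth_singleton:
  assumes "i \<in> row n t"
  shows "growth n t {i} = 1 - of_bool (i + n = t) - of_bool (2 * i = t)"
proof -
  have "(t - n = i) = (i + n = t)" using assms by (auto simp: row_def)
  moreover have "(even t \<and> t div 2 = i) = (2 * i = t)" by auto
  moreover have "ends {i} = {i}" by (auto simp: ends_def)
  ultimately show ?thesis using growth_eq[of "{i}" n t] assms by simp
qed

section \<open>The configurations of excess one\<close>

definition diag_conf :: "nat \<Rightarrow> nat \<Rightarrow> nat set" where
  "diag_conf i = (\<lambda>t. if t = 2 * i then {i} else {})"

text \<open>\<open>t - n\<close> is the wall point of row \<open>t\<close>. Its growth is zero below
  the top of \<open>H n\<close>, and the next wall point lies in its rise, so a stretch along the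
  wall is paid for only at its start.\<close>

definition wall_conf :: "nat \<Rightarrow> nat \<Rightarrow> nat \<Rightarrow> nat \<Rightarrow> nat set" where
  "wall_conf n s e = (\<lambda>t. if s \<le> t \<and> t \<le> e then {t - n} else {})"

text \<open>For \<open>lo + 1 = 2 r\<close> the second row is \<open>{c..r}\<close>, so
  \<open>c = Suc r\<close> makes it empty.\<close>

definition corner_conf :: "nat \<Rightarrow> nat \<Rightarrow> nat \<Rightarrow> nat \<Rightarrow> nat \<Rightarrow> nat set" where
  "corner_conf lo a b c = (\<lambda>t. if t = lo then {a..b} else if t = Suc lo then {c..Suc lo div 2} else {})"

definition full_conf :: "nat \<Rightarrow> nat \<Rightarrow> nat \<Rightarrow> nat \<Rightarrow> nat \<Rightarrow> nat set" where
  "full_conf n lo hi y = (\<lambda>t. if lo \<le> t \<and> t < hi then row n t else if t = hi then {hi - n..<y} else {})"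

text \<open>The first nonempty row pays its cardinality, so it is a single point of zero growth, on
  the diagonal or on the wall. Everything afterwards is free: the wall can be followed, a diagonal
  point cannot. The bound on \<open>hi\<close> keeps away from the top of \<open>H n\<close>, where
  wall and diagonal meet.\<close>

lemma excess_1_late_start:
  assumes "Z \<in> configs n lo hi" "\<And>u. u \<le> hi \<Longrightarrow> \<not> full n Z u" "excess n lo hi Z = 1"
    "Z lo = {}" "hi < 2 * n - 2"
  shows "(\<exists>i. lo < 2 * i \<and> 2 * i \<le> hi \<and> i \<le> n \<and> 1 \<le> i \<and> Z = diag_conf i) \<or>
    (\<exists>s e. lo < s \<and> n < s \<and> s \<le> e \<and> e \<le> hi \<and> Z = wall_conf n s e)"
proof -
  have "\<exists>t. Z t \<noteq> {}"
  proof (rule ccontr)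
    assume "\<nexists>t. Z t \<noteq> {}"
    then have "cost n lo Z t = 0" for t by (simp add: cost_def)
    then show False using assms(3) by (simp add: excess_def)
  qed
  then obtain t0 where t0: "Z t0 \<noteq> {}" "lo \<le> t0" "t0 \<le> hi" "\<And>s. s < t0 \<Longrightarrow> Z s = {}"
    using first_nonempty[OF assms(1)] by metis
  have lt: "lo < t0" using t0(1,2) assms(4) by (cases "t0 = lo") auto
  have c: "cost n lo Z t0 = int (card (Z t0)) + growth n t0 (Z t0)" "cost n lo Z t0 \<ge> int (card (Z t0))"
    using cost_after_empty[OF assms(1) assms(2)[OF t0(3)]] lt t0(4) by simp_all
  have c1: "cost n lo Z t0 = 1" "card (Z t0) = 1" "growth n t0 (Z t0) = 0"
    using excess_ge_cost[OF assms(1,2) t0(2,3)] card_pos_config[OF assms(1) t0(1)] c assms(3) by simp_all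
  have zero: "cost n lo Z s = 0" if "t0 < s" "s \<le> hi" for s
    by (rule other_costs_0[OF assms(1,2) t0(2,3)]) (use assms(3) c1(1) that lt in auto)
  obtain i where i: "Z t0 = {i}" using c1(2) by (auto simp: card_1_singleton_iff)
  have irow: "i \<in> row n t0" using configsD(1)[OF assms(1), of t0] i by simp
  have step: "Z (Suc t) \<subseteq> rise n t (Z t)" "growth n (Suc t) (Z (Suc t)) = 0" if "t0 \<le> t" for t
  proof -
    have "Z (Suc t) \<subseteq> rise n (Suc t - 1) (Z (Suc t - 1)) \<and> growth n (Suc t) (Z (Suc t)) = 0"
    proof (cases "Suc t \<le> hi")
      case True
      then show ?thesis using cost_0D[OF assms(1) assms(2)[OF True] zero] that lt by simp
    next
      case False
      then show ?thesis using configsD(4)[OF assms(1)] by simp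
    qed
    then show "Z (Suc t) \<subseteq> rise n t (Z t)" "growth n (Suc t) (Z (Suc t)) = 0" by simp_all
  qed
  have alt: "i + n = t0 \<or> 2 * i = t0"
    using growth_singleton[OF irow] c1(3) i by (auto split: if_splits simp: of_bool_def)
  show ?thesis
  proof (cases "i + n = t0")
    case True
    have ge: "t0 \<le> t \<Longrightarrow> Z t \<subseteq> {t - n}" for t
    proof (induction t rule: dec_induct)
      case base
      then show ?case using i True by auto
    next
      case (step t)
      have "Z (Suc t) \<subseteq> rise n t {t - n}"
        using step(3) \<open>\<And>t. t0 \<le> t \<Longrightarrow> Z (Suc t) \<subseteq> rise n t (Z t)\<close>[OF step(1)] rise_mono by blast
      moreover have "n < t" using True irow step(1) by (auto simp: row_def)
      then have "rise n t {t - n} \<subseteq> {Suc t - n}" by (auto simp: rise_def row_def)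
      ultimately show ?case by blast
    qed
    define e where "e = Max {t. t \<le> hi \<and> Z t \<noteq> {}}"
    have fin: "finite {t. t \<le> hi \<and> Z t \<noteq> {}}" by (rule finite_subset[of _ "{..hi}"]) auto
    have "e \<in> {t. t \<le> hi \<and> Z t \<noteq> {}}" unfolding e_def by (rule Max_in[OF fin]) (use t0 in auto)
    then have e: "e \<le> hi" "Z e \<noteq> {}" by auto
    have after: "Z t = {}" if "e < t" for t
    proof (rule ccontr)
      assume "Z t \<noteq> {}"
      then have "t \<in> {t. t \<le> hi \<and> Z t \<noteq> {}}" using configsD(4)[OF assms(1)] not_le_imp_less by blast
      then have "t \<le> e" unfolding e_def by (rule Max_ge[OF fin])
      then show False using that by simp
    qed
    have mono: "Z t' = {}" if "t0 \<le> t" "t \<le> t'" "Z t = {}" for t t'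
      using that(2)
    proof (induction t' rule: dec_induct)
      case (step t')
      then show ?case
        using \<open>\<And>t. t0 \<le> t \<Longrightarrow> Z (Suc t) \<subseteq> rise n t (Z t)\<close>[of t'] that(1) by simp
    qed (rule that(3))
    have "t0 \<le> e" using e(2) t0(4) not_le_imp_less by blast
    have "Z t = wall_conf n t0 e t" for t
    proof (cases "t0 \<le> t \<and> t \<le> e")
      case T: True
      then have "Z t \<noteq> {}" using mono[of t e] e(2) by blast
      then show ?thesis using ge[of t] T by (auto simp: wall_conf_def)
    next
      case False
      then show ?thesis using after[of t] t0(4)[of t] by (cases "t0 \<le> t") (auto simp: wall_conf_def)
    qed
    then have "Z = wall_conf n t0 e" by blast
    moreover have "n < t0" using True irow by (auto simp: row_def)
    ultimately show ?thesis using lt \<open>t0 \<le> e\<close> e(1) by blast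
  next
    case False
    then have di: "2 * i = t0" using alt by simp
    have "Z (Suc t0) = {}"
    proof (rule ccontr)
      assume ne: "Z (Suc t0) \<noteq> {}"
      have "Z (Suc t0) \<subseteq> {i}" using step(1)[of t0] i di by (auto simp: rise_def row_def)
      then have e: "Z (Suc t0) = {i}" using ne by blast
      then have "i \<in> row n (Suc t0)" using configsD(1)[OF assms(1), of "Suc t0"] by simp
      then have "growth n (Suc t0) {i} = 1 - of_bool (i + n = Suc t0) - of_bool (2 * i = Suc t0)"
        by (rule growth_singleton)
      then have "i + n = Suc t0" using step(2)[of t0] e di by (auto split: if_splits simp: of_bool_def)
      then show False using di t0(3) assms(5) by linarith
    qed
    from empty_after_empty[OF assms(1) _ this] lt zero assms(2)
    have "Z s = {}" if "Suc t0 \<le> s" for s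
      using that by simp
    then have "Z t = diag_conf i t" for t
      using i di t0(4)[of t] by (cases t t0 rule: linorder_cases) (auto simp: diag_conf_def)
    then have "Z = diag_conf i" by blast
    moreover have "1 \<le> i" "i \<le> n" using irow di by (auto simp: row_def)
    ultimately show ?thesis using di lt t0(3) by blast
  qed
qed

text \<open>With a full row, 1 is the least value that \<open>excess_full\<close> permits, so all
  estimates are equalities: the rows before \<open>hi\<close> are full and the last one is a prefix.
  Without full rows, a nonempty row \<open>lo\<close> uses up the unit and is one run; row
  \<open>lo + 1\<close> is free only as a suffix inside the rise, and row \<open>lo + 2\<close>, odd
  and at most \<open>n\<close> because \<open>m >= 2\<close>, is empty.\<close>

lemma excess_1_cases:
  assumes "Z \<in> configs n lo hi" "n + 1 = 2 * r + m" "lo + 1 = 2 * r" "hi + 1 = 2 * r + 2 * m"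
    "excess n lo hi Z = 1" "2 \<le> m" "2 \<le> r"
  shows "(\<exists>i. r \<le> i \<and> i < r + m \<and> Z = diag_conf i) \<or>
    (\<exists>s e. n < s \<and> s \<le> e \<and> e \<le> hi \<and> Z = wall_conf n s e) \<or>
    (\<exists>a b. 1 \<le> a \<and> a \<le> b \<and> b < r \<and> Z = corner_conf lo a b (Suc r)) \<or>
    (\<exists>a c. 1 \<le> a \<and> a < r \<and> a \<le> c \<and> c \<le> r \<and> Z = corner_conf lo a (r - 1) c) \<or>
    (\<exists>y. m \<le> y \<and> y \<le> r + m \<and> Z = full_conf n lo hi y)"
proof (cases "\<exists>u. full n Z u")
  case True
  then obtain u0 where "full n Z u0" by blast
  then have "u0 \<le> hi" using full_in_range[OF assms(1)] by simp
  from last_full[OF \<open>full n Z u0\<close> this]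
  obtain u where u: "full n Z u" "u \<le> hi" "\<And>t. u < t \<Longrightarrow> t \<le> hi \<Longrightarrow> \<not> full n Z t" by blast
  have lou: "lo \<le> u" using full_in_range[OF assms(1) u(1)] by simp
  obtain v where v: "u = 2 * v" using u(1) by (auto simp: full_def)
  have vn: "v \<le> n" using card_rise_full(2)[OF u(1)] v by simp
  have restnn: "\<And>t. t \<in> {Suc u..hi} \<Longrightarrow> cost n lo Z t \<ge> 0" using cost_nonneg[OF assms(1)] u(3) by simp
  have rest: "(\<Sum>t=Suc u..hi. cost n lo Z t) \<ge> 0" by (rule sum_nonneg) (rule restnn)
  have lnn: "(\<Sum>s=Suc lo..u. int (loss n Z s)) \<ge> 0" by (rule sum_nonneg) simp
  have e: "1 = int (n - v) + (\<Sum>s=Suc lo..u. int (loss n Z s)) - int (card (Z lo))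
    + (\<Sum>t=Suc u..hi. cost n lo Z t)"
    using excess_full[OF assms(1) u(1) lou u(2)] assms(5) v by simp
  have c: "card (Z lo) \<le> r - 1" using card_row_le[OF configsD(1)[OF assms(1)], of lo] assms(3) by auto
  have vle: "v + 1 \<le> r + m" using v u(2) assms(4) by linarith
  have "int (n - v) = int n - int v" using vn by simp
  then have eq: "v + 1 = r + m" "card (Z lo) = r - 1" "(\<Sum>s=Suc lo..u. int (loss n Z s)) = 0"
    "(\<Sum>t=Suc u..hi. cost n lo Z t) = 0"
    using e c vle rest lnn assms(2,7) by linarith+
  have uhi: "Suc u = hi" using eq(1) v assms(4) by linarith
  have full_rows: "lo \<le> t \<Longrightarrow> t \<le> u \<Longrightarrow> Z t = row n t" for t
  proof (induction t rule: dec_induct)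
    case base
    have "card (row n lo) = r - 1" using assms(2,3) by (subst card_row_low) auto
    then show ?case using eq(2) card_subset_eq[OF finite_row configsD(1)[OF assms(1)]] by simp
  next
    case (step t)
    have "int (loss n Z (Suc t)) = 0"
      using eq(3) step by (subst (asm) sum_nonneg_eq_0_iff) auto
    then have "rise n t (Z t) \<subseteq> Z (Suc t)" by (simp add: loss_def)
    then have "row n (Suc t) \<subseteq> Z (Suc t)" using step assms(3,7) rise_row[of t n] by simp
    then show ?case using configsD(1)[OF assms(1), of "Suc t"] by blast
  qed
  have "cost n lo Z hi = 0" using eq(4) uhi by simp
  then have g: "growth n hi (Z hi) = 0" using cost_0D(1)[OF assms(1)] u(3) uhi by simp
  have hin: "hi - n = m" "odd hi" "n < hi" "hi div 2 + 1 = r + m" using assms(2,4,6) by (auto, presburger+)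
  \<comment> \<open>\<open>y = m\<close> encodes an empty last row, since \<open>hi - n = m\<close>
    is its wall point.\<close>
  obtain y where y: "m \<le> y" "y \<le> r + m" "Z hi = {m..<y}"
  proof (cases "Z hi = {}")
    case True
    show ?thesis by (rule that[of m]) (use True in auto)
  next
    case False
    from growth_odd_high_0[OF configsD(1)[OF assms(1)] hin(2,3) g False]
    obtain b where "hi - n \<le> b" "b \<le> hi div 2" "Z hi = {hi - n..b}" by blast
    then show ?thesis using that[of "Suc b"] hin by (auto simp: atLeastLessThanSuc_atLeastAtMost)
  qed
  have "Z t = full_conf n lo hi y t" for t
    using full_rows[of t] y(3) uhi hin(1) configsD(3,4)[OF assms(1), of t]
    by (cases t hi rule: linorder_cases) (auto simp: full_conf_def)
  then have "Z = full_conf n lo hi y" by blast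
  then show ?thesis using y(1,2) by blast
next
  case False
  then have nf: "\<not> full n Z u" for u by blast
  show ?thesis
  proof (cases "Z lo = {}")
    case True
    have "hi < 2 * n - 2" using assms(2,4,7) by linarith
    from excess_1_late_start[OF assms(1) nf assms(5) True this] show ?thesis
    proof (elim disjE exE conjE)
      fix i assume i: "lo < 2 * i" "2 * i \<le> hi" "Z = diag_conf i"
      then have "r \<le> i" "i < r + m" using assms(3,4) by linarith+
      then show ?thesis using i(3) by blast
    qed blast
  next
    case ne: False
    have lo: "odd lo" "lo \<le> n" "lo \<le> hi" "Suc lo \<le> n" "Suc lo = 2 * r" "Suc (Suc lo) \<le> n" "Suc (Suc lo) \<le> hi"
      using assms(2,3,4,6) by presburger+
    have cl: "cost n lo Z lo = growth n lo (Z lo)" by (simp add: cost_def)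
    have g1: "growth n lo (Z lo) = 1"
      using growth_odd_low_pos[OF configsD(1)[OF assms(1)] lo(1,2) ne]
        excess_ge_cost[OF assms(1) nf, of lo] lo(3) assms(5) cl by simp
    have zero: "cost n lo Z s = 0" if "lo < s" "s \<le> hi" for s
      by (rule other_costs_0[OF assms(1) nf, of lo]) (use lo(3) assms(5) cl g1 that in auto)
    have "card (ends (Z lo)) = 1"
      using growth_odd_low[OF configsD(1)[OF assms(1)] lo(1,2)] g1 by simp
    from interval_if_card_ends_1[OF configsD(2)[OF assms(1)] this]
    obtain a b where ab: "a \<le> b" "Z lo = {a..b}" .
    have "{a..b} \<subseteq> row n lo" using configsD(1)[OF assms(1), of lo] unfolding ab(2) .
    moreover have "a \<in> {a..b}" "b \<in> {a..b}" using ab(1) by simp_all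
    ultimately have "a \<in> row n lo" "b \<in> row n lo" by blast+
    then have "1 \<le> a" "2 * b \<le> lo" by (simp_all add: row_def)
    then have abr: "1 \<le> a" "b < r" using assms(3) by linarith+
    have "cost n lo Z (Suc lo) = 0" by (rule zero) (use lo(7) in simp_all)
    from cost_0D[OF assms(1) nf this]
    have g2: "growth n (Suc lo) (Z (Suc lo)) = 0" "Z (Suc lo) \<subseteq> rise n lo (Z lo)"
      by simp_all
    have Z3: "Z (Suc (Suc lo)) = {}"
    proof (rule ccontr)
      assume "Z (Suc (Suc lo)) \<noteq> {}"
      then have "growth n (Suc (Suc lo)) (Z (Suc (Suc lo))) \<ge> 1"
        by (intro growth_odd_low_pos[OF configsD(1)[OF assms(1)]]) (use lo in auto)
      moreover have "growth n (Suc (Suc lo)) (Z (Suc (Suc lo))) = 0"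
        by (rule cost_0D(1)[OF assms(1) nf zero]) (use lo in auto)
      ultimately show False by simp
    qed
    have after: "Z s = {}" if "Suc (Suc lo) \<le> s" for s
      by (rule empty_after_empty[OF assms(1) _ Z3 _ that]) (use nf zero in auto)
    have Zall: "Z = (\<lambda>t. if t = lo then {a..b} else if t = Suc lo then Z (Suc lo) else {})"
    proof
      fix t show "Z t = (if t = lo then {a..b} else if t = Suc lo then Z (Suc lo) else {})"
        using ab(2) after[of t] configsD(3)[OF assms(1), of t] by (cases "t < lo") (auto simp: not_less)
    qed
    have dv: "Suc lo div 2 = r" using lo(5) by simp
    show ?thesis
    proof (cases "Z (Suc lo) = {}")
      case True
      then have "Z = corner_conf lo a b (Suc r)"
        by (subst Zall) (auto simp: corner_conf_def dv fun_eq_iff)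
      then show ?thesis using ab abr by blast
    next
      case False
      from growth_even_low_0[OF configsD(1)[OF assms(1)] _ lo(4) g2(1) False] lo(5)
      obtain c where c: "1 \<le> c" "c \<le> r" "Z (Suc lo) = {c..r}" by (metis dv dvd_triv_left)
      then have "{c..r} \<subseteq> rise n lo {a..b}" using g2(2) ab(2) by simp
      then have "{c, r} \<subseteq> {a..b} \<union> Suc ` {a..b}" using c by (auto simp: rise_def)
      then have "a \<le> c" "b = r - 1" using abr(2) by auto
      moreover have "Z = corner_conf lo a b c"
        by (subst Zall) (auto simp: corner_conf_def dv c(3) fun_eq_iff)
      ultimately have "1 \<le> a \<and> a < r \<and> a \<le> c \<and> c \<le> r \<and> Z = corner_conf lo a (r - 1) c"
        using ab abr c assms(7) by auto
      then show ?thesis by blast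
    qed
  qed
qed

lemma cost_empty: "Z t = {} \<Longrightarrow> cost n lo Z t = 0"
  by (simp add: cost_def)

lemma excess_support:
  assumes "T \<subseteq> {lo..hi}" "\<And>t. t \<in> {lo..hi} - T \<Longrightarrow> Z t = {}"
  shows "excess n lo hi Z = (\<Sum>t\<in>T. cost n lo Z t)"
  unfolding excess_def by (rule sum.mono_neutral_right) (use assms cost_empty in auto)

lemma excess_diag_conf:
  assumes "1 \<le> i" "i < n" "lo < 2 * i" "2 * i \<le> hi"
  shows "diag_conf i \<in> configs n lo hi" "excess n lo hi (diag_conf i) = 1"
proof -
  have i: "i \<in> row n (2 * i)" using assms by (auto simp: row_def)
  then show "diag_conf i \<in> configs n lo hi" using assms by (auto simp: configs_def diag_conf_def)
  have "excess n lo hi (diag_conf i) = (\<Sum>t\<in>{2 * i}. cost n lo (diag_conf i) t)"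
    by (rule excess_support) (use assms in \<open>auto simp: diag_conf_def\<close>)
  also have "\<dots> = 1"
    using assms growth_singleton[OF i] by (auto simp: cost_def diag_conf_def)
  finally show "excess n lo hi (diag_conf i) = 1" .
qed

lemma excess_wall_conf:
  assumes "n < s" "lo < s" "s \<le> e" "e \<le> hi" "e < 2 * n"
  shows "wall_conf n s e \<in> configs n lo hi" "excess n lo hi (wall_conf n s e) = 1"
proof -
  let ?Z = "wall_conf n s e"
  have i: "t - n \<in> row n t" if "s \<le> t" "t \<le> e" for t using that assms by (auto simp: row_def)
  then show "?Z \<in> configs n lo hi" using assms by (auto simp: configs_def wall_conf_def)
  have g: "growth n t {t - n} = 0" if "s \<le> t" "t \<le> e" for t
    using growth_singleton[OF i[OF that]] that assms by auto
  have "excess n lo hi ?Z = (\<Sum>t\<in>{s..e}. cost n lo ?Z t)"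
    by (rule excess_support) (use assms in \<open>auto simp: wall_conf_def\<close>)
  also have "\<dots> = (\<Sum>t\<in>{s..e}. if t = s then 1 else 0)"
  proof (rule sum.cong)
    fix t assume t: "t \<in> {s..e}"
    show "cost n lo ?Z t = (if t = s then 1 else 0)"
    proof (cases "t = s")
      case True
      moreover have "\<not> s \<le> s - 1" using assms by simp
      ultimately show ?thesis using assms t g[of t] by (simp add: cost_def wall_conf_def)
    next
      case False
      then obtain t' where t': "t = Suc t'" "s \<le> t'" using t by (cases t) auto
      have "t - n \<in> rise n t' {t' - n}" using i[of t] t t' assms by (auto simp: rise_def Suc_diff_le)
      then show ?thesis using False t t' g[of t] assms by (simp add: cost_def wall_conf_def)
    qed
  qed simp
  also have "\<dots> = 1" using assms by simp
  finally show "excess n lo hi ?Z = 1" .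
qed

lemma excess_corner_conf:
  assumes "1 \<le> a" "a \<le> b" "b < r" "lo + 1 = 2 * r" "Suc lo \<le> n" "Suc lo \<le> hi"
    "c = Suc r \<or> (b = r - 1 \<and> a \<le> c \<and> c \<le> r)"
  shows "corner_conf lo a b c \<in> configs n lo hi" "excess n lo hi (corner_conf lo a b c) = 1"
proof -
  let ?Z = "corner_conf lo a b c"
  have dv: "Suc lo div 2 = r" using assms(4) by simp
  have r0: "{a..b} \<subseteq> row n lo" using assms by (auto simp: row_def)
  have r1: "{c..r} \<subseteq> row n (Suc lo)" using assms by (auto simp: row_def)
  show "?Z \<in> configs n lo hi"
    using r0 r1 assms(6) by (auto simp: configs_def corner_conf_def dv)
  have "excess n lo hi ?Z = (\<Sum>t\<in>{lo, Suc lo}. cost n lo ?Z t)"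
    by (rule excess_support) (use assms in \<open>auto simp: corner_conf_def\<close>)
  also have "\<dots> = cost n lo ?Z lo + cost n lo ?Z (Suc lo)" by simp
  also have "cost n lo ?Z lo = 1"
  proof -
    have "odd lo" "lo \<le> n" using assms by presburger+
    from growth_odd_low[OF r0 this] show ?thesis
      using assms(2) by (simp add: cost_def corner_conf_def ends_interval)
  qed
  also have "cost n lo ?Z (Suc lo) = 0"
  proof (cases "c = Suc r")
    case True
    then show ?thesis by (intro cost_empty) (simp add: corner_conf_def dv)
  next
    case False
    then have c: "b = r - 1" "a \<le> c" "c \<le> r" using assms(7) by auto
    have "growth n (Suc lo) {c..r} = 0"
    proof -
      have "even (Suc lo)" using assms(4) by presburger
      from growth_even_low[OF r1 this assms(5)] show ?thesis using c(3) by (simp add: ends_interval dv)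
    qed
    moreover have "{c..r} \<subseteq> rise n lo {a..b}"
    proof
      fix x assume x: "x \<in> {c..r}"
      then have "x \<in> {a..b} \<or> x - 1 \<in> {a..b} \<and> x = Suc (x - 1)"
        using c assms(1-3) by auto
      then show "x \<in> rise n lo {a..b}" using x r1 by (auto simp: rise_def)
    qed
    then have "{c..r} - rise n lo {a..b} = {}" by blast
    ultimately show ?thesis by (simp add: cost_def corner_conf_def dv)
  qed
  finally show "excess n lo hi ?Z = 1" by simp
qed

lemma excess_eq_losses:
  assumes "Z \<in> configs n lo hi" "lo \<le> hi"
  shows "excess n lo hi Z = int (card (rise n hi (Z hi))) + (\<Sum>s=Suc lo..hi. int (loss n Z s)) - int (card (Z lo))"
  unfolding excess_def by (rule sum_cost_partial[OF assms])

lemma excess_full_conf: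
  assumes "n + 1 = 2 * r + m" "lo + 1 = 2 * r" "hi + 1 = 2 * r + 2 * m" "1 \<le> m" "2 \<le> r" "m \<le> y" "y \<le> r + m"
  shows "full_conf n lo hi y \<in> configs n lo hi" "excess n lo hi (full_conf n lo hi y) = 1"
proof -
  let ?Z = "full_conf n lo hi y"
  have hi: "hi - n = m" "odd hi" "n < hi" "lo < hi" using assms by presburger+
  have sub: "{m..<y} \<subseteq> row n hi" using assms hi by (auto simp: row_def)
  show c: "?Z \<in> configs n lo hi" using sub hi by (auto simp: configs_def full_conf_def)
  obtain h where h: "hi = Suc h" "lo \<le> h" using hi by (cases hi) auto
  have "loss n ?Z s = (if s = hi then r + m - y else 0)" if "s \<in> {Suc lo..hi}" for s
  proof -
    define s' where "s' = s - 1"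
    have s': "s = Suc s'" "lo \<le> s'" "s' < hi" using that by (auto simp: s'_def)
    have "rise n s' (?Z s') = row n s"
      using s' assms rise_row[of s' n] by (simp add: full_conf_def)
    moreover have "card (row n hi - {m..<y}) = r + m - y"
      using sub assms hi by (simp add: card_Diff_subset card_row_high)
    ultimately show ?thesis using that s' hi(1) by (auto simp: loss_def full_conf_def)
  qed
  then have "(\<Sum>s=Suc lo..hi. int (loss n ?Z s)) = (\<Sum>s=Suc lo..hi. if s = hi then int (r + m - y) else 0)"
    by (intro sum.cong) auto
  also have "\<dots> = int (r + m - y)" using hi(4) by simp
  finally have l: "(\<Sum>s=Suc lo..hi. int (loss n ?Z s)) = int (r + m - y)" .
  have "?Z hi = {m..<y}" using hi(1) by (simp add: full_conf_def)
  moreover have "card (rise n hi {m..<y}) = y - m"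
  proof (cases "m < y")
    case True
    then obtain y' where y': "y = Suc y'" "m \<le> y'" by (cases y) auto
    then show ?thesis using card_rise[OF sub] hi
      by (simp add: atLeastLessThanSuc_atLeastAtMost ends_interval)
  qed (use assms in auto)
  moreover have "card (?Z lo) = r - 1" using hi assms by (simp add: full_conf_def card_row_low)
  ultimately show "excess n lo hi ?Z = 1"
    unfolding excess_eq_losses[OF c less_imp_le[OF hi(4)]] l using assms by (simp add: of_nat_diff)
qed

text \<open>For \<open>m = 1\<close> this is \<open>full_conf\<close> with its rows written out. It
  is taken only with \<open>1 <= y\<close>: an empty third row would give a corner configuration,
  which is counted separately.\<close>

definition corner3_conf :: "nat \<Rightarrow> nat \<Rightarrow> nat \<Rightarrow> nat \<Rightarrow> nat set" where
  "corner3_conf lo r y = (\<lambda>t. if t = lo then {1..<r} else if t = Suc lo then {1..r}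
    else if t = Suc (Suc lo) then {1..y} else {})"

lemma excess_corner3_conf:
  assumes "2 \<le> r" "n = 2 * r" "lo + 1 = 2 * r" "hi = 2 * r + 1" "1 \<le> y" "y \<le> r"
  shows "corner3_conf lo r y \<in> configs n lo hi" "excess n lo hi (corner3_conf lo r y) = 1"
proof -
  let ?Z = "corner3_conf lo r y"
  have s: "{1..<r} \<subseteq> row n lo" "{1..r} \<subseteq> row n (Suc lo)" "{1..y} \<subseteq> row n (Suc (Suc lo))"
    using assms by (auto simp: row_def)
  show c: "?Z \<in> configs n lo hi" using s assms by (auto simp: configs_def corner3_conf_def)
  have e: "{1..<r} = row n lo" "{1..r} = row n (Suc lo)" "row n (Suc (Suc lo)) = {1..r}"
    using assms by (auto simp: row_def)
  have hi: "hi = Suc (Suc lo)" "2 \<le> lo" using assms by auto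
  have "rise n lo {1..<r} = {1..r}" unfolding e(1) rise_row[OF hi(2)] e(2)[symmetric] ..
  then have l1: "loss n ?Z (Suc lo) = 0" by (simp add: loss_def corner3_conf_def)
  have "loss n ?Z (Suc (Suc lo)) = card ({1..r} - {1..y})"
  proof -
    have "rise n (Suc lo) {1..r} = {1..r}" using hi(2) rise_row[of "Suc lo" n] unfolding e(2)[symmetric] e(3) by simp
    then show ?thesis by (simp add: loss_def corner3_conf_def)
  qed
  also have "\<dots> = r - y" using assms(6) by (subst card_Diff_subset) auto
  finally have l2: "loss n ?Z (Suc (Suc lo)) = r - y" .
  have "odd (Suc (Suc lo))" "Suc (Suc lo) - n = 1" using assms by presburger+
  then have r: "card (rise n (Suc (Suc lo)) {1..y}) = y"
    using card_rise[OF s(3)] assms(5) by (simp add: ends_interval)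
  show "excess n lo hi ?Z = 1"
    unfolding excess_eq_losses[OF c, unfolded hi(1), OF le_SucI[OF le_SucI[OF order_refl]]] hi(1)
    using l1 l2 r assms by (simp add: corner3_conf_def of_nat_diff)
qed

text \<open>The zero-excess parts below a configuration \<open>Z\<close>, see \<open>excess_0_even\<close>: the suffix
  \<open>{b..<r}\<close> is empty for \<open>b = r\<close>.\<close>

definition opts :: "nat \<Rightarrow> nat \<Rightarrow> (nat \<Rightarrow> nat set) \<Rightarrow> nat set" where
  "opts r lo Z = {b \<in> {1..r}. {b..<r} \<subseteq> Z lo}"

lemma finite_opts [simp]: "finite (opts r lo Z)"
  by (simp add: opts_def)

lemma opts_no_end: "1 \<le> r \<Longrightarrow> r - 1 \<notin> Z lo \<Longrightarrow> opts r lo Z = {r}"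
proof -
  assume a: "1 \<le> r" "r - 1 \<notin> Z lo"
  have "b = r" if "b \<le> r" "{b..<r} \<subseteq> Z lo" for b
  proof (rule ccontr)
    assume "b \<noteq> r"
    then have "r - 1 \<in> {b..<r}" using that a by auto
    then show False using that a by blast
  qed
  then show ?thesis using a by (auto simp: opts_def)
qed

lemma opts_suffix: "1 \<le> a \<Longrightarrow> a < r \<Longrightarrow> Z lo = {a..r - 1} \<Longrightarrow> opts r lo Z = {a..r}"
proof -
  assume a: "1 \<le> a" "a < r" "Z lo = {a..r - 1}"
  have "{b..<r} \<subseteq> {a..r - 1} \<longleftrightarrow> a \<le> b" if "1 \<le> b" "b \<le> r" for b
    using that a by (cases "b = r") (auto simp: subset_iff)
  then show ?thesis using a by (auto simp: opts_def)
qed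

section \<open>Levels of the poset as configurations of rows\<close>

type_synonym elt = "nat \<times> nat \<times> nat"

definition poset :: "nat \<Rightarrow> nat \<Rightarrow> elt set" where
  "poset k n = chain k \<times> H n"

definition lev :: "elt \<Rightarrow> nat" where
  "lev x = fst x + fst (snd x) + snd (snd x)"

lemma lev_simp [simp]: "lev (c, i, j) = c + i + j"
  by (simp add: lev_def)

lemma mem_poset: "(c, i, j) \<in> poset k n \<longleftrightarrow> 1 \<le> c \<and> c \<le> k \<and> 1 \<le> i \<and> i \<le> j \<and> j \<le> n"
  by (auto simp: poset_def chain_def H_def)

lemma finite_poset [simp]: "finite (poset k n)"
proof -
  have "H n \<subseteq> chain n \<times> chain n" by (auto simp: H_def)
  then have "finite (H n)" by (rule finite_subset) (simp add: chain_def)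
  then show ?thesis by (simp add: poset_def chain_def)
qed

lemma lev_mono: "x \<le> y \<Longrightarrow> lev x \<le> lev y"
  by (cases x; cases y) auto

lemma lev_strict: "x \<le> y \<Longrightarrow> lev x = lev y \<Longrightarrow> x = y"
  by (cases x; cases y) auto

definition cov :: "nat \<Rightarrow> nat \<Rightarrow> elt set \<Rightarrow> elt set" where
  "cov k n W = {y \<in> poset k n. \<exists>x\<in>W. x \<le> y \<and> lev y = Suc (lev x)}"

lemma finite_cov [simp]: "finite (cov k n W)"
  by (simp add: cov_def)

text \<open>Lowering the color or \<open>i'\<close> keeps \<open>i' <= j'\<close>. The coordinate
  \<open>j'\<close> is lowered only when \<open>i = i'\<close>, and then
  \<open>i' = i <= j <= j' - 1\<close>.\<close>

lemma cover_below:
  assumes "x \<in> poset k n" "y \<in> poset k n" "x \<le> y" "lev x < lev y"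
  obtains z where "z \<in> poset k n" "x \<le> z" "z \<le> y" "lev y = Suc (lev z)"
proof -
  obtain c i j where x: "x = (c, i, j)" by (cases x)
  obtain c' i' j' where y: "y = (c', i', j')" by (cases y)
  have *: "1 \<le> c" "c \<le> c'" "c' \<le> k" "1 \<le> i" "i \<le> i'" "i \<le> j" "j \<le> j'" "i' \<le> j'" "j' \<le> n"
    using assms(1-3) by (auto simp: x y mem_poset)
  consider "c < c'" | "c = c'" "i < i'" | "c = c'" "i = i'" "j < j'"
    using assms(4) * by (force simp: x y)
  then show ?thesis
  proof cases
    case 1
    then show ?thesis using * by (intro that[of "(c' - 1, i', j')"]) (auto simp: x y mem_poset)
  next
    case 2
    then show ?thesis using * by (intro that[of "(c', i' - 1, j')"]) (auto simp: x y mem_poset)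
  next
    case 3
    then show ?thesis using * by (intro that[of "(c', i', j' - 1)"]) (auto simp: x y mem_poset)
  qed
qed

definition level :: "nat \<Rightarrow> nat \<Rightarrow> nat \<Rightarrow> elt set" where
  "level k n s = {x \<in> poset k n. lev x = s}"

lemma finite_level [simp]: "finite (level k n s)"
  by (simp add: level_def)

text \<open>Row \<open>t\<close> of a set of elements of level \<open>s\<close> consists of its elements of color \<open>s - t\<close>.\<close>

definition cfg :: "nat \<Rightarrow> elt set \<Rightarrow> nat \<Rightarrow> nat set" where
  "cfg s W t = {i. (s - t, i, t - i) \<in> W}"

lemma mem_cfg:
  assumes "W \<subseteq> level k n s" "i \<in> cfg s W t"
  shows "1 \<le> i" "2 * i \<le> t" "t \<le> i + n" "t < s" "s \<le> t + k" "(s - t, i, t - i) \<in> W"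
proof -
  show *: "(s - t, i, t - i) \<in> W" using assms(2) by (simp add: cfg_def)
  then have "(s - t, i, t - i) \<in> poset k n" using assms(1) by (auto simp: level_def)
  then have "1 \<le> s - t" "s - t \<le> k" "1 \<le> i" "i \<le> t - i" "t - i \<le> n" by (simp_all only: mem_poset)
  then show "1 \<le> i" "2 * i \<le> t" "t \<le> i + n" "t < s" "s \<le> t + k" by linarith+
qed

lemma cfg_config:
  assumes "W \<subseteq> level k n s"
  shows "cfg s W \<in> configs n (s - k) (s - 1)"
proof -
  have "cfg s W t \<subseteq> row n t" for t using mem_cfg[OF assms] by (auto simp: row_def)
  moreover have "cfg s W t = {}" if "t \<notin> {s - k..s - 1}" for t
    using mem_cfg(4,5)[OF assms, of _ t] that by force
  ultimately show ?thesis by (simp add: configs_def)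
qed

definition elts :: "nat \<Rightarrow> (nat \<Rightarrow> nat set) \<Rightarrow> elt set" where
  "elts s Z = {(s - t, i, t - i) |t i. i \<in> Z t}"

lemma elts_cfg:
  assumes "W \<subseteq> level k n s"
  shows "elts s (cfg s W) = W"
proof
  show "elts s (cfg s W) \<subseteq> W" by (auto simp: elts_def cfg_def)
next
  show "W \<subseteq> elts s (cfg s W)"
  proof
    fix x assume x: "x \<in> W"
    obtain c i j where c: "x = (c, i, j)" by (cases x)
    then have "c + i + j = s" "1 \<le> c" using x assms by (auto simp: level_def mem_poset)
    then have "x = (s - (i + j), i, (i + j) - i)" "i \<in> cfg s W (i + j)"
      using x c by (auto simp: cfg_def)
    then show "x \<in> elts s (cfg s W)" unfolding elts_def by blast
  qed
qed

lemma elts_level: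
  assumes "Z \<in> configs n (s - k) (s - 1)"
  shows "elts s Z \<subseteq> level k n s"
proof
  fix x assume "x \<in> elts s Z"
  then obtain t i where x: "x = (s - t, i, t - i)" "i \<in> Z t" by (auto simp: elts_def)
  have "i \<in> row n t" using configsD(1)[OF assms, of t] x(2) by blast
  then have i: "1 \<le> i" "t \<le> i + n" "2 * i \<le> t" by (simp_all add: row_def)
  moreover have "s - k \<le> t" "t \<le> s - 1"
    using x(2) configsD(3,4)[OF assms, of t] by (metis empty_iff not_le_imp_less)+
  ultimately show "x \<in> level k n s" unfolding x(1) level_def by (auto simp: mem_poset)
qed

lemma cfg_elts:
  assumes "Z \<in> configs n (s - k) (s - 1)"
  shows "cfg s (elts s Z) = Z"
proof
  fix t
  have "(s - t, i, t - i) \<in> elts s Z \<longleftrightarrow> i \<in> Z t" for i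
  proof
    assume *: "(s - t, i, t - i) \<in> elts s Z"
    then obtain t' where t': "s - t = s - t'" "t - i = t' - i" "i \<in> Z t'" by (auto simp: elts_def)
    have "(s - t, i, t - i) \<in> level k n s" using elts_level[OF assms] * by blast
    then have "1 \<le> s - t" by (simp add: level_def mem_poset)
    then have "t = t'" using t'(1) by linarith
    then show "i \<in> Z t" using t' by simp
  next
    assume "i \<in> Z t"
    then show "(s - t, i, t - i) \<in> elts s Z" unfolding elts_def by blast
  qed
  then show "cfg s (elts s Z) t = Z t" by (simp add: cfg_def)
qed

lemma card_eq_sum_cfg:
  assumes "W \<subseteq> level k n s"
  shows "card W = (\<Sum>t=s - k..s - 1. card (cfg s W t))"
proof -
  have "W = (\<lambda>(t, i). (s - t, i, t - i)) ` (SIGMA t:{s - k..s - 1}. cfg s W t)" (is "_ = ?f ` ?S")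
  proof
    show "W \<subseteq> ?f ` ?S"
    proof
      fix x assume "x \<in> W"
      then have "x \<in> elts s (cfg s W)" by (simp add: elts_cfg[OF assms(1)])
      then obtain t i where x: "x = (s - t, i, t - i)" "i \<in> cfg s W t" by (auto simp: elts_def)
      then have "t \<in> {s - k..s - 1}" using mem_cfg[OF assms(1) x(2)] by auto
      then show "x \<in> ?f ` ?S" using x by force
    qed
  next
    show "?f ` ?S \<subseteq> W" by (auto simp: cfg_def)
  qed
  moreover have "inj_on ?f ?S"
  proof (rule inj_onI)
    fix p q assume a: "p \<in> ?S" "q \<in> ?S" "?f p = ?f q"
    obtain t i t' i' where pq: "p = (t, i)" "q = (t', i')" by (cases p; cases q)
    then have b: "i \<in> cfg s W t" "i' \<in> cfg s W t'" "s - t = s - t'" "i = i'" using a by auto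
    have "t = t'" using mem_cfg(4)[OF assms(1) b(1)] mem_cfg(4)[OF assms(1) b(2)] b(3) by linarith
    then show "p = q" using pq b(4) by simp
  qed
  ultimately have "card W = card ?S" using card_image[of ?f ?S] by simp
  also have "\<dots> = (\<Sum>t=s - k..s - 1. card (cfg s W t))"
    by (rule card_SigmaI) (use configsD(2)[OF cfg_config[OF assms(1)]] in auto)
  finally show ?thesis .
qed

lemma cov_level: "W \<subseteq> level k n s \<Longrightarrow> cov k n W \<subseteq> level k n (Suc s)"
  by (auto simp: cov_def level_def)

lemma cov_elt:
  assumes "W \<subseteq> level k n s"
  shows "(c, i, j) \<in> cov k n W \<longleftrightarrow> (c, i, j) \<in> poset k n \<and>
    ((c - 1, i, j) \<in> W \<or> (c, i - 1, j) \<in> W \<or> (c, i, j - 1) \<in> W)"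
proof
  assume a: "(c, i, j) \<in> cov k n W"
  then obtain c' i' j' where x: "(c', i', j') \<in> W" "c' \<le> c" "i' \<le> i" "j' \<le> j" "c + i + j = Suc (c' + i' + j')"
    by (auto simp: cov_def)
  then have "(c' = c - 1 \<and> i' = i \<and> j' = j) \<or> (c' = c \<and> i' = i - 1 \<and> j' = j) \<or> (c' = c \<and> i' = i \<and> j' = j - 1)"
    by linarith
  then show "(c, i, j) \<in> poset k n \<and> ((c - 1, i, j) \<in> W \<or> (c, i - 1, j) \<in> W \<or> (c, i, j - 1) \<in> W)"
    using a x(1) by (auto simp: cov_def)
next
  assume a: "(c, i, j) \<in> poset k n \<and> ((c - 1, i, j) \<in> W \<or> (c, i - 1, j) \<in> W \<or> (c, i, j - 1) \<in> W)"
  then have "1 \<le> c" "1 \<le> i" "1 \<le> j" by (auto simp: mem_poset)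
  then have "lev (c, i, j) = Suc (lev (c - 1, i, j))" "lev (c, i, j) = Suc (lev (c, i - 1, j))"
    "lev (c, i, j) = Suc (lev (c, i, j - 1))" by auto
  moreover have "(c - 1, i, j) \<le> (c, i, j)" "(c, i - 1, j) \<le> (c, i, j)" "(c, i, j - 1) \<le> (c, i, j)" by auto
  ultimately show "(c, i, j) \<in> cov k n W" using a unfolding cov_def by blast
qed

text \<open>A cover either keeps the color and moves from row \<open>t - 1\<close> to row
  \<open>t\<close>, or stays in row \<open>t\<close> and takes the next color. The bound
  \<open>s - k < t\<close> excludes the row of color \<open>k\<close>, which has no next
  color.\<close>

lemma cfg_cov:
  assumes "W \<subseteq> level k n s" "s - k < t" "t \<le> s"
  shows "cfg (Suc s) (cov k n W) t = rise n (t - 1) (cfg s W (t - 1)) \<union> cfg s W t"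
proof (rule set_eqI)
  fix i
  have t1: "1 \<le> t" using assms(2) by linarith
  have i1: "i \<in> cfg (Suc s) (cov k n W) t \<longleftrightarrow> (Suc s - t, i, t - i) \<in> cov k n W" by (simp add: cfg_def)
  have e: "s - (t - 1) = Suc s - t" "Suc s - t - 1 = s - t" "Suc (t - 1) = t" using assms t1 by linarith+
  have r: "i \<in> rise n (t - 1) (cfg s W (t - 1)) \<longleftrightarrow>
    i \<in> row n t \<and> ((Suc s - t, i, t - 1 - i) \<in> W \<or> 1 \<le> i \<and> (Suc s - t, i - 1, t - 1 - (i - 1)) \<in> W)"
    unfolding rise_def e(3) using e(1) by (auto simp: cfg_def image_iff)
  show "i \<in> cfg (Suc s) (cov k n W) t \<longleftrightarrow> i \<in> rise n (t - 1) (cfg s W (t - 1)) \<union> cfg s W t"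
  proof (cases "i \<in> row n t")
    case True
    then have i: "1 \<le> i" "t \<le> i + n" "2 * i \<le> t" by (simp_all add: row_def)
    have "(Suc s - t, i, t - i) \<in> poset k n" using assms i by (auto simp: mem_poset)
    moreover have a: "t - i - 1 = t - 1 - i" "t - 1 - (i - 1) = t - i" using i by linarith+
    moreover have "i \<in> cfg s W t \<longleftrightarrow> (s - t, i, t - i) \<in> W" by (simp add: cfg_def)
    ultimately show ?thesis
      unfolding i1 cov_elt[OF assms(1)] e(2) Un_iff r a using True i(1) by blast
  next
    case False
    have "i \<notin> cfg s W t" using False configsD(1)[OF cfg_config[OF assms(1)], of t] by blast
    moreover have "i \<notin> cfg (Suc s) (cov k n W) t"
      using False configsD(1)[OF cfg_config[OF cov_level[OF assms(1)]], of t] by blast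
    ultimately show ?thesis using r False by blast
  qed
qed

text \<open>By \<open>cfg_cov\<close> each row of the covers is the rise of the row before plus what
  \<open>Z t\<close> adds to it, and this addition is the gain in \<open>cost\<close>.\<close>

lemma excess_cfg:
  assumes "W \<subseteq> level k n s" "1 \<le> s"
  shows "int (card (cov k n W)) - int (card W) = excess n (s - k) (s - 1) (cfg s W)"
proof -
  let ?Z = "cfg s W" and ?Y = "cfg (Suc s) (cov k n W)" and ?lo = "s - k" and ?hi = "s - 1"
  have cZ: "?Z \<in> configs n ?lo ?hi" by (rule cfg_config[OF assms(1)])
  have cY: "?Y \<in> configs n (Suc s - k) s"
    using cfg_config[OF cov_level[OF assms(1)]] by simp
  have lohi: "?lo \<le> ?hi \<or> k = 0" using assms(2) by linarith
  show ?thesis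
  proof (cases "k = 0")
    case True
    then have "level k n s = {}" by (auto simp: level_def mem_poset)
    then have W: "W = {}" using assms(1) by blast
    then have "cov k n W = {}" by (simp add: cov_def)
    moreover have "cost n ?lo ?Z t = 0" for t by (rule cost_empty) (simp add: cfg_def W)
    ultimately show ?thesis using W by (simp add: excess_def)
  next
    case False
    then have lohi: "?lo \<le> ?hi" using assms(2) by linarith
    have "card (cov k n W) = (\<Sum>t=Suc s - k..s. card (?Y t))"
      using card_eq_sum_cfg[OF cov_level[OF assms(1)]] by simp
    \<comment> \<open>The two ranges differ only for \<open>s < k\<close>, when truncation makes
      \<open>t = 0\<close> an extra index; row 0 is empty.\<close>
    also have "\<dots> = (\<Sum>t=Suc ?lo..s. card (?Y t))"
    proof (rule sum.mono_neutral_right)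
      show "\<forall>t\<in>{Suc s - k..s} - {Suc ?lo..s}. card (?Y t) = 0"
      proof
        fix t assume t: "t \<in> {Suc s - k..s} - {Suc ?lo..s}"
        then have "t = 0" by (auto simp: not_le)
        then have "?Y t = {}" using configsD(1)[OF cY, of 0] row_lower_0 by auto
        then show "card (?Y t) = 0" by simp
      qed
    qed auto
    also have "\<dots> = (\<Sum>t=Suc ?lo..Suc ?hi. card (rise n (t - 1) (?Z (t - 1)) \<union> ?Z t))"
      using assms(2) by (intro sum.cong) (auto simp: cfg_cov[OF assms(1)])
    also have "\<dots> = (\<Sum>t=Suc ?lo..Suc ?hi. card (rise n (t - 1) (?Z (t - 1))) + card (?Z t - rise n (t - 1) (?Z (t - 1))))"
    proof (rule sum.cong)
      fix t
      have "rise n (t - 1) (?Z (t - 1)) \<union> ?Z t = rise n (t - 1) (?Z (t - 1)) \<union> (?Z t - rise n (t - 1) (?Z (t - 1)))"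
        by blast
      then show "card (rise n (t - 1) (?Z (t - 1)) \<union> ?Z t) =
        card (rise n (t - 1) (?Z (t - 1))) + card (?Z t - rise n (t - 1) (?Z (t - 1)))"
        using configsD(2)[OF cZ, of t]
          card_Un_disjoint[of "rise n (t - 1) (?Z (t - 1))" "?Z t - rise n (t - 1) (?Z (t - 1))"] by simp
    qed simp
    also have "\<dots> = (\<Sum>t=Suc ?lo..Suc ?hi. card (rise n (t - 1) (?Z (t - 1)))) +
      (\<Sum>t=Suc ?lo..Suc ?hi. card (?Z t - rise n (t - 1) (?Z (t - 1))))"
      by (rule sum.distrib)
    also have "(\<Sum>t=Suc ?lo..Suc ?hi. card (rise n (t - 1) (?Z (t - 1)))) = (\<Sum>t=?lo..?hi. card (rise n t (?Z t)))"
      by (subst sum.shift_bounds_cl_Suc_ivl) simp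
    also have "(\<Sum>t=Suc ?lo..Suc ?hi. card (?Z t - rise n (t - 1) (?Z (t - 1)))) =
      (\<Sum>t=Suc ?lo..?hi. card (?Z t - rise n (t - 1) (?Z (t - 1))))"
      using configsD(4)[OF cZ, of "Suc ?hi"] lohi by simp
    also have "\<dots> = (\<Sum>t=?lo..?hi. if t = ?lo then 0 else card (?Z t - rise n (t - 1) (?Z (t - 1))))"
      using lohi by (subst (2) sum.atLeast_Suc_atMost) (auto intro!: sum.cong)
    finally have c: "card (cov k n W) = (\<Sum>t=?lo..?hi. card (rise n t (?Z t))) +
      (\<Sum>t=?lo..?hi. if t = ?lo then 0 else card (?Z t - rise n (t - 1) (?Z (t - 1))))" .
    have "excess n ?lo ?hi ?Z = (\<Sum>t=?lo..?hi. int (if t = ?lo then 0 else card (?Z t - rise n (t - 1) (?Z (t - 1))))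
       + int (card (rise n t (?Z t))) - int (card (?Z t)))"
      unfolding excess_def by (rule sum.cong) (auto simp: cost_def growth_def)
    then show ?thesis
      unfolding c card_eq_sum_cfg[OF assms(1)] of_nat_sum of_nat_add sum.distrib sum_subtractf by linarith
  qed
qed

definition ups :: "nat \<Rightarrow> nat \<Rightarrow> elt set \<Rightarrow> nat \<Rightarrow> elt set" where
  "ups k n X s = {y \<in> poset k n. lev y = s \<and> (\<exists>x\<in>X. x \<le> y)}"

lemma ups_level: "ups k n X s \<subseteq> level k n s"
  by (auto simp: ups_def level_def)

lemma antichainD:
  assumes "X \<in> antichains Q" "x \<in> X" "y \<in> X" "x \<le> y"
  shows "x = y"
  using assms by (auto simp: antichains_def)

text \<open>The poset is graded, so an element of the shadow outside \<open>X\<close> covers an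
  element of the previous shadow; an element of \<open>X\<close> never does, as \<open>X\<close> is
  an antichain. The disjointness makes the sizes additive in \<open>card_ups\<close>.\<close>

lemma ups_Suc:
  assumes "X \<in> antichains (poset k n)"
  shows "ups k n X (Suc s) = cov k n (ups k n X s) \<union> {x \<in> X. lev x = Suc s}"
    "cov k n (ups k n X s) \<inter> {x \<in> X. lev x = Suc s} = {}"
proof -
  have sub: "X \<subseteq> poset k n" using assms by (simp add: antichains_def)
  show "ups k n X (Suc s) = cov k n (ups k n X s) \<union> {x \<in> X. lev x = Suc s}"
  proof (intro equalityI subsetI)
    fix y assume "y \<in> ups k n X (Suc s)"
    then obtain x where y: "y \<in> poset k n" "lev y = Suc s" "x \<in> X" "x \<le> y" by (auto simp: ups_def)
    show "y \<in> cov k n (ups k n X s) \<union> {x \<in> X. lev x = Suc s}"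
    proof (cases "lev x = Suc s")
      case True
      then show ?thesis using y lev_strict[OF y(4)] by simp
    next
      case False
      then have "lev x < lev y" using lev_mono[OF y(4)] y(2) by simp
      then obtain z where "z \<in> poset k n" "x \<le> z" "z \<le> y" "lev y = Suc (lev z)"
        using cover_below[OF _ y(1,4)] sub y(3) by blast
      moreover from this have "z \<in> ups k n X s" using y by (auto simp: ups_def)
      ultimately have "y \<in> cov k n (ups k n X s)" using y(1) unfolding cov_def by blast
      then show ?thesis by blast
    qed
  next
    fix y assume "y \<in> cov k n (ups k n X s) \<union> {x \<in> X. lev x = Suc s}"
    then show "y \<in> ups k n X (Suc s)"
      using sub by (auto simp: cov_def ups_def intro: order_trans)
  qed
  show "cov k n (ups k n X s) \<inter> {x \<in> X. lev x = Suc s} = {}"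
  proof (rule ccontr)
    assume "\<not> ?thesis"
    then obtain y where y: "y \<in> cov k n (ups k n X s)" "y \<in> X" by blast
    then obtain z where z: "z \<in> ups k n X s" "z \<le> y" "lev y = Suc (lev z)" unfolding cov_def by blast
    then obtain x where "x \<in> X" "x \<le> z" unfolding ups_def by blast
    with y(2) z(2,3) have "y \<in> X" "z \<le> y" "lev y = Suc (lev z)" "x \<in> X" "x \<le> z" by simp_all
    moreover from this have "x = y" using antichainD[OF assms, of x y] by (meson order_trans)
    ultimately show False using lev_mono[of x z] by simp
  qed
qed

lemma card_ups:
  assumes "X \<in> antichains (poset k n)"
  shows "int (card (ups k n X S)) - int (card {x \<in> X. lev x \<le> S}) =
    (\<Sum>s<S. int (card (cov k n (ups k n X s))) - int (card (ups k n X s)))"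
proof (induction S)
  case 0
  have sub: "X \<subseteq> poset k n" using assms by (simp add: antichains_def)
  have e: "{x \<in> X. lev x \<le> 0} = {}" using sub by (auto simp: mem_poset)
  moreover have "ups k n X 0 = {}" by (auto simp: ups_def mem_poset)
  ultimately show ?case unfolding e by simp
next
  case (Suc S)
  have sub: "X \<subseteq> poset k n" using assms by (simp add: antichains_def)
  then have fin: "finite X" by (rule finite_subset) simp
  have "card (ups k n X (Suc S)) = card (cov k n (ups k n X S)) + card {x \<in> X. lev x = Suc S}"
    unfolding ups_Suc(1)[OF assms] by (rule card_Un_disjoint) (use fin ups_Suc(2)[OF assms] in auto)
  moreover have "{x \<in> X. lev x \<le> Suc S} = {x \<in> X. lev x \<le> S} \<union> {x \<in> X. lev x = Suc S}" by auto
  moreover have "card \<dots> = card {x \<in> X. lev x \<le> S} + card {x \<in> X. lev x = Suc S}"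
    by (rule card_Un_disjoint) (use fin in auto)
  ultimately show ?case using Suc by simp
qed

section \<open>Two maximum antichains\<close>

text \<open>The blocks of constant \<open>min i (n + 1 - j)\<close> are saturated chains of \<open>H n\<close>.\<close>

definition block :: "nat \<Rightarrow> elt \<Rightarrow> nat" where
  "block n x = min (fst (snd x)) (n + 1 - snd (snd x))"

definition pos :: "elt \<Rightarrow> nat" where
  "pos x = fst (snd x) + snd (snd x)"

abbreviation size_bound :: "nat \<Rightarrow> nat \<Rightarrow> nat" where
  "size_bound k n \<equiv> \<Sum>a\<in>{1..(n + 1) div 2}. min k (2 * n + 3 - 4 * a)"

lemma block_range: "x \<in> poset k n \<Longrightarrow> block n x \<in> {1..(n + 1) div 2}"
  by (cases x) (auto simp: mem_poset block_def)

lemma pos_range: "x \<in> poset k n \<Longrightarrow> block n x = a \<Longrightarrow> pos x \<in> {2 * a..2 * n + 2 - 2 * a}"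
  by (cases x) (auto simp: mem_poset block_def pos_def)

text \<open>Inside block \<open>a\<close> the coordinate \<open>i\<close> stays at \<open>a\<close>
  while \<open>j\<close> rises to \<open>n + 1 - a\<close>, and after that only \<open>i\<close>
  rises; so \<open>i + j\<close> orders the block linearly.\<close>

lemma block_chain:
  assumes "x \<in> poset k n" "y \<in> poset k n" "block n x = block n y" "pos x \<le> pos y" "fst x \<le> fst y"
  shows "x \<le> y"
proof -
  obtain c i j c' i' j' where e: "x = (c, i, j)" "y = (c', i', j')" by (metis prod_cases3)
  have "1 \<le> i \<and> i \<le> j \<and> j \<le> n" "1 \<le> i' \<and> i' \<le> j' \<and> j' \<le> n" using assms(1,2) unfolding e mem_poset by simp_all
  moreover have "min i (n + 1 - j) = min i' (n + 1 - j')" "i + j \<le> i' + j'" "c \<le> c'"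
    using assms(3-5) unfolding e block_def pos_def by simp_all
  moreover define u u' where "u = n + 1 - j" and "u' = n + 1 - j'"
  ultimately have "min i u = min i' u'" "j + u = n + 1" "j' + u' = n + 1" "i + j \<le> i' + j'" "c \<le> c'" by simp_all
  then have "c \<le> c' \<and> i \<le> i' \<and> j \<le> j'"
    by (cases "i \<le> u"; cases "i' \<le> u'"; simp only: min_def if_True if_False; linarith)
  then show ?thesis unfolding e by simp
qed

lemma card_blocks:
  assumes "A \<subseteq> poset k n"
  shows "card A = (\<Sum>a\<in>{1..(n + 1) div 2}. card {x \<in> A. block n x = a})"
proof -
  have fin: "finite A" using assms finite_poset by (rule finite_subset)
  have sub: "block n ` A \<subseteq> {1..(n + 1) div 2}" using block_range assms by blast
  show ?thesis
    using sum.group[OF fin finite_atLeastAtMost sub, of "\<lambda>_. 1 :: nat"] by simp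
qed

text \<open>A block together with the colors is a product of two chains, of sizes
  \<open>2 n + 3 - 4 a\<close> and \<open>k\<close>, and an antichain projects injectively to both
  factors.\<close>

lemma card_antichain_bound:
  assumes "A \<in> antichains (poset k n)"
  shows "card A \<le> size_bound k n"
proof -
  have sub: "A \<subseteq> poset k n" using assms by (simp add: antichains_def)
  have "card {x \<in> A. block n x = a} \<le> min k (2 * n + 3 - 4 * a)" for a
  proof -
    let ?B = "{x \<in> A. block n x = a}"
    have eq: "x = y" if "x \<in> ?B" "y \<in> ?B" "fst x \<le> fst y" "pos x \<le> pos y" for x y
      using that sub by (intro antichainD[OF assms, of x y] block_chain[of x k n y]) auto
    have i1: "inj_on fst ?B"
    proof (rule inj_onI)
      fix x y assume "x \<in> ?B" "y \<in> ?B" "fst x = fst y"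
      then show "x = y" using eq[of x y] eq[of y x] by (cases "pos x \<le> pos y") simp_all
    qed
    have i2: "inj_on pos ?B"
    proof (rule inj_onI)
      fix x y assume "x \<in> ?B" "y \<in> ?B" "pos x = pos y"
      then show "x = y" using eq[of x y] eq[of y x] by (cases "fst x \<le> fst y") simp_all
    qed
    have "fst ` ?B \<subseteq> {1..k}"
    proof (rule image_subsetI)
      fix x assume "x \<in> ?B"
      then have "x \<in> poset k n" using sub by blast
      then show "fst x \<in> {1..k}" by (cases x) (simp add: mem_poset)
    qed
    then have a1: "card ?B \<le> k" using card_inj_on_le[OF i1, of "{1..k}"] by simp
    have "pos ` ?B \<subseteq> {2 * a..2 * n + 2 - 2 * a}"
    proof (rule image_subsetI)
      fix x assume "x \<in> ?B"
      then show "pos x \<in> {2 * a..2 * n + 2 - 2 * a}" using pos_range[of x k n a] sub by blast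
    qed
    then have "card ?B \<le> card {2 * a..2 * n + 2 - 2 * a}" by (intro card_inj_on_le[OF i2]) simp_all
    then have "card ?B \<le> 2 * n + 3 - 4 * a" by simp
    then show ?thesis using a1 by simp
  qed
  then show ?thesis unfolding card_blocks[OF sub] by (intro sum_mono)
qed

text \<open>On the plateau of its rank numbers, a product of two chains has as many elements of a
  given rank as the shorter chain. The hypothesis places \<open>s\<close> on the plateau of every
  block.\<close>

lemma card_level_bound:
  assumes "\<And>a. 1 \<le> a \<Longrightarrow> 2 * a \<le> n + 1 \<Longrightarrow>
    (2 * a + k \<le> s \<and> s + 2 * a \<le> 2 * n + 3) \<or> (2 * n + 3 \<le> s + 2 * a \<and> s \<le> 2 * a + k)"
  shows "size_bound k n \<le> card (level k n s)"
proof -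
  have sub: "level k n s \<subseteq> poset k n" by (auto simp: level_def)
  have "min k (2 * n + 3 - 4 * a) \<le> card {x \<in> level k n s. block n x = a}"
    if a: "a \<in> {1..(n + 1) div 2}" for a
  proof -
    let ?B = "{x \<in> level k n s. block n x = a}"
    \<comment> \<open>The element of level \<open>s\<close> over the point of rank \<open>t\<close>
      in block \<open>a\<close>; the chain turns at \<open>t = n + 1\<close>.\<close>
    let ?f = "\<lambda>t. if t \<le> n + 1 then (s - t, a, t - a) else (s - t, t - (n + 1 - a), n + 1 - a)"
    have fin: "finite ?B" by simp
    have inj: "inj_on ?f S" if "S \<subseteq> {..<s}" for S
    proof (rule inj_onI)
      fix t t' assume tt: "t \<in> S" "t' \<in> S" "?f t = ?f t'"
      have "fst (?f t) = s - t" "fst (?f t') = s - t'" by simp_all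
      then have "s - t = s - t'" using tt(3) by simp
      then show "t = t'" using tt(1,2) that by (metis lessThan_iff subsetD diff_diff_cancel less_imp_le)
    qed
    have mem: "?f t \<in> ?B" if t: "2 * a \<le> t" "t \<le> 2 * n + 2 - 2 * a" "t < s" "s \<le> t + k" for t
    proof (cases "t \<le> n + 1")
      case True
      then have "?f t = (s - t, a, t - a)" by simp
      moreover have "(s - t, a, t - a) \<in> ?B"
        using True t a by (auto simp: level_def mem_poset block_def)
      ultimately show ?thesis by simp
    next
      case False
      then have "?f t = (s - t, t - (n + 1 - a), n + 1 - a)" by simp
      moreover have "(s - t, t - (n + 1 - a), n + 1 - a) \<in> ?B"
        using False t a by (auto simp: level_def mem_poset block_def)
      ultimately show ?thesis by simp
    qed
    have a': "1 \<le> a" "2 * a \<le> n + 1" using a by auto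
    from assms[OF a'] show ?thesis
    proof (elim disjE conjE)
      assume s: "2 * a + k \<le> s" "s + 2 * a \<le> 2 * n + 3"
      have "?f ` {s - k..<s} \<subseteq> ?B"
      proof (rule image_subsetI)
        fix t assume "t \<in> {s - k..<s}"
        then show "?f t \<in> ?B" using s by (intro mem) auto
      qed
      then have "card {s - k..<s} \<le> card ?B" by (intro card_inj_on_le[OF inj _ fin]) auto
      moreover have "card {s - k..<s} = k" using s by simp
      ultimately show ?thesis by simp
    next
      assume s: "2 * n + 3 \<le> s + 2 * a" "s \<le> 2 * a + k"
      have "?f ` {2 * a..2 * n + 2 - 2 * a} \<subseteq> ?B"
      proof (rule image_subsetI)
        fix t assume "t \<in> {2 * a..2 * n + 2 - 2 * a}"
        then show "?f t \<in> ?B" using s a' by (intro mem) auto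
      qed
      moreover have "{2 * a..2 * n + 2 - 2 * a} \<subseteq> {..<s}" using s a' by auto
      ultimately have "card {2 * a..2 * n + 2 - 2 * a} \<le> card ?B" by (intro card_inj_on_le[OF inj _ fin])
      then show ?thesis by simp
    qed
  qed
  then show ?thesis unfolding card_blocks[OF sub] by (rule sum_mono)
qed

lemma level_antichain: "level k n s \<in> antichains (poset k n)"
proof -
  have "\<not> x \<le> y \<and> \<not> y \<le> x" if "x \<in> level k n s" "y \<in> level k n s" "x \<noteq> y" for x y
    using that lev_strict[of x y] lev_strict[of y x] unfolding level_def by auto
  then show ?thesis by (auto simp: antichains_def level_def)
qed

text \<open>All plateaus are centred at \<open>(2 n + 3 + k) / 2\<close>, and the one of a block
  consists of a single level only if \<open>k\<close> equals the size of the block. Otherwise two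
  consecutive levels attain the width, so the leading coefficient is at least 2, against the
  constant coefficient 1.\<close>

lemma not_palindromic_generic:
  assumes "1 \<le> k" "1 \<le> n" "\<And>a. 1 \<le> a \<Longrightarrow> 2 * a \<le> n + 1 \<Longrightarrow> k + 4 * a \<noteq> 2 * n + 3"
  shows "\<not> palindromic (antichain_poly (poset k n))"
proof
  assume pal: "palindromic (antichain_poly (poset k n))"
  let ?f = "antichain_poly (poset k n)" and ?s = "(2 * n + 3 + k) div 2" and ?W = "size_bound k n"
  have c: "coeff ?f j = int (card {A \<in> antichains (poset k n). card A = j})" for j
    by (rule coeff_antichain_poly) simp
  have fin: "finite {A \<in> antichains (poset k n). card A = j}" for j
    using finite_antichains[of "poset k n"] by simp
  have lv: "card (level k n s) = ?W" if s: "s = ?s \<or> s = Suc ?s" for s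
  proof (rule antisym)
    show "card (level k n s) \<le> ?W" by (rule card_antichain_bound[OF level_antichain])
    show "?W \<le> card (level k n s)"
    proof (rule card_level_bound)
      fix a assume a: "1 \<le> a" "2 * a \<le> n + 1"
      have d: "k + 4 * a \<noteq> 2 * n + 3" using assms(3)[OF a] .
      define q where "q = ?s"
      have s': "s = q \<or> s = Suc q" using s unfolding q_def .
      have "2 * n + 3 + k = 2 * q \<or> 2 * n + 3 + k = 2 * q + 1" unfolding q_def by linarith
      then show "(2 * a + k \<le> s \<and> s + 2 * a \<le> 2 * n + 3) \<or> (2 * n + 3 \<le> s + 2 * a \<and> s \<le> 2 * a + k)"
      proof
        assume e: "2 * n + 3 + k = 2 * q"
        \<comment> \<open>Here \<open>k\<close> is odd like the block sizes, so it differs from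
          \<open>2 n + 3 - 4 a\<close> by at least 2.\<close>
        have "k + 4 * a \<noteq> 2 * n + 4" "k + 4 * a \<noteq> 2 * n + 2" using e by presburger+
        then have "k + 4 * a < 2 * n + 2 \<or> 2 * n + 4 < k + 4 * a" using d by linarith
        then show ?thesis using e s' by linarith
      next
        assume e: "2 * n + 3 + k = 2 * q + 1"
        have "k + 4 * a < 2 * n + 3 \<or> 2 * n + 3 < k + 4 * a" using d by linarith
        then show ?thesis using e s' by linarith
      qed
    qed
  qed
  have "?W \<ge> 1"
  proof -
    have "min k (2 * n + 3 - 4 * 1) \<le> ?W"
      by (rule member_le_sum[of 1 _ "\<lambda>a. min k (2 * n + 3 - 4 * a)"]) (use assms(2) in auto)
    then show ?thesis using assms(1,2) by linarith
  qed
  have ne: "level k n ?s \<noteq> level k n (Suc ?s)"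
  proof
    assume e: "level k n ?s = level k n (Suc ?s)"
    have "level k n ?s \<noteq> {}" using lv[of ?s] \<open>?W \<ge> 1\<close> by auto
    then obtain x where "x \<in> level k n ?s" by blast
    then have "lev x = ?s" "lev x = Suc ?s" using e unfolding level_def by auto
    then show False by simp
  qed
  let ?S = "{A \<in> antichains (poset k n). card A = ?W}"
  have "{level k n ?s, level k n (Suc ?s)} \<subseteq> ?S" using lv level_antichain by blast
  then have "card {level k n ?s, level k n (Suc ?s)} \<le> card ?S" by (rule card_mono[OF fin])
  then have two: "coeff ?f ?W \<ge> 2" using ne unfolding c by simp
  have "degree ?f = ?W"
  proof (rule antisym)
    show "degree ?f \<le> ?W"
    proof (rule degree_le, intro allI impI)
      fix j assume "?W < j"
      have "{A \<in> antichains (poset k n). card A = j} = {}"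
      proof (rule equals0I)
        fix A assume "A \<in> {A \<in> antichains (poset k n). card A = j}"
        then have "A \<in> antichains (poset k n)" "card A = j" by simp_all
        then show False using card_antichain_bound[of A k n] \<open>?W < j\<close> by linarith
      qed
      then have "card {A \<in> antichains (poset k n). card A = j} = 0" by (simp only: card.empty)
      then show "coeff ?f j = 0" unfolding c by linarith
    qed
    show "?W \<le> degree ?f" by (rule le_degree) (use two in simp)
  qed
  moreover have "coeff ?f 0 = 1"
  proof -
    have "{A \<in> antichains (poset k n). card A = 0} = {{}}"
    proof (intro equalityI subsetI)
      fix A assume "A \<in> {A \<in> antichains (poset k n). card A = 0}"
      then have "A \<subseteq> poset k n" "card A = 0" by (simp_all add: antichains_def)
      then show "A \<in> {{}}" using finite_subset[OF _ finite_poset] by auto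
    next
      fix A :: "elt set" assume "A \<in> {{}}"
      then show "A \<in> {A \<in> antichains (poset k n). card A = 0}" by (simp add: antichains_def)
    qed
    then show ?thesis unfolding c by simp
  qed
  moreover have "coeff ?f 0 = coeff ?f (degree ?f - 0)" using pal unfolding palindromic_def by blast
  ultimately show False using two by simp
qed

section \<open>A unique maximum antichain\<close>

lemma cov_empty [simp]: "cov k n {} = {}"
  by (simp add: cov_def)

lemma exists_above:
  assumes "x \<in> poset k n" "lev x \<le> s" "s \<le> k + 2 * n"
  shows "\<exists>y\<in>poset k n. x \<le> y \<and> lev y = s"
  using assms(3,2)
proof (induction s rule: inc_induct)
  case base
  obtain c i j where x: "x = (c, i, j)" by (cases x)
  have "(k, n, n) \<in> poset k n" "x \<le> (k, n, n)" "lev (k, n, n) = k + 2 * n"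
    using assms(1) by (auto simp: x mem_poset)
  then show ?case by blast
next
  case (step s)
  then obtain y where y: "y \<in> poset k n" "x \<le> y" "lev y = Suc s" by auto
  have "lev x < lev y" using step y by simp
  from cover_below[OF assms(1) y(1,2) this]
  obtain z where "z \<in> poset k n" "x \<le> z" "lev y = Suc (lev z)" by metis
  then show ?case using y by auto
qed

text \<open>The block \<open>a = r\<close> has exactly \<open>k = 2 n + 3 - 4 r\<close> elements,
  and \<open>m = n + 1 - 2 r\<close> turns this into \<open>k = 2 m + 1\<close>. The value
  \<open>m = 0\<close> is the case of a single color.\<close>

locale middle =
  fixes r m :: nat
  assumes r_pos: "1 \<le> r" and m_pos: "1 \<le> m"
begin

definition k :: nat where "k = 2 * m + 1"
definition n :: nat where "n = 2 * r + m - 1"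
definition T :: nat where "T = k + 2 * r"

lemma n1: "n + 1 = 2 * r + m" using r_pos by (simp add: n_def)
lemma T_eq: "T = 2 * m + 2 * r + 1" by (simp add: T_def k_def)
lemma T2: "2 * T = k + 2 * n + 3" using n1 by (simp add: T_eq k_def)

abbreviation P where "P \<equiv> poset k n"
abbreviation M where "M \<equiv> level k n T"

definition w :: nat where "w = card M"

definition low_anti :: "elt set set" where
  "low_anti = {X \<in> antichains P. \<forall>x\<in>X. lev x < T}"

definition exc :: "elt set \<Rightarrow> int" where
  "exc X = int (card (ups k n X T)) - int (card X)"

text \<open>Levels are indexed by their distance \<open>D\<close> below the middle one, so that the
  rows run from \<open>2 r - D\<close> to \<open>2 r + 2 m - D\<close>.\<close>

definition part :: "elt set \<Rightarrow> nat \<Rightarrow> nat \<Rightarrow> nat set" where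
  "part X D = cfg (T - D) (ups k n X (T - D))"

definition pexc :: "nat \<Rightarrow> (nat \<Rightarrow> nat set) \<Rightarrow> int" where
  "pexc D Z = excess n (2 * r - D) (2 * r + 2 * m - D) Z"

lemma T_minus: "T - D - k = 2 * r - D" "T - D - 1 = 2 * r + 2 * m - D"
  by (simp_all add: T_eq k_def)

lemma part_config: "D < T \<Longrightarrow> part X D \<in> configs n (2 * r - D) (2 * r + 2 * m - D)"
  using cfg_config[OF ups_level, of "T - D" k n X] unfolding T_minus part_def .

lemma level_excess:
  assumes "1 \<le> D" "D < T"
  shows "int (card (cov k n (ups k n X (T - D)))) - int (card (ups k n X (T - D))) = pexc D (part X D)"
  using excess_cfg[OF ups_level, of "T - D" k n X] assms unfolding T_minus pexc_def part_def by simp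

lemma exc_eq_sum:
  assumes "X \<in> low_anti"
  shows "exc X = (\<Sum>D\<in>{1..<T}. pexc D (part X D))"
proof -
  have X: "X \<in> antichains P" "{x \<in> X. lev x \<le> T} = X" using assms by (auto simp: low_anti_def)
  have T0: "0 < T" by (simp add: T_eq)
  have "exc X = (\<Sum>s<T. int (card (cov k n (ups k n X s))) - int (card (ups k n X s)))"
    using card_ups[OF X(1), of T] X(2) by (simp add: exc_def)
  also have "\<dots> = (\<Sum>s\<in>{1..<T}. int (card (cov k n (ups k n X s))) - int (card (ups k n X s)))"
  proof (rule sum.mono_neutral_right)
    have "ups k n X 0 = {}" by (auto simp: ups_def mem_poset)
    then show "\<forall>s\<in>{..<T} - {1..<T}. int (card (cov k n (ups k n X s))) - int (card (ups k n X s)) = 0"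
    proof -
      assume u: "ups k n X 0 = {}"
      have "s = 0" if "s \<in> {..<T} - {1..<T}" for s using that by (cases s) auto
      then show ?thesis using u by (metis (no_types, lifting) cov_empty card.empty diff_self of_nat_0)
    qed
  qed auto
  also have "\<dots> = (\<Sum>D\<in>{1..<T}. int (card (cov k n (ups k n X (T - D)))) - int (card (ups k n X (T - D))))"
    by (rule sum.reindex_bij_witness[of _ "\<lambda>D. T - D" "\<lambda>D. T - D"]) auto
  also have "\<dots> = (\<Sum>D\<in>{1..<T}. pexc D (part X D))"
    by (rule sum.cong) (auto intro: level_excess)
  finally show ?thesis .
qed

lemma pexc_nonneg:
  assumes "1 \<le> D" "D < T"
  shows "pexc D (part X D) \<ge> 0"
  unfolding pexc_def
  by (rule excess_nonneg[OF part_config[OF assms(2)] n1 _ _ assms(1) r_pos]) (use assms in \<open>auto simp: T_eq\<close>)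

lemma pexc_le_exc:
  assumes "X \<in> low_anti" "S \<subseteq> {1..<T}"
  shows "(\<Sum>D\<in>S. pexc D (part X D)) \<le> exc X"
  unfolding exc_eq_sum[OF assms(1)] by (rule sum_mono2) (use assms pexc_nonneg in auto)

lemma T_le: "T \<le> k + 2 * n"
  using n1 r_pos m_pos by (simp add: T_eq k_def)

lemma ups_nonempty:
  assumes "X \<subseteq> P" "x \<in> X" "lev x \<le> s" "s \<le> T"
  shows "ups k n X s \<noteq> {}"
proof -
  have "x \<in> P" using assms by blast
  moreover have "s \<le> k + 2 * n" using assms(4) T_le by linarith
  ultimately obtain y where "y \<in> P" "x \<le> y" "lev y = s" using exists_above assms(3) by blast
  then show ?thesis using assms(2) unfolding ups_def by blast
qed

lemma part_nonempty:
  assumes "ups k n X (T - D) \<noteq> {}"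
  shows "\<exists>t. part X D t \<noteq> {}"
proof (rule ccontr)
  assume "\<nexists>t. part X D t \<noteq> {}"
  then have "elts (T - D) (part X D) = {}" by (auto simp: elts_def)
  then show False using assms elts_cfg[OF ups_level] by (simp add: part_def)
qed

lemma pexc_pos_odd:
  assumes "odd D" "D < T" "D \<le> 2 * r" "ups k n X (T - D) \<noteq> {}"
  shows "pexc D (part X D) \<ge> 1"
proof -
  obtain t where "part X D t \<noteq> {}" using part_nonempty[OF assms(4)] by blast
  then show ?thesis
    unfolding pexc_def
    by (intro excess_pos_odd[OF part_config[OF assms(2)] n1 _ _ assms(1,3) r_pos]) (use assms in \<open>auto simp: T_eq\<close>)
qed

lemma low_anti_sub: "X \<in> low_anti \<Longrightarrow> X \<subseteq> P"
  by (simp add: low_anti_def antichains_def)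

lemma exc_empty [simp]: "exc {} = 0"
  by (simp add: exc_def ups_def)

text \<open>A nonempty low antichain casts a nonempty shadow on level \<open>T - 1\<close>, whose
  distance 1 is odd.\<close>

lemma exc_pos:
  assumes "X \<in> low_anti" "X \<noteq> {}"
  shows "exc X \<ge> 1"
proof -
  obtain x where x: "x \<in> X" using assms(2) by blast
  have "lev x \<le> T - 1" using assms(1) x by (force simp: low_anti_def)
  then have "ups k n X (T - 1) \<noteq> {}" using ups_nonempty[OF low_anti_sub[OF assms(1)] x] by simp
  then have "pexc 1 (part X 1) \<ge> 1" using pexc_pos_odd[of 1] r_pos T_eq m_pos by simp
  moreover have "(\<Sum>D\<in>{1}. pexc D (part X D)) \<le> exc X"
    by (rule pexc_le_exc[OF assms(1)]) (use T_eq r_pos in auto)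
  ultimately show ?thesis by simp
qed

lemma exc_nonneg: "X \<in> low_anti \<Longrightarrow> exc X \<ge> 0"
  using exc_pos[of X] by (cases "X = {}") auto

section \<open>Duality and the parts of an antichain around the middle level\<close>

definition dual :: "elt \<Rightarrow> elt" where
  "dual x = (k + 1 - fst x, n + 1 - snd (snd x), n + 1 - fst (snd x))"

lemma dual_P: "x \<in> P \<Longrightarrow> dual x \<in> P"
  by (cases x) (auto simp: mem_poset dual_def)

lemma dual_dual: "x \<in> P \<Longrightarrow> dual (dual x) = x"
  by (cases x) (auto simp: mem_poset dual_def)

lemma dual_le: "x \<in> P \<Longrightarrow> y \<in> P \<Longrightarrow> dual x \<le> dual y \<longleftrightarrow> y \<le> x"
  by (cases x; cases y) (auto simp: mem_poset dual_def)

lemma lev_dual: "x \<in> P \<Longrightarrow> lev (dual x) + lev x = 2 * T"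
  unfolding T2 by (cases x) (auto simp: mem_poset dual_def)

lemma inj_dual: "S \<subseteq> P \<Longrightarrow> inj_on dual S"
  by (rule inj_on_inverseI[of _ dual]) (use dual_dual in auto)

lemma dual_image_image: "S \<subseteq> P \<Longrightarrow> dual ` dual ` S = S"
  using dual_dual by (force simp: image_image)

lemma antichain_iff: "A \<in> antichains Q \<longleftrightarrow> A \<subseteq> Q \<and> (\<forall>x\<in>A. \<forall>y\<in>A. x \<le> y \<longrightarrow> x = y)"
  unfolding antichains_def by blast

lemma dual_antichain:
  assumes "A \<in> antichains P"
  shows "dual ` A \<in> antichains P"
proof -
  have sub: "A \<subseteq> P" using assms by (simp add: antichain_iff)
  then have "dual ` A \<subseteq> P" using dual_P by blast
  moreover have "dual x = dual y" if "x \<in> A" "y \<in> A" "dual x \<le> dual y" for x y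
    using antichainD[OF assms that(2,1)] dual_le[of x y] that sub by blast
  ultimately show ?thesis unfolding antichain_iff by blast
qed

definition low :: "elt set \<Rightarrow> elt set" where "low A = {x \<in> A. lev x < T}"
definition mid :: "elt set \<Rightarrow> elt set" where "mid A = {x \<in> A. lev x = T}"
definition high :: "elt set \<Rightarrow> elt set" where "high A = dual ` {x \<in> A. T < lev x}"

text \<open>The missing part: with the upper shadow of the low elements and the lower shadow of the
  high elements removed, an antichain need not use all of the middle level.\<close>

definition rest :: "elt set \<Rightarrow> elt set" where
  "rest A = M - ups k n (low A) T - dual ` ups k n (high A) T - mid A"

lemma sub_antichain:
  assumes "A \<in> antichains Q" "B \<subseteq> A"
  shows "B \<in> antichains Q"
  unfolding antichain_iff
proof (intro conjI ballI impI)
  show "B \<subseteq> Q" using assms unfolding antichain_iff by (meson subset_trans)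
  show "x = y" if "x \<in> B" "y \<in> B" "x \<le> y" for x y
    using antichainD[OF assms(1) _ _ that(3)] that assms(2) by (meson subsetD)
qed

lemma low_low_anti:
  assumes "A \<in> antichains P"
  shows "low A \<in> low_anti"
proof -
  have "low A \<in> antichains P" by (rule sub_antichain[OF assms]) (simp add: low_def)
  moreover have "\<forall>x\<in>low A. lev x < T" by (simp add: low_def del: lev_simp)
  ultimately show ?thesis by (simp add: low_anti_def)
qed

lemma high_low_anti:
  assumes "A \<in> antichains P"
  shows "high A \<in> low_anti"
proof -
  have "{x \<in> A. T < lev x} \<in> antichains P" by (rule sub_antichain[OF assms]) (rule Collect_restrict)
  then have "high A \<in> antichains P" unfolding high_def by (rule dual_antichain)
  moreover have "lev x < T" if hx: "x \<in> high A" for x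
  proof -
    obtain y where y: "x = dual y" "y \<in> A" "T < lev y" using hx unfolding high_def by blast
    then have "y \<in> P" using assms by (auto simp: antichains_def)
    then show ?thesis using lev_dual[of y] y by simp
  qed
  ultimately show ?thesis by (simp add: low_anti_def)
qed

lemma dual_M: "dual ` M = M"
proof -
  have "dual ` M \<subseteq> M" using dual_P lev_dual by (fastforce simp: level_def)
  moreover have "M \<subseteq> dual ` M"
  proof
    fix x assume x: "x \<in> M"
    then have "dual x \<in> M" using \<open>dual ` M \<subseteq> M\<close> by blast
    moreover have "x = dual (dual x)" using x dual_dual by (auto simp: level_def)
    ultimately show "x \<in> dual ` M" by blast
  qed
  ultimately show ?thesis by blast
qed

lemma ups_T_sub: "ups k n X T \<subseteq> M"
  by (rule ups_level)

lemma M_sub: "M \<subseteq> P" by (auto simp: level_def)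

lemma finite_ups [simp]: "finite (ups k n X s)"
  using finite_subset[OF ups_level finite_level] by blast

lemma card_dual_ups: "card (dual ` ups k n X T) = card (ups k n X T)"
  by (rule card_image, rule inj_dual) (use ups_T_sub M_sub in blast)

text \<open>The upper shadow of the low part, the lower shadow of the high part, the middle part and
  \<open>rest A\<close> partition \<open>M\<close>, since an overlap would produce comparable
  elements of \<open>A\<close>. Counting \<open>M\<close> accordingly writes the size of
  \<open>A\<close> as \<open>w\<close> minus three deficiencies.\<close>

lemma antichain_parts:
  assumes A: "A \<in> antichains P"
  shows "A = low A \<union> mid A \<union> dual ` high A" "card A = card (low A) + card (mid A) + card (high A)"
    "ups k n (low A) T \<inter> dual ` ups k n (high A) T = {}"
    "ups k n (low A) T \<inter> mid A = {}" "dual ` ups k n (high A) T \<inter> mid A = {}" "mid A \<subseteq> M"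
    "int (card A) = int w - exc (low A) - exc (high A) - int (card (rest A))"
proof -
  have sub: "A \<subseteq> P" using A unfolding antichain_iff by simp
  then have fin: "finite A" by (rule finite_subset) (rule finite_poset)
  have dh: "dual ` high A = {x \<in> A. T < lev x}"
    unfolding high_def by (rule dual_image_image) (use sub in blast)
  show 1: "A = low A \<union> mid A \<union> dual ` high A" unfolding dh by (auto simp: low_def mid_def)
  have ch: "card (high A) = card {x \<in> A. T < lev x}"
    unfolding high_def by (rule card_image, rule inj_dual) (use sub in blast)
  have "card A = card (low A \<union> mid A) + card {x \<in> A. T < lev x}"
    by (subst 1, unfold dh, rule card_Un_disjoint) (use fin in \<open>auto simp: low_def mid_def\<close>)
  also have "card (low A \<union> mid A) = card (low A) + card (mid A)"
    by (rule card_Un_disjoint) (use fin in \<open>auto simp: low_def mid_def\<close>)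
  finally show 2: "card A = card (low A) + card (mid A) + card (high A)" using ch by simp
  have hu: "y \<in> dual ` ups k n (high A) T \<Longrightarrow> \<exists>z\<in>A. T < lev z \<and> y \<le> z" for y
  proof -
    assume "y \<in> dual ` ups k n (high A) T"
    then obtain u x where u: "y = dual u" "u \<in> P" "x \<in> high A" "x \<le> u"
      unfolding ups_def by blast
    then obtain z where z: "x = dual z" "z \<in> A" "T < lev z" unfolding high_def by blast
    have "z \<in> P" using z sub by blast
    then have "dual u \<le> dual (dual z)" using u z dual_le[OF u(2) dual_P] by simp
    then show ?thesis using z u(1) dual_dual[OF \<open>z \<in> P\<close>] by auto
  qed
  have lu: "y \<in> ups k n (low A) T \<Longrightarrow> \<exists>x\<in>A. lev x < T \<and> x \<le> y" for y
    unfolding ups_def low_def by blast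
  have no: "x \<in> A \<Longrightarrow> z \<in> A \<Longrightarrow> lev x < lev z \<Longrightarrow> \<not> x \<le> z" for x z
    using antichainD[OF A, of x z] by auto
  show 3: "ups k n (low A) T \<inter> dual ` ups k n (high A) T = {}"
  proof (rule equals0I)
    fix y assume "y \<in> ups k n (low A) T \<inter> dual ` ups k n (high A) T"
    then obtain x z where "x \<in> A" "lev x < T" "x \<le> y" "z \<in> A" "T < lev z" "y \<le> z"
      using hu[of y] lu[of y] by (meson IntD1 IntD2)
    then show False using no[of x z] order_trans[of x y z] by simp
  qed
  show 4: "ups k n (low A) T \<inter> mid A = {}"
  proof (rule equals0I)
    fix y assume y: "y \<in> ups k n (low A) T \<inter> mid A"
    then obtain x where "x \<in> A" "lev x < T" "x \<le> y" using lu[of y] by (meson IntD1)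
    moreover have "y \<in> A" "lev y = T" using y unfolding mid_def by simp_all
    ultimately show False using no[of x y] by simp
  qed
  show 5: "dual ` ups k n (high A) T \<inter> mid A = {}"
  proof (rule equals0I)
    fix y assume y: "y \<in> dual ` ups k n (high A) T \<inter> mid A"
    then obtain z where "z \<in> A" "T < lev z" "y \<le> z" using hu[of y] by (meson IntD1)
    moreover have "y \<in> A" "lev y = T" using y unfolding mid_def by simp_all
    ultimately show False using no[of y z] by simp
  qed
  show 6: "mid A \<subseteq> M" using sub by (auto simp: mid_def level_def)
  have dM: "dual ` ups k n (high A) T \<subseteq> M" using ups_T_sub dual_M by blast
  let ?U = "ups k n (low A) T" and ?V = "dual ` ups k n (high A) T"
  have "card M = card ?U + card ?V + card (mid A) + card (rest A)"
  proof -
    have "M = ((?U \<union> ?V) \<union> mid A) \<union> rest A" using ups_T_sub dM 6 by (auto simp: rest_def)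
    moreover have "card (((?U \<union> ?V) \<union> mid A) \<union> rest A) = card ((?U \<union> ?V) \<union> mid A) + card (rest A)"
      by (rule card_Un_disjoint) (use fin in \<open>auto simp: rest_def mid_def\<close>)
    moreover have "card ((?U \<union> ?V) \<union> mid A) = card (?U \<union> ?V) + card (mid A)"
      by (rule card_Un_disjoint) (use fin 4 5 in \<open>auto simp: mid_def\<close>)
    moreover have "card (?U \<union> ?V) = card ?U + card ?V"
      by (rule card_Un_disjoint) (use 3 in auto)
    ultimately show ?thesis by simp
  qed
  then show "int (card A) = int w - exc (low A) - exc (high A) - int (card (rest A))"
    using 2 card_dual_ups by (simp add: exc_def w_def)
qed

end

context middle
begin

lemma antichain_sub: "A \<in> antichains P \<Longrightarrow> A \<subseteq> P"
  unfolding antichain_iff by simp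

lemma finite_antichains_P [simp]: "finite (antichains P)"
  by (rule finite_antichains) (rule finite_poset)

lemma finite_low_anti [simp]: "finite low_anti"
  unfolding low_anti_def by simp

lemma M_antichain: "S \<subseteq> M \<Longrightarrow> S \<in> antichains P"
proof -
  assume S: "S \<subseteq> M"
  have "x = y" if "x \<in> S" "y \<in> S" "x \<le> y" for x y
  proof (rule lev_strict[OF that(3)])
    show "lev x = lev y" using that S unfolding level_def by (metis (mono_tags, lifting) mem_Collect_eq subsetD)
  qed
  moreover have "S \<subseteq> P" using S M_sub by (rule subset_trans)
  ultimately show ?thesis unfolding antichain_iff by simp
qed

lemma parts_inj:
  assumes "A \<in> antichains P" "B \<in> antichains P" "low A = low B" "high A = high B" "rest A = rest B"
  shows "A = B"
proof -
  have mid: "mid C = M - ups k n (low C) T - dual ` ups k n (high C) T - rest C" if "C \<in> antichains P" for C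
    using antichain_parts(4-6)[OF that] unfolding rest_def by blast
  have "mid A = mid B" using mid[OF assms(1)] mid[OF assms(2)] assms(3-5) by simp
  then show ?thesis using antichain_parts(1)[OF assms(1)] antichain_parts(1)[OF assms(2)] assms(3,4) by simp
qed

text \<open>Inverse of the decomposition for antichains with empty high part; \<open>R\<close> is
  the prescribed missing set.\<close>

definition glue :: "elt set \<Rightarrow> elt set \<Rightarrow> elt set" where
  "glue X R = X \<union> (M - ups k n X T - R)"

lemma glue:
  assumes "X \<in> low_anti" "R \<subseteq> M - ups k n X T"
  shows "glue X R \<in> antichains P" "low (glue X R) = X" "high (glue X R) = {}" "rest (glue X R) = R"
proof -
  have X: "X \<in> antichains P" "\<And>x. x \<in> X \<Longrightarrow> lev x < T" using assms(1) unfolding low_anti_def by simp_all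
  have M: "lev y = T" if "y \<in> M" for y using that unfolding level_def by simp
  have "x = y" if xy: "x \<in> glue X R" "y \<in> glue X R" "x \<le> y" for x y
  proof -
    consider "x \<in> X" "y \<in> X" | "x \<in> X" "y \<in> M" "y \<notin> ups k n X T" | "x \<in> M" "y \<in> X" | "x \<in> M" "y \<in> M"
      using xy(1,2) unfolding glue_def by blast
    then show ?thesis
    proof cases
      case 1
      then show ?thesis using antichainD[OF X(1) 1] xy(3) by simp
    next
      case 2
      have "y \<in> P" using 2(2) M_sub by (rule rev_subsetD)
      then have "y \<in> ups k n X T" using 2(1) xy(3) M[OF 2(2)] unfolding ups_def by blast
      then show ?thesis using 2(3) by contradiction
    next
      case 3
      then show ?thesis using X(2)[OF 3(2)] M[OF 3(1)] lev_mono[OF xy(3)] by simp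
    next
      case 4
      then show ?thesis using M lev_strict[OF xy(3)] by simp
    qed
  qed
  moreover have "glue X R \<subseteq> P" using antichain_sub[OF X(1)] M_sub unfolding glue_def by (simp add: subset_iff)
  ultimately show "glue X R \<in> antichains P" unfolding antichain_iff by simp
  show l: "low (glue X R) = X"
  proof (intro equalityI subsetI)
    fix x assume "x \<in> low (glue X R)"
    then show "x \<in> X" using M[of x] unfolding low_def glue_def by (cases "x \<in> X") simp_all
  next
    fix x assume "x \<in> X"
    then show "x \<in> low (glue X R)" using X(2)[of x] unfolding low_def glue_def by simp
  qed
  have "{x \<in> glue X R. T < lev x} = {}"
  proof (rule equals0I)
    fix x assume "x \<in> {x \<in> glue X R. T < lev x}"
    then show False using X(2)[of x] M[of x] unfolding glue_def by (cases "x \<in> X") simp_all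
  qed
  then show h: "high (glue X R) = {}" unfolding high_def by simp
  have m: "mid (glue X R) = M - ups k n X T - R"
  proof (intro equalityI subsetI)
    fix x assume "x \<in> mid (glue X R)"
    then show "x \<in> M - ups k n X T - R" using X(2)[of x] unfolding mid_def glue_def by (cases "x \<in> X") simp_all
  next
    fix x assume "x \<in> M - ups k n X T - R"
    then show "x \<in> mid (glue X R)" using M[of x] unfolding mid_def glue_def by simp
  qed
  have "ups k n {} T = {}" by (simp add: ups_def)
  then show "rest (glue X R) = R" unfolding rest_def l h m using assms(2) by auto
qed

lemma card_glue:
  assumes "X \<in> low_anti" "R \<subseteq> M - ups k n X T"
  shows "int (card (glue X R)) = int w - exc X - int (card R)"
  using antichain_parts(7)[OF glue(1)[OF assms]] unfolding glue(2-4)[OF assms] by simp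

lemma exc_parts: "A \<in> antichains P \<Longrightarrow> exc (low A) \<ge> 0" "A \<in> antichains P \<Longrightarrow> exc (high A) \<ge> 0"
  using exc_nonneg low_low_anti high_low_anti by blast+

lemma card_antichain_le: "A \<in> antichains P \<Longrightarrow> card A \<le> w"
  using antichain_parts(7)[of A] exc_parts[of A] by linarith

lemma finite_rest [simp]: "finite (rest A)"
  unfolding rest_def by simp

lemma low_empty_if: "A \<in> antichains P \<Longrightarrow> exc (low A) \<le> 0 \<Longrightarrow> low A = {}"
  using exc_pos[OF low_low_anti, of A] by (cases "low A = {}") auto

lemma high_empty_if: "A \<in> antichains P \<Longrightarrow> exc (high A) \<le> 0 \<Longrightarrow> high A = {}"
  using exc_pos[OF high_low_anti, of A] by (cases "high A = {}") auto

lemma empty_low_anti: "{} \<in> low_anti"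
  unfolding low_anti_def antichains_def by simp

lemma glue_empty: "glue {} {} = M"
  unfolding glue_def by (simp add: ups_def)

lemma glue_eqI:
  assumes "A \<in> antichains P" "high A = {}"
  shows "A = glue (low A) (rest A)" "rest A \<subseteq> M - ups k n (low A) T"
proof -
  show *: "rest A \<subseteq> M - ups k n (low A) T" unfolding rest_def by blast
  show "A = glue (low A) (rest A)"
    by (rule parts_inj[OF assms(1) glue(1)]) (simp_all add: glue low_low_anti assms *)
qed

lemma unique_max:
  assumes "A \<in> antichains P" "card A = w"
  shows "A = M"
proof -
  have e: "exc (low A) = 0" "exc (high A) = 0" "card (rest A) = 0"
    using antichain_parts(7)[OF assms(1)] exc_parts[OF assms(1)] assms(2) by linarith+
  then have "low A = {}" "high A = {}" "rest A = {}"
    using low_empty_if high_empty_if assms(1) by simp_all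
  then show ?thesis using glue_eqI(1)[OF assms(1)] glue_empty by simp
qed

section \<open>The coefficients of degrees 1, \<open>w - 1\<close> and \<open>w\<close>\<close>

definition acount :: "nat \<Rightarrow> nat" where
  "acount j = card {A \<in> antichains P. card A = j}"

lemma coeff_P: "coeff (antichain_poly P) j = int (acount j)"
  unfolding acount_def by (rule coeff_antichain_poly) (rule finite_poset)

lemma acount_w: "acount w = 1"
proof -
  have "{A \<in> antichains P. card A = w} = {M}"
  proof (intro equalityI subsetI)
    fix A assume "A \<in> {A \<in> antichains P. card A = w}"
    then show "A \<in> {M}" using unique_max[of A] by simp
  next
    fix A assume "A \<in> {M}"
    then show "A \<in> {A \<in> antichains P. card A = w}" using M_antichain[OF order_refl] by (simp add: w_def)
  qed
  then show ?thesis by (simp add: acount_def)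
qed

lemma degree_P: "degree (antichain_poly P) = w"
proof (rule antisym)
  show "degree (antichain_poly P) \<le> w"
  proof (rule degree_le, intro allI impI)
    fix i assume "w < i"
    have e: "{A \<in> antichains P. card A = i} = {}"
    proof (rule equals0I)
      fix A assume "A \<in> {A \<in> antichains P. card A = i}"
      then show False using card_antichain_le[of A] \<open>w < i\<close> by simp
    qed
    show "coeff (antichain_poly P) i = 0" unfolding coeff_P acount_def e by simp
  qed
  show "w \<le> degree (antichain_poly P)"
    by (rule le_degree) (simp add: coeff_P acount_w)
qed

lemma acount_1: "acount 1 = card P"
proof -
  have "{A \<in> antichains P. card A = 1} = (\<lambda>x. {x}) ` P"
  proof (intro equalityI subsetI)
    fix A assume "A \<in> {A \<in> antichains P. card A = 1}"
    then obtain x where "A = {x}" "A \<subseteq> P" using antichain_sub[of A] card_1_singletonE[of A] by blast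
    then show "A \<in> (\<lambda>x. {x}) ` P" by simp
  next
    fix A assume "A \<in> (\<lambda>x. {x}) ` P"
    then obtain x where "A = {x}" "x \<in> P" by blast
    then show "A \<in> {A \<in> antichains P. card A = 1}" unfolding antichain_iff by simp
  qed
  then show ?thesis unfolding acount_def by (simp add: card_image)
qed

definition lower :: "elt set" where "lower = {x \<in> P. lev x < T}"

lemma card_P: "card P = w + 2 * card lower"
proof -
  let ?U = "{x \<in> P. T < lev x}"
  have "dual ` lower = ?U"
  proof (intro equalityI subsetI)
    fix y assume "y \<in> dual ` lower"
    then obtain x where "x \<in> P" "lev x < T" "y = dual x" unfolding lower_def by blast
    then show "y \<in> ?U" using dual_P[of x] lev_dual[of x] by simp
  next
    fix y assume y: "y \<in> ?U"
    then have "dual y \<in> lower" using dual_P[of y] lev_dual[of y] unfolding lower_def by simp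
    then show "y \<in> dual ` lower" using dual_dual[of y] y by force
  qed
  moreover have "card (dual ` lower) = card lower"
    by (rule card_image, rule inj_dual) (auto simp: lower_def)
  ultimately have U: "card ?U = card lower" by simp
  have "P = (M \<union> lower) \<union> ?U" unfolding level_def lower_def by auto
  moreover have "card ((M \<union> lower) \<union> ?U) = card (M \<union> lower) + card ?U"
    by (rule card_Un_disjoint) (auto simp: lower_def level_def)
  moreover have "card (M \<union> lower) = card M + card lower"
    by (rule card_Un_disjoint) (auto simp: lower_def level_def)
  ultimately show ?thesis using U by (simp add: w_def)
qed

lemma w_pos: "1 \<le> w"
proof -
  have "(1, 1, 1) \<in> P" using n1 r_pos m_pos by (auto simp: mem_poset k_def)
  then have "ups k n {(1, 1, 1)} T \<noteq> {}"
    using ups_nonempty[of "{(1,1,1)}" "(1,1,1)" T] r_pos m_pos by (simp add: T_eq)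
  then have "M \<noteq> {}" using ups_T_sub by blast
  then show ?thesis unfolding w_def by (simp add: Suc_le_eq card_gt_0_iff)
qed

definition low1 :: "elt set set" where "low1 = {X \<in> low_anti. exc X = 1}"

lemma finite_low1 [simp]: "finite low1" unfolding low1_def by simp

lemma dual_low_high:
  assumes "A \<in> antichains P"
  shows "low (dual ` A) = high A" "high (dual ` A) = low A"
proof -
  have sub: "x \<in> A \<Longrightarrow> x \<in> P" for x using antichain_sub[OF assms] by blast
  have l: "lev (dual x) + lev x = 2 * T" if "x \<in> A" for x using lev_dual sub that by blast
  have l': "lev (dual x) < T \<longleftrightarrow> T < lev x" if "x \<in> A" for x using l[OF that] by linarith
  show "low (dual ` A) = high A"
  proof (intro equalityI subsetI)
    fix x assume "x \<in> low (dual ` A)"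
    then obtain y where "y \<in> A" "x = dual y" "lev (dual y) < T" unfolding low_def by blast
    then show "x \<in> high A" using l'[of y] unfolding high_def by simp
  next
    fix x assume "x \<in> high A"
    then obtain y where "y \<in> A" "x = dual y" "T < lev y" unfolding high_def by blast
    then show "x \<in> low (dual ` A)" using l'[of y] unfolding low_def by simp
  qed
  show "high (dual ` A) = low A"
  proof (intro equalityI subsetI)
    fix x assume "x \<in> high (dual ` A)"
    then obtain y where y: "y \<in> A" "T < lev (dual y)" "x = dual (dual y)" unfolding high_def by blast
    then show "x \<in> low A" using l[OF y(1)] dual_dual[OF sub[OF y(1)]] unfolding low_def by simp
  next
    fix x assume "x \<in> low A"
    then have x: "x \<in> A" "lev x < T" unfolding low_def by simp_all
    then have "dual x \<in> {x \<in> dual ` A. T < lev x}" using l[OF x(1)] by simp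
    then show "x \<in> high (dual ` A)" unfolding high_def using dual_dual[OF sub[OF x(1)]] by force
  qed
qed

text \<open>A deficiency of one is spent in exactly one place: on a missing middle element
  (\<open>w\<close> choices), in the low part, or by duality in the high part.\<close>

lemma acount_w1: "acount (w - 1) = w + 2 * card low1"
proof -
  let ?A = "{A \<in> antichains P. card A = w - 1}"
  let ?Bmid = "{A \<in> ?A. low A = {} \<and> high A = {}}" and ?Blow = "{A \<in> ?A. low A \<noteq> {}}"
    and ?Bhigh = "{A \<in> ?A. high A \<noteq> {}}"
  have e: "exc (low A) + exc (high A) + int (card (rest A)) = 1" if "A \<in> ?A" for A
    using antichain_parts(7)[of A] that w_pos by auto
  have a1: "high A = {} \<and> rest A = {} \<and> low A \<in> low1" if "A \<in> ?Blow" for A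
  proof -
    have A: "A \<in> antichains P" using that by simp
    have "exc (low A) \<ge> 1" using exc_pos[OF low_low_anti[OF A]] that by simp
    moreover have "exc (low A) + exc (high A) + int (card (rest A)) = 1"
    proof -
      have "A \<in> ?A" using that by blast
      then show ?thesis by (rule e)
    qed
    ultimately have "exc (high A) = 0" "card (rest A) = 0" "exc (low A) = 1"
      using exc_parts[OF A] by linarith+
    then show ?thesis using high_empty_if[OF A] low_low_anti[OF A] by (simp add: low1_def)
  qed
  have c1: "bij_betw low ?Blow low1"
  proof (rule bij_betw_byWitness[where f' = "\<lambda>X. glue X {}"])
    show "\<forall>A\<in>?Blow. glue (low A) {} = A"
      using a1 glue_eqI(1) by (metis (mono_tags, lifting) mem_Collect_eq)
    show "\<forall>X\<in>low1. low (glue X {}) = X" by (simp add: low1_def glue)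
    show "low ` ?Blow \<subseteq> low1" using a1 by blast
    show "(\<lambda>X. glue X {}) ` low1 \<subseteq> ?Blow"
    proof (rule image_subsetI)
      fix X assume X: "X \<in> low1"
      then have X': "X \<in> low_anti" "exc X = 1" "X \<noteq> {}" by (auto simp: low1_def)
      then show "glue X {} \<in> ?Blow" using glue[OF X'(1), of "{}"] card_glue[OF X'(1), of "{}"] w_pos by simp
    qed
  qed
  have c2: "bij_betw ((`) dual) ?Bhigh ?Blow"
  proof (rule bij_betw_byWitness[where f' = "(`) dual"])
    have sub: "A \<subseteq> P" if "A \<in> ?A" for A using antichain_sub that by simp
    show "\<forall>A\<in>?Bhigh. dual ` dual ` A = A" "\<forall>A\<in>?Blow. dual ` dual ` A = A"
      using sub dual_image_image by simp_all
    have *: "dual ` A \<in> ?A \<and> low (dual ` A) = high A \<and> high (dual ` A) = low A" if "A \<in> ?A" for A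
      using dual_antichain[of A] that card_image[OF inj_dual[OF sub[OF that]]] dual_low_high[of A] by simp
    show "(`) dual ` ?Bhigh \<subseteq> ?Blow" "(`) dual ` ?Blow \<subseteq> ?Bhigh" using * by auto
  qed
  have c0: "card ?Bmid = w"
  proof -
    have "bij_betw (\<lambda>y. glue {} {y}) M ?Bmid"
    proof (rule bij_betw_imageI)
      have g: "glue {} {y} \<in> antichains P \<and> low (glue {} {y}) = {} \<and> high (glue {} {y}) = {} \<and>
        rest (glue {} {y}) = {y} \<and> int (card (glue {} {y})) = int w - 1" if "y \<in> M" for y
      proof -
        have "{y} \<subseteq> M - ups k n {} T" using that by (simp add: ups_def)
        from glue[OF empty_low_anti this] card_glue[OF empty_low_anti this] show ?thesis by simp
      qed
      show "inj_on (\<lambda>y. glue {} {y}) M"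
      proof (rule inj_onI)
        fix y z assume yz: "y \<in> M" "z \<in> M" "glue {} {y} = glue {} {z}"
        have "{y} = rest (glue {} {y})" using g[OF yz(1)] by simp
        also have "\<dots> = rest (glue {} {z})" by (simp only: yz(3))
        also have "\<dots> = {z}" using g[OF yz(2)] by simp
        finally show "y = z" by simp
      qed
      show "(\<lambda>y. glue {} {y}) ` M = ?Bmid"
      proof (intro equalityI subsetI)
        fix A assume "A \<in> (\<lambda>y. glue {} {y}) ` M"
        then obtain y where "y \<in> M" "A = glue {} {y}" by blast
        moreover from this have "int (card A) = int w - 1" using g[of y] by simp
        then have "card A = w - 1" using w_pos by linarith
        ultimately show "A \<in> ?Bmid" using g[of y] by simp
      next
        fix A assume A: "A \<in> ?Bmid"
        then have "card (rest A) = 1" using e[of A] by simp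
        then obtain y where y: "rest A = {y}" by (auto simp: card_1_singleton_iff)
        then have "y \<in> M" unfolding rest_def by blast
        moreover have "A = glue {} {y}" using glue_eqI(1)[of A] A y by simp
        ultimately show "A \<in> (\<lambda>y. glue {} {y}) ` M" by blast
      qed
    qed
    from bij_betw_same_card[OF this] show ?thesis by (simp add: w_def)
  qed
  have fin: "finite ?A" by simp
  have "?A = (?Bmid \<union> ?Blow) \<union> ?Bhigh" by auto
  then have "card ?A = card ((?Bmid \<union> ?Blow) \<union> ?Bhigh)" by (rule arg_cong)
  moreover have "card ((?Bmid \<union> ?Blow) \<union> ?Bhigh) = card (?Bmid \<union> ?Blow) + card ?Bhigh"
    by (rule card_Un_disjoint) (use fin a1 in auto)
  moreover have "card (?Bmid \<union> ?Blow) = card ?Bmid + card ?Blow"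
    by (rule card_Un_disjoint) (use fin in auto)
  ultimately have "card ?A = card ?Bmid + card ?Blow + card ?Bhigh" by linarith
  then show ?thesis
    unfolding acount_def using c0 bij_betw_same_card[OF c1] bij_betw_same_card[OF c2] by simp
qed

lemma palindromic_low1:
  assumes "palindromic (antichain_poly P)"
  shows "card low1 = card lower"
proof -
  have "coeff (antichain_poly P) 1 = coeff (antichain_poly P) (w - 1)"
  proof -
    have "\<forall>j\<le>w. coeff (antichain_poly P) j = coeff (antichain_poly P) (w - j)"
      using assms unfolding palindromic_def degree_P by (rule conjunct2)
    then show ?thesis using w_pos by blast
  qed
  then show ?thesis unfolding coeff_P acount_w1 acount_1 card_P by simp
qed

end

section \<open>Low antichains of excess one\<close>

context middle
begin

abbreviation lo where "lo \<equiv> 2 * r - 1"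
abbreviation hi where "hi \<equiv> 2 * r + 2 * m - 1"

definition confs1 :: "(nat \<Rightarrow> nat set) set" where
  "confs1 = {Z \<in> configs n lo hi. excess n lo hi Z = 1}"

definition suf :: "nat \<Rightarrow> nat \<Rightarrow> nat set" where
  "suf b = (\<lambda>t. if t = 2 * r - 2 then {b..<r} else {})"

lemma suf_config:
  assumes "1 \<le> b"
  shows "suf b \<in> configs n (2 * r - 2) (2 * r + 2 * m - 2)"
proof -
  have "{b..<r} \<subseteq> row n (2 * r - 2)"
  proof
    fix i assume "i \<in> {b..<r}"
    then have "1 \<le> i" "i < r" using assms by auto
    moreover from this have "2 * r - 2 \<le> i + n" using n1 m_pos by linarith
    ultimately show "i \<in> row n (2 * r - 2)" by (auto simp: row_def)
  qed
  then show ?thesis by (simp add: configs_def suf_def)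
qed

lemma elts_part: "elts (T - D) (part X D) = ups k n X (T - D)"
  unfolding part_def by (rule elts_cfg[OF ups_level])

text \<open>A low antichain on the two levels below the middle one is determined by its shadows there.\<close>

definition two :: "elt set \<Rightarrow> elt set \<Rightarrow> elt set" where
  "two U2 U1 = U2 \<union> (U1 - cov k n U2)"

lemma two:
  assumes "U1 \<subseteq> level k n (T - 1)" "U2 \<subseteq> level k n (T - 2)" "cov k n U2 \<subseteq> U1"
  shows "two U2 U1 \<in> low_anti" "ups k n (two U2 U1) (T - 1) = U1" "ups k n (two U2 U1) (T - 2) = U2"
    "exc (two U2 U1) = (int (card (cov k n U1)) - int (card U1)) + (int (card (cov k n U2)) - int (card U2))"
proof -
  let ?X = "two U2 U1"
  have T3: "T - 1 = Suc (T - 2)" "T = Suc (T - 1)" "T - 2 < T" "T - 1 < T" using T_eq r_pos m_pos by simp_all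
  have U1: "x \<in> P \<and> lev x = T - 1" if "x \<in> U1" for x using assms(1) that unfolding level_def by blast
  have U2: "x \<in> P \<and> lev x = T - 2" if "x \<in> U2" for x using assms(2) that unfolding level_def by blast
  have "x = y" if xy: "x \<in> ?X" "y \<in> ?X" "x \<le> y" for x y
  proof (rule ccontr)
    assume "x \<noteq> y"
    then have "lev x \<noteq> lev y" using lev_strict[OF xy(3)] by blast
    moreover have "lev x \<le> lev y" by (rule lev_mono[OF xy(3)])
    ultimately have "x \<in> U2" "y \<in> U1" "y \<notin> cov k n U2"
      using xy(1,2) U1[of x] U1[of y] U2[of x] U2[of y] T3 unfolding two_def by auto
    then have "y \<in> cov k n U2" using U1[of y] U2[of x] xy(3) T3(1) unfolding cov_def by auto
    then show False using \<open>y \<notin> cov k n U2\<close> by contradiction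
  qed
  moreover have XP: "?X \<subseteq> P" using U1 U2 unfolding two_def by blast
  ultimately have anti: "?X \<in> antichains P" unfolding antichain_iff by simp
  moreover have "lev x < T" if "x \<in> ?X" for x using that U1[of x] U2[of x] T3 unfolding two_def by auto
  ultimately show X: "?X \<in> low_anti" unfolding low_anti_def by simp
  have X2: "{x \<in> ?X. lev x = T - 2} = U2"
    using U1 U2 T3(1) unfolding two_def by force
  have X1: "{x \<in> ?X. lev x = T - 1} = U1 - cov k n U2"
    using U1 U2 T3(1) unfolding two_def by force
  show u2: "ups k n ?X (T - 2) = U2"
  proof (intro equalityI subsetI)
    fix y assume "y \<in> ups k n ?X (T - 2)"
    then obtain x where x: "y \<in> P" "lev y = T - 2" "x \<in> ?X" "x \<le> y" unfolding ups_def by blast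
    have "lev x \<ge> T - 2" using x(3) U1[of x] U2[of x] T3(1) unfolding two_def by auto
    then have "lev x = lev y" using lev_mono[OF x(4)] x(2) by simp
    then have "x = y" by (rule lev_strict[OF x(4)])
    then show "y \<in> U2" using x X2 by blast
  next
    fix y assume "y \<in> U2"
    then show "y \<in> ups k n ?X (T - 2)" using U2[of y] unfolding ups_def two_def by blast
  qed
  show u1: "ups k n ?X (T - 1) = U1"
  proof -
    have "ups k n ?X (Suc (T - 2)) = cov k n U2 \<union> (U1 - cov k n U2)"
      unfolding ups_Suc(1)[OF anti] u2 using X1 T3(1) by simp
    then show ?thesis using assms(3) T3(1) by auto
  qed
  have "ups k n ?X (Suc (T - 1)) = cov k n U1 \<union> {x \<in> ?X. lev x = Suc (T - 1)}"
    unfolding ups_Suc(1)[OF anti] u1 ..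
  moreover have e: "{x \<in> ?X. lev x = Suc (T - 1)} = {}"
    using U1 U2 T3 unfolding two_def by force
  ultimately have uT: "ups k n ?X T = cov k n U1" unfolding e T3(2)[symmetric] by simp
  have fin: "finite U1" "finite U2" using assms finite_level finite_subset by blast+
  have "card ?X = card U2 + card (U1 - cov k n U2)"
    unfolding two_def
  proof (rule card_Un_disjoint)
    show "U2 \<inter> (U1 - cov k n U2) = {}" using U1 U2 T3(1) by force
  qed (use fin in auto)
  moreover have "card (U1 - cov k n U2) = card U1 - card (cov k n U2)"
    by (rule card_Diff_subset) (use assms(3) in auto)
  moreover have "card (cov k n U2) \<le> card U1" by (rule card_mono[OF fin(1) assms(3)])
  ultimately show "exc ?X = (int (card (cov k n U1)) - int (card U1)) + (int (card (cov k n U2)) - int (card U2))"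
    unfolding exc_def uT by simp
qed

definition pairX :: "(nat \<Rightarrow> nat set) \<times> nat \<Rightarrow> elt set" where
  "pairX p = two (elts (T - 2) (suf (snd p))) (elts (T - 1) (fst p))"

lemma T_small: "T - 1 - k = lo" "T - 1 - 1 = hi" "T - 2 - k = 2 * r - 2" "T - 2 - 1 = 2 * r + 2 * m - 2"
  "1 \<le> T - 1" "1 \<le> T - 2" "Suc (T - 2) = T - 1"
  using T_eq r_pos m_pos by (simp_all add: k_def)

lemma elts_level1: "Z \<in> configs n lo hi \<Longrightarrow> elts (T - 1) Z \<subseteq> level k n (T - 1)"
  using elts_level[of Z n "T - 1" k] unfolding T_small .

lemma elts_level2: "Z \<in> configs n (2 * r - 2) (2 * r + 2 * m - 2) \<Longrightarrow> elts (T - 2) Z \<subseteq> level k n (T - 2)"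
  using elts_level[of Z n "T - 2" k] unfolding T_small .

lemma cfg_elts1: "Z \<in> configs n lo hi \<Longrightarrow> cfg (T - 1) (elts (T - 1) Z) = Z"
  using cfg_elts[of Z n "T - 1" k] unfolding T_small by blast

lemma cfg_elts2: "Z \<in> configs n (2 * r - 2) (2 * r + 2 * m - 2) \<Longrightarrow> cfg (T - 2) (elts (T - 2) Z) = Z"
  using cfg_elts[of Z n "T - 2" k] unfolding T_small by blast

lemma excess_elts1:
  assumes "Z \<in> configs n lo hi"
  shows "int (card (cov k n (elts (T - 1) Z))) - int (card (elts (T - 1) Z)) = excess n lo hi Z"
  using excess_cfg[OF elts_level1[OF assms] T_small(5)] unfolding T_small cfg_elts1[OF assms] .

lemma excess_elts2:
  assumes "Z \<in> configs n (2 * r - 2) (2 * r + 2 * m - 2)"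
  shows "int (card (cov k n (elts (T - 2) Z))) - int (card (elts (T - 2) Z))
    = excess n (2 * r - 2) (2 * r + 2 * m - 2) Z"
  using excess_cfg[OF elts_level2[OF assms] T_small(6)] unfolding T_small cfg_elts2[OF assms] .

lemma rise_suf:
  assumes "1 \<le> b"
  shows "rise n (2 * r - 2) {b..<r} = {b..<r}"
proof -
  have "i \<in> row n (Suc (2 * r - 2)) \<longleftrightarrow> i < r" if "b \<le> i" for i
    using that assms n1 m_pos by (auto simp: row_def)
  then show ?thesis by (force simp: rise_def)
qed

lemma excess_suf:
  assumes "1 \<le> b"
  shows "excess n (2 * r - 2) (2 * r + 2 * m - 2) (suf b) = 0"
proof -
  have "excess n (2 * r - 2) (2 * r + 2 * m - 2) (suf b) = (\<Sum>t\<in>{2 * r - 2}. cost n (2 * r - 2) (suf b) t)"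
    by (rule excess_support) (auto simp: suf_def)
  then show ?thesis using rise_suf[OF assms] by (simp add: cost_def growth_def suf_def)
qed

text \<open>Row \<open>2 r - 2\<close> of level \<open>T - 2\<close> has the top color
  \<open>k\<close>, so its covers lie in row \<open>lo\<close> alone; and a run ending at the
  diagonal is its own rise.\<close>

lemma cov_suf:
  assumes "1 \<le> b"
  shows "cov k n (elts (T - 2) (suf b)) = elts (T - 1) (\<lambda>t. if t = lo then {b..<r} else {})"
proof -
  let ?W = "elts (T - 2) (suf b)"
  have lev: "?W \<subseteq> level k n (T - 2)" by (rule elts_level2[OF suf_config[OF assms]])
  have clev: "cov k n ?W \<subseteq> level k n (T - 1)" using cov_level[OF lev] unfolding T_small(7) .
  have c: "cfg (T - 1) (cov k n ?W) t = (if t = lo then {b..<r} else {})" for t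
  proof (cases "2 * r - 2 < t \<and> t \<le> T - 2")
    case True
    have "cfg (Suc (T - 2)) (cov k n ?W) t = rise n (t - 1) (cfg (T - 2) ?W (t - 1)) \<union> cfg (T - 2) ?W t"
      by (rule cfg_cov[OF lev]) (use True T_small(3) in auto)
    then have *: "cfg (T - 1) (cov k n ?W) t = rise n (t - 1) (suf b (t - 1)) \<union> suf b t"
      unfolding T_small(7) cfg_elts2[OF suf_config[OF assms]] .
    have st: "suf b t = {}" using True by (auto simp: suf_def)
    show ?thesis
    proof (cases "t = lo")
      case t: True
      then have "t - 1 = 2 * r - 2" by simp
      then have "rise n (t - 1) (suf b (t - 1)) = {b..<r}" using rise_suf[OF assms] by (simp add: suf_def)
      then show ?thesis using * st t by simp
    next
      case False
      then have "t - 1 \<noteq> 2 * r - 2" using True r_pos by arith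
      then show ?thesis using * st False by (simp add: suf_def)
    qed
  next
    case False
    have "cfg (T - 1) (cov k n ?W) \<in> configs n lo hi"
      using cfg_config[OF clev] unfolding T_small .
    moreover have "t < lo \<or> hi < t" using False T_eq r_pos by auto
    ultimately have "cfg (T - 1) (cov k n ?W) t = {}" using configsD(3,4) by blast
    moreover have "t \<noteq> lo" using False T_eq r_pos m_pos by auto
    ultimately show ?thesis by simp
  qed
  have "cov k n ?W = elts (T - 1) (cfg (T - 1) (cov k n ?W))" by (rule elts_cfg[OF clev, symmetric])
  also have "cfg (T - 1) (cov k n ?W) = (\<lambda>t. if t = lo then {b..<r} else {})" using c by (rule ext)
  finally show ?thesis .
qed

lemma elts_sub_iff:
  assumes "Z \<in> configs n lo hi" "1 \<le> b"
  shows "cov k n (elts (T - 2) (suf b)) \<subseteq> elts (T - 1) Z \<longleftrightarrow> {b..<r} \<subseteq> Z lo"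
proof -
  have lo: "(T - 1 - lo, i, lo - i) \<in> elts (T - 1) Z \<longleftrightarrow> i \<in> Z lo" for i
  proof -
    have "i \<in> cfg (T - 1) (elts (T - 1) Z) lo \<longleftrightarrow> i \<in> Z lo" by (simp only: cfg_elts1[OF assms(1)])
    then show ?thesis unfolding cfg_def by (simp only: mem_Collect_eq)
  qed
  have "elts (T - 1) (\<lambda>t. if t = lo then {b..<r} else {}) = (\<lambda>i. (T - 1 - lo, i, lo - i)) ` {b..<r}"
    unfolding elts_def by (auto simp: image_iff split: if_splits)
  then have "cov k n (elts (T - 2) (suf b)) = (\<lambda>i. (T - 1 - lo, i, lo - i)) ` {b..<r}"
    unfolding cov_suf[OF assms(2)] .
  then have "cov k n (elts (T - 2) (suf b)) \<subseteq> elts (T - 1) Z \<longleftrightarrow>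
    (\<forall>i\<in>{b..<r}. (T - 1 - lo, i, lo - i) \<in> elts (T - 1) Z)"
    by (simp only: image_subset_iff)
  then show ?thesis unfolding lo by blast
qed

text \<open>Codes for the shadows on levels \<open>T - 1\<close> and \<open>T - 2\<close>: a
  configuration of excess one and a suffix of excess zero whose covers it contains.\<close>

definition pairs :: "((nat \<Rightarrow> nat set) \<times> nat) set" where
  "pairs = (SIGMA Z:confs1. opts r lo Z)"

lemma pairX:
  assumes "p \<in> pairs"
  shows "pairX p \<in> low1" "part (pairX p) 1 = fst p" "part (pairX p) 2 = suf (snd p)"
proof -
  obtain Z b where p: "p = (Z, b)" "Z \<in> configs n lo hi" "excess n lo hi Z = 1" "1 \<le> b" "{b..<r} \<subseteq> Z lo"
    using assms by (auto simp: pairs_def confs1_def opts_def)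
  note t = two[OF elts_level1[OF p(2)] elts_level2[OF suf_config[OF p(4)]] elts_sub_iff[OF p(2,4), THEN iffD2, OF p(5)]]
  show "pairX p \<in> low1"
    using t(1,4) unfolding excess_elts1[OF p(2)] excess_elts2[OF suf_config[OF p(4)]] excess_suf[OF p(4)] p(3)
    by (simp add: low1_def pairX_def p(1))
  show "part (pairX p) 1 = fst p"
    unfolding part_def pairX_def p(1) fst_conv snd_conv t(2) by (rule cfg_elts1[OF p(2)])
  show "part (pairX p) 2 = suf (snd p)"
    unfolding part_def pairX_def p(1) fst_conv snd_conv t(3) by (rule cfg_elts2[OF suf_config[OF p(4)]])
qed

lemma suf_inj:
  assumes "suf b = suf b'" "b \<le> r" "b' \<le> r"
  shows "b = b'"
proof -
  have "{b..<r} = {b'..<r}" using fun_cong[OF assms(1), of "2 * r - 2"] by (simp add: suf_def)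
  then have "card {b..<r} = card {b'..<r}" by simp
  then show ?thesis using assms(2,3) by simp
qed

lemma inj_pairX: "inj_on pairX pairs"
proof (rule inj_onI)
  fix p q assume pq: "p \<in> pairs" "q \<in> pairs" "pairX p = pairX q"
  then have "fst p = fst q" "suf (snd p) = suf (snd q)"
    using pairX(2,3)[OF pq(1)] pairX(2,3)[OF pq(2)] by simp_all
  moreover have "snd p \<le> r" "snd q \<le> r" using pq(1,2) by (auto simp: pairs_def opts_def)
  ultimately show "p = q" using suf_inj by (simp add: prod_eq_iff)
qed

lemma finite_pairs: "finite pairs"
  by (rule finite_imageD[OF _ inj_pairX]) (rule finite_subset[of _ low1], use pairX(1) in auto)

lemma card_pairs_le: "card pairs \<le> card low1"
  by (rule card_inj_on_le[OF inj_pairX]) (use pairX(1) in auto)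

lemma low_levels:
  assumes "X \<in> low_anti"
  shows "{x \<in> X. lev x = Suc s} = ups k n X (Suc s) - cov k n (ups k n X s)"
  using ups_Suc[of X k n s] assms unfolding low_anti_def by blast

lemma ups_empty_below:
  assumes "X \<in> low_anti" "ups k n X s = {}" "x \<in> X" "s \<le> T"
  shows "s < lev x"
proof (rule ccontr)
  assume "\<not> ?thesis"
  then have "lev x \<le> s" by simp
  then show False using ups_nonempty[OF low_anti_sub[OF assms(1)] assms(3)] assms(2,4) by blast
qed

lemma low1_pexc:
  assumes "X \<in> low1"
  shows "pexc 1 (part X 1) = 1" "2 \<le> D \<Longrightarrow> D < T \<Longrightarrow> pexc D (part X D) = 0"
proof -
  have X: "X \<in> low_anti" "exc X = 1" "X \<noteq> {}" using assms by (auto simp: low1_def)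
  obtain x where x: "x \<in> X" using X(3) by blast
  have "lev x < T" using X(1) x unfolding low_anti_def by simp
  then have "ups k n X (T - 1) \<noteq> {}" using ups_nonempty[OF low_anti_sub[OF X(1)] x] by simp
  then have p1: "pexc 1 (part X 1) \<ge> 1" using pexc_pos_odd[of 1] r_pos T_eq m_pos by simp
  have "(\<Sum>D\<in>{1}. pexc D (part X D)) \<le> exc X"
    by (rule pexc_le_exc[OF X(1)]) (use T_eq r_pos in auto)
  then show e1: "pexc 1 (part X 1) = 1" using p1 X(2) by simp
  show "pexc D (part X D) = 0" if "2 \<le> D" "D < T"
  proof -
    have "(\<Sum>D\<in>{1, D}. pexc D (part X D)) \<le> exc X"
      by (rule pexc_le_exc[OF X(1)]) (use that T_eq r_pos in auto)
    then have "pexc D (part X D) \<le> 0" using e1 X(2) that by simp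
    then show ?thesis using pexc_nonneg[of D X] that by simp
  qed
qed

lemma low_eq_two:
  assumes "X \<in> low_anti" "ups k n X (T - 3) = {}" "3 \<le> T"
  shows "X = two (ups k n X (T - 2)) (ups k n X (T - 1))"
proof -
  have T3: "T - 2 = Suc (T - 3)" "T - 1 = Suc (T - 2)" using assms(3) by simp_all
  have "lev x = T - 2 \<or> lev x = T - 1" if "x \<in> X" for x
  proof -
    have "T - 3 < lev x" by (rule ups_empty_below[OF assms(1,2) that]) simp
    moreover have "lev x < T" using assms(1) that unfolding low_anti_def by simp
    ultimately show ?thesis by linarith
  qed
  then have "X = {x \<in> X. lev x = T - 2} \<union> {x \<in> X. lev x = T - 1}" by blast
  also have "{x \<in> X. lev x = T - 2} = ups k n X (T - 2)"
    unfolding T3(1) low_levels[OF assms(1)] assms(2) by simp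
  also have "{x \<in> X. lev x = T - 1} = ups k n X (T - 1) - cov k n (ups k n X (T - 2))"
    unfolding T3(2) low_levels[OF assms(1)] by simp
  finally show ?thesis unfolding two_def .
qed

text \<open>A shadow on level \<open>T - 3\<close> has odd distance 3 and would cost a second unit,
  so everything happens on two levels, with excess one on \<open>T - 1\<close> and excess zero on
  \<open>T - 2\<close>. For \<open>r = 1\<close> only the inequality \<open>card_pairs_le\<close> is
  used.\<close>

lemma card_low1:
  assumes "2 \<le> r"
  shows "card low1 = card pairs"
proof -
  have "low1 \<subseteq> pairX ` pairs"
  proof
    fix X assume X1: "X \<in> low1"
    then have X: "X \<in> low_anti" by (simp add: low1_def)
    have T3: "3 < T" using T_eq assms by simp
    have u3: "ups k n X (T - 3) = {}"
    proof (rule ccontr)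
      assume "ups k n X (T - 3) \<noteq> {}"
      then have "pexc 3 (part X 3) \<ge> 1" using pexc_pos_odd[of 3] T3 assms by simp
      then show False using low1_pexc(2)[OF X1, of 3] T3 by simp
    qed
    have c1: "part X 1 \<in> configs n lo hi" using part_config[of 1 X] T3 by simp
    have c2: "part X 2 \<in> configs n (2 * r - 2) (2 * r + 2 * m - 2)" using part_config[of 2 X] T3 by simp
    have Z: "part X 1 \<in> confs1" using c1 low1_pexc(1)[OF X1] by (simp add: confs1_def pexc_def)
    have e2: "excess n (2 * r - 2) (2 * r + 2 * m - 2) (part X 2) = 0"
      using low1_pexc(2)[OF X1, of 2] T3 by (simp add: pexc_def)
    obtain b where b: "1 \<le> b" "b \<le> r" "part X 2 = suf b"
    proof (cases "\<exists>t. part X 2 t \<noteq> {}")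
      case True
      then obtain t where t: "part X 2 t \<noteq> {}" by blast
      have "2 * r - 2 + 2 = 2 * r" "2 * r + 2 * m - 2 + 2 = 2 * r + 2 * m" using assms by simp_all
      from excess_0_even[OF c2 n1 this e2 m_pos t] obtain b where
        "1 \<le> b" "b < r" "part X 2 = (\<lambda>t. if t = 2 * r - 2 then {b..<r} else {})" by blast
      then show ?thesis using that[of b] unfolding suf_def by simp
    next
      case False
      then have "part X 2 = suf r" by (auto simp: suf_def fun_eq_iff)
      then show ?thesis using that[of r] assms by simp
    qed
    have u1: "ups k n X (T - 1) = elts (T - 1) (part X 1)" using elts_part[of 1 X] by simp
    have u2: "ups k n X (T - 2) = elts (T - 2) (suf b)" using elts_part[of 2 X] b(3) by simp
    have "X = two (ups k n X (T - 2)) (ups k n X (T - 1))"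
      by (rule low_eq_two[OF X u3]) (use T3 in simp)
    then have eq: "X = pairX (part X 1, b)" unfolding pairX_def fst_conv snd_conv u1 u2 .
    have "X \<in> antichains P" using X by (simp add: low_anti_def)
    from ups_Suc(1)[OF this, of "T - 2"] have "cov k n (ups k n X (T - 2)) \<subseteq> ups k n X (T - 1)"
      unfolding T_small(7) by blast
    then have "{b..<r} \<subseteq> part X 1 lo" unfolding u1 u2 elts_sub_iff[OF c1 b(1)] .
    then have "(part X 1, b) \<in> pairs" using Z b by (simp add: pairs_def opts_def)
    then show "X \<in> pairX ` pairs" using eq by (rule rev_image_eqI)
  qed
  then have "card low1 \<le> card pairs" using surj_card_le[OF finite_pairs] by blast
  then show ?thesis using card_pairs_le by simp
qed

end

section \<open>Counting the pairs, the middle level and the lower half\<close>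

lemma card_pairs_le_interval:
  "2 * card {(a, b). p \<le> a \<and> a \<le> b \<and> b < p + q} = q * (q + 1)" for p q :: nat
proof -
  have e: "{(a, b). p \<le> a \<and> a \<le> b \<and> b < p + q} = (SIGMA a:{p..<p + q}. {a..<p + q})" by auto
  have "card (SIGMA a:{p..<p + q}. {a..<p + q}) = (\<Sum>a\<in>{p..<p + q}. p + q - a)" by simp
  also have "\<dots> = (\<Sum>i<q. q - i)"
    by (rule sum.reindex_bij_witness[of _ "\<lambda>i. p + i" "\<lambda>a. a - p"]) auto
  also have "2 * \<dots> = q * (q + 1)"
  proof -
    have "(\<Sum>i<q. q - i) = (\<Sum>i\<in>{1..q}. i)"
      by (rule sum.reindex_bij_witness[of _ "\<lambda>i. q - i" "\<lambda>i. q - i"]) auto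
    then show ?thesis using gauss_sum_from_Suc_0[of q, where 'a = nat] by simp
  qed
  finally show ?thesis unfolding e by simp
qed

lemma sum_corner: "3 * (\<Sum>a\<in>{1..<r}. (r + 2 - a) * (r + 1 - a)) + 6 = r * (r + 1) * (r + 2)"
  if "1 \<le> r" for r :: nat
proof -
  have "(\<Sum>a\<in>{1..<r}. (r + 2 - a) * (r + 1 - a)) = (\<Sum>a\<in>{1..<r}. (r - a + 2) * (r - a + 1))"
    by (rule sum.cong) (auto simp: Suc_diff_le)
  also have "\<dots> = (\<Sum>l\<in>{1..<r}. (l + 2) * (l + 1))"
    by (rule sum.reindex_bij_witness[of _ "\<lambda>a. r - a" "\<lambda>a. r - a"]) auto
  finally have "(\<Sum>a\<in>{1..<r}. (r + 2 - a) * (r + 1 - a)) = (\<Sum>l\<in>{1..<r}. (l + 2) * (l + 1))" .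
  moreover have "3 * (\<Sum>l\<in>{1..<r}. (l + 2) * (l + 1)) + 6 = r * (r + 1) * (r + 2)"
    using that by (induction r rule: dec_induct) (auto simp: algebra_simps)
  ultimately show ?thesis by simp
qed

lemma sum_div_2: "(\<Sum>d\<le>2 * m. d div 2) = m * m" for m :: nat
proof (induction m)
  case (Suc m)
  have "{..2 * Suc m} = insert (2 * m + 2) (insert (2 * m + 1) {..2 * m})" by auto
  then show ?case using Suc by simp
qed simp

lemma card_H: "2 * card (H n) = n * (n + 1)"
proof -
  have "H n = {(a, b). 1 \<le> a \<and> a \<le> b \<and> b < 1 + n}" by (auto simp: H_def chain_def)
  then show ?thesis using card_pairs_le_interval[of 1 n] by simp
qed

declare One_nat_def [simp del]

context middle
begin

lemma card_P_formula: "2 * card P = k * (n * (n + 1))"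
  using card_H[of n] by (simp add: poset_def card_cartesian_product chain_def)

lemma two_w: "2 * w = 2 * (2 * m + 1) * r + m * (m - 1)"
proof -
  have M: "M \<subseteq> level k n T" by simp
  have cfgM: "cfg T M t = row n t" if "2 * r \<le> t" "t \<le> 2 * r + 2 * m" for t
  proof
    show "cfg T M t \<subseteq> row n t" by (rule configsD(1)[OF cfg_config[OF M]])
    show "row n t \<subseteq> cfg T M t"
      using that by (auto simp: cfg_def row_def level_def mem_poset T_eq k_def)
  qed
  have e: "T - k = 2 * r" "T - 1 = 2 * r + 2 * m" by (simp_all add: T_eq k_def)
  have "w = (\<Sum>t=2 * r..2 * r + 2 * m. card (row n t))"
    unfolding w_def card_eq_sum_cfg[OF M] e by (rule sum.cong) (auto simp: cfgM)
  also have "\<dots> = (\<Sum>d\<le>2 * m. card (row n (2 * r + d)))"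
    by (rule sum.reindex_bij_witness[of _ "\<lambda>d. 2 * r + d" "\<lambda>t. t - 2 * r"]) auto
  finally have w: "w = (\<Sum>d\<le>2 * m. card (row n (2 * r + d)))" .
  \<comment> \<open>Row \<open>2 r + d\<close> has gained \<open>d div 2\<close> elements at the
    diagonal and lost \<open>d - m\<close> (truncated) at the wall.\<close>
  have c: "card (row n (2 * r + d)) + (d - m) = r + d div 2" if "d \<le> 2 * m" for d
  proof (cases "d \<le> m")
    case True
    then show ?thesis using n1 by (subst card_row_low) auto
  next
    case False
    then show ?thesis using n1 that r_pos by (subst card_row_high) auto
  qed
  have "w + (\<Sum>d\<le>2 * m. d - m) = (\<Sum>d\<le>2 * m. r + d div 2)"
    unfolding w sum.distrib[symmetric] by (rule sum.cong) (auto simp: c)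
  also have "\<dots> = (2 * m + 1) * r + m * m" unfolding sum.distrib sum_div_2 by (simp add: algebra_simps)
  finally have *: "w + (\<Sum>d\<le>2 * m. d - m) = (2 * m + 1) * r + m * m" .
  have "(\<Sum>d\<le>2 * m. d - m) = (\<Sum>d\<in>{m..2 * m}. d - m)"
    by (rule sum.mono_neutral_right) auto
  also have "\<dots> = (\<Sum>i\<in>{0..m}. i)"
    by (rule sum.reindex_bij_witness[of _ "\<lambda>i. m + i" "\<lambda>d. d - m"]) auto
  finally have "2 * (\<Sum>d\<le>2 * m. d - m) = m * (m + 1)"
    using gauss_sum[of m, where 'a = nat] by simp
  moreover obtain m' where "m = Suc m'" using m_pos by (cases m) auto
  ultimately show ?thesis using * by (simp add: algebra_simps)
qed

lemma four_lower: "4 * card lower + 2 * w = k * (n * (n + 1))"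
  using card_P card_P_formula by simp

definition fam :: "('a \<Rightarrow> nat \<Rightarrow> nat set) \<Rightarrow> 'a set \<Rightarrow> ((nat \<Rightarrow> nat set) \<times> nat) set" where
  "fam f I = (SIGMA Z:f ` I. opts r lo Z)"

lemma card_fam:
  assumes "inj_on f I" "finite I"
  shows "card (fam f I) = (\<Sum>i\<in>I. card (opts r lo (f i)))" "finite (fam f I)"
  unfolding fam_def using assms by (auto simp: sum.reindex)

text \<open>The index sets cover the five kinds of \<open>excess_1_cases\<close> without overlap: a
  run ending at \<open>r - 1\<close> with empty second row is counted in \<open>I_corner\<close> as
  \<open>c = Suc r\<close>, so \<open>I_int\<close> stops at \<open>b = r - 2\<close>.\<close>

abbreviation "I_diag \<equiv> {r..<r + m}"
abbreviation "I_wall \<equiv> {(s, e). n + 1 \<le> s \<and> s \<le> e \<and> e < n + 1 + m}"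
abbreviation "I_int \<equiv> {(a, b). 1 \<le> a \<and> a \<le> b \<and> b < 1 + (r - 2)}"
abbreviation "I_corner \<equiv> (SIGMA a:{1..<r}. {a..Suc r})"
abbreviation "f_wall \<equiv> (\<lambda>(s, e). wall_conf n s e)"
abbreviation "f_int \<equiv> (\<lambda>(a, b). corner_conf lo a b (Suc r))"
abbreviation "f_corner \<equiv> (\<lambda>(a, c). corner_conf lo a (r - 1) c)"
abbreviation "f_full \<equiv> full_conf n lo hi"

lemma inj_wall: "inj_on f_wall I_wall"
proof (rule inj_onI, clarify)
  fix s e s' e' assume a: "n + 1 \<le> s" "s \<le> e" "n + 1 \<le> s'" "s' \<le> e'" "wall_conf n s e = wall_conf n s' e'"
  have e: "{t. wall_conf n s e t \<noteq> {}} = {s..e}" "{t. wall_conf n s' e' t \<noteq> {}} = {s'..e'}"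
    by (auto simp: wall_conf_def)
  have "{s..e} = {s'..e'}" using e(1) unfolding a(5) e(2) by (rule sym)
  then show "s = s' \<and> e = e'" using a(2,4) by (simp add: Icc_eq_Icc)
qed

lemma corner_vals:
  "corner_conf lo a b c lo = {a..b}" "corner_conf lo a b c (Suc lo) = {c..r}"
  "corner_conf lo a b c (Suc (Suc lo)) = {}" "corner_conf lo a b c (Suc (2 * r)) = {}"
  using r_pos by (auto simp: corner_conf_def)

lemma inj_int: "inj_on f_int I_int"
proof (rule inj_onI, clarify)
  fix a b a' b' assume a: "a \<le> b" "a' \<le> b'" "corner_conf lo a b (Suc r) = corner_conf lo a' b' (Suc r)"
  then have "{a..b} = {a'..b'}" using corner_vals(1) by metis
  then show "a = a' \<and> b = b'" using a(1,2) by (simp add: Icc_eq_Icc)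
qed

lemma inj_corner: "inj_on f_corner I_corner"
proof (rule inj_onI, clarify)
  fix a c a' c' assume a: "a \<in> {1..<r}" "c \<in> {a..Suc r}" "a' \<in> {1..<r}" "c' \<in> {a'..Suc r}"
    "corner_conf lo a (r - 1) c = corner_conf lo a' (r - 1) c'"
  then have "{a..r - 1} = {a'..r - 1}" "{c..r} = {c'..r}" using corner_vals(1,2) by metis+
  then show "a = a' \<and> c = c'" using a(1-4) by (auto simp: Icc_eq_Icc)
qed

lemma inj_diag: "inj_on diag_conf I"
proof (rule inj_onI)
  fix i j assume "diag_conf i = diag_conf j"
  then have "diag_conf i (2 * i) = diag_conf j (2 * i)" by simp
  then show "i = j" by (simp add: diag_conf_def split: if_splits)
qed

lemma hi_n: "hi - n = m" "lo < hi" "hi = n + m"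
  using n1 r_pos m_pos by linarith+

lemma inj_full: "inj_on f_full {m..r + m}"
proof (rule inj_onI)
  fix y y' assume y: "y \<in> {m..r + m}" "y' \<in> {m..r + m}" "f_full y = f_full y'"
  then have "f_full y hi = f_full y' hi" by simp
  then have "card {m..<y} = card {m..<y'}" unfolding full_conf_def hi_n(1) by simp
  then have "y - m = y' - m" by simp
  then show "y = y'" using y(1,2) unfolding atLeastAtMost_iff by linarith
qed

lemma diag_lo: "diag_conf i lo = {}"
proof -
  have "lo \<noteq> 2 * i" using r_pos by presburger
  then show ?thesis by (simp add: diag_conf_def)
qed

lemma wall_lo: "n < s \<Longrightarrow> wall_conf n s e lo = {}"
proof -
  assume "n < s"
  then have "\<not> s \<le> lo" using n1 m_pos by linarith
  then show ?thesis by (simp add: wall_conf_def)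
qed

lemma opts_empty: "Z lo = {} \<Longrightarrow> opts r lo Z = {r}"
  using opts_no_end[of r Z lo] r_pos by simp

text \<open>A nonempty suffix fits underneath only if row \<open>lo\<close> contains
  \<open>r - 1\<close>. The corner family has \<open>r + 2 - a\<close> values of \<open>c\<close>
  and \<open>r + 1 - a\<close> suffixes for each \<open>a\<close>, which produces the cubic
  term.\<close>

lemma sum_fams:
  "card (fam diag_conf I_diag) = m" "2 * card (fam f_wall I_wall) = m * (m + 1)"
  "2 * card (fam f_int I_int) = (r - 2) * (r - 1)" "3 * card (fam f_corner I_corner) + 6 = r * (r + 1) * (r + 2)"
  "2 \<le> m \<Longrightarrow> card (fam f_full {m..r + m}) = (r + 1) * r"
  "finite (fam diag_conf I_diag)" "finite (fam f_wall I_wall)" "finite (fam f_int I_int)"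
  "finite (fam f_corner I_corner)" "finite (fam f_full {m..r + m})"
proof -
  have fin: "finite I_wall" "finite I_int"
    by (rule finite_subset[of _ "{..n + 1 + m} \<times> {..n + 1 + m}"], auto)
      (rule finite_subset[of _ "{..r} \<times> {..r}"], auto)
  show "finite (fam diag_conf I_diag)" "finite (fam f_wall I_wall)" "finite (fam f_int I_int)"
    "finite (fam f_corner I_corner)" "finite (fam f_full {m..r + m})"
    using card_fam(2)[OF inj_diag] card_fam(2)[OF inj_wall fin(1)] card_fam(2)[OF inj_int fin(2)]
      card_fam(2)[OF inj_corner] card_fam(2)[OF inj_full] by simp_all
  have "opts r lo (diag_conf i) = {r}" for i
    by (rule opts_empty) (rule diag_lo)
  then show "card (fam diag_conf I_diag) = m" by (simp add: card_fam inj_diag)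
  have "opts r lo (f_wall p) = {r}" if "p \<in> I_wall" for p
    using that wall_lo by (intro opts_empty) (cases p, simp)
  then have "card (fam f_wall I_wall) = card I_wall" by (simp add: card_fam inj_wall fin)
  then show "2 * card (fam f_wall I_wall) = m * (m + 1)"
    using card_pairs_le_interval[of "n + 1" m] by simp
  have "opts r lo (f_int p) = {r}" if "p \<in> I_int" for p
    by (rule opts_no_end) (use that r_pos in \<open>auto simp: corner_vals\<close>)
  then have "card (fam f_int I_int) = card I_int" by (simp add: card_fam inj_int fin)
  then show "2 * card (fam f_int I_int) = (r - 2) * (r - 1)"
    using card_pairs_le_interval[of 1 "r - 2"] by (cases "r \<ge> 2") auto
  have "opts r lo (f_corner p) = {fst p..r}" if "p \<in> I_corner" for p
    using that opts_suffix[of "fst p" r "f_corner p" lo] by (auto simp: corner_vals)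
  then have "card (fam f_corner I_corner) = (\<Sum>p\<in>I_corner. r + 1 - fst p)"
    unfolding card_fam(1)[OF inj_corner finite_SigmaI[OF finite_atLeastLessThan finite_atLeastAtMost]]
    by (intro sum.cong) simp_all
  also have "\<dots> = (\<Sum>a\<in>{1..<r}. \<Sum>c\<in>{a..Suc r}. r + 1 - a)"
    by (subst sum.Sigma) (auto intro!: sum.cong)
  also have "\<dots> = (\<Sum>a\<in>{1..<r}. (r + 2 - a) * (r + 1 - a))" by simp
  finally show "3 * card (fam f_corner I_corner) + 6 = r * (r + 1) * (r + 2)"
    using sum_corner[OF r_pos] by simp
  show "card (fam f_full {m..r + m}) = (r + 1) * r" if "2 \<le> m"
  proof -
    have "f_full y lo = {1..<r}" for y
      using hi_n r_pos n1 by (auto simp: full_conf_def row_def)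
    then have "opts r lo (f_full y) = {1..r}" for y
      by (auto simp: opts_def)
    then have "card (fam f_full {m..r + m}) = (\<Sum>y\<in>{m..r + m}. r)"
      unfolding card_fam(1)[OF inj_full finite_atLeastAtMost] by simp
    then show ?thesis by (simp add: algebra_simps)
  qed
qed

lemma conf_mem:
  assumes "2 \<le> r"
  shows "i \<in> I_diag \<Longrightarrow> diag_conf i \<in> confs1" "p \<in> I_wall \<Longrightarrow> f_wall p \<in> confs1"
    "p \<in> I_int \<Longrightarrow> f_int p \<in> confs1" "q \<in> I_corner \<Longrightarrow> f_corner q \<in> confs1"
    "y \<in> {m..r + m} \<Longrightarrow> f_full y \<in> confs1"
proof -
  have l: "lo + 1 = 2 * r" "Suc lo \<le> n" "Suc lo \<le> hi" "hi + 1 = 2 * r + 2 * m"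
    using n1 r_pos m_pos by linarith+
  show "i \<in> I_diag \<Longrightarrow> diag_conf i \<in> confs1"
    unfolding confs1_def using excess_diag_conf[of i n lo hi] n1 assms m_pos by auto
  show "p \<in> I_wall \<Longrightarrow> f_wall p \<in> confs1"
    unfolding confs1_def using excess_wall_conf[of n "fst p" lo "snd p" hi] n1 assms m_pos
    by (cases p) auto
  show "p \<in> I_int \<Longrightarrow> f_int p \<in> confs1"
    unfolding confs1_def using excess_corner_conf[OF _ _ _ l(1-3), of "fst p" "snd p" "Suc r"]
    by (cases p) auto
  show "q \<in> I_corner \<Longrightarrow> f_corner q \<in> confs1"
    unfolding confs1_def using excess_corner_conf[OF _ _ _ l(1-3), of "fst q" "r - 1" "snd q"] r_pos
    by (cases q) (auto simp: le_Suc_eq)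
  show "y \<in> {m..r + m} \<Longrightarrow> f_full y \<in> confs1"
    unfolding confs1_def using excess_full_conf[OF n1 l(1,4) m_pos assms, of y] by auto
qed

lemma fam_sub: "(\<And>i. i \<in> I \<Longrightarrow> f i \<in> confs1) \<Longrightarrow> fam f I \<subseteq> pairs"
  by (auto simp: fam_def pairs_def)

text \<open>Rows \<open>lo\<close> and \<open>lo + 2\<close> tell the families apart, except for
  diagonal and wall points, which are separated in \<open>card_pairs\<close>.\<close>

lemma fam_lo:
  assumes "2 \<le> r"
  shows "p \<in> fam diag_conf I_diag \<Longrightarrow> fst p lo = {}" "p \<in> fam f_wall I_wall \<Longrightarrow> fst p lo = {}"
    "p \<in> fam f_int I_int \<Longrightarrow> fst p lo \<noteq> {} \<and> r - 1 \<notin> fst p lo"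
    "p \<in> fam f_corner I_corner \<Longrightarrow> r - 1 \<in> fst p lo \<and> fst p (Suc (Suc lo)) = {}"
    "2 \<le> m \<Longrightarrow> p \<in> fam f_full {m..r + m} \<Longrightarrow> r - 1 \<in> fst p lo \<and> fst p (Suc (Suc lo)) \<noteq> {}"
proof -
  show "p \<in> fam diag_conf I_diag \<Longrightarrow> fst p lo = {}"
    using diag_lo by (auto simp: fam_def)
  show "p \<in> fam f_wall I_wall \<Longrightarrow> fst p lo = {}"
    using wall_lo by (auto simp: fam_def)
  show "p \<in> fam f_int I_int \<Longrightarrow> fst p lo \<noteq> {} \<and> r - 1 \<notin> fst p lo"
    by (auto simp: fam_def corner_vals)
  show "p \<in> fam f_corner I_corner \<Longrightarrow> r - 1 \<in> fst p lo \<and> fst p (Suc (Suc lo)) = {}"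
    by (auto simp: fam_def corner_vals)
  show "r - 1 \<in> fst p lo \<and> fst p (Suc (Suc lo)) \<noteq> {}" if "2 \<le> m" "p \<in> fam f_full {m..r + m}"
  proof -
    have "r - 1 \<in> row n lo" using n1 assms by (auto simp: row_def)
    moreover have "1 \<in> row n (Suc (Suc lo))" using n1 assms that by (auto simp: row_def)
    moreover have "Suc (Suc lo) < hi" using that n1 assms by linarith
    ultimately show ?thesis using that hi_n(2) by (auto simp: fam_def full_conf_def)
  qed
qed

lemma card_pairs:
  assumes "2 \<le> m" "2 \<le> r"
  shows "6 * card pairs + 6 = 2 * r ^ 3 + 15 * r ^ 2 + r + 3 * m ^ 2 + 9 * m"
proof -
  let ?F1 = "fam diag_conf I_diag" and ?F2 = "fam f_wall I_wall" and ?F3 = "fam f_int I_int"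
    and ?F4 = "fam f_corner I_corner" and ?F5 = "fam f_full {m..r + m}"
  have "pairs \<subseteq> fam diag_conf I_diag \<union> fam f_wall I_wall \<union> fam f_int I_int \<union> fam f_corner I_corner \<union> fam f_full {m..r + m}"
  proof
    fix p assume "p \<in> pairs"
    then obtain Z b where p: "p = (Z, b)" "Z \<in> configs n lo hi" "excess n lo hi Z = 1" "b \<in> opts r lo Z"
      by (auto simp: pairs_def confs1_def)
    have l: "lo + 1 = 2 * r" "hi + 1 = 2 * r + 2 * m" using r_pos by linarith+
    have mem: "p \<in> fam f I" if "i \<in> I" "Z = f i" for f :: "'x \<Rightarrow> nat \<Rightarrow> nat set" and I i
      using that p(1,4) by (auto simp: fam_def)
    show "p \<in> fam diag_conf I_diag \<union> fam f_wall I_wall \<union> fam f_int I_int \<union> fam f_corner I_corner \<union> fam f_full {m..r + m}"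
      using excess_1_cases[OF p(2) n1 l p(3) assms]
    proof (elim disjE exE conjE)
      fix i assume "r \<le> i" "i < r + m" "Z = diag_conf i"
      then have "p \<in> fam diag_conf I_diag" using mem[of i I_diag diag_conf] by simp
      then show ?thesis by blast
    next
      fix s e assume "n < s" "s \<le> e" "e \<le> hi" "Z = wall_conf n s e"
      then have "p \<in> fam f_wall I_wall" using mem[of "(s, e)" I_wall f_wall] hi_n by simp
      then show ?thesis by blast
    next
      fix a b assume a: "1 \<le> a" "a \<le> b" "b < r" "Z = corner_conf lo a b (Suc r)"
      show ?thesis
      proof (cases "b = r - 1")
        case True
        moreover have "a < r" using a(2) True assms(2) by linarith
        ultimately have "(a, Suc r) \<in> I_corner" using a(1) by simp
        then have "p \<in> fam f_corner I_corner" by (rule mem) (use a(4) True in simp)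
        then show ?thesis by blast
      next
        case False
        then have "p \<in> fam f_int I_int" using a assms(2) mem[of "(a, b)" I_int f_int] by simp
        then show ?thesis by blast
      qed
    next
      fix a c assume "1 \<le> a" "a < r" "a \<le> c" "c \<le> r" "Z = corner_conf lo a (r - 1) c"
      then have "p \<in> fam f_corner I_corner" using mem[of "(a, c)" I_corner f_corner] by simp
      then show ?thesis by blast
    next
      fix y assume "m \<le> y" "y \<le> r + m" "Z = f_full y"
      then have "p \<in> fam f_full {m..r + m}" using mem[of y "{m..r + m}" f_full] by simp
      then show ?thesis by blast
    qed
  qed
  moreover have "fam diag_conf I_diag \<union> fam f_wall I_wall \<union> fam f_int I_int \<union> fam f_corner I_corner \<union> fam f_full {m..r + m} \<subseteq> pairs"
    using fam_sub[of I_diag] fam_sub[of I_wall f_wall] fam_sub[of I_int f_int] fam_sub[of I_corner f_corner]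
      fam_sub[of "{m..r + m}" f_full] conf_mem[OF assms(2)] by (intro Un_least) blast+
  ultimately have eq: "pairs = fam diag_conf I_diag \<union> fam f_wall I_wall \<union> fam f_int I_int \<union> fam f_corner I_corner \<union> fam f_full {m..r + m}"
    by (rule antisym)
  have d12: "fam diag_conf I_diag \<inter> fam f_wall I_wall = {}"
  proof (rule equals0I)
    fix p assume p: "p \<in> fam diag_conf I_diag \<inter> fam f_wall I_wall"
    from IntD1[OF p] obtain i where i: "fst p = diag_conf i" "r \<le> i" "i < r + m"
      unfolding fam_def by auto
    from IntD2[OF p] obtain s e where se: "fst p = wall_conf n s e" unfolding fam_def by auto
    have "diag_conf i (2 * i) = wall_conf n s e (2 * i)" using i(1) se by simp
    then have "2 * i - n = i" by (auto simp: diag_conf_def wall_conf_def split: if_splits)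
    then show False using i(2,3) n1 assms by linarith
  qed
  have d5: "(fam diag_conf I_diag \<union> fam f_wall I_wall \<union> fam f_int I_int \<union> fam f_corner I_corner) \<inter> fam f_full {m..r + m} = {}"
  proof (rule equals0I)
    fix p assume p: "p \<in> (fam diag_conf I_diag \<union> fam f_wall I_wall \<union> fam f_int I_int \<union> fam f_corner I_corner) \<inter> fam f_full {m..r + m}"
    have "r - 1 \<in> fst p lo" "fst p (Suc (Suc lo)) \<noteq> {}"
      using fam_lo(5)[OF assms(2,1), of p] p by blast+
    then show False
      using fam_lo(1-4)[OF assms(2), of p] IntD1[OF p] unfolding Un_iff by (elim disjE) simp_all
  qed
  have d4: "(fam diag_conf I_diag \<union> fam f_wall I_wall \<union> fam f_int I_int) \<inter> fam f_corner I_corner = {}"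
  proof (rule equals0I)
    fix p assume p: "p \<in> (fam diag_conf I_diag \<union> fam f_wall I_wall \<union> fam f_int I_int) \<inter> fam f_corner I_corner"
    have "r - 1 \<in> fst p lo" using fam_lo(4)[OF assms(2), of p] p by blast
    then show False
      using fam_lo(1-3)[OF assms(2), of p] IntD1[OF p] unfolding Un_iff by (elim disjE) simp_all
  qed
  have d3: "(fam diag_conf I_diag \<union> fam f_wall I_wall) \<inter> fam f_int I_int = {}"
  proof (rule equals0I)
    fix p assume p: "p \<in> (fam diag_conf I_diag \<union> fam f_wall I_wall) \<inter> fam f_int I_int"
    have "fst p lo \<noteq> {}" using fam_lo(3)[OF assms(2), of p] p by blast
    then show False
      using fam_lo(1-2)[OF assms(2), of p] IntD1[OF p] unfolding Un_iff by (elim disjE) simp_all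
  qed
  have "card pairs = card (fam diag_conf I_diag) + card (fam f_wall I_wall) + card (fam f_int I_int)
      + card (fam f_corner I_corner) + card (fam f_full {m..r + m})"
    unfolding eq card_Un_disjoint[OF finite_UnI[OF finite_UnI[OF finite_UnI[OF sum_fams(6,7)] sum_fams(8)] sum_fams(9)] sum_fams(10) d5]
      card_Un_disjoint[OF finite_UnI[OF finite_UnI[OF sum_fams(6,7)] sum_fams(8)] sum_fams(9) d4]
      card_Un_disjoint[OF finite_UnI[OF sum_fams(6,7)] sum_fams(8) d3]
      card_Un_disjoint[OF sum_fams(6,7) d12] ..
  then have "6 * card pairs + 18 = 6 * m + 3 * (m * (m + 1)) + 3 * ((r - 2) * (r - 1))
    + 2 * (r * (r + 1) * (r + 2)) + 6 * ((r + 1) * r) + 6"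
    using sum_fams(1-4) sum_fams(5)[OF assms(1)] by linarith
  moreover obtain r' where "r = r' + 2" using assms(2) le_Suc_ex[of 2 r] by auto
  ultimately show ?thesis by (simp add: algebra_simps power2_eq_square power3_eq_cube)
qed

text \<open>The cubic equation expressing \<open>card low1 = card lower\<close>.\<close>

lemma palindromic_cubic:
  assumes "palindromic (antichain_poly P)" "2 \<le> m" "2 \<le> r"
  shows "2 * int r ^ 3 + 9 * int r ^ 2 + 7 * int r - 6 + 3 * int m ^ 2 + 9 * int m
    = 3 * int m * (4 * int r ^ 2 + 4 * int r * int m - 2 * int r + int m ^ 2 - int m)"
proof -
  have l: "6 * card lower + 6 = 2 * r ^ 3 + 15 * r ^ 2 + r + 3 * m ^ 2 + 9 * m"
    using card_pairs[OF assms(2,3)] card_low1[OF assms(3)] palindromic_low1[OF assms(1)] by simp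
  have n: "int n = 2 * int r + int m - 1" using n1 by linarith
  have "2 * int w = 2 * (2 * int m + 1) * int r + int m * (int m - 1)"
  proof -
    have "int (m - 1) = int m - 1" using m_pos by simp
    moreover have "2 * int w = 2 * (2 * int m + 1) * int r + int m * int (m - 1)"
      using arg_cong[OF two_w, of int] by (simp only: of_nat_add of_nat_mult of_nat_numeral of_nat_1)
    ultimately show ?thesis by simp
  qed
  moreover have "4 * int (card lower) + 2 * int w = (2 * int m + 1) * (int n * (int n + 1))"
    using arg_cong[OF four_lower, of int] by (simp add: k_def)
  ultimately have "4 * int (card lower) = (2 * int m + 1) * ((2 * int r + int m - 1) * (2 * int r + int m))
    - 2 * (2 * int m + 1) * int r - int m * (int m - 1)"
    unfolding n by (simp add: algebra_simps)
  moreover have "6 * int (card lower) + 6 = 2 * int r ^ 3 + 15 * int r ^ 2 + int r + 3 * int m ^ 2 + 9 * int m"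
    using arg_cong[OF l, of int] by simp
  ultimately show ?thesis by (simp add: algebra_simps power2_eq_square power3_eq_cube)
qed

end

section \<open>Counting configurations of excess two\<close>

text \<open>A set of at most two elements is the union of two optional elements, whence the
  square.\<close>

lemma card_small_subsets:
  assumes "finite A"
  shows "finite {S. S \<subseteq> A \<and> card S \<le> 1}" "card {S. S \<subseteq> A \<and> card S \<le> 1} \<le> card A + 1"
    "finite {S. S \<subseteq> A \<and> card S \<le> 2}" "card {S. S \<subseteq> A \<and> card S \<le> 2} \<le> (card A + 1) ^ 2"
proof -
  let ?f = "\<lambda>p. {x. p = Some x}" and ?O = "insert None (Some ` A)"
  have cO: "card ?O = card A + 1" "finite ?O" using assms by (simp_all add: card_image)
  have 1: "{S. S \<subseteq> A \<and> card S \<le> 1} \<subseteq> ?f ` ?O"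
  proof
    fix S assume S: "S \<in> {S. S \<subseteq> A \<and> card S \<le> 1}"
    then have "finite S" using assms finite_subset by blast
    have "card S = 0 \<or> card S = 1" using S by auto
    then consider "S = {}" | x where "S = {x}"
      using \<open>finite S\<close> card_0_eq card_1_singletonE by metis
    then show "S \<in> ?f ` ?O"
    proof cases
      case 1
      then show ?thesis by (intro image_eqI[of _ _ None]) auto
    next
      case 2
      then show ?thesis using S by (intro image_eqI[of _ _ "Some x"]) auto
    qed
  qed
  show "finite {S. S \<subseteq> A \<and> card S \<le> 1}" by (rule finite_subset[OF 1]) (use cO in simp)
  show "card {S. S \<subseteq> A \<and> card S \<le> 1} \<le> card A + 1"
    using surj_card_le[OF cO(2) 1] cO(1) by simp
  let ?g = "\<lambda>(p, q). ?f p \<union> ?f q"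
  have 2: "{S. S \<subseteq> A \<and> card S \<le> 2} \<subseteq> ?g ` (?O \<times> ?O)"
  proof
    fix S assume S: "S \<in> {S. S \<subseteq> A \<and> card S \<le> 2}"
    then have "finite S" using assms finite_subset by blast
    have "card S = 0 \<or> card S = 1 \<or> card S = 2" using S by auto
    then consider "S = {}" | x where "S = {x}" | x y where "S = {x, y}"
      using \<open>finite S\<close> card_0_eq card_1_singletonE card_2_iff by metis
    then show "S \<in> ?g ` (?O \<times> ?O)"
    proof cases
      case 1
      then show ?thesis by (intro image_eqI[of _ _ "(None, None)"]) auto
    next
      case 2
      then show ?thesis using S by (intro image_eqI[of _ _ "(Some x, None)"]) auto
    next
      case 3
      then show ?thesis using S by (intro image_eqI[of _ _ "(Some x, Some y)"]) auto
    qed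
  qed
  show "finite {S. S \<subseteq> A \<and> card S \<le> 2}" by (rule finite_subset[OF 2]) (use cO in simp)
  show "card {S. S \<subseteq> A \<and> card S \<le> 2} \<le> (card A + 1) ^ 2"
    using surj_card_le[OF finite_cartesian_product[OF cO(2) cO(2)] 2]
    by (simp only: card_cartesian_product cO(1) power2_eq_square)
qed

lemma finite_configs [simp]: "finite (configs n lo hi)"
proof -
  let ?g = "\<lambda>S t. {i. (t, i) \<in> S}"
  have "configs n lo hi \<subseteq> ?g ` Pow ({lo..hi} \<times> {..hi})"
  proof
    fix Z assume Z: "Z \<in> configs n lo hi"
    let ?S = "{(t, i). i \<in> Z t}"
    have "?S \<subseteq> {lo..hi} \<times> {..hi}"
    proof clarify
      fix t i assume i: "i \<in> Z t"
      then have "i \<in> row n t" using configsD(1)[OF Z] by blast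
      moreover have "lo \<le> t" "t \<le> hi" using i configsD(3,4)[OF Z, of t] by (auto simp: not_less[symmetric])
      ultimately show "t \<in> {lo..hi} \<and> i \<in> {..hi}" by (auto simp: row_def)
    qed
    then show "Z \<in> ?g ` Pow ({lo..hi} \<times> {..hi})" by (intro image_eqI[of _ _ ?S]) auto
  qed
  then show ?thesis by (rule finite_subset) simp
qed

text \<open>A configuration is determined by its gains and, where the rows are small, by the rows with
  losses together with two bits which tell whether the extreme elements survive.\<close>

definition gains :: "nat \<Rightarrow> (nat \<Rightarrow> nat set) \<Rightarrow> (nat \<times> nat) set" where
  "gains n Z = {(t, i). i \<in> Z t \<and> i \<notin> rise n (t - 1) (Z (t - 1))}"

definition losses :: "nat \<Rightarrow> nat \<Rightarrow> nat \<Rightarrow> (nat \<Rightarrow> nat set) \<Rightarrow> (nat \<times> bool \<times> bool) set" where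
  "losses n lo hi Z = {(t, Min (rise n (t - 1) (Z (t - 1))) \<in> Z t, Max (rise n (t - 1) (Z (t - 1))) \<in> Z t) |t.
     t \<in> {Suc lo..hi} \<and> loss n Z t \<noteq> 0}"

lemma two_element_set:
  assumes "finite S" "card S \<le> 2" "x \<in> S"
  shows "x = Min S \<or> x = Max (S :: nat set)"
proof (rule ccontr)
  assume a: "\<not> ?thesis"
  have ne: "S \<noteq> {}" using assms(3) by blast
  have "Min S \<le> x" "x \<le> Max S" using assms by simp_all
  then have "Min S < x" "x < Max S" using a by linarith+
  then have "card {Min S, x, Max S} = 3" by simp
  moreover have "card {Min S, x, Max S} \<le> card S"
    by (rule card_mono) (use assms ne in auto)
  ultimately show False using assms(2) by simp
qed

text \<open>Induction over the rows from the empty row \<open>lo\<close>: outside the common rise a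
  row is given by the gains, and inside it, where at most two elements are in question, by the two
  bits of a row with losses.\<close>

lemma config_eqI:
  assumes Z: "Z \<in> configs n lo hi" "Z lo = {}" "\<And>t. card (rise n t (Z t)) \<le> 2"
    and Z': "Z' \<in> configs n lo hi" "Z' lo = {}" "\<And>t. card (rise n t (Z' t)) \<le> 2"
    and eq: "gains n Z = gains n Z'" "losses n lo hi Z = losses n lo hi Z'"
  shows "Z = Z'"
proof
  fix t
  have "lo \<le> t \<Longrightarrow> Z t = Z' t"
  proof (induction t rule: dec_induct)
    case base
    show ?case using Z(2) Z'(2) by simp
  next
    case (step t)
    let ?R = "rise n t (Z t)"
    have R: "rise n t (Z' t) = ?R" using step by simp
    show ?case
    proof (cases "Suc t \<le> hi")
      case False
      then show ?thesis using configsD(4)[OF Z(1)] configsD(4)[OF Z'(1)] by simp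
    next
      case True
      have g: "i \<in> Z (Suc t) \<longleftrightarrow> i \<in> Z' (Suc t)" if "i \<notin> ?R" for i
      proof -
        have "(Suc t, i) \<in> gains n Z \<longleftrightarrow> (Suc t, i) \<in> gains n Z'" using eq(1) by simp
        then show ?thesis using that R by (simp add: gains_def)
      qed
      have l: "loss n Y (Suc t) \<noteq> 0 \<longleftrightarrow> \<not> ?R \<subseteq> Y (Suc t)" if "rise n t (Y t) = ?R" for Y
        using that by (simp add: loss_def)
      have r: "i \<in> Z (Suc t) \<longleftrightarrow> i \<in> Z' (Suc t)" if i: "i \<in> ?R" for i
      proof (cases "?R \<subseteq> Z (Suc t)")
        case T: True
        have "?R \<subseteq> Z' (Suc t)"
        proof (rule ccontr)
          assume "\<not> ?thesis"
          then have "loss n Z' (Suc t) \<noteq> 0" using l[of Z', OF R] by blast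
          then have "(Suc t, Min ?R \<in> Z' (Suc t), Max ?R \<in> Z' (Suc t)) \<in> losses n lo hi Z'"
            unfolding losses_def using step(1) True R by auto
          then have "(Suc t, Min ?R \<in> Z' (Suc t), Max ?R \<in> Z' (Suc t)) \<in> losses n lo hi Z" using eq(2) by simp
          then have "loss n Z (Suc t) \<noteq> 0" unfolding losses_def by auto
          then show False using l[of Z] T by simp
        qed
        then show ?thesis using T i by blast
      next
        case F: False
        then have "loss n Z (Suc t) \<noteq> 0" using l[of Z] by simp
        then have "(Suc t, Min ?R \<in> Z (Suc t), Max ?R \<in> Z (Suc t)) \<in> losses n lo hi Z"
          unfolding losses_def using step(1) True by auto
        then have "(Suc t, Min ?R \<in> Z (Suc t), Max ?R \<in> Z (Suc t)) \<in> losses n lo hi Z'" using eq(2) by simp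
        then have "(Min ?R \<in> Z (Suc t)) = (Min ?R \<in> Z' (Suc t))" "(Max ?R \<in> Z (Suc t)) = (Max ?R \<in> Z' (Suc t))"
          unfolding losses_def using R by auto
        moreover have "i = Min ?R \<or> i = Max ?R" by (rule two_element_set[OF finite_rise Z(3) i])
        ultimately show ?thesis by blast
      qed
      show ?thesis using g r by blast
    qed
  qed
  then show "Z t = Z' t" using configsD(3)[OF Z(1), of t] configsD(3)[OF Z'(1), of t] by (cases "lo \<le> t") auto
qed

text \<open>In a configuration of excess two without full rows which starts late, all rows have at most
  two elements.\<close>

definition late2 :: "nat \<Rightarrow> nat \<Rightarrow> nat \<Rightarrow> (nat \<Rightarrow> nat set) set" where
  "late2 n lo hi = {Z \<in> configs n lo hi. (\<forall>u. \<not> full n Z u) \<and> excess n lo hi Z = 2 \<and> Z lo = {}}"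

text \<open>Since \<open>Z lo\<close> is empty, \<open>sum_cost_partial\<close> bounds the current
  rise and all losses so far together by the excess; nonnegative growth passes the bound from the
  rise to the row itself.\<close>

lemma late2_facts:
  assumes "Z \<in> late2 n lo hi" "lo < hi"
  shows "card (rise n t (Z t)) \<le> 2" "card (Z t) \<le> 2" "card (losses n lo hi Z) \<le> 2"
    "gains n Z \<subseteq> {Suc lo..hi} \<times> {1..hi div 2}"
    "int (card (gains n Z)) + (\<Sum>t=Suc lo..hi. growth n t (Z t)) = 2" "finite (gains n Z)"
proof -
  have Z: "Z \<in> configs n lo hi" "\<And>u. \<not> full n Z u" "excess n lo hi Z = 2" "Z lo = {}"
    using assms(1) unfolding late2_def by blast+
  have nn: "\<And>t. cost n lo Z t \<ge> 0" using cost_nonneg[OF Z(1,2)] .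
  have gn: "\<And>t. growth n t (Z t) \<ge> 0" using growth_nonneg_config[OF Z(1,2)] .
  have part: "(\<Sum>s=lo..u. cost n lo Z s) \<le> 2" if "u \<le> hi" for u
    unfolding Z(3)[symmetric] excess_def by (rule sum_mono2) (use that nn in auto)
  show r: "card (rise n t (Z t)) \<le> 2" for t
  proof (cases "lo \<le> t \<and> t \<le> hi")
    case True
    have "(\<Sum>s=lo..t. cost n lo Z s) = int (card (rise n t (Z t))) + (\<Sum>s=Suc lo..t. int (loss n Z s)) - 0"
      using sum_cost_partial[OF Z(1), of t] True Z(4) by simp
    moreover have "(\<Sum>s=Suc lo..t. int (loss n Z s)) \<ge> 0" by (rule sum_nonneg) simp
    ultimately show ?thesis using part[of t] True by linarith
  next
    case False
    then have "Z t = {}" using configsD(3,4)[OF Z(1), of t] by (auto simp: not_le)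
    then show ?thesis by simp
  qed
  show "card (Z t) \<le> 2" using gn[of t] r[of t] by (simp add: growth_def)
  have l: "(\<Sum>s=Suc lo..hi. int (loss n Z s)) \<le> 2"
    using sum_cost_partial[OF Z(1), of hi] assms(2) Z(3,4) unfolding excess_def by simp
  let ?L = "{t \<in> {Suc lo..hi}. loss n Z t \<noteq> 0}"
  have "losses n lo hi Z = (\<lambda>t. (t, Min (rise n (t - 1) (Z (t - 1))) \<in> Z t, Max (rise n (t - 1) (Z (t - 1))) \<in> Z t)) ` ?L"
    unfolding losses_def by blast
  then have "card (losses n lo hi Z) \<le> card ?L" by (simp add: card_image_le)
  have 1: "int (card ?L) \<le> (\<Sum>s\<in>?L. int (loss n Z s))"
    using sum_bounded_below[of ?L 1 "\<lambda>s. int (loss n Z s)"] by force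
  have 2: "(\<Sum>s\<in>?L. int (loss n Z s)) \<le> (\<Sum>s=Suc lo..hi. int (loss n Z s))" by (rule sum_mono2) auto
  have "int (card ?L) \<le> 2" using 1 2 l by linarith
  then show "card (losses n lo hi Z) \<le> 2" using \<open>card (losses n lo hi Z) \<le> card ?L\<close> by linarith
  have rng: "lo < t \<and> t \<le> hi" if "Z t \<noteq> {}" for t
    using that configsD(3,4)[OF Z(1), of t] Z(4) by (metis nat_neq_iff not_le_imp_less)
  show gs: "gains n Z \<subseteq> {Suc lo..hi} \<times> {1..hi div 2}"
  proof clarify
    fix t i assume "(t, i) \<in> gains n Z"
    then have i: "i \<in> Z t" by (simp add: gains_def)
    then have "lo < t \<and> t \<le> hi" using rng by blast
    moreover have "i \<in> row n t" using i configsD(1)[OF Z(1)] by blast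
    ultimately show "t \<in> {Suc lo..hi} \<and> i \<in> {1..hi div 2}" by (auto simp: row_def)
  qed
  then show "finite (gains n Z)" by (rule finite_subset) simp
  have "gains n Z = (SIGMA t:{Suc lo..hi}. Z t - rise n (t - 1) (Z (t - 1)))"
    using gs by (auto simp: gains_def)
  then have "card (gains n Z) = (\<Sum>t=Suc lo..hi. card (Z t - rise n (t - 1) (Z (t - 1))))"
    using configsD(2)[OF Z(1)] by simp
  moreover have "excess n lo hi Z = (\<Sum>t=Suc lo..hi. cost n lo Z t)"
    unfolding excess_def using assms(2) cost_empty[where Z = Z and t = lo and n = n and lo = lo, OF Z(4)] by (simp add: sum.atLeast_Suc_atMost)
  moreover have "\<dots> = (\<Sum>t=Suc lo..hi. int (card (Z t - rise n (t - 1) (Z (t - 1)))) + growth n t (Z t))"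
    by (rule sum.cong) (auto simp: cost_def)
  ultimately show "int (card (gains n Z)) + (\<Sum>t=Suc lo..hi. growth n t (Z t)) = 2"
    using Z(3) by (simp add: sum.distrib)
qed

text \<open>Zero growth means as many runs as boundary contacts. With at most two elements, each of
  them is then a boundary element or the neighbour of one.\<close>

lemma growth_0_positions:
  assumes "S \<subseteq> row n t" "growth n t S = 0" "card S \<le> 2" "i \<in> S"
  shows "i \<in> {t - n, Suc (t - n), t div 2 - 1, t div 2}"
proof -
  have fin: "finite S" using assms(1) finite_row_subset by blast
  have b: "t - n \<le> x \<and> x \<le> t div 2 \<and> 1 \<le> x" if "x \<in> S" for x using assms(1) that by (auto simp: row_eq)
  have g: "int (card (ends S)) = of_bool (t - n \<in> S) + of_bool (even t \<and> t div 2 \<in> S)"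
    using growth_eq[OF assms(1)] assms(2) by linarith
  show ?thesis
  proof (rule ccontr)
    assume n: "\<not> ?thesis"
    then have i: "i \<noteq> t - n" "i \<noteq> Suc (t - n)" "i \<noteq> t div 2 - 1" "i \<noteq> t div 2" by auto
    have "t - n \<in> S \<or> t div 2 \<in> S"
    proof (rule ccontr)
      assume "\<not> ?thesis"
      then have "card (ends S) = 0" using g by simp
      then show False using card_ends_pos[OF fin] assms(4) by fastforce
    qed
    then obtain x where x: "x \<in> S" "x = t - n \<or> x = t div 2" by blast
    have "i \<noteq> x" using x(2) i by blast
    then have "card {i, x} = 2" by simp
    moreover have "{i, x} \<subseteq> S" using assms(4) x(1) by blast
    ultimately have "S = {i, x}" using card_seteq[OF fin, of "{i, x}"] assms(3) by simp
    moreover have "Suc i \<noteq> x" "Suc x \<noteq> i" using x(2) i b[OF assms(4)] b[OF x(1)] by auto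
    ultimately have "ends S = {i, x}" by (auto simp: ends_def)
    then have "card (ends S) = 2" using x i by auto
    then have "t - n \<in> S" "t div 2 \<in> S" using g by (auto split: if_splits simp: of_bool_def)
    then have "x = t - n" "x = t div 2" using \<open>S = {i, x}\<close> i by auto
    then have "i = x" using b[OF assms(4)] by simp
    then show False using i x by auto
  qed
qed

text \<open>Gains and growths sum to 2. Either there is at most one gain, at any place, or there are
  two and all growths vanish, so that the gains sit at four positions per row. The last factor codes
  at most two rows with losses and their two bits.\<close>

lemma card_late2:
  assumes "lo < hi"
  shows "card (late2 n lo hi) \<le>
    (((hi - lo) * (hi div 2) + 1) + (4 * (hi - lo) + 1) ^ 2) * (4 * (hi - lo) + 1) ^ 2"
proof -
  let ?R = "{Suc lo..hi}"
  let ?G1 = "{G. G \<subseteq> ?R \<times> {1..hi div 2} \<and> card G \<le> 1}"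
  let ?P = "SIGMA t:?R. {t - n, Suc (t - n), t div 2 - 1, t div 2}"
  let ?G2 = "{G. G \<subseteq> ?P \<and> card G \<le> 2}"
  let ?B = "?R \<times> (UNIV :: (bool \<times> bool) set)"
  let ?L = "{L. L \<subseteq> ?B \<and> card L \<le> 2}"
  have fP: "finite ?P" by simp
  have "card ?P \<le> (\<Sum>t\<in>?R. 4)"
    unfolding card_SigmaI[OF finite_atLeastAtMost ballI[OF finite.insertI[OF finite.insertI[OF finite.insertI[OF finite.insertI[OF finite.emptyI]]]]]]
    by (rule sum_mono) (simp add: card_insert_if)
  then have cP: "card ?P \<le> 4 * (hi - lo)" by simp
  have cB: "card ?B = 4 * (hi - lo)" by (simp add: card_cartesian_product UNIV_bool card_UNIV_bool flip: UNIV_Times_UNIV)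
  have sub: "(\<lambda>Z. (gains n Z, losses n lo hi Z)) ` late2 n lo hi \<subseteq> (?G1 \<union> ?G2) \<times> ?L"
  proof (rule image_subsetI)
    fix Z assume Z: "Z \<in> late2 n lo hi"
    note f = late2_facts[OF Z assms]
    have Z': "Z \<in> configs n lo hi" "\<And>u. \<not> full n Z u" using Z unfolding late2_def by blast+
    have gn: "\<And>t. growth n t (Z t) \<ge> 0" using growth_nonneg_config[OF Z'] .
    have "losses n lo hi Z \<in> ?L" using f(3) by (auto simp: losses_def)
    moreover have "gains n Z \<in> ?G1 \<union> ?G2"
    proof (cases "card (gains n Z) \<le> 1")
      case True
      then show ?thesis using f(4) by simp
    next
      case False
      have "(\<Sum>t=Suc lo..hi. growth n t (Z t)) \<ge> 0" by (rule sum_nonneg) (rule gn)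
      then have c: "card (gains n Z) \<le> 2" "(\<Sum>t=Suc lo..hi. growth n t (Z t)) = 0" using f(5) False by linarith+
      have g0: "growth n t (Z t) = 0" if "t \<in> ?R" for t
        using c(2) that sum_nonneg_eq_0_iff[of ?R "\<lambda>t. growth n t (Z t)"] gn by simp
      have "gains n Z \<subseteq> ?P"
      proof clarify
        fix t i assume ti: "(t, i) \<in> gains n Z"
        then have t: "t \<in> ?R" "i \<in> Z t" using f(4) by (auto simp: gains_def)
        from growth_0_positions[OF configsD(1)[OF Z'(1)] g0[OF t(1)] f(2) t(2)]
        show "t \<in> ?R \<and> i \<in> {t - n, Suc (t - n), t div 2 - 1, t div 2}" using t(1) by blast
      qed
      then show ?thesis using c(1) by simp
    qed
    ultimately show "(gains n Z, losses n lo hi Z) \<in> (?G1 \<union> ?G2) \<times> ?L" by simp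
  qed
  have inj: "inj_on (\<lambda>Z. (gains n Z, losses n lo hi Z)) (late2 n lo hi)"
  proof (rule inj_onI)
    fix Z Z' assume a: "Z \<in> late2 n lo hi" "Z' \<in> late2 n lo hi"
      "(gains n Z, losses n lo hi Z) = (gains n Z', losses n lo hi Z')"
    show "Z = Z'"
      by (rule config_eqI[of Z n lo hi Z'])
        (use a late2_facts(1)[OF a(1) assms] late2_facts(1)[OF a(2) assms] in \<open>simp_all add: late2_def\<close>)
  qed
  have fin: "finite ?G1" "finite ?G2" "finite ?L"
    by (rule card_small_subsets(1), simp) (rule card_small_subsets(3)[OF fP], rule card_small_subsets(3), simp)
  have "card (late2 n lo hi) \<le> card ((?G1 \<union> ?G2) \<times> ?L)"
    by (rule card_inj_on_le[OF inj sub]) (use fin in simp)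
  also have "\<dots> = card (?G1 \<union> ?G2) * card ?L" by (rule card_cartesian_product)
  also have "\<dots> \<le> (((hi - lo) * (hi div 2) + 1) + (4 * (hi - lo) + 1) ^ 2) * (4 * (hi - lo) + 1) ^ 2"
  proof (rule mult_le_mono)
    have "card ?G1 \<le> card (?R \<times> {1..hi div 2}) + 1" by (rule card_small_subsets(2)) simp
    moreover have "card (?R \<times> {1..hi div 2}) = (hi - lo) * (hi div 2)" by (simp add: card_cartesian_product)
    moreover have "card ?G2 \<le> (card ?P + 1) ^ 2" by (rule card_small_subsets(4)[OF fP])
    moreover have "(card ?P + 1) ^ 2 \<le> (4 * (hi - lo) + 1) ^ 2" using cP by (intro power_mono) auto
    moreover have "card (?G1 \<union> ?G2) \<le> card ?G1 + card ?G2" by (rule card_Un_le)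
    ultimately show "card (?G1 \<union> ?G2) \<le> ((hi - lo) * (hi div 2) + 1) + (4 * (hi - lo) + 1) ^ 2" by linarith
    show "card ?L \<le> (4 * (hi - lo) + 1) ^ 2" using card_small_subsets(4)[of ?B] cB by simp
  qed
  finally show ?thesis .
qed

text \<open>For \<open>r = 1\<close> the filters of \<open>H n\<close>, which correspond to the subsets of \<open>{1..n}\<close>,
  already give too many configurations of excess one.\<close>

definition filt :: "nat \<Rightarrow> nat \<Rightarrow> nat set \<Rightarrow> nat \<Rightarrow> nat set" where
  "filt n e S = (\<lambda>t. if t \<le> e then {i \<in> row n t. n + 1 + i - t \<le> card {s \<in> S. t - 2 * i < s}} else {})"

lemma filt_configs:
  assumes "e \<le> 2 * n - 1"
  shows "filt n e S \<in> configs n 1 (2 * n - 1)"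
  unfolding configs_def
proof (intro CollectI allI conjI impI)
  fix t
  show "filt n e S t \<subseteq> row n t" by (auto simp: filt_def)
  assume t: "t \<notin> {1..2 * n - 1}"
  show "filt n e S t = {}"
  proof (cases "t = 0")
    case True
    then show ?thesis by (simp add: filt_def row_lower_0)
  next
    case False
    then have "\<not> t \<le> e" using t assms by auto
    then show ?thesis by (simp add: filt_def)
  qed
qed

text \<open>With \<open>j = t - i\<close> the condition reads
  \<open>n + 1 - j <= card {s in S. j - i < s}\<close>, the shifted diagram of the strict partition
  with parts \<open>S\<close>. Raising \<open>j\<close> lowers the left side by one and removes at
  most one \<open>s\<close>; raising \<open>i\<close> only enlarges the set on the right.\<close>

lemma rise_filt:
  assumes "Suc t \<le> e" "finite S"
  shows "rise n t (filt n e S t) \<subseteq> filt n e S (Suc t)"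
proof
  fix i assume i: "i \<in> rise n t (filt n e S t)"
  then have r: "i \<in> row n (Suc t)" by (simp add: rise_def)
  have r': "1 \<le> i" "Suc t \<le> i + n" "2 * i \<le> Suc t" using r by (simp_all add: row_def)
  have fin: "finite {s \<in> S. d < s}" for d using assms(2) by simp
  have "n + 1 + i - Suc t \<le> card {s \<in> S. Suc t - 2 * i < s}"
  proof (cases "i \<in> filt n e S t")
    case True
    then have c: "n + 1 + i - t \<le> card {s \<in> S. t - 2 * i < s}" "2 * i \<le> t" "t \<le> i + n"
      by (auto simp: filt_def row_def split: if_splits)
    have "{s \<in> S. t - 2 * i < s} \<subseteq> insert (Suc t - 2 * i) {s \<in> S. Suc t - 2 * i < s}" using c(2) by auto
    then have "card {s \<in> S. t - 2 * i < s} \<le> card (insert (Suc t - 2 * i) {s \<in> S. Suc t - 2 * i < s})"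
      by (rule card_mono[rotated]) (use fin in simp)
    also have "\<dots> \<le> Suc (card {s \<in> S. Suc t - 2 * i < s})" by (rule card_insert_le_m1) simp_all
    finally show ?thesis using c by linarith
  next
    case False
    then obtain i' where i': "i = Suc i'" "i' \<in> filt n e S t" using i by (auto simp: rise_def)
    then have c: "n + 1 + i' - t \<le> card {s \<in> S. t - 2 * i' < s}" "2 * i' \<le> t" "t \<le> i' + n"
      by (auto simp: filt_def row_def split: if_splits)
    have "card {s \<in> S. t - 2 * i' < s} \<le> card {s \<in> S. Suc t - 2 * i < s}"
      by (rule card_mono[OF fin]) (use i'(1) r' in auto)
    then show ?thesis using c i'(1) by linarith
  qed
  then show "i \<in> filt n e S (Suc t)" using r assms(1) by (simp add: filt_def)
qed

lemma loss_filt: "1 \<le> s \<Longrightarrow> s \<le> e \<Longrightarrow> finite S \<Longrightarrow> loss n (filt n e S) s = 0"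
  using rise_filt[of "s - 1" e S n] by (simp add: loss_def Diff_eq_empty_iff)

lemma top_rows: "3 \<le> n \<Longrightarrow> row n (2 * n) = {n}" "3 \<le> n \<Longrightarrow> row n (2 * n - 1) = {n - 1}"
  "3 \<le> n \<Longrightarrow> row n (2 * n - 2) = {n - 2, n - 1}"
  by (auto simp: row_eq)

lemma filt_top:
  assumes "3 \<le> n" "finite S" "\<exists>s\<in>S. 2 \<le> s"
  shows "filt n (2 * n - 1) S (2 * n - 1) = {n - 1}"
proof -
  obtain s where "s \<in> S" "2 \<le> s" using assms(3) by blast
  then have "card {s} \<le> card {s \<in> S. 1 < s}" using assms(2) by (intro card_mono) auto
  then have "1 \<le> card {s \<in> S. 1 < s}" by simp
  moreover have "n + 1 + (n - 1) - (2 * n - 1) = 1" "2 * n - 1 - 2 * (n - 1) = 1" using assms(1) by auto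
  ultimately have "n - 1 \<in> filt n (2 * n - 1) S (2 * n - 1)" using top_rows(2)[OF assms(1)] by (simp add: filt_def)
  moreover have "filt n (2 * n - 1) S (2 * n - 1) \<subseteq> {n - 1}" using top_rows(2)[OF assms(1)] by (auto simp: filt_def)
  ultimately show ?thesis by blast
qed

text \<open>There are no losses, and the last rise is the single top element of \<open>H n\<close>;
  so \<open>excess_eq_losses\<close> gives 1.\<close>

lemma excess_filt1:
  assumes "3 \<le> n" "finite S" "\<exists>s\<in>S. 2 \<le> s"
  shows "excess n 1 (2 * n - 1) (filt n (2 * n - 1) S) = 1"
proof -
  have "rise n (2 * n - 1) {n - 1} = {n}"
    using assms(1) top_rows(1)[OF assms(1)] by (auto simp: rise_def)
  then have "card (rise n (2 * n - 1) (filt n (2 * n - 1) S (2 * n - 1))) = 1" unfolding filt_top[OF assms] by simp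
  moreover have "(\<Sum>s=Suc 1..2 * n - 1. int (loss n (filt n (2 * n - 1) S) s)) = 0"
    by (rule sum.neutral) (use loss_filt[of _ "2 * n - 1" S n] assms(2) in auto)
  moreover have "filt n (2 * n - 1) S 1 = {}" by (simp add: filt_def row_lower_0(2)[folded One_nat_def])
  ultimately show ?thesis
    using excess_eq_losses[OF filt_configs[of "2 * n - 1" n S], of] assms(1) by simp
qed

lemma filt_top2:
  assumes "3 \<le> n" "finite S" "(\<exists>s\<in>S. 3 \<le> s) \<or> (1 \<in> S \<and> 2 \<in> S)"
  shows "filt n (2 * n - 2) S (2 * n - 2) \<noteq> {}"
  using assms(3)
proof
  assume "\<exists>s\<in>S. 3 \<le> s"
  then obtain s where "s \<in> S" "3 \<le> s" by blast
  then have "card {s} \<le> card {s \<in> S. 2 < s}" using assms(2) by (intro card_mono) auto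
  then have "1 \<le> card {s \<in> S. 2 < s}" by simp
  moreover have "n + 1 + (n - 2) - (2 * n - 2) = 1" "2 * n - 2 - 2 * (n - 2) = 2" using assms(1) by auto
  ultimately have "n - 2 \<in> filt n (2 * n - 2) S (2 * n - 2)" using top_rows(3)[OF assms(1)] by (simp add: filt_def)
  then show ?thesis by blast
next
  assume "1 \<in> S \<and> 2 \<in> S"
  then have "card {1, 2 :: nat} \<le> card {s \<in> S. 0 < s}" using assms(2) by (intro card_mono) auto
  then have "2 \<le> card {s \<in> S. 0 < s}" by simp
  moreover have "n + 1 + (n - 1) - (2 * n - 2) = 2" "2 * n - 2 - 2 * (n - 1) = 0" using assms(1) by auto
  ultimately have "n - 1 \<in> filt n (2 * n - 2) S (2 * n - 2)" using top_rows(3)[OF assms(1)] by (simp add: filt_def)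
  then show ?thesis by blast
qed

lemma rise_top:
  assumes "3 \<le> n" "X \<subseteq> {n - 2, n - 1}" "X \<noteq> {}"
  shows "rise n (2 * n - 2) X = {n - 1}"
proof -
  have S: "Suc (2 * n - 2) = 2 * n - 1" "Suc (n - 2) = n - 1" using assms(1) by simp_all
  have "rise n (2 * n - 2) X \<subseteq> {n - 1}" using rise_subset[of n "2 * n - 2" X] top_rows(2)[OF assms(1)] unfolding S by simp
  moreover have "n - 1 \<in> X \<union> Suc ` X" using assms(2,3) S(2) by (metis UnCI image_eqI insertE singletonD subsetD all_not_in_conv)
  then have "n - 1 \<in> rise n (2 * n - 2) X" unfolding rise_def S top_rows(2)[OF assms(1)] by simp
  ultimately show ?thesis by blast
qed

text \<open>Stopping one row earlier replaces the one element of the last rise by a single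
  loss.\<close>

lemma excess_filt2:
  assumes "3 \<le> n" "finite S" "(\<exists>s\<in>S. 3 \<le> s) \<or> (1 \<in> S \<and> 2 \<in> S)"
  shows "excess n 1 (2 * n - 1) (filt n (2 * n - 2) S) = 1"
proof -
  let ?Z = "filt n (2 * n - 2) S"
  have hi: "?Z (2 * n - 1) = {}" using assms(1) by (simp add: filt_def)
  have "?Z (2 * n - 2) \<subseteq> {n - 2, n - 1}" using top_rows(3)[OF assms(1)] by (auto simp: filt_def)
  then have "rise n (2 * n - 2) (?Z (2 * n - 2)) = {n - 1}"
    by (rule rise_top[OF assms(1) _ filt_top2[OF assms]])
  moreover have "2 * n - 1 - 1 = 2 * n - 2" by simp
  ultimately have l: "loss n ?Z (2 * n - 1) = 1" unfolding loss_def hi by simp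
  have "(\<Sum>s=Suc 1..2 * n - 1. int (loss n ?Z s)) = (\<Sum>s=Suc 1..2 * n - 1. if s = 2 * n - 1 then 1 else 0)"
  proof (rule sum.cong[OF refl])
    fix s assume "s \<in> {Suc 1..2 * n - 1}"
    then show "int (loss n ?Z s) = (if s = 2 * n - 1 then 1 else 0)"
      using loss_filt[of s "2 * n - 2" S n] assms(2) l by (cases "s = 2 * n - 1") auto
  qed
  also have "\<dots> = 1" using assms(1) by simp
  finally have "(\<Sum>s=Suc 1..2 * n - 1. int (loss n ?Z s)) = 1" .
  moreover have "?Z 1 = {}" by (simp add: filt_def row_lower_0(2)[folded One_nat_def])
  ultimately show ?thesis
    using excess_eq_losses[OF filt_configs[of "2 * n - 2" n S]] assms(1) hi by simp
qed

text \<open>\<open>S\<close> is read off from its tail counts: for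
  \<open>c = card {s in S. d < s}\<close> the point \<open>i = n + 1 - c - d\<close> of row
  \<open>2 i + d\<close> satisfies the inequality of \<open>filt\<close> with equality. That row
  must be among the kept ones, which can fail only for \<open>c = 1\<close> and
  \<open>d <= 1\<close>; there the element of \<open>S'\<close> above 1 helps.\<close>

lemma filt_le:
  assumes "filt n e S = filt n e S'" "S \<subseteq> {1..n}" "\<exists>s\<in>S'. 2 \<le> s" "finite S'" "2 * n - 2 \<le> e" "d < n"
  shows "card {s \<in> S. d < s} \<le> card {s \<in> S'. d < s}"
proof -
  let ?c = "card {s \<in> S. d < s}"
  have "?c \<le> card {Suc d..n}" by (rule card_mono) (use assms(2) in auto)
  then have c: "?c \<le> n - d" by simp
  consider "?c = 0" | "?c = 1" "d \<le> 1" | "1 \<le> ?c" "4 \<le> 2 * ?c + d" by linarith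
  then show ?thesis
  proof cases
    case 2
    obtain s where "s \<in> S'" "2 \<le> s" using assms(3) by blast
    then have "card {s} \<le> card {s \<in> S'. d < s}" using 2(2) assms(4) by (intro card_mono) auto
    then show ?thesis using 2(1) by simp
  next
    case 3
    define i where "i = n + 1 - ?c - d"
    define t where "t = 2 * i + d"
    have f: "1 \<le> i" "i + ?c + d = n + 1" using c 3 assms(6) by (simp_all add: i_def)
    have "t \<le> e" "i \<in> row n t" "n + 1 + i - t = ?c" "t - 2 * i = d"
      using f 3 assms(5) by (auto simp: t_def row_def)
    then have "i \<in> filt n e S t" "i \<in> filt n e S' t \<Longrightarrow> ?thesis" by (simp_all add: filt_def)
    then show ?thesis using assms(1) by simp
  qed simp
qed

lemma filt_inj:
  assumes "filt n e S = filt n e S'" "S \<subseteq> {1..n}" "S' \<subseteq> {1..n}" "\<exists>s\<in>S. 2 \<le> s" "\<exists>s\<in>S'. 2 \<le> s"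
    "2 * n - 2 \<le> e"
  shows "S = S'"
proof -
  have fin: "finite S" "finite S'" using assms(2,3) finite_subset by blast+
  have c: "card {s \<in> S. d < s} = card {s \<in> S'. d < s}" if "d < n" for d
    using filt_le[OF assms(1,2,5) fin(2) assms(6) that]
      filt_le[OF assms(1)[symmetric] assms(3,4) fin(1) assms(6) that] by simp
  have c': "card {s \<in> S. d < s} = card {s \<in> S'. d < s}" for d
  proof (cases "d < n")
    case False
    then have "{s \<in> S. d < s} = {}" "{s \<in> S'. d < s} = {}" using assms(2,3) by auto
    then show ?thesis by (simp only:)
  qed (rule c)
  have m: "s \<in> A \<longleftrightarrow> card {x \<in> A. s < x} < card {x \<in> A. s - 1 < x}" if "1 \<le> s" "finite A" for s and A :: "nat set"
  proof (cases "s \<in> A")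
    case True
    then have "{x \<in> A. s - 1 < x} = insert s {x \<in> A. s < x}" using that(1) by auto
    then show ?thesis using True that(2) by simp
  next
    case False
    then have "{x \<in> A. s - 1 < x} = {x \<in> A. s < x}" using that(1) by (auto simp: less_le)
    then show ?thesis using False by simp
  qed
  have "s \<in> S \<longleftrightarrow> s \<in> S'" if "1 \<le> s" for s using m[OF that fin(1)] m[OF that fin(2)] c' by simp
  moreover have "1 \<le> s" if "s \<in> S \<union> S'" for s using that assms(2,3) by auto
  ultimately show ?thesis by blast
qed

text \<open>The two filter families and the diagonal points contribute \<open>2^n - 2\<close>,
  \<open>2^n - 3\<close> and \<open>n - 2\<close>, which explains the 7. The omitted sets are those
  whose filter does not reach the last kept row.\<close>

lemma excess_1_many:
  assumes "5 \<le> n"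
  shows "2 ^ (n + 1) + n \<le> card {Z \<in> configs n 1 (2 * n - 1). excess n 1 (2 * n - 1) Z = 1} + 7"
proof -
  let ?C = "{Z \<in> configs n 1 (2 * n - 1). excess n 1 (2 * n - 1) Z = 1}"
  let ?SA = "Pow {1..n} - {{}, {1}}" and ?SB = "Pow {1..n} - {{}, {1}, {2}}"
  let ?A = "filt n (2 * n - 1) ` ?SA" and ?B = "filt n (2 * n - 2) ` ?SB" and ?D = "diag_conf ` {1..n - 2}"
  have fp: "finite S" if "S \<in> Pow {1..n}" for S using that finite_subset[of S "{1..n}"] by auto
  have SA: "\<exists>s\<in>S. 2 \<le> s" if "S \<in> ?SA" for S
  proof (rule ccontr)
    assume "\<not> ?thesis"
    then have "S \<subseteq> {1}" using that by force
    then show False using that by blast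
  qed
  have SB: "(\<exists>s\<in>S. 3 \<le> s) \<or> (1 \<in> S \<and> 2 \<in> S)" if "S \<in> ?SB" for S
  proof (rule ccontr)
    assume n: "\<not> ?thesis"
    have "s \<in> {1, 2}" if "s \<in> S" for s
    proof -
      have "1 \<le> s" using that \<open>S \<in> ?SB\<close> by auto
      moreover have "\<not> 3 \<le> s" using n that by blast
      ultimately show ?thesis by auto
    qed
    then have "S \<subseteq> {1} \<or> S \<subseteq> {2}" using n by blast
    then show False using that by blast
  qed
  have n3: "3 \<le> n" using assms by simp
  have sub: "?A \<union> ?B \<union> ?D \<subseteq> ?C"
  proof (intro Un_least image_subsetI)
    fix S assume "S \<in> ?SA"
    then show "filt n (2 * n - 1) S \<in> ?C"
      using excess_filt1[OF n3 fp SA, of S] filt_configs[of "2 * n - 1" n S] by blast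
  next
    fix S assume "S \<in> ?SB"
    then show "filt n (2 * n - 2) S \<in> ?C"
      using excess_filt2[OF n3 fp SB, of S] filt_configs[of "2 * n - 2" n S] by simp
  next
    fix i assume "i \<in> {1..n - 2}"
    then show "diag_conf i \<in> ?C"
      using excess_diag_conf[of i n 1 "2 * n - 1"] assms by auto
  qed
  have iA: "inj_on (filt n (2 * n - 1)) ?SA"
    by (rule inj_onI, rule filt_inj[of n "2 * n - 1"]) (use SA in auto)
  have iB: "inj_on (filt n (2 * n - 2)) ?SB"
  proof (rule inj_onI, rule filt_inj[of n "2 * n - 2"])
    fix S S' assume "S \<in> ?SB" "S' \<in> ?SB"
    then show "\<exists>s\<in>S. 2 \<le> s" "\<exists>s\<in>S'. 2 \<le> s" using SA[of S] SA[of S'] by blast+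
  qed auto
  have cA: "card ?A = 2 ^ n - 2"
    unfolding card_image[OF iA] by (subst card_Diff_subset) (use assms in \<open>auto simp: card_Pow\<close>)
  have cB: "card ?B = 2 ^ n - 3"
    unfolding card_image[OF iB] by (subst card_Diff_subset) (use assms in \<open>auto simp: card_Pow\<close>)
  have cD: "card ?D = n - 2" 
  proof -
    have "inj_on diag_conf {1..n - 2}"
    proof (rule inj_onI)
      fix i i' assume "diag_conf i = diag_conf i'"
      then have "diag_conf i (2 * i) = diag_conf i' (2 * i)" by simp
      then show "i = i'" by (simp add: diag_conf_def split: if_splits)
    qed
    then show ?thesis by (simp add: card_image)
  qed
  have AB: "?A \<inter> ?B = {}"
  proof (rule ccontr)
    assume "?A \<inter> ?B \<noteq> {}"
    then obtain S S' where S: "S \<in> ?SA" "filt n (2 * n - 1) S = filt n (2 * n - 2) S'" by blast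
    have "filt n (2 * n - 2) S' (2 * n - 1) = {}" using assms by (simp add: filt_def)
    then show False using filt_top[OF n3 fp SA, of S] S by auto
  qed
  have "filt n e S \<noteq> diag_conf i" if "i \<in> {1..n - 2}" "2 * n - 2 \<le> e" "finite S" for S e i
  proof
    assume e: "filt n e S = diag_conf i"
    have "filt n e S (2 * i) = {i}" unfolding e by (simp add: diag_conf_def)
    moreover have "Suc (2 * i) \<le> e" using that(1,2) assms by auto
    ultimately have "rise n (2 * i) {i} \<subseteq> filt n e S (Suc (2 * i))"
      using rise_filt[of "2 * i" e S n] that(3) by simp
    moreover have "filt n e S (Suc (2 * i)) = {}" unfolding e by (simp add: diag_conf_def)
    moreover have "i \<in> rise n (2 * i) {i}" using that by (auto simp: rise_def row_def)
    ultimately show False by blast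
  qed
  note nd = this
  have "?A \<inter> ?D = {}"
  proof (rule ccontr)
    assume "?A \<inter> ?D \<noteq> {}"
    then obtain S i where "S \<in> ?SA" "i \<in> {1..n - 2}" "filt n (2 * n - 1) S = diag_conf i" by blast
    then show False using nd[of i "2 * n - 1" S] fp[of S] by simp
  qed
  moreover have "?B \<inter> ?D = {}"
  proof (rule ccontr)
    assume "?B \<inter> ?D \<noteq> {}"
    then obtain S i where "S \<in> ?SB" "i \<in> {1..n - 2}" "filt n (2 * n - 2) S = diag_conf i" by blast
    then show False using nd[of i "2 * n - 2" S] fp[of S] by simp
  qed
  ultimately have "(?A \<union> ?B) \<inter> ?D = {}" by blast
  moreover have f: "finite ?A" "finite ?B" "finite ?D" by simp_all
  ultimately have "card (?A \<union> ?B \<union> ?D) = card ?A + card ?B + card ?D"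
    using card_Un_disjoint[OF f(1,2) AB] card_Un_disjoint[of "?A \<union> ?B" ?D] by (metis finite_UnI)
  then have "card (?A \<union> ?B \<union> ?D) = (2 ^ n - 2) + (2 ^ n - 3) + (n - 2)" unfolding cA cB cD .
  moreover have "card (?A \<union> ?B \<union> ?D) \<le> card ?C" by (rule card_mono[OF _ sub]) simp
  moreover have "(2 :: nat) ^ (n + 1) = 2 * 2 ^ n" using power_Suc[of "2 :: nat" n] by (simp only: Suc_eq_plus1)
  moreover have "(2 :: nat) ^ 2 \<le> 2 ^ n" by (rule power_increasing) (use assms in auto)
  ultimately show ?thesis using assms by simp
qed

text \<open>This is \<open>(n^3 - n) / 2 < 2^(n + 1) + n - 7\<close>, the comparison of the lower
  half with \<open>excess_1_many\<close>, cleared of fractions.\<close>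

lemma power_cubic: "5 \<le> n \<Longrightarrow> n ^ 3 + 15 \<le> 4 * 2 ^ n + 3 * n" for n :: nat
proof (induction n rule: dec_induct)
  case (step n)
  have "5 * n \<le> n * n" "5 * (n * n) \<le> n * (n * n)" using step(1) by (simp_all only: mult_le_mono1)
  moreover have "Suc n ^ 3 = n * (n * n) + 3 * (n * n) + 3 * n + 1" "n ^ 3 = n * (n * n)"
    by (simp_all add: power3_eq_cube algebra_simps)
  ultimately show ?case using step(1,3) unfolding power_Suc by linarith
qed simp

section \<open>The boundary cases r = 1 and m = 1\<close>

context middle
begin

text \<open>For \<open>n = m + 1\<close> the lower half has \<open>(n^3 - n) / 2\<close> elements,
  whereas the configurations of excess one, each paired with the empty suffix, are exponentially
  many. The bound \<open>m >= 4\<close> amounts to \<open>n >= 5\<close>.\<close>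

lemma lower_less_r1:
  assumes "r = 1" "4 \<le> m"
  shows "card lower < card low1"
proof -
  have n: "n = m + 1" "lo = 1" "hi = 2 * n - 1" using assms n1 by auto
  have "confs1 = {Z \<in> configs n 1 (2 * n - 1). excess n 1 (2 * n - 1) Z = 1}"
    unfolding confs1_def using n(2,3) by simp
  then have many: "2 ^ (n + 1) + n \<le> card confs1 + 7" using excess_1_many[of n] n(1) assms(2) by simp
  have "(\<lambda>Z. (Z, 1)) ` confs1 \<subseteq> pairs" unfolding pairs_def opts_def using assms(1) by auto
  then have "card confs1 \<le> card pairs" by (intro card_inj_on_le[OF _ _ finite_pairs]) (auto intro: inj_onI)
  then have X: "2 ^ (n + 1) + n \<le> card low1 + 7" using many card_pairs_le by linarith
  have four: "4 * card lower + 2 * w = (2 * m + 1) * ((m + 1) * (m + 2))"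
    using four_lower unfolding n(1) k_def by (simp add: algebra_simps)
  have w2: "2 * w = 2 * (2 * m + 1) + m * (m - 1)" using two_w unfolding assms(1) by simp
  define p where "p = m * (m - 1)"
  have "int p = int m * (int m - 1)" using assms(2) unfolding p_def by (simp add: of_nat_diff)
  moreover have "int (4 * card lower + (2 * (2 * m + 1) + p)) = int ((2 * m + 1) * ((m + 1) * (m + 2)))"
    using four unfolding w2 p_def by (simp only:)
  ultimately have "4 * int (card lower) = (2 * int m + 1) * ((int m + 1) * (int m + 2)) - 2 * (2 * int m + 1) - int m * (int m - 1)"
    by (simp add: algebra_simps)
  then have "2 * int (card lower) = int n ^ 3 - int n" unfolding n(1)
    by (simp add: power3_eq_cube algebra_simps)
  moreover have "int (n ^ 3 + 15) \<le> int (4 * 2 ^ n + 3 * n)"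
    using power_cubic[of n] n(1) assms(2) by (simp only: of_nat_le_iff)
  moreover have "int (2 ^ (n + 1) + n) \<le> int (card low1 + 7)" using X by (simp only: of_nat_le_iff)
  moreover have "(2 :: int) ^ (n + 1) = 2 * 2 ^ n" using power_Suc[of "2 :: int" n] by (simp only: Suc_eq_plus1)
  ultimately have "int (card lower) < int (card low1)" by simp
  then show ?thesis by simp
qed

text \<open>The lower half has only \<open>3 r^2\<close> elements, while the corner family alone is
  cubic in \<open>r\<close>. Three disjoint families of pairs already give enough.\<close>

lemma lower_less_m1:
  assumes "m = 1" "3 \<le> r"
  shows "card lower < card low1"
proof -
  have r2: "2 \<le> r" using assms(2) by simp
  have n: "n = 2 * r" "hi = 2 * r + 1" "Suc lo = 2 * r" using assms n1 by auto
  let ?f = "corner3_conf lo r"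
  have v: "?f y lo = {1..<r}" "?f y (Suc (Suc lo)) = {1..y}" for y by (simp_all add: corner3_conf_def)
  have mem: "?f y \<in> confs1" if "y \<in> {1..r}" for y
    using excess_corner3_conf[of r n lo hi y] that n r2 by (simp add: confs1_def)
  have inj: "inj_on ?f {1..r}"
  proof (rule inj_onI)
    fix y y' assume "?f y = ?f y'"
    then have "{1..y} = {1..y'}" using v(2)[of y] v(2)[of y'] by metis
    then have "card {1..y} = card {1..y'}" by (simp only:)
    then show "y = y'" by simp
  qed
  have "opts r lo (?f y) = {1..r}" for y
    using opts_suffix[of 1 r "?f y" lo] v(1)[of y] r2 by (auto simp: opts_def)
  then have c3: "card (fam ?f {1..r}) = r * r" "finite (fam ?f {1..r})"
    using card_fam[OF inj] by simp_all
  let ?F1 = "fam f_int I_int" and ?F2 = "fam f_corner I_corner" and ?F3 = "fam ?f {1..r}"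
  have sub: "?F1 \<union> ?F2 \<union> ?F3 \<subseteq> pairs"
    using fam_sub[of I_int f_int] fam_sub[of I_corner f_corner] fam_sub[of "{1..r}" ?f] conf_mem(3,4)[OF r2] mem
    by blast
  have lo3: "r - 1 \<in> fst p lo \<and> fst p (Suc (Suc lo)) \<noteq> {}" if "p \<in> ?F3" for p
  proof -
    have "fst p \<in> ?f ` {1..r}" using that unfolding fam_def by auto
    then obtain y where "y \<in> {1..r}" "fst p = ?f y" by blast
    then show ?thesis using v r2 by auto
  qed
  have d12: "?F1 \<inter> ?F2 = {}" using fam_lo(3,4)[OF r2] by blast
  have d3: "(?F1 \<union> ?F2) \<inter> ?F3 = {}" using fam_lo(3,4)[OF r2] lo3 by blast
  have "card (?F1 \<union> ?F2 \<union> ?F3) = card ?F1 + card ?F2 + card ?F3"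
    using card_Un_disjoint[OF _ _ d3] card_Un_disjoint[OF _ _ d12] sum_fams(8,9) c3(2) by simp
  moreover have "card (?F1 \<union> ?F2 \<union> ?F3) \<le> card low1"
    using card_mono[OF finite_pairs sub] card_pairs_le by linarith
  ultimately have "card ?F1 + card ?F2 + r * r \<le> card low1" using c3(1) by simp
  then have "6 * (card ?F1 + card ?F2 + r * r) \<le> 6 * card low1" by simp
  then have "3 * (2 * card ?F1) + 2 * (3 * card ?F2 + 6) + 6 * (r * r) \<le> 6 * card low1 + 12"
    by (simp add: algebra_simps)
  then have X: "int (3 * (2 * card ?F1) + 2 * (3 * card ?F2 + 6) + 6 * (r * r)) \<le> int (6 * card low1 + 12)"
    by (simp only: of_nat_le_iff)
  have k3: "k = 3" unfolding k_def using assms(1) by simp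
  have "4 * card lower + 2 * w = 3 * (2 * r * (2 * r + 1))" using four_lower unfolding k3 n(1) .
  moreover have "2 * w = 6 * r" using two_w assms(1) by simp
  ultimately have "card lower = 3 * (r * r)" by (simp add: algebra_simps)
  then have L: "int (card lower) = 3 * (int r * int r)" by simp
  have "int ((r - 2) * (r - 1)) = (int r - 2) * (int r - 1)" using r2 by (simp add: of_nat_diff)
  then have "3 * ((int r - 2) * (int r - 1)) + 2 * (int r * (int r + 1) * (int r + 2)) + 6 * (int r * int r)
      \<le> 6 * int (card low1) + 12" using X unfolding sum_fams(3,4) by (simp add: algebra_simps)
  \<comment> \<open>Six times the difference of \<open>card low1\<close> and
    \<open>card lower\<close> is at least this product plus 6.\<close>
  moreover have "(int r - 3) * (2 * (int r * int r) + 3 * int r + 4) \<ge> 0" using assms(2) by simp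
  ultimately show ?thesis using L by (simp add: algebra_simps)
qed

end

section \<open>Excess two without full rows\<close>

definition cut :: "nat \<Rightarrow> (nat \<Rightarrow> nat set) \<Rightarrow> nat \<Rightarrow> nat set" where
  "cut u Z = (\<lambda>t. if u \<le> t then Z t else {})"

lemma cut_config: "Z \<in> configs n lo hi \<Longrightarrow> cut u Z \<in> configs n u hi"
  unfolding configs_def cut_def by auto

lemma cut_full: "full n (cut u Z) v \<Longrightarrow> full n Z v"
  by (auto simp: full_def cut_def split: if_splits)

lemma excess_cut:
  assumes "lo \<le> u" "u \<le> hi" "Z u = {}"
  shows "excess n lo hi Z = (\<Sum>t=lo..u. cost n lo Z t) + excess n u hi (cut u Z)"
proof -
  have "excess n lo hi Z = (\<Sum>t=lo..u. cost n lo Z t) + (\<Sum>t=Suc u..hi. cost n lo Z t)"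
  proof -
    have "{lo..hi} = {lo..u} \<union> {Suc u..hi}" using assms(1,2) by auto
    then show ?thesis unfolding excess_def by (simp add: sum.union_disjoint)
  qed
  moreover have "(\<Sum>t=Suc u..hi. cost n lo Z t) = (\<Sum>t=Suc u..hi. cost n u (cut u Z) t)"
    by (rule sum.cong) (use assms(1) in \<open>auto simp: cost_def cut_def\<close>)
  moreover have "cost n u (cut u Z) u = 0" by (rule cost_empty) (simp add: cut_def assms(3))
  then have "excess n u hi (cut u Z) = (\<Sum>t=Suc u..hi. cost n u (cut u Z) t)"
    unfolding excess_def using assms(2) by (simp add: sum.atLeast_Suc_atMost)
  ultimately show ?thesis by simp
qed

text \<open>What may follow an empty row when one unit is left, by
  \<open>excess_1_late_start\<close>; the index ranges are coarse, as only the number of tails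
  matters.\<close>

definition tails :: "nat \<Rightarrow> nat \<Rightarrow> (nat \<Rightarrow> nat set) set" where
  "tails n hi = insert (\<lambda>t. {}) (diag_conf ` {1..n} \<union> (\<lambda>(s, e). wall_conf n s e) ` ({Suc n..hi} \<times> {Suc n..hi}))"

lemma card_tails: "finite (tails n hi)" "card (tails n hi) \<le> 1 + n + (hi - n) ^ 2"
proof -
  have f: "finite (diag_conf ` {1..n})" "finite ((\<lambda>(s, e). wall_conf n s e) ` ({Suc n..hi} \<times> {Suc n..hi}))" by simp_all
  then show "finite (tails n hi)" by (simp add: tails_def)
  have "card (diag_conf ` {1..n}) \<le> n" using card_image_le[of "{1..n}" diag_conf] by simp
  moreover have "card ((\<lambda>(s, e). wall_conf n s e) ` ({Suc n..hi} \<times> {Suc n..hi})) \<le> (hi - n) ^ 2"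
    using card_image_le[of "{Suc n..hi} \<times> {Suc n..hi}" "\<lambda>(s, e). wall_conf n s e"]
    by (simp add: card_cartesian_product power2_eq_square)
  moreover have "card (tails n hi) \<le> Suc (card (diag_conf ` {1..n} \<union> (\<lambda>(s, e). wall_conf n s e) ` ({Suc n..hi} \<times> {Suc n..hi})))"
    unfolding tails_def by (rule card_insert_le_m1) simp_all
  moreover note card_Un_le[of "diag_conf ` {1..n}" "(\<lambda>(s, e). wall_conf n s e) ` ({Suc n..hi} \<times> {Suc n..hi})"]
  ultimately show "card (tails n hi) \<le> 1 + n + (hi - n) ^ 2" by linarith
qed

definition nonfull :: "nat \<Rightarrow> (nat \<Rightarrow> nat set) \<Rightarrow> bool" where
  "nonfull n Z \<longleftrightarrow> (\<forall>u. \<not> full n Z u)"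

lemma tail_mem:
  assumes "Z \<in> configs n lo hi" "nonfull n Z" "lo \<le> u" "u \<le> hi" "Z u = {}" "hi < 2 * n - 2"
    "excess n lo hi Z - (\<Sum>t=lo..u. cost n lo Z t) = 1"
  shows "cut u Z \<in> tails n hi"
proof -
  have c: "cut u Z \<in> configs n u hi" "cut u Z u = {}" "excess n u hi (cut u Z) = 1"
    using cut_config[OF assms(1)] excess_cut[where lo = lo and u = u and hi = hi and Z = Z and n = n, OF assms(3,4,5)] assms(5,7) by (simp_all add: cut_def)
  have nf: "\<not> full n (cut u Z) v" for v using assms(2) cut_full unfolding nonfull_def by blast
  from excess_1_late_start[OF c(1) nf c(3,2) assms(6)] show ?thesis
  proof (elim disjE exE conjE)
    fix i assume "i \<le> n" "1 \<le> i" "cut u Z = diag_conf i"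
    then show ?thesis by (simp add: tails_def)
  next
    fix s e assume "n < s" "s \<le> e" "e \<le> hi" "cut u Z = wall_conf n s e"
    then have "cut u Z \<in> (\<lambda>(s, e). wall_conf n s e) ` ({Suc n..hi} \<times> {Suc n..hi})"
      by (intro image_eqI[of _ _ "(s, e)"]) auto
    then show ?thesis by (simp add: tails_def)
  qed
qed

definition head :: "nat \<Rightarrow> nat set \<Rightarrow> nat set \<Rightarrow> (nat \<Rightarrow> nat set) \<Rightarrow> nat \<Rightarrow> nat set" where
  "head lo A B Y = (\<lambda>t. if t = lo then A else if t = Suc lo then B else Y t)"

abbreviation "none \<equiv> (\<lambda>t :: nat. {} :: nat set)"

text \<open>The families \<open>hA\<close> to \<open>hH\<close> contain the configurations of excess
  two without full rows and with nonempty odd row \<open>lo\<close>, which takes the first unit.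
  They are sorted by where the second one is spent: in a later tail (\<open>hA\<close>,
  \<open>hB\<close>), in row \<open>lo\<close> again (\<open>hC\<close>, \<open>hD\<close>), in row
  \<open>lo + 1\<close> (\<open>hE\<close>, \<open>hF\<close>) or in row \<open>lo + 2\<close>
  (\<open>hG\<close>, \<open>hH\<close>). They may contain more; what matters is that their sizes
  are of order four.\<close>

definition hA :: "nat \<Rightarrow> nat \<Rightarrow> nat \<Rightarrow> (nat \<Rightarrow> nat set) set" where
  "hA n lo hi = (\<lambda>(a, c, Y). head lo {a..c} {} Y) ` ({..lo div 2 + 3} \<times> {..lo div 2 + 3} \<times> tails n hi)"

definition hB :: "nat \<Rightarrow> nat \<Rightarrow> nat \<Rightarrow> (nat \<Rightarrow> nat set) set" where
  "hB n lo hi = (\<lambda>(a, c, Y). head lo {a..lo div 2} {c..Suc (lo div 2)} Y) ` ({..lo div 2 + 3} \<times> {..lo div 2 + 3} \<times> tails n hi)"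

definition hC :: "nat \<Rightarrow> nat \<Rightarrow> nat \<Rightarrow> (nat \<Rightarrow> nat set) set" where
  "hC n lo hi = (\<lambda>(a, c, d, e). head lo ({a..c} \<union> {d..e}) {} none) ` ({..lo div 2 + 3} \<times> {..lo div 2 + 3} \<times> {..lo div 2 + 3} \<times> {..lo div 2 + 3})"

definition hD :: "nat \<Rightarrow> nat \<Rightarrow> nat \<Rightarrow> (nat \<Rightarrow> nat set) set" where
  "hD n lo hi = (\<lambda>(a, c, d, e). head lo ({a..c} \<union> {d..lo div 2}) {e..Suc (lo div 2)} none) ` ({..lo div 2 + 3} \<times> {..lo div 2 + 3} \<times> {..lo div 2 + 3} \<times> {..lo div 2 + 3})"

definition hE :: "nat \<Rightarrow> nat \<Rightarrow> nat \<Rightarrow> (nat \<Rightarrow> nat set) set" where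
  "hE n lo hi = (\<lambda>(a, c, d, e). head lo {a..c} {d..e} none) ` ({..lo div 2 + 3} \<times> {..lo div 2 + 3} \<times> {..lo div 2 + 3} \<times> {..lo div 2 + 3})"

definition hF :: "nat \<Rightarrow> nat \<Rightarrow> nat \<Rightarrow> (nat \<Rightarrow> nat set) set" where
  "hF n lo hi = (\<lambda>(a, c, d, e). head lo {a..lo div 2} ({c..d} \<union> {e..Suc (lo div 2)}) none) ` ({..lo div 2 + 3} \<times> {..lo div 2 + 3} \<times> {..lo div 2 + 3} \<times> {..lo div 2 + 3})"

definition hG :: "nat \<Rightarrow> nat \<Rightarrow> nat \<Rightarrow> (nat \<Rightarrow> nat set) set" where
  "hG n lo hi = (\<lambda>(a, c, d, e). head lo {a..lo div 2} {c..Suc (lo div 2)} (head (Suc (Suc lo)) {d..e} {} none)) ` ({..lo div 2 + 3} \<times> {..lo div 2 + 3} \<times> {..lo div 2 + 3} \<times> {..lo div 2 + 3})"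

definition hH :: "nat \<Rightarrow> nat \<Rightarrow> nat \<Rightarrow> (nat \<Rightarrow> nat set) set" where
  "hH n lo hi = (\<lambda>(a, c, d, e). head lo {a..lo div 2} {c..Suc (lo div 2)} (head (Suc (Suc lo)) {d..Suc (lo div 2)} {e..Suc (Suc (lo div 2))} none)) `
  ({..lo div 2 + 3} \<times> {..lo div 2 + 3} \<times> {..lo div 2 + 3} \<times> {..lo div 2 + 3})"

text \<open>The margins keep the first rows below the wall, where nonempty odd rows are never free,
  and the last row away from the top of \<open>H n\<close>.\<close>

locale nonfull_conf =
  fixes n lo hi :: nat and Z :: "nat \<Rightarrow> nat set"
  assumes conf: "Z \<in> configs n lo hi" and nonfull: "nonfull n Z"
    and lo_n: "lo + 5 \<le> n" and n_hi: "n < hi" and hi_n: "hi < 2 * n - 2"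
begin

lemma sub: "Z t \<subseteq> row n t" and fin: "finite (Z t)"
  using configsD[OF conf] by blast+

lemma nf: "\<not> full n Z u" using nonfull unfolding nonfull_def by blast

lemma cn: "cost n lo Z t \<ge> 0" by (rule cost_nonneg[OF conf nf])

lemma gn: "growth n t (Z t) \<ge> 0" by (rule growth_nonneg_config[OF conf nf])

lemma part_le: "u \<le> hi \<Longrightarrow> (\<Sum>s=lo..u. cost n lo Z s) \<le> excess n lo hi Z"
  unfolding excess_def by (rule sum_mono2) (use cn in auto)

lemma odd_cost: "odd t \<Longrightarrow> t \<le> n \<Longrightarrow> Z t \<noteq> {} \<Longrightarrow> cost n lo Z t \<ge> 1"
  using growth_odd_low_pos[OF sub, of t] by (cases "t = lo") (simp_all add: cost_def)

lemma odd_cost_1: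
  assumes "odd t" "t \<le> n" "cost n lo Z t = 1" "Z t \<noteq> {}"
  obtains a b where "a \<le> b" "Z t = {a..b}" "b \<le> t div 2"
proof -
  have g: "growth n t (Z t) \<ge> 1" using growth_odd_low_pos[OF sub assms(1,2,4)] .
  then have g1: "growth n t (Z t) = 1"
    using assms(3) by (auto simp: cost_def split: if_splits)
  have "card (ends (Z t)) = 1" using growth_odd_low[OF sub assms(1,2)] g1 by simp
  from interval_if_card_ends_1[OF fin this] obtain a b where ab: "a \<le> b" "Z t = {a..b}" "b = Max (Z t)" .
  have "b \<in> Z t" unfolding ab(2) using ab(1) by simp
  then have "b \<in> row n t" using sub by blast
  then have "b \<le> t div 2" by (auto simp: row_def)
  then show ?thesis by (rule that[OF ab(1,2)])
qed

lemma sub_rise: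
  assumes "cost n lo Z t \<le> growth n t (Z t)" "t \<noteq> lo"
  shows "Z t \<subseteq> rise n (t - 1) (Z (t - 1))"
proof -
  have "card (Z t - rise n (t - 1) (Z (t - 1))) = 0" using assms by (simp add: cost_def)
  then show ?thesis using gain_eq_0_iff[OF conf] by blast
qed

lemma even_cost_0:
  assumes "even t" "t \<le> n" "cost n lo Z t = 0"
  obtains a where "1 \<le> a" "a \<le> Suc (t div 2)" "Z t = {a..t div 2}"
proof (cases "Z t = {}")
  case True
  then show ?thesis using that[of "Suc (t div 2)"] by simp
next
  case False
  from growth_even_low_0[OF sub assms(1,2) cost_0D(1)[OF conf nf assms(3)] False]
  obtain a where "1 \<le> a" "a \<le> t div 2" "Z t = {a..t div 2}" .
  then show ?thesis using that[of a] by simp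
qed

text \<open>A diagonal point \<open>(q, q)\<close> covers only \<open>(q - 1, q)\<close>, the last
  element of the odd row before.\<close>

lemma top_from:
  assumes "odd t" "Suc t div 2 \<in> rise n t (Z t)"
  shows "t div 2 \<in> Z t"
proof -
  have s: "Suc t div 2 = Suc (t div 2)" using assms(1) by presburger
  have "Suc (t div 2) \<notin> Z t" using sub[of t] by (auto simp: row_def)
  then show ?thesis using assms(2) unfolding rise_def s by auto
qed

text \<open>Once the excess is used up, an odd row below the wall must be empty, and after an empty
  row every element would be a gain to pay for.\<close>

lemma vanish:
  assumes "odd t" "lo < t" "t \<le> n" "(\<Sum>s=lo..t - 1. cost n lo Z s) = excess n lo hi Z" "t \<le> s"
  shows "Z s = {}"
proof -
  have z: "cost n lo Z s = 0" if "t \<le> s" "s \<le> hi" for s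
  proof -
    have "(\<Sum>s=lo..t - 1. cost n lo Z s) + cost n lo Z s = (\<Sum>s\<in>insert s {lo..t - 1}. cost n lo Z s)"
      using that assms(2) by (subst sum.insert) auto
    also have "\<dots> \<le> excess n lo hi Z"
      unfolding excess_def by (rule sum_mono2) (use cn that assms(2,3) n_hi in auto)
    finally show ?thesis using assms(4) cn[of s] by linarith
  qed
  have "t \<le> hi" using assms(3) n_hi by simp
  then have "Z t = {}" using odd_cost[OF assms(1,3)] z[of t] by fastforce
  then show ?thesis using empty_after_empty[OF conf _ _ _ assms(5)] assms(2) z nf by simp
qed

lemma head_eqI:
  assumes "Z lo = A" "Z (Suc lo) = B" "u \<le> Suc (Suc lo)" "lo < u"
  shows "Z = head lo A B (cut u Z)"
proof
  fix t
  consider "t < lo" | "t = lo" | "t = Suc lo" | "Suc lo < t" by linarith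
  then show "Z t = head lo A B (cut u Z) t"
    using assms configsD(3)[OF conf, of t] by cases (simp_all add: head_def cut_def)
qed

lemma head_eq2:
  assumes "Z lo = A" "Z (Suc lo) = B" "\<And>t. Suc lo < t \<Longrightarrow> Z t = {}"
  shows "Z = head lo A B none"
proof
  fix t
  consider "t < lo" | "t = lo" | "t = Suc lo" | "Suc lo < t" by linarith
  then show "Z t = head lo A B none t"
    using assms(1,2) assms(3)[of t] configsD(3)[OF conf, of t] by cases (simp_all add: head_def)
qed

lemma head_eq4:
  assumes "Z lo = A" "Z (Suc lo) = B" "Z (Suc (Suc lo)) = C" "Z (Suc (Suc (Suc lo))) = D"
    "\<And>t. Suc (Suc (Suc lo)) < t \<Longrightarrow> Z t = {}"
  shows "Z = head lo A B (head (Suc (Suc lo)) C D none)"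
proof
  fix t
  consider "t < lo" | "t = lo" | "t = Suc lo" | "t = Suc (Suc lo)" | "t = Suc (Suc (Suc lo))"
    | "Suc (Suc (Suc lo)) < t" by linarith
  then show "Z t = head lo A B (head (Suc (Suc lo)) C D none) t"
    using assms(1-4) assms(5)[of t] configsD(3)[OF conf, of t] by cases (simp_all add: head_def)
qed

text \<open>A nonempty odd row costs a unit, and an even row is free only as a suffix. So the unit
  is spent in row \<open>lo\<close>, in row \<open>lo + 1\<close>, possibly followed by a free
  suffix, or in a tail after the empty row \<open>lo + 1\<close>.\<close>

lemma even_start:
  assumes "even lo" "excess n lo hi Z = 1"
  shows "(\<exists>c\<in>{1..Suc (lo div 2)}. \<exists>Y\<in>tails n hi. Z = head lo {c..lo div 2} {} Y) \<or>
    (\<exists>c\<in>{..Suc (lo div 2)}. \<exists>f\<in>{..Suc (lo div 2)}. \<exists>g\<in>{..Suc (lo div 2)}.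
      Z = head lo {c..lo div 2} {f..g} none) \<or>
    (\<exists>c\<in>{..Suc (lo div 2)}. \<exists>f\<in>{..Suc (lo div 2)}. \<exists>h\<in>{..Suc (Suc (lo div 2))}.
      Z = head lo {c..lo div 2} {f..lo div 2} (head (Suc (Suc lo)) {h..Suc (lo div 2)} {} none)) \<or>
    (\<exists>a\<in>{..Suc (lo div 2)}. \<exists>c\<in>{..Suc (lo div 2)}. \<exists>d\<in>{..Suc (lo div 2)}.
      Z = head lo ({a..c} \<union> {d..lo div 2}) {} none)"
    (is "?A \<or> ?B \<or> ?C \<or> ?D")
proof -
  let ?p = "lo div 2"
  have o: "odd (Suc lo)" "Suc lo \<le> n" "lo \<le> n" "odd (Suc (Suc (Suc lo)))" "Suc (Suc (Suc lo)) \<le> n"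
    "even (Suc (Suc lo))" "Suc (Suc lo) \<le> n" "lo \<le> hi" "Suc lo \<le> hi" "Suc (Suc lo) \<le> hi"
    using assms(1) lo_n n_hi by simp_all
  have d: "Suc lo div 2 = ?p" "Suc (Suc lo) div 2 = Suc ?p" using assms(1) by auto
  have c0: "cost n lo Z lo \<le> 1" using part_le[of lo] assms(2) o by simp
  have c1: "cost n lo Z lo + cost n lo Z (Suc lo) \<le> 1" using part_le[of "Suc lo"] assms(2) o by simp
  have c2: "cost n lo Z lo + cost n lo Z (Suc lo) + cost n lo Z (Suc (Suc lo)) \<le> 1"
    using part_le[of "Suc (Suc lo)"] assms(2) o by simp
  show ?thesis
  proof (cases "cost n lo Z lo = 0")
    case True
    from even_cost_0[OF assms(1) o(3) True] obtain c where c: "1 \<le> c" "c \<le> Suc ?p" "Z lo = {c..?p}" .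
    show ?thesis
    proof (cases "Z (Suc lo) = {}")
      case e: True
      have "cut (Suc lo) Z \<in> tails n hi"
        by (rule tail_mem[OF conf nonfull _ o(9) e hi_n]) (use True assms(2) cost_empty[where Z = Z and t = "Suc lo" and n = n and lo = lo, OF e] in simp_all)
      moreover have "Z = head lo {c..?p} {} (cut (Suc lo) Z)" by (rule head_eqI[OF c(3) e]) simp_all
      moreover have "c \<in> {1..Suc ?p}" using c(1,2) by simp
      ultimately have ?A by blast
      then show ?thesis by blast
    next
      case ne: False
      have c11: "cost n lo Z (Suc lo) = 1" using odd_cost[OF o(1,2) ne] c1 True by linarith
      from odd_cost_1[OF o(1,2) c11 ne] obtain f g where fg0: "f \<le> g" "Z (Suc lo) = {f..g}" "g \<le> Suc lo div 2" .
      have fg: "Z (Suc lo) = {f..g}" "f \<le> g" "g \<le> ?p" using fg0 unfolding d by simp_all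
      have z2: "cost n lo Z (Suc (Suc lo)) = 0" using c2 c11 True cn[of "Suc (Suc lo)"] by linarith
      have v: "Z s = {}" if "Suc (Suc (Suc lo)) \<le> s" for s
        by (rule vanish[OF o(4) _ o(5) _ that]) (use True c11 z2 assms(2) in simp_all)
      from even_cost_0[OF o(6,7) z2] obtain h where h0: "1 \<le> h" "h \<le> Suc (Suc (Suc lo) div 2)"
        "Z (Suc (Suc lo)) = {h..Suc (Suc lo) div 2}" .
      have h: "h \<le> Suc (Suc ?p)" "Z (Suc (Suc lo)) = {h..Suc ?p}" "Z (Suc (Suc lo)) \<subseteq> rise n (Suc lo) (Z (Suc lo))"
        using h0 sub_rise[of "Suc (Suc lo)"] z2 gn[of "Suc (Suc lo)"] unfolding d by simp_all
      show ?thesis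
      proof (cases "Z (Suc (Suc lo)) = {}")
        case e2: True
        have "Z = head lo {c..?p} {f..g} none"
        proof (rule head_eq2[OF c(3) fg(1)])
          fix t assume "Suc lo < t"
          then show "Z t = {}" using v[of t] e2 by (cases "t = Suc (Suc lo)") simp_all
        qed
        moreover have "c \<in> {..Suc ?p}" "f \<in> {..Suc ?p}" "g \<in> {..Suc ?p}" using c(2) fg by simp_all
        ultimately have ?B by blast
        then show ?thesis by blast
      next
        case ne2: False
        then have "Suc ?p \<in> Z (Suc (Suc lo))" unfolding h(2) by simp
        then have "Suc (Suc lo) div 2 \<in> rise n (Suc lo) (Z (Suc lo))" using h(3) unfolding d by blast
        from top_from[OF o(1) this] have "g = ?p" using fg unfolding d by simp
        then have fp: "Z (Suc lo) = {f..?p}" using fg(1) by simp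
        have "Z = head lo {c..?p} {f..?p} (head (Suc (Suc lo)) {h..Suc ?p} {} none)"
          by (rule head_eq4[OF c(3) fp h(2)]) (rule v, simp)+
        moreover have "c \<in> {..Suc ?p}" "f \<in> {..Suc ?p}" "h \<in> {..Suc (Suc ?p)}" using c(2) fg h(1) by simp_all
        ultimately have ?C by blast
        then show ?thesis by blast
      qed
    qed
  next
    case False
    then have c01: "cost n lo Z lo = 1" using c0 cn[of lo] by linarith
    then have g: "growth n lo (Z lo) = 1" by (simp add: cost_def)
    have v: "Z s = {}" if "Suc lo \<le> s" for s
      by (rule vanish[OF o(1) _ o(2) _ that]) (use c01 assms(2) in simp_all)
    have b: "x \<le> ?p" if "x \<in> Z lo" for x using sub[of lo] that by (auto simp: row_eq)
    have "\<exists>a\<in>{..Suc ?p}. \<exists>c\<in>{..Suc ?p}. \<exists>d\<in>{..Suc ?p}. Z lo = {a..c} \<union> {d..?p}"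
    proof (cases "?p \<in> Z lo")
      case True
      then have "card (ends (Z lo)) = 2" using growth_even_low[OF sub assms(1) o(3)] g by simp
      from two_intervals_if_card_ends_2[OF fin this] obtain a c d e where
        q: "Z lo = {a..c} \<union> {d..e}" "a \<le> c" "Suc c < d" "d \<le> e" "e = Max (Z lo)" .
      have "Max (Z lo) = ?p" by (rule Max_row_subset[OF sub True])
      with q(5) have e: "e = ?p" by (simp only:)
      have "a \<in> {..Suc ?p}" "c \<in> {..Suc ?p}" "d \<in> {..Suc ?p}" using q(2-4) unfolding e by simp_all
      moreover have "Z lo = {a..c} \<union> {d..?p}" using q(1) unfolding e .
      ultimately have "a \<in> {..Suc ?p}" "c \<in> {..Suc ?p}" "d \<in> {..Suc ?p}" "Z lo = {a..c} \<union> {d..?p}" .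
      then show ?thesis by blast
    next
      case False
      then have "card (ends (Z lo)) = 1" using growth_even_low[OF sub assms(1) o(3)] g by simp
      from interval_if_card_ends_1[OF fin this] obtain a c where q: "a \<le> c" "Z lo = {a..c}" "c = Max (Z lo)" .
      have "c \<in> Z lo" unfolding q(2) using q(1) by simp
      then have "c \<le> ?p" by (rule b)
      then have "a \<in> {..Suc ?p}" "c \<in> {..Suc ?p}" "Suc ?p \<in> {..Suc ?p}" using q(1) by simp_all
      moreover have "Z lo = {a..c} \<union> {Suc ?p..?p}" unfolding q(2) by simp
      ultimately have "a \<in> {..Suc ?p}" "c \<in> {..Suc ?p}" "Suc ?p \<in> {..Suc ?p}" "Z lo = {a..c} \<union> {Suc ?p..?p}" .
      then show ?thesis by blast
    qed
    then obtain a c d where q: "a \<in> {..Suc ?p}" "c \<in> {..Suc ?p}" "d \<in> {..Suc ?p}" "Z lo = {a..c} \<union> {d..?p}" by blast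
    have "Z = head lo ({a..c} \<union> {d..?p}) {} none"
      by (rule head_eq2[OF q(4) v]) (simp, rule v, simp)
    then have ?D using q(1-3) by blast
    then show ?thesis by blast
  qed
qed

abbreviation "p \<equiv> lo div 2"
abbreviation "N \<equiv> {..p + 3}"

text \<open>The odd row \<open>lo\<close> takes one or both units. A free even row is a suffix, and
  if it is nonempty the run below it must reach the end of its row. Whether \<open>p\<close> lies in
  row \<open>lo\<close> is recorded because it decides if a nonempty suffix fits underneath, see
  \<open>opts_no_end\<close>.\<close>

lemma odd_start:
  assumes "odd lo" "excess n lo hi Z = 2" "Z lo \<noteq> {}"
  shows "(lo div 2 \<notin> Z lo \<and> (Z \<in> hA n lo hi \<or> Z \<in> hC n lo hi)) \<or> Z \<in> hB n lo hi \<or> Z \<in> hD n lo hi \<or> Z \<in> hE n lo hi \<or> Z \<in> hF n lo hi \<or> Z \<in> hG n lo hi \<or> Z \<in> hH n lo hi"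
proof -
  let ?l1 = "Suc lo" and ?l2 = "Suc (Suc lo)" and ?l3 = "Suc (Suc (Suc lo))" and ?l4 = "Suc (Suc (Suc (Suc lo)))"
  have o: "lo \<le> n" "even ?l1" "?l1 \<le> n" "odd ?l2" "?l2 \<le> n" "even ?l3" "?l3 \<le> n" "odd ?l4" "?l4 \<le> n"
    using assms(1) lo_n by simp_all
  have h: "lo \<le> hi" "?l1 \<le> hi" "?l2 \<le> hi" "?l3 \<le> hi" using lo_n n_hi by simp_all
  have d: "?l1 div 2 = Suc p" "?l2 div 2 = Suc p" "?l3 div 2 = Suc (Suc p)" using assms(1) by presburger+
  have s1: "(\<Sum>s=lo..?l1. cost n lo Z s) = cost n lo Z lo + cost n lo Z ?l1"
    and s2: "(\<Sum>s=lo..?l2. cost n lo Z s) = cost n lo Z lo + cost n lo Z ?l1 + cost n lo Z ?l2"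
    and s3: "(\<Sum>s=lo..?l3. cost n lo Z s) = cost n lo Z lo + cost n lo Z ?l1 + cost n lo Z ?l2 + cost n lo Z ?l3"
    by simp_all
  have c0: "1 \<le> cost n lo Z lo" "cost n lo Z lo \<le> 2"
    using odd_cost[OF assms(1) o(1) assms(3)] part_le[OF h(1)] assms(2) by simp_all
  have c1: "cost n lo Z lo + cost n lo Z ?l1 \<le> 2" using part_le[OF h(2)] assms(2) s1 by linarith
  have c2: "cost n lo Z lo + cost n lo Z ?l1 + cost n lo Z ?l2 \<le> 2" using part_le[OF h(3)] assms(2) s2 by linarith
  have c3: "cost n lo Z lo + cost n lo Z ?l1 + cost n lo Z ?l2 + cost n lo Z ?l3 \<le> 2"
    using part_le[OF h(4)] assms(2) s3 by linarith
  have lp: "x \<le> p" if "x \<in> Z lo" for x using sub[of lo] that by (auto simp: row_eq)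
  have l1p: "x \<le> Suc p" if "x \<in> Z ?l1" for x
  proof -
    have "x \<le> ?l1 div 2" using sub[of ?l1] that by (auto simp: row_eq)
    then show ?thesis unfolding d .
  qed
  have reach: "p \<in> Z lo" if "Suc p \<in> Z ?l1" "Z ?l1 \<subseteq> rise n lo (Z lo)"
    using top_from[OF assms(1)] that unfolding d by blast
  have suffix: "p \<in> Z lo" if "Z ?l1 \<noteq> {}" "Z ?l1 = {c..Suc p}" "cost n lo Z ?l1 = 0" for c
  proof (rule reach)
    show "Suc p \<in> Z ?l1" using that(1) unfolding that(2) by simp
    show "Z ?l1 \<subseteq> rise n lo (Z lo)" using sub_rise[of ?l1] that(3) gn[of ?l1] by simp
  qed
  show ?thesis
  proof (cases "cost n lo Z lo = 2")
    case True
    then have e2: "card (ends (Z lo)) = 2" using growth_odd_low[OF sub assms(1) o(1)] by (simp add: cost_def)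
    from two_intervals_if_card_ends_2[OF fin e2] obtain a b c e where
      q: "Z lo = {a..b} \<union> {c..e}" "a \<le> b" "Suc b < c" "c \<le> e" "e = Max (Z lo)" .
    have "e \<in> Z lo" unfolding q(1) using q(4) by simp
    then have ep: "e \<le> p" by (rule lp)
    have z1: "cost n lo Z ?l1 = 0" using c1 True cn[of ?l1] by linarith
    have v: "Z s = {}" if "?l2 \<le> s" for s
      by (rule vanish[OF o(4) _ o(5) _ that]) (use True z1 assms(2) in simp_all)
    from even_cost_0[OF o(2,3) z1] obtain f where f0: "1 \<le> f" "f \<le> Suc (?l1 div 2)" "Z ?l1 = {f..?l1 div 2}" .
    have f: "f \<le> Suc (Suc p)" "Z ?l1 = {f..Suc p}" using f0 unfolding d by simp_all
    have bd: "a \<in> N" "b \<in> N" "c \<in> N" "e \<in> N" "f \<in> N" using q(2-4) ep f(1) by simp_all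
    show ?thesis
    proof (cases "p \<in> Z lo")
      case True
      then have "e = p" using q(2-4) ep unfolding q(1) by auto
      have "Z = head lo ({a..b} \<union> {c..p}) {f..Suc p} none"
        by (rule head_eq2[OF _ f(2)]) (use q(1) \<open>e = p\<close> v in simp_all)
      then have "Z \<in> hD n lo hi" unfolding hD_def using bd by (intro image_eqI[of _ _ "(a, b, c, f)"]) simp_all
      then show ?thesis by blast
    next
      case False
      have "Z ?l1 = {}" using suffix[OF _ f(2) z1] False by blast
      then have "Z = head lo ({a..b} \<union> {c..e}) {} none" using head_eq2[OF q(1)] v by simp
      then have "Z \<in> hC n lo hi" unfolding hC_def using bd by (intro image_eqI[of _ _ "(a, b, c, e)"]) simp_all
      then show ?thesis using False by blast
    qed
  next
    case False
    then have c01: "cost n lo Z lo = 1" using c0 by linarith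
    from odd_cost_1[OF assms(1) o(1) c01 assms(3)] obtain a c where q: "a \<le> c" "Z lo = {a..c}" "c \<le> p" .
    have cp: "c = p" if "p \<in> Z lo" using that q unfolding q(2) by simp
    have bd: "a \<in> N" "c \<in> N" "p \<in> N" "Suc p \<in> N" "Suc (Suc p) \<in> N" using q by simp_all
    show ?thesis
    proof (cases "Z ?l1 = {}")
      case e: True
      have T: "cut ?l1 Z \<in> tails n hi"
        by (rule tail_mem[OF conf nonfull _ h(2) e hi_n])
          (use c01 assms(2) cost_empty[where Z = Z and t = ?l1 and n = n and lo = lo, OF e] in simp_all)
      have Z: "Z = head lo {a..c} {} (cut ?l1 Z)" by (rule head_eqI[OF q(2) e]) simp_all
      show ?thesis
      proof (cases "p \<in> Z lo")
        case True
        \<comment> \<open>The empty second row is written as a suffix that starts beyond its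
          end.\<close>
        have "Z = head lo {a..p} {Suc (Suc p)..Suc p} (cut ?l1 Z)" using Z cp[OF True] by simp
        then have "Z \<in> hB n lo hi" unfolding hB_def using bd T by (intro image_eqI[of _ _ "(a, Suc (Suc p), cut ?l1 Z)"]) simp_all
        then show ?thesis by blast
      next
        case False
        have "Z \<in> hA n lo hi" unfolding hA_def using Z bd T by (intro image_eqI[of _ _ "(a, c, cut ?l1 Z)"]) simp_all
        then show ?thesis using False by blast
      qed
    next
      case ne: False
      show ?thesis
      proof (cases "cost n lo Z ?l1 = 0")
        case z1: True
        from even_cost_0[OF o(2,3) z1] obtain f where f0: "1 \<le> f" "f \<le> Suc (?l1 div 2)" "Z ?l1 = {f..?l1 div 2}" .
        have f: "f \<in> N" "Z ?l1 = {f..Suc p}" using f0 unfolding d by simp_all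
        have "c = p" by (rule cp[OF suffix[OF ne f(2) z1]])
        with q(2) have qp: "Z lo = {a..p}" by (simp only:)
        show ?thesis
        proof (cases "Z ?l2 = {}")
          case e: True
          have T: "cut ?l2 Z \<in> tails n hi"
            by (rule tail_mem[OF conf nonfull _ h(3) e hi_n])
              (use c01 z1 assms(2) cost_empty[where Z = Z and t = ?l2 and n = n and lo = lo, OF e] in simp_all)
          have "Z = head lo {a..p} {f..Suc p} (cut ?l2 Z)" by (rule head_eqI[OF qp f(2)]) simp_all
          then have "Z \<in> hB n lo hi" unfolding hB_def using bd T f(1) by (intro image_eqI[of _ _ "(a, f, cut ?l2 Z)"]) simp_all
          then show ?thesis by blast
        next
          case ne2: False
          have c21: "cost n lo Z ?l2 = 1" using odd_cost[OF o(4,5) ne2] c2 c01 z1 by linarith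
          from odd_cost_1[OF o(4,5) c21 ne2] obtain g i where g0: "g \<le> i" "Z ?l2 = {g..i}" "i \<le> ?l2 div 2" .
          have g: "g \<le> i" "Z ?l2 = {g..i}" "i \<le> Suc p" using g0 unfolding d .
          have gi: "g \<in> N" "i \<in> N" using g by simp_all
          have z3: "cost n lo Z ?l3 = 0" using c3 c01 z1 c21 cn[of ?l3] by linarith
          have v: "Z s = {}" if "?l4 \<le> s" for s
          proof (rule vanish[OF o(8) _ o(9) _ that])
            show "(\<Sum>s=lo..?l4 - 1. cost n lo Z s) = excess n lo hi Z"
              unfolding diff_Suc_1 using s3 c01 z1 c21 z3 assms(2) by linarith
          qed simp
          from even_cost_0[OF o(6,7) z3] obtain j where j0: "1 \<le> j" "j \<le> Suc (?l3 div 2)" "Z ?l3 = {j..?l3 div 2}" .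
          have j: "j \<in> N" "Z ?l3 = {j..Suc (Suc p)}" using j0 unfolding d by simp_all
          show ?thesis
          proof (cases "Z ?l3 = {}")
            case True
            have "Z = head lo {a..p} {f..Suc p} (head ?l2 {g..i} {} none)"
              by (rule head_eq4[OF qp f(2) g(2) True]) (use v in simp)
            then have "Z \<in> hG n lo hi" unfolding hG_def using bd f(1) gi by (intro image_eqI[of _ _ "(a, f, g, i)"]) simp_all
            then show ?thesis by blast
          next
            case ne3: False
            have "Suc (Suc p) \<in> Z ?l3" using ne3 unfolding j(2) by simp
            moreover have "Z ?l3 \<subseteq> rise n ?l2 (Z ?l2)" using sub_rise[of ?l3] z3 gn[of ?l3] by simp
            ultimately have "Suc ?l2 div 2 \<in> rise n ?l2 (Z ?l2)" unfolding d by blast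
            from top_from[OF o(4) this] have "i = Suc p" using g unfolding d by simp
            then have gp: "Z ?l2 = {g..Suc p}" using g(2) by simp
            have "Z = head lo {a..p} {f..Suc p} (head ?l2 {g..Suc p} {j..Suc (Suc p)} none)"
              by (rule head_eq4[OF qp f(2) gp j(2)]) (use v in simp)
            then have "Z \<in> hH n lo hi" unfolding hH_def using bd f(1) gi j(1) by (intro image_eqI[of _ _ "(a, f, g, j)"]) simp_all
            then show ?thesis by blast
          qed
        qed
      next
        case False
        then have c11: "cost n lo Z ?l1 = 1" using c1 c01 cn[of ?l1] by linarith
        have v: "Z s = {}" if "?l2 \<le> s" for s
          by (rule vanish[OF o(4) _ o(5) _ that]) (use c01 c11 assms(2) in simp_all)
        have g01: "growth n ?l1 (Z ?l1) \<le> 1" using c11 by (simp add: cost_def)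
        show ?thesis
        proof (cases "card (ends (Z ?l1)) \<le> 1")
          case True
          then have "card (ends (Z ?l1)) = 1" using card_ends_pos[OF fin ne] by linarith
          from interval_if_card_ends_1[OF fin this] obtain f g where f: "f \<le> g" "Z ?l1 = {f..g}" "g = Max (Z ?l1)" .
          have "g \<in> Z ?l1" unfolding f(2) using f(1) by simp
          then have "g \<le> Suc p" by (rule l1p)
          then have fg: "f \<in> N" "g \<in> N" using f(1) by simp_all
          have "Z = head lo {a..c} {f..g} none" by (rule head_eq2[OF q(2) f(2)]) (use v in simp)
          then have "Z \<in> hE n lo hi" unfolding hE_def using bd fg by (intro image_eqI[of _ _ "(a, c, f, g)"]) simp_all
          then show ?thesis by blast
        next
          case False
          have ge: "growth n ?l1 (Z ?l1) = int (card (ends (Z ?l1))) - of_bool (Suc p \<in> Z ?l1)"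
            using growth_even_low[OF sub o(2,3)] unfolding d .
          have top: "Suc p \<in> Z ?l1"
          proof (rule ccontr)
            assume "Suc p \<notin> Z ?l1"
            then have "of_bool (Suc p \<in> Z ?l1) = (0 :: int)" by simp
            then show False using ge g01 False by linarith
          qed
          then have "of_bool (Suc p \<in> Z ?l1) = (1 :: int)" by simp
          then have e2: "card (ends (Z ?l1)) = 2" and g1: "growth n ?l1 (Z ?l1) = 1" using ge g01 False by linarith+
          have "Z ?l1 \<subseteq> rise n lo (Z lo)" using sub_rise[of ?l1] g1 c11 by simp
          then have "c = p" by (intro cp reach[OF top])
          with q(2) have qp: "Z lo = {a..p}" by (simp only:)
          from two_intervals_if_card_ends_2[OF fin e2] obtain f g i j where
            f: "Z ?l1 = {f..g} \<union> {i..j}" "f \<le> g" "Suc g < i" "i \<le> j" "j = Max (Z ?l1)" .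
          have "j \<in> Z ?l1" unfolding f(1) using f(4) by simp
          then have "j \<le> Suc p" by (rule l1p)
          moreover have "Suc p \<le> j" using top f(2-4) unfolding f(1) by auto
          ultimately have j: "j = Suc p" by simp
          then have fg: "f \<in> N" "g \<in> N" "i \<in> N" using f(2-4) by simp_all
          have f': "Z ?l1 = {f..g} \<union> {i..Suc p}" using f(1) j by simp
          have "Z = head lo {a..p} ({f..g} \<union> {i..Suc p}) none" by (rule head_eq2[OF qp f']) (use v in simp)
          then have "Z \<in> hF n lo hi" unfolding hF_def using bd fg by (intro image_eqI[of _ _ "(a, f, g, i)"]) simp_all
          then show ?thesis by blast
        qed
      qed
    qed
  qed
qed

end

section \<open>Excess two with full rows\<close>

definition defect :: "nat \<Rightarrow> (nat \<Rightarrow> nat set) \<Rightarrow> nat \<Rightarrow> int" where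
  "defect n Z t = int (card (row n t)) - int (card (Z t))"

text \<open>The row \<open>s\<close> without the element \<open>x\<close>, propagated upwards without gains and losses.\<close>

primrec dent :: "nat \<Rightarrow> nat \<Rightarrow> nat \<Rightarrow> nat \<Rightarrow> nat set" where
  "dent n s x 0 = row n s - {x}"
| "dent n s x (Suc j) = rise n (s + j) (dent n s x j)"

lemma defect_nonneg: "Z \<in> configs n lo hi \<Longrightarrow> defect n Z t \<ge> 0"
  unfolding defect_def using card_mono[OF finite_row configsD(1)] by (metis diff_ge_0_iff_ge of_nat_mono)

lemma defect_0: "Z \<in> configs n lo hi \<Longrightarrow> defect n Z t = 0 \<Longrightarrow> Z t = row n t"
  unfolding defect_def by (rule card_subset_eq[OF finite_row configsD(1)]) simp_all

text \<open>The defect of a nonempty set does not increase: a row grows by one at odd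
  \<open>t <= n\<close>, shrinks by one at even \<open>t > n\<close> and keeps its size otherwise,
  and no nonempty subset grows less than that.\<close>

lemma row_growth:
  assumes "S \<subseteq> row n t" "S \<noteq> {}"
  shows "int (card (row n (Suc t))) - int (card (rise n t S)) \<le> int (card (row n t)) - int (card S)"
proof -
  have "int (card (row n (Suc t))) - int (card (row n t)) \<le> growth n t S"
  proof (cases "t \<le> n")
    case True
    have "int (card (row n (Suc t))) - int (card (row n t)) = of_bool (odd t)"
      using True by (simp add: card_row_low of_bool_def)
    moreover have "growth n t S \<ge> 1" if "odd t" using growth_odd_low_pos[OF assms(1) that True assms(2)] .
    moreover have "growth n t S \<ge> 0" using True growth_nonneg[OF assms(1)] by simp
    ultimately show ?thesis by (cases "odd t") simp_all
  next
    case False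
    have ne: "row n t \<noteq> {}" using assms by blast
    then have "max 1 (t - n) \<le> t div 2" unfolding row_eq by simp
    then have "int (card (row n (Suc t))) - int (card (row n t)) = of_bool (odd t) - 1"
      using False by (auto simp: card_row_high of_bool_def elim!: oddE evenE)
    moreover have "growth n t S \<ge> 0" if "odd t" using that growth_nonneg[OF assms(1)] by simp
    moreover have "growth n t S \<ge> - 1" by (rule growth_ge_minus_1[OF assms(1)])
    ultimately show ?thesis by (cases "odd t") simp_all
  qed
  then show ?thesis by (simp add: growth_def)
qed

lemma card_ge_loss:
  assumes "Z \<in> configs n lo hi"
  shows "int (card (Z (Suc t))) \<ge> int (card (rise n t (Z t))) - int (loss n Z (Suc t))"
proof -
  have "rise n t (Z t) \<subseteq> Z (Suc t) \<union> (rise n t (Z t) - Z (Suc t))" by blast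
  then have "card (rise n t (Z t)) \<le> card (Z (Suc t) \<union> (rise n t (Z t) - Z (Suc t)))"
    by (rule card_mono[rotated]) (use configsD(2)[OF assms] in simp)
  also have "\<dots> \<le> card (Z (Suc t)) + loss n Z (Suc t)"
    using card_Un_le[of "Z (Suc t)" "rise n t (Z t) - Z (Suc t)"] by (simp add: loss_def)
  finally show ?thesis by linarith
qed

text \<open>The rows up to the last full row \<open>u\<close> when at most one unit is left for
  them. By \<open>wide\<close>, a row with one element missing is still nonempty, as
  \<open>row_growth\<close> requires.\<close>

locale dented =
  fixes n lo hi u :: nat and Z :: "nat \<Rightarrow> nat set"
  assumes conf: "Z \<in> configs n lo hi" and lo_u: "lo \<le> u" "u \<le> hi" and lo2: "2 \<le> lo"
    and wide: "\<And>t. lo \<le> t \<Longrightarrow> t \<le> u \<Longrightarrow> 2 \<le> card (row n t)"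
    and slack: "defect n Z lo + (\<Sum>s=Suc lo..u. int (loss n Z s)) \<le> 1"
    and top: "Z u = row n u"
begin

lemma sum_le: "t \<le> u \<Longrightarrow> (\<Sum>s=Suc lo..t. int (loss n Z s)) \<le> (\<Sum>s=Suc lo..u. int (loss n Z s))"
  by (rule sum_mono2) auto

lemma defect_le:
  assumes "lo \<le> t" "t \<le> u"
  shows "defect n Z t \<le> defect n Z lo + (\<Sum>s=Suc lo..t. int (loss n Z s))"
  using assms
proof (induction t rule: dec_induct)
  case (step t)
  have d: "defect n Z t \<le> defect n Z lo + (\<Sum>s=Suc lo..t. int (loss n Z s))" using step by simp
  then have "defect n Z t \<le> 1" using sum_le[of t] slack step by linarith
  then have "Z t \<noteq> {}" using wide[of t] step unfolding defect_def by auto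
  from row_growth[OF configsD(1)[OF conf] this]
  have "defect n Z (Suc t) \<le> defect n Z t + int (loss n Z (Suc t))"
    using card_ge_loss[OF conf, of t] unfolding defect_def by linarith
  then show ?case using d step(1) by simp
qed simp

lemma defect_le_1: "lo \<le> t \<Longrightarrow> t \<le> u \<Longrightarrow> defect n Z t \<le> 1"
  using defect_le[of t] sum_le[of t] slack by linarith

lemma rows_full:
  assumes "defect n Z lo + (\<Sum>s=Suc lo..u. int (loss n Z s)) = 0" "lo \<le> t" "t \<le> u"
  shows "Z t = row n t"
proof -
  have "defect n Z t \<le> 0" using defect_le[OF assms(2,3)] sum_le[OF assms(3)] assms(1) by linarith
  then show ?thesis using defect_nonneg[OF conf, of t] defect_0[OF conf] by simp
qed

text \<open>The first row \<open>s\<close> that is not full lacks a single element \<open>x\<close>,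
  which uses up the slack. From there on nothing is lost, and while the defect stays 1 nothing is
  gained, so the dent is propagated by \<open>rise\<close>; once a row is full again, so are all
  later ones.\<close>

lemma rows_dented:
  obtains s e x where "s \<le> u" "e \<le> u" "x \<le> u div 2"
    "\<And>t. lo \<le> t \<Longrightarrow> t \<le> u \<Longrightarrow> Z t = (if s \<le> t \<and> t \<le> e then dent n s x (t - s) else row n t)"
proof (cases "\<exists>t. lo \<le> t \<and> t \<le> u \<and> Z t \<noteq> row n t")
  case False
  have "Z t = row n t" if "lo \<le> t" "t \<le> u" for t using False that by blast
  \<comment> \<open>No dent: \<open>e = 0\<close> lies below \<open>s = u\<close>, so the range of
    dented rows is empty.\<close>
  then show ?thesis using that[of u 0 0] lo_u lo2 by auto
next
  case True
  define s where "s = (LEAST t. lo \<le> t \<and> t \<le> u \<and> Z t \<noteq> row n t)"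
  have s: "lo \<le> s" "s \<le> u" "Z s \<noteq> row n s" using LeastI_ex[OF True] unfolding s_def by blast+
  have before: "Z t = row n t" if "lo \<le> t" "t < s" for t
    using not_less_Least[OF that(2)[unfolded s_def]] that s(2) by auto
  have one: "defect n Z t = 1" if "lo \<le> t" "t \<le> u" "Z t \<noteq> row n t" for t
    using defect_le_1[OF that(1,2)] defect_nonneg[OF conf, of t] defect_0[OF conf, of t] that(3) by linarith
  have "Z s \<subseteq> row n s" by (rule configsD(1)[OF conf])
  moreover have "card (row n s - Z s) = 1"
    using one[OF s] card_Diff_subset[of "Z s" "row n s"] configsD(1,2)[OF conf, of s] unfolding defect_def
    by (metis card_mono finite_row int_ops(2) nat_int of_nat_diff)
  then obtain x where x: "row n s - Z s = {x}" by (rule card_1_singletonE)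
  ultimately have Zs: "Z s = row n s - {x}" by blast
  have xs: "x \<in> row n s" using x by blast
  then have "x \<le> s div 2" by (simp add: row_eq)
  then have xu: "x \<le> u div 2" using s(2) by (meson div_le_mono le_trans)
  have noloss: "loss n Z t = 0" if "s < t" "t \<le> u" for t
  proof -
    have "(\<Sum>i=Suc lo..s. int (loss n Z i)) + int (loss n Z t) = (\<Sum>i\<in>insert t {Suc lo..s}. int (loss n Z i))"
      using that by (subst sum.insert) auto
    also have "\<dots> \<le> (\<Sum>i=Suc lo..u. int (loss n Z i))" by (rule sum_mono2) (use that s in auto)
    finally show ?thesis using defect_le[OF s(1,2)] one[OF s] slack by linarith
  qed
  have keep: "rise n t (Z t) \<subseteq> Z (Suc t)" if "s \<le> t" "Suc t \<le> u" for t
    using noloss[of "Suc t"] that by (simp add: loss_def)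
  have su: "s < u" using s(2,3) top by (cases "s = u") auto
  define e' where "e' = (LEAST t. s < t \<and> t \<le> u \<and> Z t = row n t)"
  have ex: "\<exists>t. s < t \<and> t \<le> u \<and> Z t = row n t" using su top by blast
  have e': "s < e'" "e' \<le> u" "Z e' = row n e'" using LeastI_ex[OF ex] unfolding e'_def by blast+
  have between: "Z t \<noteq> row n t" if "s \<le> t" "t < e'" for t
    using not_less_Least[OF that(2)[unfolded e'_def]] that e'(2) s(3) by (cases "s = t") auto
  have D: "Z (s + j) = dent n s x j" if "s + j < e'" for j
    using that
  proof (induction j)
    case (Suc j)
    have j: "s + j < e'" "lo \<le> s + j" "s + j \<le> u" "lo \<le> Suc (s + j)" "Suc (s + j) \<le> u" using Suc.prems s(1) e'(2) by simp_all
    have d1: "defect n Z (s + j) = 1" "defect n Z (Suc (s + j)) = 1"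
      using one[OF j(2,3)] one[OF j(4,5)] between[of "s + j"] between[of "Suc (s + j)"] Suc.prems j(1) by simp_all
    then have "Z (s + j) \<noteq> {}" using wide[OF j(2,3)] unfolding defect_def by auto
    from row_growth[OF configsD(1)[OF conf] this]
    have "card (Z (Suc (s + j))) \<le> card (rise n (s + j) (Z (s + j)))" using d1 unfolding defect_def by linarith
    then have "rise n (s + j) (Z (s + j)) = Z (Suc (s + j))"
      using card_seteq[OF configsD(2)[OF conf] keep] j by simp
    then show ?case using Suc.IH j(1) by simp
  qed (simp add: Zs)
  have after: "e' \<le> t \<Longrightarrow> t \<le> u \<Longrightarrow> Z t = row n t" for t
  proof (induction t rule: dec_induct)
    case (step t)
    have "Z t = row n t" using step by simp
    then have "row n (Suc t) \<subseteq> Z (Suc t)" using keep[of t] rise_row[of t n] step e'(1) s(1) lo2 by simp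
    then show ?case using configsD(1)[OF conf, of "Suc t"] by blast
  qed (rule e'(3))
  show ?thesis
  proof (rule that[of s "e' - 1" x])
    show "s \<le> u" "e' - 1 \<le> u" "x \<le> u div 2" using s e' xu by simp_all
    fix t assume t: "lo \<le> t" "t \<le> u"
    consider "t < s" | "s \<le> t" "t < e'" | "e' \<le> t" by linarith
    then show "Z t = (if s \<le> t \<and> t \<le> e' - 1 then dent n s x (t - s) else row n t)"
    proof cases
      case 1
      then show ?thesis using before t by simp
    next
      case 2
      then have "Z t = dent n s x (t - s)" using D[of "t - s"] by simp
      moreover have "s \<le> t \<and> t \<le> e' - 1" using 2 by linarith
      ultimately show ?thesis by simp
    next
      case 3
      then have "\<not> t \<le> e' - 1" using e'(1) by linarith
      then show ?thesis using after[OF 3 t(2)] by simp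
    qed
  qed
qed

end

text \<open>Rows \<open>s\<close> to \<open>e\<close> carry the dent; the arguments
  \<open>1 0 0\<close> describe full rows without a dent.\<close>

definition dconf :: "nat \<Rightarrow> nat \<Rightarrow> nat \<Rightarrow> nat \<Rightarrow> nat \<Rightarrow> nat \<Rightarrow> (nat \<Rightarrow> nat set) \<Rightarrow> nat \<Rightarrow> nat set" where
  "dconf n lo u s e x Y = (\<lambda>t. if u < t then Y t else if t < lo then {} else
     if s \<le> t \<and> t \<le> e then dent n s x (t - s) else row n t)"

lemma odd_high_cost_0:
  assumes "Z \<in> configs n lo hi" "odd t" "n < t" "\<not> full n Z t" "cost n lo Z t = 0"
  obtains b where "b \<le> t div 2" "Z t = {t - n..b}"
proof (cases "Z t = {}")
  case True
  \<comment> \<open>As \<open>t - n > 0\<close>, the value \<open>b = 0\<close> gives the empty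
    prefix.\<close>
  show ?thesis by (rule that[of 0]) (use True assms(3) in auto)
next
  case False
  from growth_odd_high_0[OF configsD(1)[OF assms(1)] assms(2,3) cost_0D(1)[OF assms(1,4,5)] False]
  obtain b where "t - n \<le> b" "b \<le> t div 2" "Z t = {t - n..b}" .
  then show ?thesis using that by blast
qed

lemma odd_high_growth_1:
  assumes "S \<subseteq> row n t" "odd t" "n < t" "growth n t S \<le> 1"
  obtains b c d where "b \<le> t div 2" "c \<le> Suc (t div 2)" "d \<le> t div 2" "S = {t - n..b} \<union> {c..d}"
proof -
  have fin: "finite S" using assms(1) finite_row_subset by blast
  have b: "t - n \<le> x \<and> x \<le> t div 2" if "x \<in> S" for x using assms(1) that by (auto simp: row_eq)
  have g: "int (card (ends S)) - of_bool (t - n \<in> S) \<le> 1" using growth_eq[OF assms(1)] assms(2,4) by simp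
  consider "S = {}" | "card (ends S) = 1" | "card (ends S) = 2" "t - n \<in> S"
  proof (cases "S = {}")
    case False
    then have "card (ends S) \<ge> 1" by (rule card_ends_pos[OF fin])
    then show ?thesis using g that by (cases "t - n \<in> S"; cases "card (ends S) = 1") simp_all
  qed (rule that(1))
  then show ?thesis
  proof cases
    case 1
    show ?thesis by (rule that[of 0 1 0]) (use 1 assms(3) in auto)
  next
    case 2
    from interval_if_card_ends_1[OF fin 2] obtain c d where q: "c \<le> d" "S = {c..d}" "d = Max S" .
    have "d \<in> S" unfolding q(2) using q(1) by simp
    then have "d \<le> t div 2" using b by blast
    moreover have "S = {t - n..0} \<union> {c..d}" using q(2) assms(3) by simp
    ultimately show ?thesis using that[of 0 c d] q(1) by simp
  next
    case 3
    from two_intervals_if_card_ends_2[OF fin 3(1)] obtain a e c d where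
      q: "S = {a..e} \<union> {c..d}" "a \<le> e" "Suc e < c" "c \<le> d" "d = Max S" .
    have "d \<in> S" "a \<in> S" unfolding q(1) using q(2,4) by simp_all
    then have "d \<le> t div 2" "t - n \<le> a" using b by blast+
    moreover have "a \<le> t - n" using 3(2) q(2-4) unfolding q(1) by auto
    ultimately have d: "d \<le> t div 2" "a = t - n" by simp_all
    then have "S = {t - n..e} \<union> {c..d}" using q(1) by simp
    then show ?thesis using that[of e c d] q(2-4) d(1) by simp
  qed
qed

lemma even_high_growth_0:
  assumes "S \<subseteq> row n t" "even t" "n < t" "growth n t S = 0"
  obtains b c where "b \<le> t div 2" "c \<le> Suc (t div 2)" "S = {t - n..b} \<union> {c..t div 2}"
proof -
  have fin: "finite S" using assms(1) finite_row_subset by blast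
  have b: "t - n \<le> x \<and> x \<le> t div 2" if "x \<in> S" for x using assms(1) that by (auto simp: row_eq)
  have g: "int (card (ends S)) = of_bool (t - n \<in> S) + of_bool (t div 2 \<in> S)"
    using growth_eq[OF assms(1)] assms(2,4) by simp
  consider "S = {}" | "card (ends S) = 1" "t - n \<in> S \<or> t div 2 \<in> S" | "card (ends S) = 2" "t - n \<in> S" "t div 2 \<in> S"
  proof (cases "S = {}")
    case False
    then have "card (ends S) \<ge> 1" by (rule card_ends_pos[OF fin])
    then show ?thesis using g that by (cases "t - n \<in> S"; cases "t div 2 \<in> S") simp_all
  qed (rule that(1))
  then show ?thesis
  proof cases
    case 1
    show ?thesis by (rule that[of 0 "Suc (t div 2)"]) (use 1 assms(3) in auto)
  next
    case 2
    from interval_if_card_ends_1[OF fin 2(1)] obtain c d where q: "c \<le> d" "S = {c..d}" "d = Max S" .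
    have "d \<in> S" "c \<in> S" unfolding q(2) using q(1) by simp_all
    then have cd: "d \<le> t div 2" "t - n \<le> c" using b by blast+
    from 2(2) show ?thesis
    proof
      assume "t - n \<in> S"
      then have "c = t - n" using cd unfolding q(2) by simp
      then have "S = {t - n..d} \<union> {Suc (t div 2)..t div 2}" using q(2) by simp
      then show ?thesis using that[of d "Suc (t div 2)"] cd by simp
    next
      assume "t div 2 \<in> S"
      then have "d = t div 2" using cd unfolding q(2) by simp
      then have "S = {t - n..0} \<union> {c..t div 2}" using q(2) assms(3) by simp
      then show ?thesis using that[of 0 c] q(1) \<open>d = t div 2\<close> by simp
    qed
  next
    case 3
    from two_intervals_if_card_ends_2[OF fin 3(1)] obtain a e c d where
      q: "S = {a..e} \<union> {c..d}" "a \<le> e" "Suc e < c" "c \<le> d" "d = Max S" .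
    have "d \<in> S" "a \<in> S" unfolding q(1) using q(2,4) by simp_all
    then have "d \<le> t div 2" "t - n \<le> a" using b by blast+
    moreover have "a \<le> t - n" "t div 2 \<le> d" using 3(2,3) q(2-4) unfolding q(1) by auto
    ultimately have d: "d = t div 2" "a = t - n" by simp_all
    then have "S = {t - n..e} \<union> {c..t div 2}" using q(1) by simp
    then show ?thesis using that[of e c] q(2-4) d(1) by simp
  qed
qed

lemma card_image3: "finite A \<Longrightarrow> finite B \<Longrightarrow> finite C \<Longrightarrow>
    card (f ` (A \<times> B \<times> C)) \<le> card A * (card B * card C)"
  using card_image_le[of "A \<times> B \<times> C" f] by (simp add: card_cartesian_product)

lemma card_image4: "finite A \<Longrightarrow> finite B \<Longrightarrow> finite C \<Longrightarrow> finite D \<Longrightarrow>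
    card (f ` (A \<times> B \<times> C \<times> D)) \<le> card A * (card B * (card C * card D))"
  using card_image_le[of "A \<times> B \<times> C \<times> D" f] by (simp add: card_cartesian_product)

lemma power4_id: "2 * q * (2 * q * (q * q)) = 4 * q ^ 4" "q ^ 4 = q * (q * (q * q))"
    "(2 * (q * q) + (2 * q) ^ 2) * (2 * q) ^ 2 = 24 * q ^ 4" "15 * q * q ^ 4 = 15 * q ^ 5" for q :: nat
  by (simp_all add: numeral_eq_Suc algebra_simps)

lemma cube_bound: "1 \<le> q \<Longrightarrow> q ^ 3 + q ^ 3 + q ^ 3 + q ^ 3 + 1 \<le> 6 * q ^ 3"
    "1 \<le> q \<Longrightarrow> q * (q * q) \<le> q * (q * (q * q))" for q :: nat
  using one_le_power[of q 3] by (linarith, simp)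

lemma card_Un_bound: "card A \<le> a \<Longrightarrow> card B \<le> b \<Longrightarrow> card (A \<union> B) \<le> a + b"
  using card_Un_le[of A B] by linarith

lemma finite_heads: "finite (hA n lo hi)" "finite (hB n lo hi)" "finite (hC n lo hi)" "finite (hD n lo hi)"
    "finite (hE n lo hi)" "finite (hF n lo hi)" "finite (hG n lo hi)" "finite (hH n lo hi)"
  unfolding hA_def hB_def hC_def hD_def hE_def hF_def hG_def hH_def using card_tails(1)[of n hi] by simp_all

lemma card_heads:
  assumes "lo div 2 + 4 \<le> q" "1 + n + (hi - n) ^ 2 \<le> q * q"
  shows "card (hA n lo hi) \<le> q ^ 4" "card (hB n lo hi) \<le> q ^ 4" "card (hC n lo hi) \<le> q ^ 4" "card (hD n lo hi) \<le> q ^ 4"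
    "card (hE n lo hi) \<le> q ^ 4" "card (hF n lo hi) \<le> q ^ 4" "card (hG n lo hi) \<le> q ^ 4" "card (hH n lo hi) \<le> q ^ 4"
proof -
  let ?N = "{..lo div 2 + 3}"
  have N: "card ?N \<le> q" "finite ?N" using assms(1) by simp_all
  have t: "card (tails n hi) \<le> q * q" "finite (tails n hi)" using card_tails[of n hi] assms(2) by simp_all
  have q4: "q ^ 4 = q * (q * (q * q))" by (simp add: numeral_eq_Suc)
  have 3: "card (f ` (?N \<times> ?N \<times> tails n hi)) \<le> q ^ 4" for f :: "_ \<Rightarrow> nat \<Rightarrow> nat set"
    unfolding q4 by (rule order_trans[OF card_image3[OF N(2) N(2) t(2)]]) (intro mult_le_mono N t)
  have 4: "card (f ` (?N \<times> ?N \<times> ?N \<times> ?N)) \<le> q ^ 4" for f :: "_ \<Rightarrow> nat \<Rightarrow> nat set"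
    unfolding q4 by (rule order_trans[OF card_image4[OF N(2) N(2) N(2) N(2)]]) (intro mult_le_mono N)
  show "card (hA n lo hi) \<le> q ^ 4" "card (hB n lo hi) \<le> q ^ 4" unfolding hA_def hB_def by (rule 3)+
  show "card (hC n lo hi) \<le> q ^ 4" "card (hD n lo hi) \<le> q ^ 4"
    "card (hE n lo hi) \<le> q ^ 4" "card (hF n lo hi) \<le> q ^ 4" "card (hG n lo hi) \<le> q ^ 4" "card (hH n lo hi) \<le> q ^ 4"
    unfolding hC_def hD_def hE_def hF_def hG_def hH_def by (rule 4)+
qed

section \<open>Bounds on the numbers of configurations\<close>

context middle
begin

abbreviation Q where "Q \<equiv> r + m + 2"

lemma wide_rows:
  assumes "3 \<le> r" "2 * r - 2 \<le> t" "t \<le> 2 * r + 2 * m - 2"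
  shows "2 \<le> card (row n t)"
proof (cases "t \<le> Suc n")
  case True
  then show ?thesis using assms by (simp add: card_row_low)
next
  case False
  then have "card (row n t) = Suc (t div 2) - (t - n)" by (simp add: card_row_high)
  moreover have "t + 2 + r \<le> Suc (t div 2) + n + 2"
  proof (cases "even t")
    case True
    then obtain q where "t = 2 * q" by blast
    then show ?thesis using assms n1 by simp
  next
    case False
    then obtain q where "t = 2 * q + 1" by (rule oddE)
    then show ?thesis using assms n1 by simp
  qed
  ultimately show ?thesis using False assms(1) by simp
qed

text \<open>For \<open>D = 1, 2\<close> the row \<open>l\<close> has \<open>r - 1\<close> elements.
  With the defect in place of \<open>card (Z l)\<close> the excess is 1 plus four nonnegative terms,
  the first of which measures how far \<open>u\<close> is from the last possible place. So excess
  one leaves nothing to distribute and excess two leaves one unit.\<close>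

lemma full_rest:
  assumes "Z \<in> configs n l h" "l = 2 * r - D" "h = 2 * r + 2 * m - D" "1 \<le> D" "D \<le> 2" "3 \<le> r" "full n Z u0"
  obtains u where "full n Z u" "l \<le> u" "u \<le> h" "u div 2 < r + m" "\<forall>t>u. cost n l Z t \<ge> 0 \<and> \<not> full n Z t"
    "excess n l h Z = int (n - u div 2) - int r + 1 + (\<Sum>s=Suc l..u. int (loss n Z s)) + defect n Z l
      + (\<Sum>t=Suc u..h. cost n l Z t)" "n - u div 2 \<ge> r" "dented n l h u Z \<or>
    defect n Z l + (\<Sum>s=Suc l..u. int (loss n Z s)) > 1"
proof -
  have r0: "l \<le> u0 \<and> u0 \<le> h" by (rule full_in_range[OF assms(1,7)])
  from last_full[OF assms(7) conjunct2[OF r0]] obtain u where u: "full n Z u" "u \<le> h"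
    "\<And>t. u < t \<Longrightarrow> t \<le> h \<Longrightarrow> \<not> full n Z t" by blast
  have lu: "l \<le> u" using full_in_range[OF assms(1) u(1)] by simp
  have ev: "even u" "n < u" "Z u = row n u" using u(1) by (auto simp: full_def)
  have nf: "\<not> full n Z t" if "u < t" for t
    using u(3)[OF that] full_in_range[OF assms(1), of t] by (cases "t \<le> h") auto
  obtain b where "u = 2 * b" using ev(1) by (rule evenE)
  then have uh: "u \<le> 2 * r + 2 * m - 2" using u(2) assms(3,4,5) by presburger
  have v: "u div 2 < r + m" using uh assms(6) by linarith
  have ln: "l \<le> Suc n" using assms(2) n1 by linarith
  have cl: "int (card (row n l)) = int r - 1" using card_row_low[OF ln] assms(2,4,5,6) by (cases "D = 1") auto
  have e: "excess n l h Z = int (n - u div 2) + (\<Sum>s=Suc l..u. int (loss n Z s)) - int (card (Z l))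
    + (\<Sum>t=Suc u..h. cost n l Z t)" by (rule excess_full[OF assms(1) u(1) lu u(2)])
  have dn: "dented n l h u Z" if "\<not> defect n Z l + (\<Sum>s=Suc l..u. int (loss n Z s)) > 1"
  proof
    show "2 \<le> card (row n t)" if "l \<le> t" "t \<le> u" for t
      by (rule wide_rows[OF assms(6)]) (use that assms(2,5) uh in linarith)+
    show "2 \<le> l" using assms by linarith
  qed (use assms(1) lu u(2) ev(3) that in simp_all)
  show ?thesis
  proof (rule that[OF u(1) lu u(2) v])
    show "\<forall>t>u. cost n l Z t \<ge> 0 \<and> \<not> full n Z t" using cost_nonneg[OF assms(1) nf] nf by blast
    show "n - u div 2 \<ge> r" using v n1 by linarith
    show "excess n l h Z = int (n - u div 2) - int r + 1 + (\<Sum>s=Suc l..u. int (loss n Z s)) + defect n Z l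
      + (\<Sum>t=Suc u..h. cost n l Z t)" using e cl unfolding defect_def by linarith
    show "dented n l h u Z \<or> defect n Z l + (\<Sum>s=Suc l..u. int (loss n Z s)) > 1" using dn by blast
  qed
qed

definition confs2 :: "(nat \<Rightarrow> nat set) set" where
  "confs2 = {Z \<in> configs n (2 * r - 2) (2 * r + 2 * m - 2). excess n (2 * r - 2) (2 * r + 2 * m - 2) Z = 1}"

lemma tails_bound: "1 + n + (2 * r + 2 * m - D - n) ^ 2 \<le> Q * Q" if "1 \<le> D"
proof -
  have "2 * r + 2 * m - D - n \<le> m" using that n1 by linarith
  then have "(2 * r + 2 * m - D - n) ^ 2 \<le> m ^ 2" by (rule power_mono) simp
  moreover have "1 + n + m ^ 2 \<le> Q * Q" using n1 by (simp add: power2_eq_square algebra_simps)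
  ultimately show ?thesis by linarith
qed

text \<open>Without full rows these are the four shapes of \<open>even_start\<close>. With one,
  \<open>full_rest\<close> leaves no unit, and only the configuration with all rows full
  remains.\<close>

lemma card_confs2:
  assumes "4 \<le> m" "3 \<le> r"
  shows "card confs2 \<le> 6 * Q ^ 3"
proof -
  let ?l = "2 * r - 2" and ?h = "2 * r + 2 * m - 2"
  let ?p = "?l div 2"
  let ?N = "{..Q - 1}" and ?t = "tails n ?h"
  let ?A = "(\<lambda>(c, Y). head ?l {c..?p} {} Y) ` (?N \<times> ?t)"
  let ?B = "(\<lambda>(c, f, g). head ?l {c..?p} {f..g} none) ` (?N \<times> ?N \<times> ?N)"
  let ?C = "(\<lambda>(c, f, h). head ?l {c..?p} {f..?p} (head (Suc (Suc ?l)) {h..Suc ?p} {} none)) ` (?N \<times> ?N \<times> ?N)"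
  let ?D = "(\<lambda>(a, c, d). head ?l ({a..c} \<union> {d..?p}) {} none) ` (?N \<times> ?N \<times> ?N)"
  let ?E = "{\<lambda>t. if ?l \<le> t \<and> t \<le> ?h then row n t else {}}"
  have cN: "card ?N = Q" "finite ?N" by simp_all
  have pN: "i \<in> ?N" if "i \<le> Suc (Suc ?p)" for i using that assms by auto
  have ct: "card ?t \<le> Q * Q" "finite ?t" using card_tails[of n ?h] tails_bound[of 2] by simp_all
  have q3: "Q ^ 3 = Q * (Q * Q)" by (simp add: power3_eq_cube)
  have "confs2 \<subseteq> ?A \<union> ?B \<union> ?C \<union> ?D \<union> ?E"
  proof
    fix Z assume "Z \<in> confs2"
    then have Z: "Z \<in> configs n ?l ?h" "excess n ?l ?h Z = 1" by (simp_all add: confs2_def)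
    show "Z \<in> ?A \<union> ?B \<union> ?C \<union> ?D \<union> ?E"
    proof (cases "nonfull n Z")
      case True
      interpret nonfull_conf n ?l ?h Z
        by unfold_locales (use Z(1) True n1 assms in simp_all)
      from even_start[OF _ Z(2)] have
        "(\<exists>c\<in>{1..Suc ?p}. \<exists>Y\<in>?t. Z = head ?l {c..?p} {} Y) \<or>
        (\<exists>c\<in>{..Suc ?p}. \<exists>f\<in>{..Suc ?p}. \<exists>g\<in>{..Suc ?p}. Z = head ?l {c..?p} {f..g} none) \<or>
        (\<exists>c\<in>{..Suc ?p}. \<exists>f\<in>{..Suc ?p}. \<exists>h\<in>{..Suc (Suc ?p)}.
          Z = head ?l {c..?p} {f..?p} (head (Suc (Suc ?l)) {h..Suc ?p} {} none)) \<or>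
        (\<exists>a\<in>{..Suc ?p}. \<exists>c\<in>{..Suc ?p}. \<exists>d\<in>{..Suc ?p}. Z = head ?l ({a..c} \<union> {d..?p}) {} none)" by simp
      then show ?thesis
      proof (elim disjE bexE)
        fix c Y assume "c \<in> {1..Suc ?p}" "Y \<in> ?t" "Z = head ?l {c..?p} {} Y"
        then have "Z \<in> ?A" by (intro image_eqI[of _ _ "(c, Y)"]) (use pN[of c] in simp_all)
        then show ?thesis by blast
      next
        fix c f g assume "c \<in> {..Suc ?p}" "f \<in> {..Suc ?p}" "g \<in> {..Suc ?p}" "Z = head ?l {c..?p} {f..g} none"
        then have "Z \<in> ?B" by (intro image_eqI[of _ _ "(c, f, g)"]) (use pN[of c] pN[of f] pN[of g] in simp_all)
        then show ?thesis by blast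
      next
        fix c f h assume "c \<in> {..Suc ?p}" "f \<in> {..Suc ?p}" "h \<in> {..Suc (Suc ?p)}"
          "Z = head ?l {c..?p} {f..?p} (head (Suc (Suc ?l)) {h..Suc ?p} {} none)"
        then have "Z \<in> ?C" by (intro image_eqI[of _ _ "(c, f, h)"]) (use pN[of c] pN[of f] pN[of h] in simp_all)
        then show ?thesis by blast
      next
        fix a c d assume "a \<in> {..Suc ?p}" "c \<in> {..Suc ?p}" "d \<in> {..Suc ?p}" "Z = head ?l ({a..c} \<union> {d..?p}) {} none"
        then have "Z \<in> ?D" by (intro image_eqI[of _ _ "(a, c, d)"]) (use pN[of a] pN[of c] pN[of d] in simp_all)
        then show ?thesis by blast
      qed
    next
      case False
      then obtain u0 where "full n Z u0" unfolding nonfull_def by blast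
      from full_rest[OF Z(1) refl refl one_le_numeral order_refl assms(2) this] obtain u where u: "full n Z u" "?l \<le> u" "u \<le> ?h"
        "u div 2 < r + m" "\<forall>t>u. cost n ?l Z t \<ge> 0 \<and> \<not> full n Z t"
        "excess n ?l ?h Z = int (n - u div 2) - int r + 1 + (\<Sum>s=Suc ?l..u. int (loss n Z s)) + defect n Z ?l
          + (\<Sum>t=Suc u..?h. cost n ?l Z t)" "n - u div 2 \<ge> r" "dented n ?l ?h u Z \<or>
        defect n Z ?l + (\<Sum>s=Suc ?l..u. int (loss n Z s)) > 1" .
      have u5: "cost n ?l Z t \<ge> 0 \<and> \<not> full n Z t" if "u < t" for t using u(5) that by blast
      have c: "(\<Sum>t=Suc u..?h. cost n ?l Z t) \<ge> 0" by (rule sum_nonneg) (use u5 in auto)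
      have l: "(\<Sum>s=Suc ?l..u. int (loss n Z s)) \<ge> 0" by (rule sum_nonneg) simp
      have d: "defect n Z ?l \<ge> 0" by (rule defect_nonneg[OF Z(1)])
      have eq: "int (n - u div 2) = int r" "defect n Z ?l + (\<Sum>s=Suc ?l..u. int (loss n Z s)) = 0"
        using u(6,7) c l d Z(2) by linarith+
      then have "u div 2 + 1 = r + m" using n1 u(4) by linarith
      moreover have "even u" using u(1) by (simp add: full_def)
      ultimately have uh: "u = ?h" by (auto elim!: evenE)
      interpret dented n ?l ?h u Z using u(8) eq(2) by simp
      have "Z = (\<lambda>t. if ?l \<le> t \<and> t \<le> ?h then row n t else {})"
      proof
        fix t show "Z t = (if ?l \<le> t \<and> t \<le> ?h then row n t else {})"
          using rows_full[OF eq(2), of t] configsD(3,4)[OF Z(1), of t] uh by (cases "?l \<le> t"; cases "t \<le> ?h") simp_all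
      qed
      then show ?thesis by blast
    qed
  qed
  then have "card confs2 \<le> card (?A \<union> ?B \<union> ?C \<union> ?D \<union> ?E)" by (rule card_mono[rotated]) (use ct in simp)
  also have "\<dots> \<le> Q ^ 3 + Q ^ 3 + Q ^ 3 + Q ^ 3 + 1"
  proof (intro card_Un_bound)
    have "card ?A \<le> card (?N \<times> ?t)" by (rule card_image_le) (use ct in simp)
    also have "\<dots> = Q * card ?t" by (simp only: card_cartesian_product cN)
    also have "\<dots> \<le> Q ^ 3" unfolding q3 by (rule mult_le_mono2[OF ct(1)])
    finally show "card ?A \<le> Q ^ 3" .
    have F: "card (f ` (?N \<times> ?N \<times> ?N)) \<le> Q ^ 3" for f :: "_ \<Rightarrow> nat \<Rightarrow> nat set"
      using card_image3[OF cN(2) cN(2) cN(2), of f] unfolding cN(1) q3 .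
    show "card ?B \<le> Q ^ 3" "card ?C \<le> Q ^ 3" "card ?D \<le> Q ^ 3" by (rule F)+
  qed simp
  also have "\<dots> \<le> 6 * Q ^ 3" by (rule cube_bound(1)) simp
  finally show ?thesis .
qed

text \<open>The unit left over by \<open>full_rest\<close> is spent on a dent before the last full
  row (\<open>F1\<close>), in the last row (\<open>F2\<close>), or by that full row lying two rows
  lower than possible (\<open>F3\<close>).\<close>

definition F1 :: "(nat \<Rightarrow> nat set) set" where
  "F1 = (\<lambda>(s, e, x, b). dconf n lo (hi - 1) s e x (\<lambda>t. if t = hi then {hi - n..b} else {})) `
    ({..<2 * Q} \<times> {..<2 * Q} \<times> {..<Q} \<times> {..<Q})"

definition F2 :: "(nat \<Rightarrow> nat set) set" where
  "F2 = (\<lambda>(b, c, d). dconf n lo (hi - 1) 1 0 0 (\<lambda>t. if t = hi then {hi - n..b} \<union> {c..d} else {})) `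
    ({..<Q} \<times> {..<Q} \<times> {..<Q})"

definition F3 :: "(nat \<Rightarrow> nat set) set" where
  "F3 = (\<lambda>(b, c, d, f). dconf n lo (hi - 3) 1 0 0 (\<lambda>t. if t = hi - 2 then {hi - 2 - n..b}
      else if t = hi - 1 then {hi - 1 - n..c} \<union> {d..(hi - 1) div 2} else if t = hi then {hi - n..f} else {})) `
    ({..<Q} \<times> {..<Q} \<times> {..<Q} \<times> {..<Q})"

lemma card_F: "finite F1" "finite F2" "finite F3" "card F1 \<le> 4 * Q ^ 4" "card F2 \<le> Q ^ 4" "card F3 \<le> Q ^ 4"
proof -
  have q4: "Q ^ 4 = Q * (Q * (Q * Q))" by (rule power4_id(2))
  have c: "card {..<2 * Q} = 2 * Q" "card {..<Q} = Q" by simp_all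
  show "finite F1" "finite F2" "finite F3" unfolding F1_def F2_def F3_def by simp_all
  have "card F1 \<le> 2 * Q * (2 * Q * (Q * Q))"
    unfolding F1_def by (rule order_trans[OF card_image4]) (simp_all only: c finite_lessThan order_refl)
  then show "card F1 \<le> 4 * Q ^ 4" unfolding power4_id(1)[of Q] .
  have "card F2 \<le> Q * (Q * Q)"
    unfolding F2_def by (rule order_trans[OF card_image3]) (simp_all only: c finite_lessThan order_refl)
  also have "\<dots> \<le> Q * (Q * (Q * Q))" by (rule cube_bound(2)) simp
  finally show "card F2 \<le> Q ^ 4" unfolding q4 .
  have "card F3 \<le> Q * (Q * (Q * Q))"
    unfolding F3_def by (rule order_trans[OF card_image4]) (simp_all only: c finite_lessThan order_refl)
  then show "card F3 \<le> Q ^ 4" unfolding q4 .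
qed

lemma dconf_eqI:
  assumes "Z \<in> configs n lo hi" "\<And>t. lo \<le> t \<Longrightarrow> t \<le> u \<Longrightarrow> Z t = (if s \<le> t \<and> t \<le> e then dent n s x (t - s) else row n t)"
    "\<And>t. u < t \<Longrightarrow> Z t = Y t"
  shows "Z = dconf n lo u s e x Y"
proof
  fix t
  consider "u < t" | "t \<le> u" "t < lo" | "lo \<le> t" "t \<le> u" by linarith
  then show "Z t = dconf n lo u s e x Y t"
  proof cases
    case 1
    then show ?thesis using assms(3) by (simp add: dconf_def)
  next
    case 2
    then show ?thesis using configsD(3)[OF assms(1)] by (simp add: dconf_def)
  next
    case 3
    then show ?thesis using assms(2)[OF 3] by (simp add: dconf_def)
  qed
qed

lemma full_excess_2:
  assumes "Z \<in> configs n lo hi" "excess n lo hi Z = 2" "full n Z u0" "4 \<le> m" "3 \<le> r"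
  shows "Z \<in> F1 \<union> F2 \<union> F3"
proof -
  from full_rest[where D = 1, OF assms(1) refl refl order_refl one_le_numeral assms(5,3)] obtain u where u: "full n Z u" "lo \<le> u" "u \<le> hi"
    "u div 2 < r + m" "\<forall>t>u. cost n lo Z t \<ge> 0 \<and> \<not> full n Z t"
    "excess n lo hi Z = int (n - u div 2) - int r + 1 + (\<Sum>s=Suc lo..u. int (loss n Z s)) + defect n Z lo
      + (\<Sum>t=Suc u..hi. cost n lo Z t)" "n - u div 2 \<ge> r" "dented n lo hi u Z \<or>
    defect n Z lo + (\<Sum>s=Suc lo..u. int (loss n Z s)) > 1" .
  have u5: "cost n lo Z t \<ge> 0 \<and> \<not> full n Z t" if "u < t" for t using u(5) that by blast
  have c: "(\<Sum>t=Suc u..hi. cost n lo Z t) \<ge> 0" by (rule sum_nonneg) (use u5 in auto)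
  have l: "(\<Sum>s=Suc lo..u. int (loss n Z s)) \<ge> 0" by (rule sum_nonneg) simp
  have d: "defect n Z lo \<ge> 0" by (rule defect_nonneg[OF assms(1)])
  have eq: "(int (n - u div 2) - int r) + (defect n Z lo + (\<Sum>s=Suc lo..u. int (loss n Z s))) + (\<Sum>t=Suc u..hi. cost n lo Z t) = 1"
    using u(6) assms(2) by linarith
  have x: "int (n - u div 2) - int r \<ge> 0" using u(7) by linarith
  have "\<not> defect n Z lo + (\<Sum>s=Suc lo..u. int (loss n Z s)) > 1" using eq x c l d by linarith
  then interpret dented n lo hi u Z using u(8) by blast
  obtain b0 where b0: "u = 2 * b0" using u(1) by (auto simp: full_def elim: evenE)
  have un: "n < u" using u(1) by (simp add: full_def)
  have out: "Z t = {}" if "hi < t" for t using configsD(4)[OF assms(1) that] .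
  have sub: "Z t \<subseteq> row n t" for t by (rule configsD(1)[OF assms(1)])
  have bnd: "b < Q" if "b \<le> Suc (t div 2)" "t \<le> hi" for b t
  proof -
    have "t div 2 \<le> hi div 2" using that(2) by (rule div_le_mono)
    moreover have "hi div 2 < r + m" using assms(5) by linarith
    ultimately show ?thesis using that(1) by linarith
  qed
  have nu: "n - u div 2 = 2 * r + m - 1 - b0" using n1 b0 by simp
  have oddh: "odd hi" "n < hi" using n1 assms(4,5) by auto
  \<comment> \<open>Lowering the even index \<open>u = 2 b0\<close> by two rows costs one
    unit.\<close>
  consider "b0 + 1 = r + m" "(\<Sum>t=Suc u..hi. cost n lo Z t) = 0" | "b0 + 1 = r + m"
      "defect n Z lo + (\<Sum>s=Suc lo..u. int (loss n Z s)) = 0" "(\<Sum>t=Suc u..hi. cost n lo Z t) = 1"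
    | "b0 + 2 = r + m" "defect n Z lo + (\<Sum>s=Suc lo..u. int (loss n Z s)) = 0" "(\<Sum>t=Suc u..hi. cost n lo Z t) = 0"
  proof -
    have "b0 < r + m" using u(4) b0 by simp
    then have "int (2 * r + m - 1 - b0) = 2 * int r + int m - 1 - int b0" using assms(5) by linarith
    then have "int r + int m - 1 - int b0 + (defect n Z lo + (\<Sum>s=Suc lo..u. int (loss n Z s))) + (\<Sum>t=Suc u..hi. cost n lo Z t) = 1"
      "int r + int m - 1 - int b0 \<ge> 0"
      using eq x unfolding nu by linarith+
    moreover define A B where "A = defect n Z lo + (\<Sum>s=Suc lo..u. int (loss n Z s))" and "B = (\<Sum>t=Suc u..hi. cost n lo Z t)"
    ultimately have s: "int r + int m - 1 - int b0 + A + B = 1" "int r + int m - 1 - int b0 \<ge> 0" "A \<ge> 0" "B \<ge> 0"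
      using c l d by simp_all
    then have "b0 + 1 = r + m \<or> b0 + 2 = r + m" by linarith
    then show ?thesis
    proof
      assume e: "b0 + 1 = r + m"
      then have "B = 0 \<or> A = 0 \<and> B = 1" using s by linarith
      then show ?thesis using that(1,2)[OF e] unfolding A_def B_def by blast
    next
      assume e: "b0 + 2 = r + m"
      then have "A = 0" "B = 0" using s by linarith+
      then show ?thesis using that(3)[OF e] unfolding A_def B_def by blast
    qed
  qed
  then show ?thesis
  proof cases
    case 1
    then have uh: "u = hi - 1" "Suc u = hi" using b0 by simp_all
    have "cost n lo Z hi = 0" using 1(2) uh(2) by simp
    from odd_high_cost_0[OF assms(1) oddh conjunct2[OF u5] this] uh obtain b where
      b: "b \<le> hi div 2" "Z hi = {hi - n..b}" by auto
    from rows_dented obtain s e x where se: "s \<le> u" "e \<le> u" "x \<le> u div 2"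
      "\<And>t. lo \<le> t \<Longrightarrow> t \<le> u \<Longrightarrow> Z t = (if s \<le> t \<and> t \<le> e then dent n s x (t - s) else row n t)" by blast
    have "Z = dconf n lo u s e x (\<lambda>t. if t = hi then {hi - n..b} else {})"
    proof (rule dconf_eqI[OF assms(1) se(4)])
      fix t assume "u < t"
      then have "t = hi \<or> hi < t" using uh by linarith
      then show "Z t = (if t = hi then {hi - n..b} else {})" using b(2) out by auto
    qed
    moreover have "hi < 2 * Q" by (rule le_less_trans[of _ "2 * r + 2 * m"]) simp_all
    then have "s < 2 * Q" "e < 2 * Q" using le_less_trans[OF order_trans[OF se(1) u(3)]]
      le_less_trans[OF order_trans[OF se(2) u(3)]] by blast+
    moreover have "x < Q" by (rule bnd[of x u]) (use se(3) u(3) in linarith)+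
    moreover have "b < Q" by (rule bnd[of b hi]) (use b(1) in simp_all)
    ultimately have "Z \<in> F1" unfolding F1_def uh(1)[symmetric] by (intro image_eqI[of _ _ "(s, e, x, b)"]) simp_all
    then show ?thesis by blast
  next
    case 2
    then have uh: "u = hi - 1" "Suc u = hi" using b0 by simp_all
    have "cost n lo Z hi = 1" using 2(3) uh(2) by simp
    then have "growth n hi (Z hi) \<le> 1" using u(3) uh by (simp add: cost_def split: if_splits)
    from odd_high_growth_1[OF sub oddh this] obtain b c d where
      b: "b \<le> hi div 2" "c \<le> Suc (hi div 2)" "d \<le> hi div 2" "Z hi = {hi - n..b} \<union> {c..d}" .
    have "Z = dconf n lo u 1 0 0 (\<lambda>t. if t = hi then {hi - n..b} \<union> {c..d} else {})"
    proof (rule dconf_eqI[OF assms(1)])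
      fix t assume "lo \<le> t" "t \<le> u"
      then show "Z t = (if 1 \<le> t \<and> t \<le> 0 then dent n 1 0 (t - 1) else row n t)" using rows_full[OF 2(2)] by (cases t) simp_all
    next
      fix t assume "u < t"
      then have "t = hi \<or> hi < t" using uh by linarith
      then show "Z t = (if t = hi then {hi - n..b} \<union> {c..d} else {})" using b(4) out by auto
    qed
    moreover have "b < Q" "c < Q" "d < Q"
      by (rule bnd[OF le_SucI[OF b(1)] order_refl], rule bnd[OF b(2) order_refl], rule bnd[OF le_SucI[OF b(3)] order_refl])
    ultimately have "Z \<in> F2" unfolding F2_def uh(1)[symmetric] by (intro image_eqI[of _ _ "(b, c, d)"]) simp_all
    then show ?thesis by blast
  next
    case 3
    then have uh: "u = hi - 3" "hi - 2 = Suc u" "hi - 1 = Suc (Suc u)" "hi = Suc (Suc (Suc u))" using b0 assms(5) by simp_all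
    have c0: "cost n lo Z t = 0" if "t \<in> {Suc u..hi}" for t
      using 3(3) sum_nonneg_eq_0_iff[of "{Suc u..hi}" "cost n lo Z"] u5 that by auto
    have cs: "cost n lo Z (hi - 2) = 0" "cost n lo Z (hi - 1) = 0" "cost n lo Z hi = 0"
      by (rule c0, simp only: atLeastAtMost_iff, use uh(2-4) in linarith)+
    have lt: "u < hi - 2" "u < hi - 1" "u < hi" using uh(2-4) by linarith+
    have nf: "\<not> full n Z (hi - 2)" "\<not> full n Z (hi - 1)" "\<not> full n Z hi"
      by (rule conjunct2[OF u5[OF lt(1)]], rule conjunct2[OF u5[OF lt(2)]], rule conjunct2[OF u5[OF lt(3)]])
    have par: "odd (hi - 2)" "even (hi - 1)" "n < hi - 2" "n < hi - 1" unfolding uh(2,3) using b0 un by simp_all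
    from odd_high_cost_0[OF assms(1) par(1,3) nf(1) cs(1)] obtain b where b: "b \<le> (hi - 2) div 2" "Z (hi - 2) = {hi - 2 - n..b}" .
    from odd_high_cost_0[OF assms(1) oddh nf(3) cs(3)] obtain f where f: "f \<le> hi div 2" "Z hi = {hi - n..f}" .
    from even_high_growth_0[OF sub par(2,4) cost_0D(1)[OF assms(1) nf(2) cs(2)]] obtain c d where
      cd: "c \<le> (hi - 1) div 2" "d \<le> Suc ((hi - 1) div 2)" "Z (hi - 1) = {hi - 1 - n..c} \<union> {d..(hi - 1) div 2}" .
    let ?Y = "\<lambda>t. if t = hi - 2 then {hi - 2 - n..b}
      else if t = hi - 1 then {hi - 1 - n..c} \<union> {d..(hi - 1) div 2} else if t = hi then {hi - n..f} else {}"
    have "Z = dconf n lo u 1 0 0 ?Y"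
    proof (rule dconf_eqI[OF assms(1)])
      fix t assume "lo \<le> t" "t \<le> u"
      then show "Z t = (if 1 \<le> t \<and> t \<le> 0 then dent n 1 0 (t - 1) else row n t)" using rows_full[OF 3(2)] by (cases t) simp_all
    next
      fix t assume "u < t"
      then consider "t = hi - 2" | "t = hi - 1" "t \<noteq> hi - 2" | "t = hi" "t \<noteq> hi - 1" "t \<noteq> hi - 2"
        | "hi < t" "t \<noteq> hi" "t \<noteq> hi - 1" "t \<noteq> hi - 2" using uh by linarith
      then show "Z t = ?Y t"
      proof cases
        case 1
        show ?thesis unfolding 1 using b(2) by simp
      next
        case 2
        show ?thesis using 2(2) cd(3) unfolding 2(1) by simp
      next
        case 3
        show ?thesis using 3(2,3) f(2) unfolding 3(1) by simp
      next
        case 4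
        then show ?thesis using out[OF 4(1)] by simp
      qed
    qed
    moreover have "b < Q" "c < Q" "d < Q" "f < Q"
      by (rule bnd[OF le_SucI[OF b(1)] diff_le_self], rule bnd[OF le_SucI[OF cd(1)] diff_le_self],
        rule bnd[OF cd(2) diff_le_self], rule bnd[OF le_SucI[OF f(1)] order_refl])
    ultimately have "Z \<in> F3" unfolding F3_def uh(1)[symmetric] by (intro image_eqI[of _ _ "(b, c, d, f)"]) simp_all
    then show ?thesis by blast
  qed
qed

definition pairs2 :: "((nat \<Rightarrow> nat set) \<times> nat) set" where
  "pairs2 = (SIGMA Z:{Z \<in> configs n lo hi. excess n lo hi Z = 2}. opts r lo Z)"

text \<open>The late configurations and those counted through \<open>hA\<close> and
  \<open>hC\<close> miss \<open>r - 1\<close> in row \<open>lo\<close> and go only with the suffix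
  \<open>b = r\<close>; the others number at most \<open>12 Q^4\<close> and go with at most
  \<open>r\<close> suffixes each. The condition \<open>4 m <= r\<close> yields
  \<open>8 m + 1 <= 2 Q\<close> in the bound for the late ones.\<close>

lemma card_pairs2:
  assumes "5 \<le> m" "4 * m \<le> r"
  shows "finite pairs2" "card pairs2 \<le> 15 * Q ^ 5"
proof -
  have r3: "3 \<le> r" using assms by simp
  let ?S = "late2 n lo hi \<union> hA n lo hi \<union> hC n lo hi"
  let ?B = "hB n lo hi \<union> hD n lo hi \<union> hE n lo hi \<union> hF n lo hi \<union> hG n lo hi \<union> hH n lo hi \<union> F1 \<union> F2 \<union> F3"
  have p: "lo div 2 = r - 1" using r3 by simp
  have fl: "finite (late2 n lo hi)" by (rule finite_subset[of _ "configs n lo hi"]) (auto simp: late2_def)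
  have sub: "pairs2 \<subseteq> ?S \<times> {r} \<union> ?B \<times> {1..r}"
  proof
    fix q assume q: "q \<in> pairs2"
    obtain Z b where zb: "q = (Z, b)" by (rule prod.exhaust)
    have Z: "Z \<in> configs n lo hi" "excess n lo hi Z = 2" "b \<in> opts r lo Z" using q unfolding zb pairs2_def by simp_all
    have b: "b \<in> {1..r}" using Z(3) by (simp add: opts_def)
    have no: "b = r" if "r - 1 \<notin> Z lo" using Z(3) opts_no_end[where r = r and lo = lo and Z = Z, OF r_pos that] by simp
    show "q \<in> ?S \<times> {r} \<union> ?B \<times> {1..r}"
    proof (cases "nonfull n Z")
      case True
      show ?thesis
      proof (cases "Z lo = {}")
        case e: True
        have "Z \<in> late2 n lo hi" using True Z(1,2) e unfolding late2_def nonfull_def by blast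
        moreover have "b = r" using no e by simp
        ultimately show ?thesis unfolding zb by blast
      next
        case False
        interpret nonfull_conf n lo hi Z
          by unfold_locales (use Z(1) True n1 assms in simp_all)
        have "odd lo" using r3 by simp
        from odd_start[OF this Z(2) False] have
          "(Z \<in> hA n lo hi \<or> Z \<in> hC n lo hi) \<and> b = r \<or> Z \<in> ?B" using no unfolding p by blast
        then show ?thesis using b unfolding zb by blast
      qed
    next
      case False
      then obtain u0 where "full n Z u0" unfolding nonfull_def by blast
      from full_excess_2[OF Z(1,2) this _ r3] show ?thesis using b assms(1) unfolding zb by force
    qed
  qed
  have fin: "finite (?S \<times> {r} \<union> ?B \<times> {1..r})" using finite_heads[of n lo hi] fl card_F(1-3) by simp
  then show "finite pairs2" by (rule finite_subset[OF sub])
  have "lo div 2 + 4 \<le> Q" using p r3 assms by simp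
  note h = card_heads[OF this tails_bound[of 1, OF order_refl]]
  have lt: "lo < hi" using hi_n(2) .
  have late: "card (late2 n lo hi) \<le> 24 * Q ^ 4"
  proof -
    have e: "hi - lo = 2 * m" "hi div 2 \<le> Q" using r3 by simp_all
    have "4 * (2 * m) + 1 \<le> 2 * Q" using assms by simp
    then have s: "(4 * (hi - lo) + 1) ^ 2 \<le> (2 * Q) ^ 2" unfolding e(1) by (rule power_mono) simp
    have "2 * m * (hi div 2) + 1 \<le> Q * Q + 1 * 1"
      using mult_le_mono[of "2 * m" Q "hi div 2" Q] e(2) assms by simp
    also have "\<dots> \<le> Q * Q + Q * Q" by (intro add_mono mult_le_mono) simp_all
    finally have "(hi - lo) * (hi div 2) + 1 + (4 * (hi - lo) + 1) ^ 2 \<le> 2 * (Q * Q) + (2 * Q) ^ 2"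
      using s unfolding e(1) by linarith
    then have "((hi - lo) * (hi div 2) + 1 + (4 * (hi - lo) + 1) ^ 2) * (4 * (hi - lo) + 1) ^ 2
      \<le> (2 * (Q * Q) + (2 * Q) ^ 2) * (2 * Q) ^ 2" using s by (rule mult_le_mono)
    also have "\<dots> = 24 * Q ^ 4" by (rule power4_id(3))
    finally show ?thesis using card_late2[OF lt, of n] by linarith
  qed
  have "card ?S \<le> 24 * Q ^ 4 + Q ^ 4 + Q ^ 4" by (intro card_Un_bound late h)
  moreover have "card ?B \<le> Q ^ 4 + Q ^ 4 + Q ^ 4 + Q ^ 4 + Q ^ 4 + Q ^ 4 + 4 * Q ^ 4 + Q ^ 4 + Q ^ 4"
    by (intro card_Un_bound h card_F)
  ultimately have c: "card ?S \<le> 26 * Q ^ 4" "card ?B \<le> 12 * Q ^ 4" by simp_all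
  have "card pairs2 \<le> card (?S \<times> {r} \<union> ?B \<times> {1..r})" by (rule card_mono[OF fin sub])
  also have "\<dots> \<le> card ?S * 1 + card ?B * r"
    using card_Un_le[of "?S \<times> {r}" "?B \<times> {1..r}"] by (simp only: card_cartesian_product card_atLeastAtMost is_singletonI card_1_singleton_iff) simp
  also have "\<dots> \<le> 26 * Q ^ 4 * 1 + 12 * Q ^ 4 * r" by (intro add_mono mult_le_mono c order_refl)
  also have "\<dots> = (26 + 12 * r) * Q ^ 4" by (simp add: algebra_simps)
  also have "\<dots> \<le> (15 * Q) * Q ^ 4" by (rule mult_le_mono1) (use assms in simp)
  also have "\<dots> = 15 * Q ^ 5" by (rule power4_id(4))
  finally show "card pairs2 \<le> 15 * Q ^ 5" .
qed

end

section \<open>Low antichains of excess two\<close>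

context middle
begin

definition low2 :: "elt set set" where "low2 = {X \<in> low_anti. exc X = 2}"

text \<open>The elements of \<open>X\<close> on a level are those of its shadow there that do not
  cover the previous shadow.\<close>

lemma ups_determine:
  assumes "X \<in> low_anti" "X' \<in> low_anti" "\<And>D. 1 \<le> D \<Longrightarrow> D < T \<Longrightarrow> part X D = part X' D"
  shows "X = X'"
proof -
  have u: "ups k n X s = ups k n X' s" if "s < T" for s
  proof (cases "s = 0")
    case True
    have "ups k n Y 0 = {}" for Y by (auto simp: ups_def mem_poset)
    then show ?thesis unfolding True by simp
  next
    case False
    then have "1 \<le> T - s" "T - s < T" "T - (T - s) = s" using that by simp_all
    then show ?thesis using elts_part[of "T - s" X] elts_part[of "T - s" X'] assms(3)[of "T - s"] by simp
  qed
  have "Y \<subseteq> Y'" if "Y \<in> low_anti" "Y' \<in> low_anti" "\<And>s. s < T \<Longrightarrow> ups k n Y s = ups k n Y' s" for Y Y'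
  proof
    fix x assume x: "x \<in> Y"
    have "lev x < T" using that(1) x unfolding low_anti_def by simp
    moreover have "x \<in> P" using low_anti_sub[OF that(1)] x by blast
    then have "lev x \<noteq> 0" by (cases x) (simp add: mem_poset)
    then obtain s where s: "lev x = Suc s" using not0_implies_Suc by blast
    ultimately have "x \<in> {x \<in> Y. lev x = Suc s}" "s < T" "Suc s < T" using x by simp_all
    then have "x \<in> {x \<in> Y'. lev x = Suc s}" unfolding low_levels[OF that(1)] low_levels[OF that(2)] using that(3) by simp
    then show "x \<in> Y'" by simp
  qed
  then show ?thesis using assms(1,2) u by (metis subset_antisym)
qed

lemma ups_empty_mono:
  assumes "X \<in> low_anti" "ups k n X s' = {}" "s \<le> s'" "s' \<le> T"
  shows "ups k n X s = {}"
proof (rule equals0I)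
  fix y assume "y \<in> ups k n X s"
  then obtain x where x: "x \<in> X" "x \<le> y" "lev y = s" unfolding ups_def by blast
  then have "lev x \<le> s'" using lev_mono[of x y] assms(3) by simp
  then show False using ups_nonempty[OF low_anti_sub[OF assms(1)] x(1)] assms(2,4) by blast
qed

lemma part_empty: "ups k n X (T - D) = {} \<Longrightarrow> part X D = none"
  by (rule ext) (simp add: part_def cfg_def)

lemma pexc_none: "pexc D none = 0"
  by (simp add: pexc_def excess_def cost_empty)

text \<open>A coarse cover by families with at most two parameters; wall indices are shifted by
  \<open>n\<close> so that all parameters are below \<open>Q\<close>.\<close>

lemma confs1_image:
  assumes "2 \<le> m" "2 \<le> r"
  shows "confs1 \<subseteq> diag_conf ` {..<Q} \<union> (\<lambda>(s, e). wall_conf n (n + s) (n + e)) ` ({..<Q} \<times> {..<Q}) \<union>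
    (\<lambda>(a, b). corner_conf lo a b (Suc r)) ` ({..<Q} \<times> {..<Q}) \<union>
    (\<lambda>(a, c). corner_conf lo a (r - 1) c) ` ({..<Q} \<times> {..<Q}) \<union> full_conf n lo hi ` {..<Q}" (is "_ \<subseteq> ?U")
proof
  fix Z assume "Z \<in> confs1"
  then have Z: "Z \<in> configs n lo hi" "excess n lo hi Z = 1" by (simp_all add: confs1_def)
  have e: "lo + 1 = 2 * r" "hi + 1 = 2 * r + 2 * m" using assms by simp_all
  from excess_1_cases[OF Z(1) n1 e Z(2) assms] show "Z \<in> ?U"
  proof (elim disjE exE conjE)
    fix i assume "i < r + m" "Z = diag_conf i"
    then have "Z \<in> diag_conf ` {..<Q}" by (intro image_eqI[of _ _ i]) simp_all
    then show ?thesis by blast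
  next
    fix s e assume se: "n < s" "s \<le> e" "e \<le> hi" "Z = wall_conf n s e"
    then have "s - n < Q" "e - n < Q" using hi_n(3) by linarith+
    with se have "Z \<in> (\<lambda>(s, e). wall_conf n (n + s) (n + e)) ` ({..<Q} \<times> {..<Q})"
      using hi_n(3) by (intro image_eqI[of _ _ "(s - n, e - n)"]) simp_all
    then show ?thesis by blast
  next
    fix a b assume "a \<le> b" "b < r" "Z = corner_conf lo a b (Suc r)"
    then have "Z \<in> (\<lambda>(a, b). corner_conf lo a b (Suc r)) ` ({..<Q} \<times> {..<Q})"
      by (intro image_eqI[of _ _ "(a, b)"]) simp_all
    then show ?thesis by blast
  next
    fix a c assume "a < r" "c \<le> r" "Z = corner_conf lo a (r - 1) c"
    then have "Z \<in> (\<lambda>(a, c). corner_conf lo a (r - 1) c) ` ({..<Q} \<times> {..<Q})"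
      by (intro image_eqI[of _ _ "(a, c)"]) simp_all
    then show ?thesis by blast
  next
    fix y assume "y \<le> r + m" "Z = full_conf n lo hi y"
    then have "Z \<in> full_conf n lo hi ` {..<Q}" by (intro image_eqI[of _ _ y]) simp_all
    then show ?thesis by blast
  qed
qed

lemma card_confs1:
  assumes "2 \<le> m" "2 \<le> r"
  shows "finite confs1" "card confs1 \<le> 5 * Q ^ 2"
proof -
  let ?N = "{..<Q}"
  have 1: "card (f ` ?N) \<le> Q ^ 2" for f :: "nat \<Rightarrow> nat \<Rightarrow> nat set"
    using card_image_le[of ?N f] mult_le_mono1[of 1 Q Q] unfolding power2_eq_square by simp
  have 2: "card (f ` (?N \<times> ?N)) \<le> Q ^ 2" for f :: "nat \<times> nat \<Rightarrow> nat \<Rightarrow> nat set"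
    using card_image_le[of "?N \<times> ?N" f] by (simp only: card_cartesian_product card_lessThan power2_eq_square finite_cartesian_product finite_lessThan)
  show "finite confs1" by (rule finite_subset[OF confs1_image[OF assms]]) simp
  then have "card confs1 \<le> Q ^ 2 + Q ^ 2 + Q ^ 2 + Q ^ 2 + Q ^ 2"
    by (intro order_trans[OF card_mono[OF _ confs1_image[OF assms]]] card_Un_bound 1 2) simp
  then show "card confs1 \<le> 5 * Q ^ 2" by simp
qed

lemma part2_suf:
  assumes "pexc 2 (part X 2) = 0" "2 \<le> r"
  obtains b where "1 \<le> b" "b \<le> r" "part X 2 = suf b"
proof (cases "\<exists>t. part X 2 t \<noteq> {}")
  case True
  then obtain t where t: "part X 2 t \<noteq> {}" by blast
  have c2: "part X 2 \<in> configs n (2 * r - 2) (2 * r + 2 * m - 2)" using part_config[of 2 X] T_eq assms(2) by simp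
  have e2: "excess n (2 * r - 2) (2 * r + 2 * m - 2) (part X 2) = 0" using assms(1) by (simp add: pexc_def)
  have "2 * r - 2 + 2 = 2 * r" "2 * r + 2 * m - 2 + 2 = 2 * r + 2 * m" using assms by simp_all
  from excess_0_even[OF c2 n1 this e2 m_pos t] obtain b where
    "1 \<le> b" "b < r" "part X 2 = (\<lambda>t. if t = 2 * r - 2 then {b..<r} else {})" by blast
  then show ?thesis using that[of b] unfolding suf_def by simp
next
  case False
  then have "part X 2 = suf r" by (auto simp: suf_def fun_eq_iff)
  then show ?thesis using that[of r] assms by simp
qed

lemma opts_part:
  assumes "X \<in> low_anti" "part X 2 = suf b" "1 \<le> b" "b \<le> r"
  shows "b \<in> opts r lo (part X 1)"
proof -
  have T3: "2 < T" using T_eq m_pos by simp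
  have c1: "part X 1 \<in> configs n lo hi" using part_config[of 1 X] T3 by simp
  have u1: "ups k n X (T - 1) = elts (T - 1) (part X 1)" using elts_part[of 1 X] by simp
  have u2: "ups k n X (T - 2) = elts (T - 2) (suf b)" using elts_part[of 2 X] assms(2) by simp
  have "X \<in> antichains P" using assms(1) by (simp add: low_anti_def)
  from ups_Suc(1)[OF this, of "T - 2"] have "cov k n (ups k n X (T - 2)) \<subseteq> ups k n X (T - 1)"
    unfolding T_small(7) by blast
  then have "{b..<r} \<subseteq> part X 1 lo" unfolding u1 u2 elts_sub_iff[OF c1 assms(3)] .
  then show ?thesis using assms(3,4) by (simp add: opts_def)
qed

text \<open>The covers of one shadow belong to the shadow on the next level; here this is read off
  row by row.\<close>

lemma part_rise:
  assumes "X \<in> low_anti" "2 \<le> D" "D < T" "2 * r - D < t" "t \<le> T - D"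
  shows "rise n (t - 1) (part X D (t - 1)) \<union> part X D t \<subseteq> part X (D - 1) t"
proof -
  have lv: "ups k n X (T - D) \<subseteq> level k n (T - D)" by (rule ups_level)
  have t: "T - D - k < t" using assms(4) T_minus(1)[of D] by simp
  have S: "Suc (T - D) = T - (D - 1)" using assms(2,3) by simp
  have "X \<in> antichains P" using assms(1) by (simp add: low_anti_def)
  from ups_Suc(1)[OF this, of "T - D"] have "cov k n (ups k n X (T - D)) \<subseteq> ups k n X (T - (D - 1))" unfolding S by blast
  then have "cfg (Suc (T - D)) (cov k n (ups k n X (T - D))) t \<subseteq> cfg (T - (D - 1)) (ups k n X (T - (D - 1))) t"
    unfolding S cfg_def by blast
  then show ?thesis unfolding cfg_cov[OF lv t assms(5)] part_def .
qed

lemma rise_ne: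
  assumes "S \<subseteq> row n t" "S \<noteq> {}" "t \<le> n"
  shows "rise n t S \<noteq> {}"
proof
  assume "rise n t S = {}"
  then have "growth n t S = - int (card S)" by (simp add: growth_def)
  moreover have "growth n t S \<ge> 0" by (rule growth_nonneg[OF assms(1)]) (use assms(3) in simp)
  moreover have "card S \<noteq> 0" using assms(2) finite_row_subset[OF assms(1)] by simp
  ultimately show False by simp
qed

text \<open>A row of one level reappears one color up in the same row of the next level and, below
  the wall, has a nonempty rise in the row after it. If the next level has nothing beyond row
  \<open>2 r - D + 1\<close>, only row \<open>2 r - D\<close> can be occupied.\<close>

lemma part_collapse:
  assumes "X \<in> low_anti" "2 \<le> D" "D < 2 * r" "3 \<le> m" "\<And>t. 2 * r - D + 1 < t \<Longrightarrow> part X (D - 1) t = {}"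
  shows "part X D = (\<lambda>t. if t = 2 * r - D then part X D (2 * r - D) else {})"
    "rise n (2 * r - D) (part X D (2 * r - D)) \<subseteq> part X (D - 1) (2 * r - D + 1)"
proof -
  have DT: "D < T" "2 * r - D + 2 \<le> T - D" using assms(3,4) T_eq by simp_all
  have c: "part X D \<in> configs n (2 * r - D) (2 * r + 2 * m - D)" by (rule part_config[OF DT(1)])
  show "rise n (2 * r - D) (part X D (2 * r - D)) \<subseteq> part X (D - 1) (2 * r - D + 1)"
    using part_rise[OF assms(1,2) DT(1), of "2 * r - D + 1"] DT(2) by simp
  have e: "part X D t = {}" if "2 * r - D + 1 < t" for t
  proof (cases "t \<le> T - D")
    case True
    then show ?thesis using part_rise[OF assms(1,2) DT(1), of t] assms(5)[OF that] that by simp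
  next
    case False
    then have "2 * r + 2 * m - D < t" using T_eq by linarith
    then show ?thesis using configsD(4)[OF c] by simp
  qed
  have e1: "part X D (2 * r - D + 1) = {}"
  proof (rule ccontr)
    assume ne: "part X D (2 * r - D + 1) \<noteq> {}"
    have n': "2 * r - D + 1 \<le> n" using assms(2,4) n1 by linarith
    have d: "2 * r - D + 2 - 1 = 2 * r - D + 1" by simp
    have "rise n (2 * r - D + 1) (part X D (2 * r - D + 1)) \<subseteq> part X (D - 1) (2 * r - D + 2)"
      using part_rise[OF assms(1,2) DT(1) _ DT(2)] unfolding d by simp
    moreover have "part X (D - 1) (2 * r - D + 2) = {}" by (rule assms(5)) simp
    ultimately show False using rise_ne[OF configsD(1)[OF c] ne n'] by blast
  qed
  show "part X D = (\<lambda>t. if t = 2 * r - D then part X D (2 * r - D) else {})"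
  proof
    fix t
    consider "t < 2 * r - D" | "t = 2 * r - D" | "t = 2 * r - D + 1" | "2 * r - D + 1 < t" by linarith
    then show "part X D t = (if t = 2 * r - D then part X D (2 * r - D) else {})"
      using e[of t] e1 configsD(3)[OF c, of t] by cases simp_all
  qed
qed

definition single :: "nat \<Rightarrow> nat set \<Rightarrow> nat \<Rightarrow> nat set" where
  "single t0 S = (\<lambda>t. if t = t0 then S else {})"

lemma pexc_single:
  assumes "part X D = single (2 * r - D) S" "D < 2 * r"
  shows "pexc D (part X D) = growth n (2 * r - D) S"
proof -
  have "pexc D (part X D) = (\<Sum>t\<in>{2 * r - D}. cost n (2 * r - D) (part X D) t)"
    unfolding pexc_def by (rule excess_support) (use assms in \<open>auto simp: single_def\<close>)
  then show ?thesis by (simp add: cost_def assms(1) single_def)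
qed

text \<open>Contains the parts at distances 3 and 4 when these cost one and zero: a run in row
  \<open>2 r - 3\<close>, and underneath it nothing or a free suffix of row \<open>2 r - 4\<close>,
  which forces the run to reach the end \<open>r - 2\<close>.\<close>

definition W34 :: "((nat \<Rightarrow> nat set) \<times> (nat \<Rightarrow> nat set)) set" where
  "W34 = (\<lambda>(a, c). (single (2 * r - 3) {a..c}, none)) ` ({..<Q} \<times> {..<Q}) \<union>
    (\<lambda>(a, d). (single (2 * r - 3) {a..r - 2}, single (2 * r - 4) {d..r - 2})) ` ({..<Q} \<times> {..<Q})"

lemma card_W34: "finite W34" "card W34 \<le> 2 * Q ^ 2"
proof -
  show "finite W34" by (simp add: W34_def)
  have "card (f ` ({..<Q} \<times> {..<Q})) \<le> Q ^ 2" for f :: "nat \<times> nat \<Rightarrow> (nat \<Rightarrow> nat set) \<times> (nat \<Rightarrow> nat set)"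
    using card_image_le[of "{..<Q} \<times> {..<Q}" f] by (simp only: card_cartesian_product card_lessThan power2_eq_square finite_cartesian_product finite_lessThan)
  then have "card W34 \<le> Q ^ 2 + Q ^ 2" unfolding W34_def by (intro card_Un_bound)
  then show "card W34 \<le> 2 * Q ^ 2" by simp
qed

lemma parts34:
  assumes "X \<in> low_anti" "3 \<le> m" "3 \<le> r" "part X 2 = suf b" "pexc 3 (part X 3) = 1" "pexc 4 (part X 4) = 0"
  shows "(part X 3, part X 4) \<in> W34"
proof -
  have "part X 2 t = {}" if "2 * r - 3 + 1 < t" for t using that unfolding assms(4) suf_def by simp
  then have p3: "part X 3 = single (2 * r - 3) (part X 3 (2 * r - 3))"
    using part_collapse(1)[OF assms(1), of 3] assms(2,3) unfolding single_def by simp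
  define S where "S = part X 3 (2 * r - 3)"
  have e3: "part X 3 t = {}" if "2 * r - 4 + 1 < t" for t
  proof -
    have "t \<noteq> 2 * r - 3" using that assms(3) by linarith
    then show ?thesis using fun_cong[OF p3, of t] by (simp add: single_def)
  qed
  have q: "2 * r - 4 + 1 = 2 * r - 3" using assms(3) by simp
  have p4: "part X 4 = single (2 * r - 4) (part X 4 (2 * r - 4))"
    and s4: "rise n (2 * r - 4) (part X 4 (2 * r - 4)) \<subseteq> S"
    using part_collapse[OF assms(1), of 4] e3 assms(2,3) q unfolding single_def S_def by simp_all
  define R where "R = part X 4 (2 * r - 4)"
  have p3: "part X 3 = single (2 * r - 3) S" and p4: "part X 4 = single (2 * r - 4) R" and s4: "rise n (2 * r - 4) R \<subseteq> S"
    using p3 p4 s4 unfolding S_def R_def .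
  have T4: "4 < T" using T_eq assms(2) by simp
  have Sr: "S \<subseteq> row n (2 * r - 3)" unfolding S_def by (rule configsD(1)[OF part_config]) (use T4 in simp)
  have Rr: "R \<subseteq> row n (2 * r - 4)" unfolding R_def by (rule configsD(1)[OF part_config]) (use T4 in simp)
  have par: "odd (2 * r - 3)" "even (2 * r - 4)" "2 * r - 3 \<le> n" "2 * r - 4 \<le> n" "(2 * r - 4) div 2 = r - 2" "(2 * r - 3) div 2 = r - 2"
    using assms(2,3) n1 by auto
  have "growth n (2 * r - 3) S = 1" using pexc_single[OF p3] assms(3,5) by simp
  then have "card (ends S) = 1" using growth_odd_low[OF Sr par(1,3)] by simp
  from interval_if_card_ends_1[OF finite_row_subset[OF Sr] this] obtain a c where ac: "a \<le> c" "S = {a..c}" "c = Max S" .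
  have "c \<in> S" unfolding ac(2) using ac(1) by simp
  then have "c \<le> r - 2" using Sr par(6) by (auto simp: row_eq)
  then have acQ: "a < Q" "c < Q" using ac(1) by simp_all
  show ?thesis
  proof (cases "R = {}")
    case True
    have "part X 4 = none" unfolding p4 True single_def by simp
    then have "(part X 3, part X 4) = (single (2 * r - 3) {a..c}, none)" using p3 ac(2) by simp
    then have "(part X 3, part X 4) \<in> (\<lambda>(a, c). (single (2 * r - 3) {a..c}, none)) ` ({..<Q} \<times> {..<Q})"
      using acQ by (intro image_eqI[of _ _ "(a, c)"]) simp_all
    then show ?thesis unfolding W34_def by blast
  next
    case False
    have "growth n (2 * r - 4) R = 0" using pexc_single[OF p4] assms(3,6) by simp
    from growth_even_low_0[OF Rr par(2,4) this False] obtain d where d: "1 \<le> d" "d \<le> r - 2" "R = {d..r - 2}"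
      unfolding par(5) .
    have "r - 2 \<in> R" unfolding d(3) using d(2) by simp
    moreover have "r - 2 \<in> row n (Suc (2 * r - 4))" using assms(2,3) n1 by (auto simp: row_def)
    ultimately have "r - 2 \<in> S" using s4 unfolding rise_def by blast
    then have "c = r - 2" using \<open>c \<le> r - 2\<close> unfolding ac(2) by simp
    then have "(part X 3, part X 4) = (single (2 * r - 3) {a..r - 2}, single (2 * r - 4) {d..r - 2})"
      unfolding p3 p4 ac(2) d(3) by simp
    then have "(part X 3, part X 4) \<in> (\<lambda>(a, d). (single (2 * r - 3) {a..r - 2}, single (2 * r - 4) {d..r - 2})) ` ({..<Q} \<times> {..<Q})"
      using acQ d(2) by (intro image_eqI[of _ _ "(a, d)"]) simp_all
    then show ?thesis unfolding W34_def by blast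
  qed
qed

definition code4 :: "elt set \<Rightarrow> (nat \<Rightarrow> nat set) \<times> (nat \<Rightarrow> nat set) \<times> (nat \<Rightarrow> nat set) \<times> (nat \<Rightarrow> nat set)" where
  "code4 X = (part X 1, part X 2, part X 3, part X 4)"

text \<open>The two units are distributed over the distances 1 to 4 as \<open>2, 0, 0, 0\<close> or
  \<open>1, 1, 0, 0\<close> or \<open>1, 0, 1, 0\<close>; a cost of zero at distance 2 means a
  suffix.\<close>

definition codes :: "((nat \<Rightarrow> nat set) \<times> (nat \<Rightarrow> nat set) \<times> (nat \<Rightarrow> nat set) \<times> (nat \<Rightarrow> nat set)) set" where
  "codes = (\<lambda>(Z, b). (Z, suf b, none, none)) ` pairs2 \<union> (\<lambda>(Z, Y). (Z, Y, none, none)) ` (confs1 \<times> confs2) \<union>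
    (\<lambda>((Z, b), Y, Y'). (Z, suf b, Y, Y')) ` (pairs \<times> W34)"

text \<open>Nonempty shadows at the odd distances 1, 3 and 5 would cost three units, so level
  \<open>T - 5\<close> carries none; a shadow at distance 3 fixes the costs as
  \<open>1, 0, 1, 0\<close>.\<close>

lemma low2_code:
  assumes "X \<in> low2" "3 \<le> m" "3 \<le> r"
  shows "code4 X \<in> codes" "5 \<le> D \<Longrightarrow> D < T \<Longrightarrow> part X D = none"
proof -
  have X: "X \<in> low_anti" "exc X = 2" "X \<noteq> {}" using assms(1) by (auto simp: low2_def)
  have T5: "7 \<le> T" using T_eq assms(2) by simp
  obtain x where x: "x \<in> X" using X(3) by blast
  have "lev x < T" using X(1) x unfolding low_anti_def by simp
  then have "ups k n X (T - 1) \<noteq> {}" using ups_nonempty[OF low_anti_sub[OF X(1)] x] by simp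
  then have p1: "pexc 1 (part X 1) \<ge> 1" using pexc_pos_odd[of 1] T5 assms by simp
  have s: "(\<Sum>D\<in>S. pexc D (part X D)) \<le> 2" if "S \<subseteq> {1..<T}" for S using pexc_le_exc[OF X(1) that] X(2) by simp
  have u5: "ups k n X (T - 5) = {}"
  proof (rule ccontr)
    assume u5: "ups k n X (T - 5) \<noteq> {}"
    have u3: "ups k n X (T - 3) \<noteq> {}"
    proof
      assume "ups k n X (T - 3) = {}"
      moreover have "T - 5 \<le> T - 3" by (rule diff_le_mono2) simp
      ultimately show False using ups_empty_mono[OF X(1), of "T - 3" "T - 5"] u5 by simp
    qed
    have "pexc 5 (part X 5) \<ge> 1" "pexc 3 (part X 3) \<ge> 1"
      using pexc_pos_odd[of 5, OF _ _ _ u5] pexc_pos_odd[of 3, OF _ _ _ u3] T5 assms by simp_all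
    moreover have "(\<Sum>D\<in>{1, 3, 5}. pexc D (part X D)) \<le> 2" by (rule s) (use T5 in auto)
    ultimately show False using p1 by simp
  qed
  show none5: "part X D = none" if "5 \<le> D" "D < T" for D
    by (rule part_empty[OF ups_empty_mono[OF X(1) u5]]) (use that in auto)
  have nn: "pexc D (part X D) \<ge> 0" if "1 \<le> D" "D < T" for D using pexc_nonneg[OF that] .
  have c1: "part X 1 \<in> configs n lo hi" using part_config[of 1 X] T5 by simp
  have c2: "part X 2 \<in> configs n (2 * r - 2) (2 * r + 2 * m - 2)" using part_config[of 2 X] T5 by simp
  have r2: "2 \<le> r" using assms(3) by simp
  show "code4 X \<in> codes"
  proof (cases "ups k n X (T - 3) = {}")
    case True
    have n34: "part X D = none" if "3 \<le> D" "D < T" for D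
      by (rule part_empty[OF ups_empty_mono[OF X(1) True]]) (use that in auto)
    have "exc X = (\<Sum>D\<in>{1..<T}. pexc D (part X D))" by (rule exc_eq_sum[OF X(1)])
    also have "\<dots> = (\<Sum>D\<in>{1, 2}. pexc D (part X D))"
    proof (rule sum.mono_neutral_right)
      show "\<forall>D\<in>{1..<T} - {1, 2}. pexc D (part X D) = 0"
      proof
        fix D assume "D \<in> {1..<T} - {1, 2}"
        then have "3 \<le> D" "D < T" by auto
        then show "pexc D (part X D) = 0" using n34[of D] pexc_none by simp
      qed
    qed (use T5 in auto)
    finally have sum: "pexc 1 (part X 1) + pexc 2 (part X 2) = 2" using X(2) by simp
    have c4: "code4 X = (part X 1, part X 2, none, none)" unfolding code4_def using n34[of 3] n34[of 4] T5 by simp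
    have "pexc 2 (part X 2) \<ge> 0" using nn[of 2] T5 by simp
    then consider "pexc 1 (part X 1) = 2" "pexc 2 (part X 2) = 0" | "pexc 1 (part X 1) = 1" "pexc 2 (part X 2) = 1"
      using sum p1 by linarith
    then show ?thesis
    proof cases
      case 1
      from part2_suf[OF 1(2) r2] obtain b where b: "1 \<le> b" "b \<le> r" "part X 2 = suf b" .
      have "(part X 1, b) \<in> pairs2" using c1 1(1) opts_part[OF X(1) b(3,1,2)] by (simp add: pairs2_def pexc_def)
      then have "code4 X \<in> (\<lambda>(Z, b). (Z, suf b, none, none)) ` pairs2"
        using c4 b(3) by (intro image_eqI[of _ _ "(part X 1, b)"]) simp_all
      then show ?thesis unfolding codes_def by blast
    next
      case 2
      have "part X 1 \<in> confs1" "part X 2 \<in> confs2" using 2 c1 c2 by (simp_all add: confs1_def confs2_def pexc_def)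
      then have "code4 X \<in> (\<lambda>(Z, Y). (Z, Y, none, none)) ` (confs1 \<times> confs2)"
        using c4 by (intro image_eqI[of _ _ "(part X 1, part X 2)"]) simp_all
      then show ?thesis unfolding codes_def by blast
    qed
  next
    case False
    then have p3: "pexc 3 (part X 3) \<ge> 1" using pexc_pos_odd[of 3] T5 assms by simp
    have "(\<Sum>D\<in>{1, 2, 3, 4}. pexc D (part X D)) \<le> 2" by (rule s) (use T5 in auto)
    then have "pexc 1 (part X 1) + pexc 2 (part X 2) + pexc 3 (part X 3) + pexc 4 (part X 4) \<le> 2" by simp
    moreover have "pexc 2 (part X 2) \<ge> 0" "pexc 4 (part X 4) \<ge> 0" using nn T5 by simp_all
    ultimately have p: "pexc 1 (part X 1) = 1" "pexc 2 (part X 2) = 0" "pexc 3 (part X 3) = 1" "pexc 4 (part X 4) = 0"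
      using p1 p3 by linarith+
    from part2_suf[OF p(2) r2] obtain b where b: "1 \<le> b" "b \<le> r" "part X 2 = suf b" .
    have "(part X 1, b) \<in> pairs" using c1 p(1) opts_part[OF X(1) b(3,1,2)] by (simp add: pairs_def confs1_def pexc_def)
    then have "code4 X \<in> (\<lambda>((Z, b), Y, Y'). (Z, suf b, Y, Y')) ` (pairs \<times> W34)"
      using parts34[OF X(1) assms(2,3) b(3) p(3,4)] b(3)
      by (intro image_eqI[of _ _ "((part X 1, b), part X 3, part X 4)"]) (simp_all add: code4_def)
    then show ?thesis unfolding codes_def by blast
  qed
qed

lemma pairs_bound: "2 \<le> m \<Longrightarrow> 2 \<le> r \<Longrightarrow> card pairs \<le> Q ^ 3"
proof -
  assume mr: "2 \<le> m" "2 \<le> r"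
  have "2 * r ^ 3 + 15 * r ^ 2 + r + 3 * m ^ 2 + 9 * m \<le> 6 * Q ^ 3"
    by (simp add: power3_eq_cube power2_eq_square algebra_simps)
  then have "6 * card pairs + 6 \<le> 6 * Q ^ 3" unfolding card_pairs[OF mr] .
  moreover define z where "z = Q ^ 3"
  ultimately have "6 * card pairs + 6 \<le> 6 * z" by simp
  then show ?thesis unfolding z_def[symmetric] by linarith
qed

text \<open>The three kinds of codes contribute \<open>15 Q^5\<close>, \<open>5 Q^2 * 6 Q^3\<close>
  and \<open>Q^3 * 2 Q^2\<close>, together \<open>47 Q^5\<close>.\<close>

lemma card_low2:
  assumes "5 \<le> m" "4 * m \<le> r"
  shows "finite low2" "card low2 \<le> 47 * Q ^ 5"
proof -
  have m3: "3 \<le> m" "2 \<le> m" "4 \<le> m" and r3: "3 \<le> r" "2 \<le> r" using assms by simp_all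
  show "finite low2" unfolding low2_def by simp
  have inj: "inj_on code4 low2"
  proof (rule inj_onI)
    fix X Y assume a: "X \<in> low2" "Y \<in> low2" "code4 X = code4 Y"
    then have "X \<in> low_anti" "Y \<in> low_anti" by (simp_all add: low2_def)
    then show "X = Y"
    proof (rule ups_determine)
      fix D assume D: "1 \<le> D" "D < T"
      show "part X D = part Y D"
      proof (cases "5 \<le> D")
        case True
        then show ?thesis using low2_code(2)[OF a(1) m3(1) r3(1) True D(2)] low2_code(2)[OF a(2) m3(1) r3(1) True D(2)] by simp
      next
        case False
        then have "D = 1 \<or> D = 2 \<or> D = 3 \<or> D = 4" using D(1) by linarith
        then show ?thesis using a(3) unfolding code4_def by auto
      qed
    qed
  qed
  note p2 = card_pairs2[OF assms]
  note c1 = card_confs1[OF m3(2) r3(2)]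
  have f2: "finite confs2" unfolding confs2_def by simp
  have fc: "finite codes" unfolding codes_def using p2(1) c1(1) f2 finite_pairs card_W34(1) by simp
  have "card ((\<lambda>(Z, b). (Z, suf b, none, none)) ` pairs2) \<le> 15 * Q ^ 5"
    using card_image_le[OF p2(1)] p2(2) order_trans by blast
  moreover have "card ((\<lambda>(Z, Y). (Z, Y, none, none)) ` (confs1 \<times> confs2)) \<le> 5 * Q ^ 2 * (6 * Q ^ 3)"
    by (rule order_trans[OF card_image_le]) (use c1(1) f2 in simp, simp only: card_cartesian_product,
      rule mult_le_mono[OF c1(2) card_confs2[OF m3(3) r3(1)]])
  moreover have "card ((\<lambda>((Z, b), Y, Y'). (Z, suf b, Y, Y')) ` (pairs \<times> W34)) \<le> Q ^ 3 * (2 * Q ^ 2)"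
    by (rule order_trans[OF card_image_le]) (use finite_pairs card_W34(1) in simp, simp only: card_cartesian_product,
      rule mult_le_mono[OF pairs_bound[OF m3(2) r3(2)] card_W34(2)])
  ultimately have "card codes \<le> 15 * Q ^ 5 + 5 * Q ^ 2 * (6 * Q ^ 3) + Q ^ 3 * (2 * Q ^ 2)"
    unfolding codes_def by (intro card_Un_bound)
  also have "\<dots> = 47 * Q ^ 5"
  proof -
    have "15 * q ^ 5 + 5 * q ^ 2 * (6 * q ^ 3) + q ^ 3 * (2 * q ^ 2) = 47 * q ^ 5" for q :: nat
      by (simp add: numeral_eq_Suc algebra_simps)
    then show ?thesis .
  qed
  finally have "card codes \<le> 47 * Q ^ 5" .
  moreover have "card low2 \<le> card codes"
    by (rule card_inj_on_le[OF inj _ fc]) (use low2_code(1)[OF _ m3(1) r3(1)] in blast)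
  ultimately show "card low2 \<le> 47 * Q ^ 5" by linarith
qed

end

section \<open>The two coefficients next to the ends\<close>

lemma sum_first: "2 * (\<Sum>i\<in>{1..q}. i) = q * (q + 1)" for q :: nat
  by (induction q) (simp_all add: algebra_simps)

lemma sum_squares: "6 * (\<Sum>i\<in>{1..q}. i * i) = q * (q + 1) * (2 * q + 1)" for q :: nat
  by (induction q) (simp_all add: algebra_simps)

lemma sum_below: "i \<le> Suc j \<Longrightarrow> 2 * (\<Sum>a\<in>{1..i}. Suc j - a) + i * i = i * (2 * j + 1)" for i j :: nat
proof (induction i)
  case (Suc i)
  then obtain d where "j = i + d" using le_iff_add by auto
  then show ?case using Suc by (simp add: algebra_simps)
qed simp

lemma sum_below2: "6 * (\<Sum>i\<in>{1..j}. \<Sum>a\<in>{1..i}. Suc j - a) = j * (j + 1) * (2 * j + 1)" for j :: nat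
proof -
  have "(\<Sum>i\<in>{1..j}. 2 * (\<Sum>a\<in>{1..i}. Suc j - a) + i * i) = (\<Sum>i\<in>{1..j}. i * (2 * j + 1))"
    by (rule sum.cong) (auto simp: sum_below)
  then have "2 * (\<Sum>i\<in>{1..j}. \<Sum>a\<in>{1..i}. Suc j - a) + (\<Sum>i\<in>{1..j}. i * i) = (\<Sum>i\<in>{1..j}. i) * (2 * j + 1)"
    by (simp only: sum.distrib sum_distrib_left sum_distrib_right)
  then have "6 * (2 * (\<Sum>i\<in>{1..j}. \<Sum>a\<in>{1..i}. Suc j - a)) + 6 * (\<Sum>i\<in>{1..j}. i * i)
      = 3 * ((2 * (\<Sum>i\<in>{1..j}. i)) * (2 * j + 1))"
    by (simp add: algebra_simps)
  then show ?thesis unfolding sum_first sum_squares by (simp add: algebra_simps)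
qed

lemma sum_rows: "2 * (\<Sum>j\<in>{1..n}. j * (j + 1) * (2 * j + 1)) = n * (n + 1) * (n + 1) * (n + 2)" for n :: nat
  by (induction n) (simp_all add: algebra_simps)

lemma below_H:
  assumes "(i, j) \<in> H n"
  shows "{x \<in> H n. x \<le> (i, j)} = (SIGMA a:{1..i}. {a..j})"
  using assms by (auto simp: H_def chain_def)

lemma finite_H [simp]: "finite (H n)"
  by (rule finite_subset[of _ "{..n} \<times> {..n}"]) (auto simp: H_def chain_def)

text \<open>Below \<open>(i, j)\<close> lie the points \<open>(a, b)\<close> with
  \<open>a <= i\<close> and \<open>a <= b <= j\<close>, that is \<open>j + 1 - a\<close> points for
  each \<open>a\<close>; the sums over \<open>i\<close> and then over \<open>j\<close> are closed
  forms.\<close>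

lemma comparable_H: "12 * card {(x, y). x \<in> H n \<and> y \<in> H n \<and> x \<le> y} = n * (n + 1) * (n + 1) * (n + 2)"
proof -
  let ?g = "\<lambda>i j. \<Sum>a\<in>{1..i}. Suc j - a"
  have "{(x, y). x \<in> H n \<and> y \<in> H n \<and> x \<le> y} = prod.swap ` (SIGMA y:H n. {x \<in> H n. x \<le> y})" by auto
  then have "card {(x, y). x \<in> H n \<and> y \<in> H n \<and> x \<le> y} = card (SIGMA y:H n. {x \<in> H n. x \<le> y})"
    by (simp add: card_image)
  also have "\<dots> = (\<Sum>y\<in>H n. card {x \<in> H n. x \<le> y})" by simp
  also have "\<dots> = (\<Sum>(i, j)\<in>H n. ?g i j)"
  proof (rule sum.cong[OF refl])
    fix y assume y: "y \<in> H n"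
    obtain i j where ij: "y = (i, j)" by (rule prod.exhaust)
    show "card {x \<in> H n. x \<le> y} = (case y of (i, j) \<Rightarrow> ?g i j)"
      using below_H[of i j n] y unfolding ij by simp
  qed
  also have "\<dots> = (\<Sum>(j, i)\<in>(SIGMA j:{1..n}. {1..j}). ?g i j)"
    by (rule sum.reindex_bij_witness[of _ prod.swap prod.swap]) (auto simp: H_def chain_def)
  also have "\<dots> = (\<Sum>j\<in>{1..n}. \<Sum>i\<in>{1..j}. ?g i j)" by (subst sum.Sigma) simp_all
  finally have "6 * card {(x, y). x \<in> H n \<and> y \<in> H n \<and> x \<le> y} = (\<Sum>j\<in>{1..n}. 6 * (\<Sum>i\<in>{1..j}. ?g i j))"
    by (simp only: sum_distrib_left)
  then show ?thesis using sum_rows[of n] unfolding sum_below2 by simp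
qed

lemma comparable_chain: "2 * card {(c, d). c \<in> chain k \<and> d \<in> chain k \<and> c \<le> d} = k * (k + 1)"
proof -
  have "{(c, d). c \<in> chain k \<and> d \<in> chain k \<and> c \<le> d} = prod.swap ` (SIGMA d:{1..k}. {1..d})"
    by (auto simp: chain_def)
  then have "card {(c, d). c \<in> chain k \<and> d \<in> chain k \<and> c \<le> d} = (\<Sum>d\<in>{1..k}. d)"
    by (simp add: card_image)
  then show ?thesis by (simp only: sum_first)
qed

lemma comparable_poset:
  "24 * card {(x, y). x \<in> poset k n \<and> y \<in> poset k n \<and> x \<le> y} = k * (k + 1) * (n * (n + 1) * (n + 1) * (n + 2))"
proof -
  let ?C = "{(c, d). c \<in> chain k \<and> d \<in> chain k \<and> c \<le> d}" and ?E = "{(x, y). x \<in> H n \<and> y \<in> H n \<and> x \<le> y}"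
  let ?f = "\<lambda>((c, d), (x, y)). ((c, x), (d, y)) :: elt \<times> elt"
  have "{(x, y). x \<in> poset k n \<and> y \<in> poset k n \<and> x \<le> y} = ?f ` (?C \<times> ?E)"
  proof (intro equalityI subsetI)
    fix p assume p: "p \<in> {(x, y). x \<in> poset k n \<and> y \<in> poset k n \<and> x \<le> y}"
    obtain c x d y where e: "p = ((c, x), (d, y))" by (metis prod.exhaust)
    have "(c, d) \<in> ?C" "(x, y) \<in> ?E" using p unfolding e poset_def by (simp_all add: less_eq_prod_def)
    then show "p \<in> ?f ` (?C \<times> ?E)" unfolding e by (intro image_eqI[of _ _ "((c, d), (x, y))"]) simp_all
  next
    fix p assume "p \<in> ?f ` (?C \<times> ?E)"
    then obtain q where q: "q \<in> ?C \<times> ?E" "p = ?f q" by blast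
    obtain c d x y where "q = ((c, d), (x, y))" by (metis prod.exhaust)
    with q have "p = ((c, x), (d, y))" "(c, d) \<in> ?C" "(x, y) \<in> ?E" by simp_all
    then show "p \<in> {(x, y). x \<in> poset k n \<and> y \<in> poset k n \<and> x \<le> y}" unfolding poset_def by simp
  qed
  moreover have "inj_on ?f (?C \<times> ?E)" by (rule inj_onI) auto
  ultimately have "card {(x, y). x \<in> poset k n \<and> y \<in> poset k n \<and> x \<le> y} = card ?C * card ?E"
    by (simp only: card_image card_cartesian_product)
  then have "24 * card {(x, y). x \<in> poset k n \<and> y \<in> poset k n \<and> x \<le> y} = (2 * card ?C) * (12 * card ?E)" by simp
  then show ?thesis unfolding comparable_chain comparable_H by simp
qed

context middle
begin

abbreviation "ncomp \<equiv> card {(x, y). x \<in> P \<and> y \<in> P \<and> x \<le> y}"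

text \<open>\<open>ncomp\<close> includes the reflexive pairs, hence \<open>card P\<close> on the
  left. A subset of two elements that is no antichain comes from a strictly comparable pair.\<close>

lemma acount_2_ge: "(card P choose 2) + card P \<le> acount 2 + ncomp"
proof -
  let ?C = "{(x, y). x \<in> P \<and> y \<in> P \<and> x \<le> y}" and ?D = "{(x, y). x \<in> P \<and> y \<in> P \<and> x \<le> y \<and> x \<noteq> y}"
  have finC: "finite ?C" by (rule finite_subset[of _ "P \<times> P"]) auto
  have finD: "finite ?D" by (rule finite_subset[OF _ finC]) auto
  have "?C = (\<lambda>x. (x, x)) ` P \<union> ?D"
  proof (intro equalityI subsetI)
    fix p assume p: "p \<in> ?C"
    obtain x y where e: "p = (x, y)" by (rule prod.exhaust)
    show "p \<in> (\<lambda>x. (x, x)) ` P \<union> ?D" using p unfolding e by (cases "x = y") simp_all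
  next
    fix p assume "p \<in> (\<lambda>x. (x, x)) ` P \<union> ?D"
    then show "p \<in> ?C" by (elim UnE imageE) auto
  qed
  moreover have "(\<lambda>x. (x, x)) ` P \<inter> ?D = {}" by auto
  ultimately have "card ?C = card ((\<lambda>x. (x, x)) ` P) + card ?D"
    using card_Un_disjoint[of "(\<lambda>x. (x, x)) ` P" ?D] finD by simp
  moreover have "inj_on (\<lambda>x. (x, x)) P" by (rule inj_onI) simp
  ultimately have c: "card ?C = card P + card ?D" by (simp add: card_image)
  let ?S = "{A. A \<subseteq> P \<and> card A = 2}" and ?A = "{A \<in> antichains P. card A = 2}"
  have "?S \<subseteq> ?A \<union> (\<lambda>(x, y). {x, y}) ` ?D"
  proof
    fix A assume A: "A \<in> ?S"
    then have AP: "A \<subseteq> P" "card A = 2" by simp_all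
    obtain x y where xy: "A = {x, y}" "x \<noteq> y" using AP(2) card_2_iff by metis
    have xyP: "x \<in> P" "y \<in> P" using AP(1) xy(1) by simp_all
    show "A \<in> ?A \<union> (\<lambda>(x, y). {x, y}) ` ?D"
    proof (cases "A \<in> antichains P")
      case True
      then show ?thesis using AP(2) by simp
    next
      case False
      then have "x \<le> y \<or> y \<le> x" using AP(1) unfolding antichain_iff xy(1) by auto
      then have "(x, y) \<in> ?D \<or> (y, x) \<in> ?D" using xy(2) xyP by simp
      then show ?thesis
      proof
        assume D: "(x, y) \<in> ?D"
        have "A \<in> (\<lambda>(x, y). {x, y}) ` ?D"
          by (rule image_eqI[of _ _ "(x, y)", OF _ D]) (use xy(1) in simp)
        then show ?thesis by (rule UnI2)
      next
        assume D: "(y, x) \<in> ?D"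
        have "A \<in> (\<lambda>(x, y). {x, y}) ` ?D"
          by (rule image_eqI[of _ _ "(y, x)", OF _ D]) (use xy(1) in \<open>simp add: insert_commute\<close>)
        then show ?thesis by (rule UnI2)
      qed
    qed
  qed
  then have "card ?S \<le> card (?A \<union> (\<lambda>(x, y). {x, y}) ` ?D)" by (rule card_mono[rotated]) (use finD in simp)
  also have "\<dots> \<le> card ?A + card ?D" by (rule card_Un_bound[OF order_refl card_image_le[OF finD]])
  finally have "(card P choose 2) \<le> acount 2 + card ?D" unfolding acount_def using n_subsets[OF finite_poset, of k n 2] by simp
  then show ?thesis using c by linarith
qed

text \<open>A deficiency of 2 is divided among the low part, the high part and the missing elements,
  and by \<open>parts_inj\<close> this triple determines the antichain. Low and high parts need not
  be compatible, so only an upper bound results.\<close>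

lemma acount_w2_le: "acount (w - 2) \<le> (w choose 2) + 2 * (card low1 * w) + card low1 * card low1 + 2 * card low2"
  if "2 \<le> w"
proof -
  let ?S = "{A \<in> antichains P. card A = w - 2}"
  let ?f = "\<lambda>A. (low A, high A, rest A)"
  let ?E = "{{}} :: elt set set"
  let ?R1 = "(\<lambda>x. {x}) ` M" and ?R2 = "{R. R \<subseteq> M \<and> card R = 2}"
  let ?U1 = "?E \<times> ?E \<times> ?R2" and ?U2 = "low1 \<times> ?E \<times> ?R1" and ?U3 = "?E \<times> low1 \<times> ?R1"
    and ?U4 = "low1 \<times> low1 \<times> ?E" and ?U5 = "low2 \<times> ?E \<times> ?E" and ?U6 = "?E \<times> low2 \<times> ?E"
  have fM: "finite M" by simp
  have fR2: "finite ?R2" by (rule finite_subset[of _ "Pow M"]) (use fM in auto)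
  have f2: "finite low2" unfolding low2_def by simp
  have inj: "inj_on ?f ?S"
  proof (rule inj_onI)
    fix A B assume A: "A \<in> ?S" and B: "B \<in> ?S" and e: "?f A = ?f B"
    have A': "A \<in> antichains P \<and> card A = w - 2" using A by (simp only: mem_Collect_eq)
    have B': "B \<in> antichains P \<and> card B = w - 2" using B by (simp only: mem_Collect_eq)
    have "A \<in> antichains P" using A' by (rule conjunct1)
    moreover have "B \<in> antichains P" using B' by (rule conjunct1)
    moreover have "low A = low B" "high A = high B" "rest A = rest B" using e by (simp_all only: prod.inject)
    ultimately show "A = B" by (rule parts_inj)
  qed
  have sub: "?f ` ?S \<subseteq> ?U1 \<union> ?U2 \<union> ?U3 \<union> ?U4 \<union> ?U5 \<union> ?U6"
  proof (rule image_subsetI)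
    fix A assume "A \<in> ?S"
    then have A: "A \<in> antichains P" "card A = w - 2" by simp_all
    have s: "exc (low A) + exc (high A) + int (card (rest A)) = 2"
    proof -
      have "int (card A) = int w - 2" using that unfolding A(2) by (simp only: of_nat_diff of_nat_numeral)
      then show ?thesis using antichain_parts(7)[OF A(1)] by linarith
    qed
    have l: "low A \<in> low_anti" "high A \<in> low_anti" using low_low_anti[OF A(1)] high_low_anti[OF A(1)] .
    have rM: "rest A \<subseteq> M" unfolding rest_def by blast
    have e0: "exc (low A) = 0 \<Longrightarrow> low A = {}" "exc (high A) = 0 \<Longrightarrow> high A = {}"
      using low_empty_if[OF A(1)] high_empty_if[OF A(1)] by simp_all
    have r0: "card (rest A) = 0 \<Longrightarrow> rest A = {}" using finite_rest by simp
    have r1: "rest A \<in> ?R1" if "card (rest A) = 1"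
    proof -
      from that obtain x where x: "rest A = {x}" by (rule card_1_singletonE)
      have "x \<in> rest A" unfolding x by (rule singletonI)
      then have "x \<in> M" by (rule subsetD[OF rM])
      then show ?thesis using x by (rule rev_image_eqI)
    qed
    have nn: "exc (low A) \<ge> 0" "exc (high A) \<ge> 0" using exc_parts[OF A(1)] .
    consider "exc (low A) = 0" "exc (high A) = 0" "card (rest A) = 2" | "exc (low A) = 1" "exc (high A) = 0" "card (rest A) = 1"
      | "exc (low A) = 0" "exc (high A) = 1" "card (rest A) = 1" | "exc (low A) = 1" "exc (high A) = 1" "card (rest A) = 0"
      | "exc (low A) = 2" "exc (high A) = 0" "card (rest A) = 0" | "exc (low A) = 0" "exc (high A) = 2" "card (rest A) = 0"
    proof -
      have "exc (low A) = 0 \<or> exc (low A) = 1 \<or> exc (low A) = 2" using s nn by linarith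
      moreover have "exc (high A) = 0 \<or> exc (high A) = 1 \<or> exc (high A) = 2" using s nn by linarith
      moreover have "card (rest A) = 0 \<or> card (rest A) = 1 \<or> card (rest A) = 2" using s nn by linarith
      ultimately show thesis using s that by (elim disjE) simp_all
    qed
    then show "?f A \<in> ?U1 \<union> ?U2 \<union> ?U3 \<union> ?U4 \<union> ?U5 \<union> ?U6"
    proof cases
      case 1
      have "low A = {}" "high A = {}" by (rule e0(1)[OF 1(1)], rule e0(2)[OF 1(2)])
      moreover have "rest A \<in> ?R2" using rM 1(3) by (simp only: mem_Collect_eq)
      ultimately have "?f A \<in> ?U1" by (simp only: mem_Sigma_iff singleton_iff)
      then show ?thesis by blast
    next
      case 2
      have "low A \<in> low1" using 2(1) l(1) unfolding low1_def by (simp only: mem_Collect_eq)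
      moreover have "high A = {}" by (rule e0(2)[OF 2(2)])
      moreover have "rest A \<in> ?R1" by (rule r1[OF 2(3)])
      ultimately have "?f A \<in> ?U2" by (simp only: mem_Sigma_iff singleton_iff)
      then show ?thesis by blast
    next
      case 3
      have "high A \<in> low1" using 3(2) l(2) unfolding low1_def by (simp only: mem_Collect_eq)
      moreover have "low A = {}" by (rule e0(1)[OF 3(1)])
      moreover have "rest A \<in> ?R1" by (rule r1[OF 3(3)])
      ultimately have "?f A \<in> ?U3" by (simp only: mem_Sigma_iff singleton_iff)
      then show ?thesis by blast
    next
      case 4
      have "low A \<in> low1" "high A \<in> low1" using 4(1,2) l unfolding low1_def by (simp_all only: mem_Collect_eq)
      moreover have "rest A = {}" by (rule r0[OF 4(3)])
      ultimately have "?f A \<in> ?U4" by (simp only: mem_Sigma_iff singleton_iff)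
      then show ?thesis by blast
    next
      case 5
      have "low A \<in> low2" using 5(1) l(1) unfolding low2_def by (simp only: mem_Collect_eq)
      moreover have "high A = {}" "rest A = {}" by (rule e0(2)[OF 5(2)], rule r0[OF 5(3)])
      ultimately have "?f A \<in> ?U5" by (simp only: mem_Sigma_iff singleton_iff)
      then show ?thesis by blast
    next
      case 6
      have "high A \<in> low2" using 6(2) l(2) unfolding low2_def by (simp only: mem_Collect_eq)
      moreover have "low A = {}" "rest A = {}" by (rule e0(1)[OF 6(1)], rule r0[OF 6(3)])
      ultimately have "?f A \<in> ?U6" by (simp only: mem_Sigma_iff singleton_iff)
      then show ?thesis by blast
    qed
  qed
  have cR1: "card ?R1 = w" by (simp add: card_image w_def)
  have cR2: "card ?R2 = w choose 2" unfolding w_def by (rule n_subsets) simp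
  have "acount (w - 2) \<le> card (?U1 \<union> ?U2 \<union> ?U3 \<union> ?U4 \<union> ?U5 \<union> ?U6)"
    unfolding acount_def by (rule card_inj_on_le[OF inj sub]) (use fR2 f2 in simp)
  also have "\<dots> \<le> (w choose 2) + card low1 * w + card low1 * w + card low1 * card low1 + card low2 + card low2"
  proof (intro card_Un_bound)
    show "card ?U1 \<le> w choose 2" "card ?U2 \<le> card low1 * w" "card ?U3 \<le> card low1 * w"
      "card ?U4 \<le> card low1 * card low1" "card ?U5 \<le> card low2" "card ?U6 \<le> card low2"
      by (simp_all only: card_cartesian_product cR1 cR2) simp_all
  qed
  also have "\<dots> = (w choose 2) + 2 * (card low1 * w) + card low1 * card low1 + 2 * card low2" by simp
  finally show ?thesis .
qed

text \<open>With \<open>card low1 = card lower = l\<close> the terms \<open>2 l w\<close> cancel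
  between the degrees 2 and \<open>w - 2\<close>: expanding \<open>(w + 2 l) choose 2\<close> leaves
  \<open>l (2 l - 1)\<close> on one side against \<open>l^2\<close> on the other.\<close>

lemma palindromic_second:
  assumes "palindromic (antichain_poly P)" "2 \<le> w"
  shows "card lower * card lower + w + card lower \<le> 2 * card low2 + ncomp"
proof -
  let ?f = "antichain_poly P"
  have "coeff ?f 2 = coeff ?f (w - 2)" using assms unfolding palindromic_def degree_P by blast
  then have "acount 2 = acount (w - 2)" unfolding coeff_P by simp
  then have "acount 2 \<le> (w choose 2) + 2 * (card low1 * w) + card low1 * card low1 + 2 * card low2"
    using acount_w2_le[OF assms(2)] by (simp only:)
  then have le: "(card P choose 2) + card P \<le> (w choose 2) + 2 * (card low1 * w) + card low1 * card low1 + 2 * card low2 + ncomp"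
    by (rule order_trans[OF acount_2_ge add_right_mono])
  define l where "l = card lower"
  have low1: "card low1 = l" using palindromic_low1[OF assms(1)] by (simp add: l_def)
  have cP: "card P = w + 2 * l" using card_P by (simp add: l_def)
  have ch: "int x * (int x - 1) = 2 * int (x choose 2)" for x
  proof (cases x)
    case (Suc y)
    have "even (x * (x - 1))" by (cases "even x") simp_all
    then have "2 * (x choose 2) = x * (x - 1)" unfolding choose_two by (rule dvd_mult_div_cancel)
    then have "int (2 * (x choose 2)) = int (x * (x - 1))" by (simp only:)
    then show ?thesis using Suc by (simp add: algebra_simps)
  qed simp
  have "int ((card P choose 2) + card P) \<le> int ((w choose 2) + 2 * (card low1 * w) + card low1 * card low1 + 2 * card low2 + ncomp)"
    using le by (simp only: of_nat_le_iff)
  then have "2 * int (card P choose 2) + 2 * int (card P) \<le> 2 * int (w choose 2) + 4 * (int l * int w) + 2 * (int l * int l)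
      + 4 * int (card low2) + 2 * int ncomp"
    unfolding low1 by simp
  then have "int (w + 2 * l) * (int (w + 2 * l) - 1) + 2 * int (w + 2 * l) \<le> int w * (int w - 1) + 4 * (int l * int w) + 2 * (int l * int l)
      + 4 * int (card low2) + 2 * int ncomp"
    unfolding ch[of "card P", symmetric] ch[of w, symmetric] unfolding cP .
  then have "int l * int l + int w + int l \<le> 2 * int (card low2) + int ncomp" by (simp add: algebra_simps)
  then have "int (l * l + w + l) \<le> int (2 * card low2 + ncomp)" by simp
  then show ?thesis unfolding of_nat_le_iff l_def .
qed

end

text \<open>Here \<open>y\<close> stands for \<open>n + 1\<close>. To leading order the right side
  is \<open>m^2 y^4 / 4\<close> and the comparable pairs are \<open>m^2 y^4 / 6\<close>. The
  difference \<open>m^2 y^4 / 12\<close> exceeds \<open>5 y^5\<close> for \<open>y <= 15 m\<close>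
  once \<open>m\<close> is above 900; this is the origin of 910.\<close>

lemma big_estimate:
  fixes m y :: real
  assumes "910 \<le> m" "13 * m \<le> y" "y \<le> 15 * m"
  shows "94 * ((y + m + 4) / 2) ^ 5 + (2 * m + 1) * (2 * m + 2) * ((y - 1) * y * y * (y + 1)) / 24
    < ((2 * m + 1) * y * (y - 2) / 4) ^ 2"
proof -
  have y0: "0 < y" "11830 \<le> y" using assms by linarith+
  have "10 * m + 40 \<le> y" using assms by linarith
  \<comment> \<open>The factor 11/20 is small enough to bring 94 times its fifth power below
    5.\<close>
  then have "(y + m + 4) / 2 \<le> 11 / 20 * y" by (simp add: field_simps)
  then have "((y + m + 4) / 2) ^ 5 \<le> (11 / 20 * y) ^ 5" by (rule power_mono) (use assms y0 in simp)
  also have "\<dots> = 161051 / 3200000 * y ^ 5" by (simp add: power_mult_distrib power_divide)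
  finally have 1: "94 * ((y + m + 4) / 2) ^ 5 \<le> 5 * y ^ 5" using zero_less_power[OF y0(1), of 5] by linarith
  have y3: "0 < y ^ 3" using y0(1) by simp
  have "(y - 1) * y * y * (y + 1) = y ^ 4 - y ^ 2" by (simp add: algebra_simps numeral_eq_Suc)
  then have "(y - 1) * y * y * (y + 1) \<le> y ^ 4" by simp
  then have "(2 * m + 1) * (2 * m + 2) * ((y - 1) * y * y * (y + 1)) \<le> (2 * m + 1) * (2 * m + 2) * y ^ 4"
    by (rule mult_left_mono) (use assms in simp)
  then have 2: "(2 * m + 1) * (2 * m + 2) * ((y - 1) * y * y * (y + 1)) / 24 \<le> (2 * m + 1) * (2 * m + 2) * y ^ 4 / 24" by simp
  have "((2 * m + 1) * y * (y - 2) / 4) ^ 2 = (2 * m + 1) ^ 2 * y ^ 3 * (y - 4) / 16 + (2 * m + 1) ^ 2 * y ^ 2 / 4"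
    by (simp add: power2_eq_square power3_eq_cube field_simps)
  then have 3: "(2 * m + 1) ^ 2 * y ^ 3 * (y - 4) / 16 \<le> ((2 * m + 1) * y * (y - 2) / 4) ^ 2" by simp
  have a: "(2 * m - 3) * y \<le> (2 * m - 1) * y - 12 * (2 * m + 1)" using assms by (simp add: algebra_simps)
  have "910 * m \<le> m * m" using assms(1) by (intro mult_right_mono) simp_all
  moreover have "(2 * m + 1) * (2 * m - 3) = 4 * (m * m) - 4 * m - 3" by (simp add: algebra_simps)
  ultimately have "240 * (15 * m) < (2 * m + 1) * (2 * m - 3)" using assms(1) by linarith
  then have "240 * y < (2 * m + 1) * (2 * m - 3)" using assms(3) by linarith
  then have "240 * y * y < (2 * m + 1) * (2 * m - 3) * y" using y0(1) by (rule mult_strict_right_mono)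
  also have "\<dots> \<le> (2 * m + 1) * ((2 * m - 1) * y - 12 * (2 * m + 1))"
    using mult_left_mono[OF a, of "2 * m + 1"] assms by (simp add: mult.assoc)
  finally have "240 * y * y * y ^ 3 < (2 * m + 1) * ((2 * m - 1) * y - 12 * (2 * m + 1)) * y ^ 3"
    using y3 by (rule mult_strict_right_mono)
  moreover have "240 * y * y * y ^ 3 = 48 * (5 * y ^ 5)" by (simp add: numeral_eq_Suc)
  moreover have "(2 * m + 1) * ((2 * m - 1) * y - 12 * (2 * m + 1)) * y ^ 3 =
      48 * ((2 * m + 1) ^ 2 * y ^ 3 * (y - 4) / 16) - 48 * ((2 * m + 1) * (2 * m + 2) * y ^ 4 / 24)"
    by (simp add: numeral_eq_Suc field_simps)
  ultimately have "5 * y ^ 5 + (2 * m + 1) * (2 * m + 2) * y ^ 4 / 24 < (2 * m + 1) ^ 2 * y ^ 3 * (y - 4) / 16" by linarith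
  then show ?thesis using 1 2 3 by linarith
qed

context middle
begin

text \<open>For \<open>y = n + 1 = 2 r + m\<close> the range of \<open>r\<close> gives
  \<open>13 m < y < 15 m\<close>, and the inequality of \<open>palindromic_second\<close>
  contradicts \<open>big_estimate\<close>.\<close>

lemma not_palindromic_large:
  assumes "910 \<le> m" "6 * m < r" "r < 7 * m"
  shows "\<not> palindromic (antichain_poly P)"
proof
  assume pal: "palindromic (antichain_poly P)"
  define y where "y = 2 * r + m"
  have w2: "2 * w = 2 * (2 * m + 1) * r + m * (m - 1)" by (rule two_w)
  have "2 \<le> w"
  proof -
    have "2 * 1 * 2 \<le> 2 * (2 * m + 1) * r" using assms by (intro mult_le_mono) simp_all
    then show ?thesis using w2 by linarith
  qed
  note sec = palindromic_second[OF pal this]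
  have "card low2 \<le> 47 * Q ^ 5" using card_low2(2) assms by simp
  then have le: "card lower * card lower \<le> 94 * Q ^ 5 + ncomp" using sec by linarith
  have n: "real n = real y - 1" using n1 assms unfolding y_def by (metis add_diff_cancel_right' of_nat_1 of_nat_add)
  have k: "real k = 2 * real m + 1" by (simp add: k_def)
  have "real (24 * ncomp) = real (k * (k + 1) * (n * (n + 1) * (n + 1) * (n + 2)))" by (simp only: comparable_poset)
  then have "24 * real ncomp = real k * (real k + 1) * (real n * (real n + 1) * (real n + 1) * (real n + 2))"
    by (simp only: of_nat_mult of_nat_add of_nat_numeral of_nat_1)
  then have nc: "real ncomp = (2 * real m + 1) * (2 * real m + 2) * ((real y - 1) * real y * real y * (real y + 1)) / 24"
    unfolding n k by (simp add: ac_simps)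
  have q: "real Q = (real y + real m + 4) / 2" unfolding y_def by simp
  have "real (4 * card lower + 2 * w) = real (k * (n * (n + 1)))" by (simp only: four_lower)
  then have L: "4 * real (card lower) = (2 * real m + 1) * ((real y - 1) * real y) - real (2 * w)" using n k by simp
  have "2 * w \<le> (2 * m + 1) * y" unfolding w2 y_def by (simp add: algebra_simps diff_mult_distrib2)
  then have "real (2 * w) \<le> real ((2 * m + 1) * y)" by (simp only: of_nat_le_iff)
  then have "4 * real (card lower) \<ge> (2 * real m + 1) * ((real y - 1) * real y) - (2 * real m + 1) * real y"
    using L by simp
  then have Lb: "(2 * real m + 1) * real y * (real y - 2) / 4 \<le> real (card lower)" by (simp add: algebra_simps)
  have b: "910 \<le> real m" "13 * real m \<le> real y" "real y \<le> 15 * real m" using assms unfolding y_def by simp_all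
  have "0 \<le> (2 * real m + 1) * real y * (real y - 2) / 4" using b by simp
  then have "((2 * real m + 1) * real y * (real y - 2) / 4) ^ 2 \<le> real (card lower) ^ 2"
    using power_mono[OF Lb, of 2] by simp
  also have "\<dots> = real (card lower * card lower)" by (simp add: power2_eq_square)
  also have "\<dots> \<le> real (94 * Q ^ 5 + ncomp)" using le by (simp only: of_nat_le_iff)
  also have "\<dots> = 94 * real Q ^ 5 + real ncomp" by simp
  also have "\<dots> = 94 * ((real y + real m + 4) / 2) ^ 5
    + (2 * real m + 1) * (2 * real m + 2) * ((real y - 1) * real y * real y * (real y + 1)) / 24"
    unfolding q nc ..
  finally show False using big_estimate[OF b] by linarith
qed

end

section \<open>The classification\<close>

theorem theorem4p14:
  fixes k n :: nat
  assumes "k \<ge> 1" and "n \<ge> 1"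
  shows "palindromic (antichain_poly (chain k \<times> H n)) \<longleftrightarrow>
    (k = 1 \<and> odd n) \<or> (k, n) \<in> {(3, 2), (5, 3), (3, 4), (7, 4)}"
proof
  assume "(k = 1 \<and> odd n) \<or> (k, n) \<in> {(3, 2), (5, 3), (3, 4), (7, 4)}"
  then show "palindromic (antichain_poly (chain k \<times> H n))"
    using palindromic_k1 palindromic_small by auto
next
  assume "palindromic (antichain_poly (chain k \<times> H n))"
  then have pal: "palindromic (antichain_poly (poset k n))" by (simp add: poset_def)
  \<comment> \<open>\<open>k\<close> must be the size of some block; for \<open>k = 1\<close> this
    already makes \<open>n\<close> odd.\<close>
  obtain r where r: "1 \<le> r" "2 * r \<le> n + 1" "k + 4 * r = 2 * n + 3"
    using not_palindromic_generic[OF assms] pal by blast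
  define m where "m = n + 1 - 2 * r"
  have m: "n + 1 = 2 * r + m" "k = 2 * m + 1" using r unfolding m_def by linarith+
  show "(k = 1 \<and> odd n) \<or> (k, n) \<in> {(3, 2), (5, 3), (3, 4), (7, 4)}"
  proof (cases "m = 0")
    case True
    have "odd n" using m(1) unfolding True by presburger
    then show ?thesis using m(2) True by simp
  next
    case False
    interpret M: middle r m by unfold_locales (use r(1) False in simp_all)
    have kn: "M.k = k" "M.n = n" using M.n1 m unfolding M.k_def by linarith+
    have pal': "palindromic (antichain_poly (poset M.k M.n))" using pal unfolding kn .
    have eq: "\<not> card M.lower < card M.low1" using M.palindromic_low1[OF pal'] by simp
    consider "r = 1" | "2 \<le> r" "m = 1" | "2 \<le> r" "2 \<le> m" using r(1) False by linarith
    then show ?thesis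
    proof cases
      case 1
      have "\<not> 4 \<le> m" using M.lower_less_r1[OF 1] eq by blast
      \<comment> \<open>With \<open>r = 1\<close> these are the cases \<open>(3, 2)\<close>,
        \<open>(5, 3)\<close> and \<open>(7, 4)\<close>.\<close>
      then have "m = 1 \<or> m = 2 \<or> m = 3" using False by linarith
      then show ?thesis using m 1 by auto
    next
      case 2
      have "\<not> 3 \<le> r" using M.lower_less_m1[OF 2(2)] eq by blast
      \<comment> \<open>With \<open>m = 1\<close> this is the case \<open>(3, 4)\<close>.\<close>
      then have "r = 2" using 2(1) by linarith
      then show ?thesis using m 2(2) by simp
    next
      case 3
      have z: "cubic (int r) (int m) = 0"
        using M.palindromic_cubic[OF pal' 3(2,1)]
        by (simp add: cubic_def power2_eq_square power3_eq_cube algebra_simps)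
      have p: "0 < int r" using r(1) by simp
      consider (a) "int m = 2" | (b) "3 \<le> int m" "int m < 910" | (c) "910 \<le> int m" using 3(2) by linarith
      then show ?thesis
      proof cases
        case a
        then show ?thesis using cubic_2[OF p] z by simp
      next
        case b
        then show ?thesis using cubic_small[OF b p] z by simp
      next
        case c
        have "910 \<le> m" "6 * m < r" "r < 7 * m" using cubic_range[OF c p z] c by linarith+
        then show ?thesis using M.not_palindromic_large pal' by blast
      qed
    qed
  qed
qed

end
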